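(* Let $\Gamma<\mathsf{Isom}(\mathbb{H}^3)$ be a torsion-free cocompact lattice such that the closed hyperbolic 3-manifold $M=\Gamma\backslash\mathbb{H}^3$ admits a fibration $S\to M\to\mathbb{S}^1$ over the circle with a fiber $S\subset M$, and view $\pi_1(S)$ as an infinite-index normal subgroup of $\Gamma$ with $\Gamma/\pi_1(S)\cong\mathbb{Z}$. Then there exists a probability measure $\mathsf{m}'$ on $\pi_1(S)$ with $\pi_1(S)=\langle\operatorname{supp}\mathsf{m}'\rangle$ whose associated stationary measure on $\partial\mathbb{H}^3$ is absolutely continuous with respect to $\mathrm{Leb}$.
   Context: $\mathrm{Leb}$ denotes a measure on $\partial\mathbb{H}^3$ (diffeomorphic to the two-sphere, with $\mathsf{Isom}(\mathbb{H}^3)$ acting by diffeomorphisms) induced by a smooth volume form. $\langle A\rangle$ is the group generated by $A$. A Borel probability measure $\nu$ on $\partial\mathbb{H}^3$ is $\mathsf{m}'$-stationary if $\mathsf{m}'*\nu=\sum_{g}\mathsf{m}'(g)\,g_*\nu=\nu$; when $\operatorname{supp}\mathsf{m}'$ generates $\pi_1(S)$ (a non-elementary discrete group) the $\mathsf{m}'$-stationary measure on $\partial\mathbb{H}^3$ is known to exist and be unique, and this is the associated stationary measure. *)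

theory Defs
  imports
    "HOL-Probability.Probability"
    "HOL-Algebra.Bij"
    "HOL-Algebra.Generated_Groups"
    "HOL-Algebra.Elementary_Groups"
begin

section \<open>Hyperbolic 3-space and its isometry group\<close>

text \<open>Poincare ball model, curvature \<open>-1\<close>. The hyperbolic metric induces the Euclidean
  topology on the ball, and the sphere at infinity is the unit sphere.\<close>

definition H3 :: "(real^3) set" where
  "H3 = ball 0 1"

definition hdist :: "real^3 \<Rightarrow> real^3 \<Rightarrow> real" where
  "hdist x y = arcosh (1 + 2 * (norm (x - y))\<^sup>2 / ((1 - (norm x)\<^sup>2) * (1 - (norm y)\<^sup>2)))"

definition bdH3 :: "(real^3) set" where
  "bdH3 = sphere 0 1"

text \<open>All isometries of \<open>H3\<close>, orientation-reversing ones included. Elements of \<open>Bij H3\<close> take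
  the value \<open>undefined\<close> outside \<open>H3\<close>.\<close>

definition Isom_H3 :: "(real^3 \<Rightarrow> real^3) monoid" where
  "Isom_H3 = (BijGroup H3)
     \<lparr>carrier := {g \<in> Bij H3. \<forall>x\<in>H3. \<forall>y\<in>H3. hdist (g x) (g y) = hdist x y}\<rparr>"

lemma group_Isom_H3: "group Isom_H3"
proof -
  let ?I = "{g \<in> Bij H3. \<forall>x\<in>H3. \<forall>y\<in>H3. hdist (g x) (g y) = hdist x y}"
  interpret B: group "BijGroup H3" by (rule group_BijGroup)
  have "subgroup ?I (BijGroup H3)"
  proof (rule B.subgroupI)
    show "?I \<subseteq> carrier (BijGroup H3)" by (auto simp: BijGroup_def)
    show "?I \<noteq> {}" using id_Bij[of H3] by auto
  next
    fix g assume g: "g \<in> ?I"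
    then have b: "bij_betw g H3 H3" by (simp add: Bij_def)
    have "hdist (inv_into H3 g x) (inv_into H3 g y) = hdist x y" if "x \<in> H3" "y \<in> H3" for x y
    proof -
      from b that have "inv_into H3 g x \<in> H3" "inv_into H3 g y \<in> H3"
        by (auto simp: bij_betw_def inv_into_into)
      with g have "hdist (g (inv_into H3 g x)) (g (inv_into H3 g y))
          = hdist (inv_into H3 g x) (inv_into H3 g y)" by blast
      with b that show ?thesis by (simp add: bij_betw_inv_into_right)
    qed
    with g show "inv\<^bsub>BijGroup H3\<^esub> g \<in> ?I"
      by (simp add: inv_BijGroup restrict_inv_into_Bij)
  next
    fix g h assume "g \<in> ?I" "h \<in> ?I"
    then show "g \<otimes>\<^bsub>BijGroup H3\<^esub> h \<in> ?I"
      using Bij_imp_funcset[of h H3] compose_Bij[of g H3 h]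
      by (auto simp: BijGroup_def compose_eq Pi_iff)
  qed
  then show ?thesis
    unfolding Isom_H3_def by (rule subgroup.subgroup_is_group) (rule B.is_group)
qed

text \<open>The topology on isometries is that of pointwise convergence, which on an isometry group
  agrees with the compact-open topology.\<close>

definition discrete_isometry_group :: "(real^3 \<Rightarrow> real^3) set \<Rightarrow> bool" where
  "discrete_isometry_group \<Gamma> \<longleftrightarrow> subgroup \<Gamma> Isom_H3 \<and>
     subtopology (product_topology (\<lambda>_. top_of_set H3) H3) \<Gamma> = discrete_topology \<Gamma>"

definition torsion_free :: "('a, 'b) monoid_scheme \<Rightarrow> 'a set \<Rightarrow> bool" where
  "torsion_free G \<Gamma> \<longleftrightarrow>
     (\<forall>g\<in>\<Gamma>. \<forall>n::nat. 0 < n \<longrightarrow> g [^]\<^bsub>G\<^esub> n = \<one>\<^bsub>G\<^esub> \<longrightarrow> g = \<one>\<^bsub>G\<^esub>)"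

section \<open>The quotient manifold\<close>

definition orbit_of :: "(real^3 \<Rightarrow> real^3) set \<Rightarrow> real^3 \<Rightarrow> (real^3) set" where
  "orbit_of \<Gamma> x = (\<lambda>g. g x) ` \<Gamma>"

definition quotient_space :: "(real^3 \<Rightarrow> real^3) set \<Rightarrow> (real^3) set topology" where
  "quotient_space \<Gamma> = topology (\<lambda>U. U \<subseteq> orbit_of \<Gamma> ` H3 \<and>
     openin (top_of_set H3) {x \<in> H3. orbit_of \<Gamma> x \<in> U})"

lemma openin_quotient_space:
  "openin (quotient_space \<Gamma>) U \<longleftrightarrow>
     U \<subseteq> orbit_of \<Gamma> ` H3 \<and> openin (top_of_set H3) {x \<in> H3. orbit_of \<Gamma> x \<in> U}"
proof -
  let ?P = "\<lambda>U. U \<subseteq> orbit_of \<Gamma> ` H3 \<and> openin (top_of_set H3) {x \<in> H3. orbit_of \<Gamma> x \<in> U}"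
  have "istopology ?P"
    unfolding istopology_def
  proof (intro conjI allI impI)
    fix S T assume S: "?P S" and T: "?P T"
    have "{x \<in> H3. orbit_of \<Gamma> x \<in> S \<inter> T}
        = {x \<in> H3. orbit_of \<Gamma> x \<in> S} \<inter> {x \<in> H3. orbit_of \<Gamma> x \<in> T}" by auto
    with S T show "openin (top_of_set H3) {x \<in> H3. orbit_of \<Gamma> x \<in> S \<inter> T}"
      by (simp add: openin_Int)
    from S show "S \<inter> T \<subseteq> orbit_of \<Gamma> ` H3" by auto
  next
    fix K assume K: "\<forall>S\<in>K. ?P S"
    then show "\<Union>K \<subseteq> orbit_of \<Gamma> ` H3" by blast
    have "{x \<in> H3. orbit_of \<Gamma> x \<in> \<Union>K} = (\<Union>S\<in>K. {x \<in> H3. orbit_of \<Gamma> x \<in> S})" by auto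
    moreover have "openin (top_of_set H3) (\<Union>S\<in>K. {x \<in> H3. orbit_of \<Gamma> x \<in> S})"
      using K by (intro openin_Union) blast
    ultimately show "openin (top_of_set H3) {x \<in> H3. orbit_of \<Gamma> x \<in> \<Union>K}"
      by (rule ssubst)
  qed
  then show ?thesis by (simp add: quotient_space_def)
qed

lemma quotient_map_orbit_of: "quotient_map (top_of_set H3) (quotient_space \<Gamma>) (orbit_of \<Gamma>)"
proof -
  have "{x \<in> H3. orbit_of \<Gamma> x \<in> orbit_of \<Gamma> ` H3} = H3" by blast
  then have "openin (quotient_space \<Gamma>) (orbit_of \<Gamma> ` H3)"
    by (simp add: openin_quotient_space)
  then have "topspace (quotient_space \<Gamma>) = orbit_of \<Gamma> ` H3"
    by (meson openin_quotient_space openin_subset openin_topspace subset_antisym)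
  then show ?thesis
    by (auto simp: quotient_map_def openin_quotient_space)
qed

definition cocompact_lattice :: "(real^3 \<Rightarrow> real^3) set \<Rightarrow> bool" where
  "cocompact_lattice \<Gamma> \<longleftrightarrow> discrete_isometry_group \<Gamma> \<and> compact_space (quotient_space \<Gamma>)"

section \<open>Fibrations over the circle\<close>

definition closed_surface :: "'a topology \<Rightarrow> bool" where
  "closed_surface X \<longleftrightarrow> compact_space X \<and> connected_space X \<and> Hausdorff_space X \<and>
     topspace X \<noteq> {} \<and>
     (\<forall>x\<in>topspace X. \<exists>U. openin X U \<and> x \<in> U \<and>
        subtopology X U homeomorphic_space (euclidean :: (real^2) topology))"

definition fiber_bundle :: "'a topology \<Rightarrow> 'b topology \<Rightarrow> 'c topology \<Rightarrow> ('a \<Rightarrow> 'b) \<Rightarrow> bool" where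
  "fiber_bundle E B F p \<longleftrightarrow> continuous_map E B p \<and>
     (\<forall>b\<in>topspace B. \<exists>U \<phi>. openin B U \<and> b \<in> U \<and>
        homeomorphic_map (subtopology E {x \<in> topspace E. p x \<in> U})
          (prod_topology (subtopology B U) F) \<phi> \<and>
        (\<forall>x\<in>topspace E. p x \<in> U \<longrightarrow> fst (\<phi> x) = p x))"

text \<open>\<open>S\<close> is the fiber, as a subset of the total space \<open>M\<close>.\<close>

definition surface_fibration_over_circle ::
    "'a topology \<Rightarrow> 'a set \<Rightarrow> ('a \<Rightarrow> complex) \<Rightarrow> bool" where
  "surface_fibration_over_circle M S p \<longleftrightarrow>
     closed_surface (subtopology M S) \<and>
     (\<exists>z\<in>sphere 0 1. S = {x \<in> topspace M. p x = z}) \<and>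
     fiber_bundle M (top_of_set (sphere 0 1)) (subtopology M S) p"

text \<open>The image of \<open>\<pi>\<^sub>1(S) \<rightarrow> \<pi>\<^sub>1(M) = \<Gamma>\<close>, where \<open>M\<close> is the quotient manifold and the
  base points are the orbit of \<open>x0\<close> in \<open>M\<close> and \<open>x0\<close> in \<open>H3\<close>: a loop \<open>l\<close> in \<open>S\<close>
  is sent to the \<open>g \<in> \<Gamma>\<close> for which the lift \<open>c\<close> of \<open>l\<close> starting at
  \<open>x0\<close> ends at \<open>g x0\<close>.\<close>

definition pi1_in_lattice ::
    "(real^3 \<Rightarrow> real^3) set \<Rightarrow> (real^3) set set \<Rightarrow> real^3 \<Rightarrow> (real^3 \<Rightarrow> real^3) set" where
  "pi1_in_lattice \<Gamma> S x0 = {g \<in> \<Gamma>. \<exists>l c.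
     pathin (subtopology (quotient_space \<Gamma>) S) l \<and> l 0 = orbit_of \<Gamma> x0 \<and> l 1 = orbit_of \<Gamma> x0 \<and>
     pathin (top_of_set H3) c \<and> (\<forall>t\<in>{0..1}. orbit_of \<Gamma> (c t) = l t) \<and>
     c 0 = x0 \<and> c 1 = g x0}"

section \<open>Measures on the sphere at infinity\<close>

definition bd_action :: "(real^3 \<Rightarrow> real^3) \<Rightarrow> real^3 \<Rightarrow> real^3" where
  "bd_action g \<xi> = Lim (at \<xi> within H3) g"

definition bd_borel :: "(real^3) measure" where
  "bd_borel = restrict_space borel bdH3"

text \<open>The area measure of the round sphere: the area of \<open>A\<close> is three times the volume of the
  cone over \<open>A\<close>.\<close>

definition round_area :: "(real^3) measure" where
  "round_area =
     scale_measure 3 (distr (restrict_space lborel (ball 0 1 - {0})) bd_borel (\<lambda>x. x /\<^sub>R norm x))"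

fun cont_diff_on :: "nat \<Rightarrow> (real^3) set \<Rightarrow> (real^3 \<Rightarrow> real) \<Rightarrow> bool" where
  "cont_diff_on 0 U f \<longleftrightarrow> continuous_on U f"
| "cont_diff_on (Suc k) U f \<longleftrightarrow>
     (\<exists>D. (\<forall>x\<in>U. (f has_derivative (\<lambda>h. D x \<bullet> h)) (at x)) \<and>
          (\<forall>i. cont_diff_on k U (\<lambda>x. D x $ i)))"

text \<open>A smooth volume form on the sphere is a smooth nowhere vanishing multiple of the round area
  form, and smooth functions on the sphere are those extending smoothly to a neighbourhood.\<close>

definition smooth_volume_measure :: "(real^3) measure \<Rightarrow> bool" where
  "smooth_volume_measure L \<longleftrightarrow>
     (\<exists>U f. open U \<and> bdH3 \<subseteq> U \<and> (\<forall>k. cont_diff_on k U f) \<and> (\<forall>\<xi>\<in>bdH3. 0 < f \<xi>) \<and>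
        L = density round_area (\<lambda>\<xi>. ennreal (f \<xi>)))"

definition stationary :: "(real^3 \<Rightarrow> real^3) pmf \<Rightarrow> (real^3) measure \<Rightarrow> bool" where
  "stationary m \<nu> \<longleftrightarrow> prob_space \<nu> \<and> sets \<nu> = sets bd_borel \<and>
     (\<forall>A\<in>sets bd_borel.
        (\<Sum>\<^sub>\<infinity>g\<in>set_pmf m. ennreal (pmf m g) * emeasure (distr \<nu> bd_borel (bd_action g)) A)
        = emeasure \<nu> A)"

definition associated_stationary_measure ::
    "(real^3 \<Rightarrow> real^3) pmf \<Rightarrow> (real^3) measure \<Rightarrow> bool" where
  "associated_stationary_measure m \<nu> \<longleftrightarrow>
     stationary m \<nu> \<and> (\<forall>\<nu>'. stationary m \<nu>' \<longrightarrow> \<nu>' = \<nu>)"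

end

theory Submission
  imports Defs
begin

text \<open>The measure \<open>m\<close> is constructed so that the rotation invariant measure of the sphere is itself
  stationary. Under an isometry \<open>g\<close> this measure acquires the Poisson kernel at \<open>g 0\<close> as its density,
  so it is stationary as soon as \<open>m\<close> averages the Poisson kernel over the orbit of \<open>0\<close> to its value
  at \<open>0\<close>.

  For the lattice such an \<open>m\<close> comes from a walk in hyperbolic space with uniform jumps in balls,
  stopped at random near the orbit of \<open>0\<close>. The mean value property of the Poisson kernel makes it
  harmonic for this walk, and the reversibility of the walk makes \<open>m\<close> symmetric. The projection of
  \<open>m\<close> to the integers is symmetric with finite second moment, hence recurrent, so the first return
  to the fibre group \<open>N\<close> defines a symmetric probability measure on \<open>N\<close>. The Poisson kernel is
  superharmonic for it; as the kernel has integral \<open>1\<close> over the sphere, it is harmonic almost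
  everywhere.

  For uniqueness, the difference of the Poisson-type integrals of a continuous function against two
  stationary measures is a bounded harmonic function on \<open>N\<close>. If neither measure has atoms, it
  vanishes at infinity by north-south dynamics, hence everywhere by the maximum principle. The atoms
  of maximal mass would form a finite invariant set, which the symmetry of \<open>m\<close> excludes.\<close>

section \<open>Isometries of the ball model\<close>

text \<open>Both passages, from hyperbolic space to the lattice and from the lattice to
  \<open>N\<close>, are the same construction: a symmetric killed kernel whose lost mass is handed
  to absorbing targets. It is set up once in \<open>sym_kernel\<close> and instantiated with
  hyperbolic volume and with counting measure on \<open>\<Gamma> - N\<close>. Using one family of
  functions both as starting densities and as absorption rates makes the resulting measure
  symmetric, by self-adjointness of the kernel. Symmetry is spent twice: it removes the drift of the
  projection to the integers, and it makes a sum of Poisson kernels over a finite invariant set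
  comparable with the sum of their reciprocals. The Poisson kernel is unbounded on the group, so
  stopping at a random time only yields an inequality for it. The inequality is carried through both
  passages, and equality is recovered at the very end, on the sphere, from equal total masses.
  Derivatives of Moebius maps are never written out: one exact formula for
  \<open>norm (mobius a x - mobius a y)\<close> gives isometry, Jacobians, the cocycle of the
  Poisson kernel and the contraction at the boundary.\<close>

definition mobius_den :: "'a::real_inner \<Rightarrow> 'a \<Rightarrow> real" where
  "mobius_den a x = 1 + 2 * (a \<bullet> x) + (a \<bullet> a) * (x \<bullet> x)"

text \<open>Moebius addition of \<open>a\<close> and \<open>x\<close>: the hyperbolic translation
  along the diameter through \<open>a\<close> that takes 0 to \<open>a\<close>. For nonzero
  \<open>a\<close> the denominator is \<open>a \<bullet> a\<close> times the squared distance of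
  \<open>x\<close> from the pole of the map, which is why it governs every distortion
  formula.\<close>

definition mobius :: "'a::real_inner \<Rightarrow> 'a \<Rightarrow> 'a" where
  "mobius a x = (1 / mobius_den a x) *\<^sub>R
     ((1 + 2 * (a \<bullet> x) + x \<bullet> x) *\<^sub>R a + (1 - a \<bullet> a) *\<^sub>R x)"

lemma mobius_den_pos:
  assumes "norm a < 1" "norm x \<le> 1"
  shows "0 < mobius_den a x"
proof -
  have "norm a * norm x < 1"
    using assms by (smt (verit) mult_left_le norm_ge_zero)
  then have "0 < (1 - norm a * norm x)\<^sup>2" by simp
  also have "\<dots> = 1 - 2 * (norm a * norm x) + (norm a)\<^sup>2 * (norm x)\<^sup>2"
    by (simp add: power2_eq_square algebra_simps)
  also have "\<dots> \<le> mobius_den a x"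
    using Cauchy_Schwarz_ineq2[of a x] by (simp add: mobius_den_def power2_norm_eq_inner)
  finally show ?thesis .
qed

lemma mobius_0 [simp]: "mobius a 0 = a"
  by (simp add: mobius_def mobius_den_def)

text \<open>Denominators are kept on the left, so that the facts derived from it are polynomial
  identities in the inner products of \<open>a\<close>, \<open>x\<close> and
  \<open>y\<close>.\<close>

lemma inner_mobius_mobius:
  assumes "mobius_den a x \<noteq> 0" "mobius_den a y \<noteq> 0"
  shows "mobius_den a x * mobius_den a y * (mobius a x \<bullet> mobius a y) =
    (1 + 2 * (a \<bullet> x) + x \<bullet> x) * (1 + 2 * (a \<bullet> y) + y \<bullet> y) * (a \<bullet> a)
    + (1 - a \<bullet> a) * (1 + 2 * (a \<bullet> x) + x \<bullet> x) * (a \<bullet> y)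
    + (1 - a \<bullet> a) * (1 + 2 * (a \<bullet> y) + y \<bullet> y) * (a \<bullet> x)
    + (1 - a \<bullet> a)\<^sup>2 * (x \<bullet> y)"
proof -
  define N where "N x = (1 + 2 * (a \<bullet> x) + x \<bullet> x) *\<^sub>R a + (1 - a \<bullet> a) *\<^sub>R x" for x
  have "mobius_den a x * mobius_den a y * (mobius a x \<bullet> mobius a y) = N x \<bullet> N y"
    using assms by (simp add: mobius_def N_def[symmetric])
  also have "\<dots> = (1 + 2 * (a \<bullet> x) + x \<bullet> x) * (1 + 2 * (a \<bullet> y) + y \<bullet> y) * (a \<bullet> a)
    + (1 - a \<bullet> a) * (1 + 2 * (a \<bullet> x) + x \<bullet> x) * (a \<bullet> y)
    + (1 - a \<bullet> a) * (1 + 2 * (a \<bullet> y) + y \<bullet> y) * (a \<bullet> x)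
    + (1 - a \<bullet> a)\<^sup>2 * (x \<bullet> y)"
    unfolding N_def
    by (simp only: inner_add_left inner_add_right inner_scaleR_left inner_scaleR_right
          inner_commute[of x a]) algebra
  finally show ?thesis .
qed

lemma inner_mobius_self:
  assumes "mobius_den a x \<noteq> 0"
  shows "mobius_den a x * (mobius a x \<bullet> mobius a x) = a \<bullet> a + 2 * (a \<bullet> x) + x \<bullet> x"
proof -
  have "mobius_den a x * (mobius_den a x * (mobius a x \<bullet> mobius a x))
      = mobius_den a x * (a \<bullet> a + 2 * (a \<bullet> x) + x \<bullet> x)"
    using inner_mobius_mobius[OF assms assms] unfolding mobius_den_def
    by (simp add: algebra_simps power2_eq_square)
  with assms show ?thesis by simp
qed

text \<open>Polarisation of the two preceding identities. It holds for points of the ball and of the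
  sphere alike, so it serves the metric, the Jacobians, the Poisson kernel and the boundary
  dynamics.\<close>

lemma norm_mobius_diff:
  assumes "mobius_den a x \<noteq> 0" "mobius_den a y \<noteq> 0"
  shows "mobius_den a x * mobius_den a y * (norm (mobius a x - mobius a y))\<^sup>2
    = (1 - (norm a)\<^sup>2)\<^sup>2 * (norm (x - y))\<^sup>2"
proof -
  have "mobius_den a x * mobius_den a y * (norm (mobius a x - mobius a y))\<^sup>2
    = mobius_den a y * (mobius_den a x * (mobius a x \<bullet> mobius a x))
    + mobius_den a x * (mobius_den a y * (mobius a y \<bullet> mobius a y))
    - 2 * (mobius_den a x * mobius_den a y * (mobius a x \<bullet> mobius a y))"
    by (simp add: power2_norm_eq_inner inner_diff_left inner_diff_right inner_commute algebra_simps)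
  also have "\<dots> = (1 - a \<bullet> a)\<^sup>2 * (x \<bullet> x + y \<bullet> y - 2 * (x \<bullet> y))"
    unfolding inner_mobius_self[OF assms(1)] inner_mobius_self[OF assms(2)]
      inner_mobius_mobius[OF assms] unfolding mobius_den_def
    by (simp add: algebra_simps power2_eq_square)
  also have "\<dots> = (1 - (norm a)\<^sup>2)\<^sup>2 * (norm (x - y))\<^sup>2"
    by (simp add: power2_norm_eq_inner inner_diff_left inner_diff_right inner_commute algebra_simps)
  finally show ?thesis .
qed

lemma one_minus_norm_mobius:
  assumes "mobius_den a x \<noteq> 0"
  shows "mobius_den a x * (1 - (norm (mobius a x))\<^sup>2) = (1 - (norm a)\<^sup>2) * (1 - (norm x)\<^sup>2)"
  using inner_mobius_self[OF assms]
  by (simp add: power2_norm_eq_inner algebra_simps) (simp add: mobius_den_def)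

lemma norm_mobius_sphere:
  assumes "norm a < 1" "norm x = 1"
  shows "norm (mobius a x) = 1"
proof -
  have "mobius_den a x > 0" using assms by (intro mobius_den_pos) auto
  with one_minus_norm_mobius[of a x] assms have "(norm (mobius a x))\<^sup>2 = 1" by simp
  then show ?thesis by (simp add: power2_eq_1_iff) (smt (verit) norm_ge_zero)
qed

lemma norm_mobius_ball:
  assumes "norm a < 1" "norm x < 1"
  shows "norm (mobius a x) < 1"
proof -
  have p: "mobius_den a x > 0" using assms by (intro mobius_den_pos) auto
  have "(norm a)\<^sup>2 < 1" "(norm x)\<^sup>2 < 1" using assms by (simp_all add: power_less_one_iff)
  then have "0 < mobius_den a x * (1 - (norm (mobius a x))\<^sup>2)"
    using p by (simp add: one_minus_norm_mobius)
  then have "(norm (mobius a x))\<^sup>2 < 1" using p by (simp add: zero_less_mult_iff)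
  then show ?thesis by (simp add: power_less_one_iff)
qed

lemma mobius_minus_mobius:
  assumes "norm a < 1" "norm x \<le> 1"
  shows "mobius (- a) (mobius a x) = x"
proof -
  have Q: "mobius_den a x > 0" using assms by (intro mobius_den_pos) auto
  have a: "(norm a)\<^sup>2 < 1" using assms by (simp add: power_less_one_iff)
  define s where "s = 1 - a \<bullet> a"
  define u where "u = 1 + 2 * (a \<bullet> x) + x \<bullet> x"
  define Q where "Q = mobius_den a x"
  have s: "s > 0" using a by (simp add: s_def power2_norm_eq_inner)
  have Qp: "Q > 0" using Q by (simp add: Q_def)
  have 1: "Q * (a \<bullet> mobius a x) = u * (a \<bullet> a) + s * (a \<bullet> x)"
    using Qp unfolding mobius_def Q_def[symmetric] u_def[symmetric] s_def[symmetric]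
    by (simp add: inner_add_right)
  have 2: "Q * (mobius a x \<bullet> mobius a x) = a \<bullet> a + 2 * (a \<bullet> x) + x \<bullet> x"
    using inner_mobius_self[of a x] Q by (simp add: Q_def)
  \<comment> \<open>The two denominators multiply to \<open>s\<^sup>2\<close>, that is, the
    conformal factors \<open>s / Q\<close> of a translation and of its inverse cancel.\<close>
  have "Q * mobius_den (- a) (mobius a x)
     = Q - 2 * (Q * (a \<bullet> mobius a x)) + (a \<bullet> a) * (Q * (mobius a x \<bullet> mobius a x))"
    unfolding mobius_den_def[of "-a"] by (simp add: algebra_simps)
  also have "\<dots> = s\<^sup>2"
    unfolding 1 2 unfolding u_def s_def Q_def mobius_den_def by (simp add: algebra_simps power2_eq_square)
  finally have 3: "mobius_den (- a) (mobius a x) = s\<^sup>2 / Q" using Qp by (simp add: field_simps)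
  have "Q * (1 + 2 * (- a \<bullet> mobius a x) + mobius a x \<bullet> mobius a x)
     = Q - 2 * (Q * (a \<bullet> mobius a x)) + Q * (mobius a x \<bullet> mobius a x)"
    by (simp add: algebra_simps)
  also have "\<dots> = s * u"
    unfolding 1 2 unfolding u_def s_def Q_def mobius_den_def by (simp add: algebra_simps power2_eq_square)
  finally have 4: "1 + 2 * (- a \<bullet> mobius a x) + mobius a x \<bullet> mobius a x = s * u / Q"
    using Qp by (simp add: field_simps)
  have 5: "mobius a x = (1 / Q) *\<^sub>R (u *\<^sub>R a + s *\<^sub>R x)"
    by (simp add: mobius_def Q_def u_def s_def)
  have "mobius (- a) (mobius a x) = (Q / s\<^sup>2) *\<^sub>R ((s * u / Q) *\<^sub>R (- a) + s *\<^sub>R mobius a x)"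
    unfolding mobius_def[of "-a"] 3 4 by (simp add: s_def)
  also have "\<dots> = x"
    unfolding 5 using s Qp by (simp add: scaleR_add_right power2_eq_square)
  finally show ?thesis .
qed

lemma mobius_mobius_minus:
  assumes "norm a < 1" "norm x \<le> 1"
  shows "mobius a (mobius (- a) x) = x"
  using mobius_minus_mobius[of "- a" x] assms by simp

lemma mobius_neg_center: assumes "norm a < 1" shows "mobius (- a) a = 0"
  using mobius_minus_mobius[of a 0] assms by simp

lemma mobius_in_H3: "norm a < 1 \<Longrightarrow> x \<in> H3 \<Longrightarrow> mobius a x \<in> H3"
  by (simp add: H3_def norm_mobius_ball)

text \<open>The half-angle form: \<open>hdefect x y = (sinh (d / 2))\<^sup>2\<close> for the hyperbolic distance \<open>d\<close>.\<close>

definition hdefect :: "real^3 \<Rightarrow> real^3 \<Rightarrow> real" where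
  "hdefect x y = (norm (x - y))\<^sup>2 / ((1 - (norm x)\<^sup>2) * (1 - (norm y)\<^sup>2))"

section \<open>The hyperbolic metric: invariance and triangle inequality\<close>

lemma H3_norm: "x \<in> H3 \<longleftrightarrow> norm x < 1" by (simp add: H3_def)

lemma one_minus_norm_pos: "x \<in> H3 \<Longrightarrow> 0 < 1 - (norm x)\<^sup>2"
  by (simp add: H3_norm power_less_one_iff)

lemma hdefect_nonneg: "x \<in> H3 \<Longrightarrow> y \<in> H3 \<Longrightarrow> 0 \<le> hdefect x y"
  unfolding hdefect_def by (intro divide_nonneg_nonneg mult_nonneg_nonneg less_imp_le[OF one_minus_norm_pos]) auto

lemma hdist_hdefect: "hdist x y = arcosh (1 + 2 * hdefect x y)"
  by (simp add: hdist_def hdefect_def)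

lemma cosh_hdist: "x \<in> H3 \<Longrightarrow> y \<in> H3 \<Longrightarrow> cosh (hdist x y) = 1 + 2 * hdefect x y"
  using hdefect_nonneg[of x y] by (simp add: hdist_hdefect)

lemma hdist_nonneg: "x \<in> H3 \<Longrightarrow> y \<in> H3 \<Longrightarrow> 0 \<le> hdist x y"
  using hdefect_nonneg[of x y] by (simp add: hdist_hdefect)

lemma hdist_commute: "hdist x y = hdist y x"
  by (simp add: hdist_def norm_minus_commute mult.commute)

lemma hdist_self [simp]: "hdist x x = 0" by (simp add: hdist_def)

lemma hdefect_mobius:
  assumes "norm a < 1" "x \<in> H3" "y \<in> H3"
  shows "hdefect (mobius a x) (mobius a y) = hdefect x y"
proof -
  let ?qx = "mobius_den a x" and ?qy = "mobius_den a y"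
  have q: "?qx > 0" "?qy > 0" using assms by (auto intro!: mobius_den_pos simp: H3_norm)
  have a: "1 - (norm a)\<^sup>2 > 0" using assms by (simp add: power_less_one_iff)
  have "hdefect (mobius a x) (mobius a y) =
     (?qx * ?qy * (norm (mobius a x - mobius a y))\<^sup>2) /
     ((?qx * (1 - (norm (mobius a x))\<^sup>2)) * (?qy * (1 - (norm (mobius a y))\<^sup>2)))"
    using q by (simp add: hdefect_def)
  also have "\<dots> = ((1 - (norm a)\<^sup>2)\<^sup>2 * (norm (x - y))\<^sup>2) /
      (((1 - (norm a)\<^sup>2) * (1 - (norm x)\<^sup>2)) * ((1 - (norm a)\<^sup>2) * (1 - (norm y)\<^sup>2)))"
    using q by (simp only: norm_mobius_diff one_minus_norm_mobius less_imp_neq[symmetric] not_False_eq_True)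
  also have "\<dots> = hdefect x y"
    using a by (simp add: hdefect_def power2_eq_square[of "1 - (norm a)\<^sup>2"] mult_ac)
  finally show ?thesis .
qed

lemma hdist_mobius:
  assumes "norm a < 1" "x \<in> H3" "y \<in> H3"
  shows "hdist (mobius a x) (mobius a y) = hdist x y"
  by (simp add: hdist_hdefect hdefect_mobius assms)

lemma hdefect_eq_iff:
  assumes "x \<in> H3" "y \<in> H3" "x' \<in> H3" "y' \<in> H3"
  shows "hdefect x y = hdefect x' y' \<longleftrightarrow> hdist x y = hdist x' y'"
proof
  assume "hdist x y = hdist x' y'"
  then have "cosh (hdist x y) = cosh (hdist x' y')" by (rule arg_cong)
  then show "hdefect x y = hdefect x' y'"
    unfolding cosh_hdist[OF assms(1,2)] cosh_hdist[OF assms(3,4)] by simp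
qed (simp add: hdist_hdefect)

lemma hdist_0_norm:
  assumes "x \<in> H3"
  shows "cosh (hdist 0 x) = (1 + (norm x)\<^sup>2) / (1 - (norm x)\<^sup>2)"
    and "sinh (hdist 0 x) = 2 * norm x / (1 - (norm x)\<^sup>2)"
proof -
  have p: "0 < 1 - (norm x)\<^sup>2" by (rule one_minus_norm_pos[OF assms])
  have 0: "(0::real^3) \<in> H3" by (simp add: H3_def)
  show c: "cosh (hdist 0 x) = (1 + (norm x)\<^sup>2) / (1 - (norm x)\<^sup>2)"
    using p cosh_hdist[OF 0 assms] by (simp add: hdefect_def field_simps)
  have "(sinh (hdist 0 x))\<^sup>2 = (cosh (hdist 0 x))\<^sup>2 - 1" using cosh_square_eq[of "hdist 0 x"] by simp
  also have "\<dots> = (2 * norm x / (1 - (norm x)\<^sup>2))\<^sup>2"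
    unfolding c using p by (simp add: power_divide field_simps) (simp add: power2_eq_square algebra_simps)
  finally show "sinh (hdist 0 x) = 2 * norm x / (1 - (norm x)\<^sup>2)"
    using p hdist_nonneg[OF 0 assms] by (simp add: power2_eq_iff_nonneg)
qed

text \<open>The addition theorem for \<open>cosh\<close> turns the sum of the two distances from 0
  into an expression in \<open>norm x + norm y\<close>, so the claim reduces to the Euclidean
  triangle inequality. The general case moves the middle point to 0.\<close>

lemma hdist_triangle_0:
  assumes "x \<in> H3" "y \<in> H3"
  shows "hdist x y \<le> hdist 0 x + hdist 0 y"
proof -
  have 0: "(0::real^3) \<in> H3" by (simp add: H3_def)
  have p: "0 < 1 - (norm x)\<^sup>2" "0 < 1 - (norm y)\<^sup>2" using assms one_minus_norm_pos by auto
  let ?r = "norm x" and ?s = "norm y"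
  have "cosh (hdist 0 x + hdist 0 y) = 1 + 2 * ((?r + ?s)\<^sup>2 / ((1 - ?r\<^sup>2) * (1 - ?s\<^sup>2)))"
    unfolding cosh_add hdist_0_norm[OF assms(1)] hdist_0_norm[OF assms(2)]
    using p by (simp add: add_divide_distrib [symmetric] add_frac_eq add_num_frac)
       (simp add: divide_simps power2_eq_square algebra_simps)
  moreover have "hdefect x y \<le> (?r + ?s)\<^sup>2 / ((1 - ?r\<^sup>2) * (1 - ?s\<^sup>2))"
    unfolding hdefect_def using p
    by (intro divide_right_mono power_mono norm_triangle_ineq4) auto
  ultimately have "cosh (hdist x y) \<le> cosh (hdist 0 x + hdist 0 y)"
    using cosh_hdist[OF assms] by simp
  then show ?thesis using hdist_nonneg[OF assms] hdist_nonneg[OF 0 assms(1)] hdist_nonneg[OF 0 assms(2)]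
    by (subst (asm) cosh_real_nonneg_le_iff) auto
qed

lemma hdist_triangle:
  assumes "x \<in> H3" "y \<in> H3" "z \<in> H3"
  shows "hdist x z \<le> hdist x y + hdist y z"
proof -
  have y: "norm (- y) < 1" "norm y < 1" using assms by (auto simp: H3_norm)
  let ?f = "mobius (- y)"
  have "hdist x z = hdist (?f x) (?f z)" using hdist_mobius[OF y(1)] assms by simp
  also have "\<dots> \<le> hdist 0 (?f x) + hdist 0 (?f z)"
    using assms y by (intro hdist_triangle_0 mobius_in_H3) auto
  also have "\<dots> = hdist (?f y) (?f x) + hdist (?f y) (?f z)"
    using y(2) by (simp add: mobius_neg_center)
  also have "\<dots> = hdist x y + hdist y z"
    using hdist_mobius[OF y(1)] assms by (simp add: hdist_commute)
  finally show ?thesis .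
qed

section \<open>Normal form of isometries and their action on the sphere at infinity\<close>

lemma carrier_Isom_H3: "g \<in> carrier Isom_H3 \<longleftrightarrow>
    g \<in> Bij H3 \<and> (\<forall>x\<in>H3. \<forall>y\<in>H3. hdist (g x) (g y) = hdist x y)"
  by (simp add: Isom_H3_def)

lemma zero_in_H3 [simp]: "(0::real^3) \<in> H3" by (simp add: H3_def)

lemma Isom_H3_bij_betw: "g \<in> carrier Isom_H3 \<Longrightarrow> bij_betw g H3 H3"
  by (simp add: carrier_Isom_H3 Bij_def)

lemma Isom_H3_in_H3: "g \<in> carrier Isom_H3 \<Longrightarrow> x \<in> H3 \<Longrightarrow> g x \<in> H3"
  using Isom_H3_bij_betw bij_betwE by blast

lemma Isom_H3_hdist: "g \<in> carrier Isom_H3 \<Longrightarrow> x \<in> H3 \<Longrightarrow> y \<in> H3 \<Longrightarrow> hdist (g x) (g y) = hdist x y"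
  by (simp add: carrier_Isom_H3)

lemma Isom_H3_mult_apply:
  assumes "g \<in> carrier Isom_H3" "h \<in> carrier Isom_H3" "x \<in> H3"
  shows "(g \<otimes>\<^bsub>Isom_H3\<^esub> h) x = g (h x)"
  using assms by (simp add: Isom_H3_def BijGroup_def compose_eq)

lemma Isom_H3_one_apply: "x \<in> H3 \<Longrightarrow> \<one>\<^bsub>Isom_H3\<^esub> x = x"
  by (simp add: Isom_H3_def BijGroup_def)

lemma Isom_H3_inv_apply:
  assumes g: "g \<in> carrier Isom_H3" and x: "x \<in> H3"
  shows "(inv\<^bsub>Isom_H3\<^esub> g) (g x) = x" "g ((inv\<^bsub>Isom_H3\<^esub> g) x) = x"
proof -
  interpret I: group Isom_H3 by (rule group_Isom_H3)
  show "(inv\<^bsub>Isom_H3\<^esub> g) (g x) = x"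
    using Isom_H3_mult_apply[of "inv\<^bsub>Isom_H3\<^esub> g" g x] g x by (simp add: Isom_H3_one_apply)
  show "g ((inv\<^bsub>Isom_H3\<^esub> g) x) = x"
    using Isom_H3_mult_apply[of g "inv\<^bsub>Isom_H3\<^esub> g" x] g x by (simp add: Isom_H3_one_apply)
qed

lemma hdist_0_eq_norm:
  assumes "x \<in> H3" "y \<in> H3" "hdist 0 x = hdist 0 y"
  shows "norm x = norm y"
proof -
  have "hdefect 0 x = hdefect 0 y" using assms hdefect_eq_iff by simp
  moreover have "0 < 1 - (norm x)\<^sup>2" "0 < 1 - (norm y)\<^sup>2" using assms one_minus_norm_pos by auto
  ultimately have "(norm x)\<^sup>2 = (norm y)\<^sup>2" by (simp add: hdefect_def field_simps)
  then show ?thesis by simp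
qed

text \<open>The map \<open>T\<close> is read off on the sphere of radius 1/2, rescaled to the unit
  sphere, and extended from there. It agrees with \<open>f\<close> on the rest of the ball because
  inner products are preserved and the vectors \<open>T b\<close> determine a vector.\<close>

lemma isometry_ball_orthogonal:
  fixes f :: "'a::euclidean_space \<Rightarrow> 'a"
  assumes nf: "\<And>x. norm x < 1 \<Longrightarrow> norm (f x) = norm x"
    and df: "\<And>x y. norm x < 1 \<Longrightarrow> norm y < 1 \<Longrightarrow> norm (f x - f y) = norm (x - y)"
  obtains T where "orthogonal_transformation T" "\<And>x. norm x < 1 \<Longrightarrow> f x = T x"
proof -
  have ip: "f x \<bullet> f y = x \<bullet> y" if "norm x < 1" "norm y < 1" for x y
    using nf[OF that(1)] nf[OF that(2)] df[OF that] by (simp add: dot_norm_neg)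
  define F where "F = (\<lambda>x. 2 *\<^sub>R f (x /\<^sub>R 2))"
  have "\<exists>T. orthogonal_transformation T \<and> (\<forall>x. norm x = 1 \<longrightarrow> T x = F x)"
  proof (rule isometry_sphere_extend)
    fix x y :: 'a assume "norm x = 1" "norm y = 1"
    then show "dist (F x) (F y) = dist x y"
      using df[of "x /\<^sub>R 2" "y /\<^sub>R 2"]
      by (simp add: F_def dist_norm flip: scaleR_diff_right)
  qed (simp add: F_def nf)
  then obtain T where T: "orthogonal_transformation T" "\<And>x. norm x = 1 \<Longrightarrow> T x = F x" by blast
  have "f x = T x" if x: "norm x < 1" for x
  proof (rule vector_eq_rdot[THEN iffD1, rule_format])
    have "f x \<bullet> T b = T x \<bullet> T b" if b: "norm b = 1" for b
    proof -
      have "f x \<bullet> T b = 2 * (f x \<bullet> f (b /\<^sub>R 2))" by (simp add: T(2)[OF b] F_def)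
      also have "\<dots> = x \<bullet> b" using ip[OF x, of "b /\<^sub>R 2"] b by simp
      also have "\<dots> = T x \<bullet> T b" using T(1) by (simp add: orthogonal_transformation_def)
      finally show ?thesis .
    qed
    then have "f x \<bullet> T b = T x \<bullet> T b" for b
    proof (cases "b = 0")
      case False
      with \<open>\<And>b. norm b = 1 \<Longrightarrow> f x \<bullet> T b = T x \<bullet> T b\<close>[of "b /\<^sub>R norm b"] T(1)
      show ?thesis by (simp add: orthogonal_transformation_scaleR)
    qed (use T(1) in \<open>simp add: orthogonal_transformation_def linear_0\<close>)
    then show "f x \<bullet> z = T x \<bullet> z" for z
      using surj_f_inv_f[OF orthogonal_transformation_surj[OF T(1)], of z] by metis
  qed
  with T(1) show ?thesis by (rule that)
qed

text \<open>After composition with the translation by \<open>- g 0\<close> the origin is fixed.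
  Distances from 0 then fix Euclidean norms, and with equal norms the invariance of
  \<open>hdefect\<close> becomes invariance of the Euclidean distance.\<close>

lemma Isom_H3_decomp:
  assumes g: "g \<in> carrier Isom_H3"
  obtains T where "orthogonal_transformation T" "\<forall>x\<in>H3. g x = mobius (g 0) (T x)"
proof -
  have a: "norm (g 0) < 1" "norm (- g 0) < 1" using Isom_H3_in_H3[OF g, of 0] by (auto simp: H3_norm)
  define f where "f x = mobius (- g 0) (g x)" for x
  have fH: "f x \<in> H3" if "x \<in> H3" for x
    unfolding f_def by (rule mobius_in_H3[OF a(2) Isom_H3_in_H3[OF g that]])
  have fd: "hdist (f x) (f y) = hdist x y" if "x \<in> H3" "y \<in> H3" for x y
    unfolding f_def using that g a by (simp add: hdist_mobius Isom_H3_in_H3 Isom_H3_hdist)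
  have f0: "f 0 = 0" unfolding f_def using a by (simp add: mobius_neg_center)
  have nf: "norm (f x) = norm x" if "x \<in> H3" for x
    using hdist_0_eq_norm[OF fH[OF that] that] fd[OF zero_in_H3 that] unfolding f0 .
  have df: "norm (f x - f y) = norm (x - y)" if "x \<in> H3" "y \<in> H3" for x y
  proof -
    have "hdefect (f x) (f y) = hdefect x y" using fd[OF that] fH that hdefect_eq_iff by simp
    then have "(norm (f x - f y))\<^sup>2 = (norm (x - y))\<^sup>2"
      using one_minus_norm_pos[OF that(1)] one_minus_norm_pos[OF that(2)]
      by (simp add: hdefect_def nf that)
    then show ?thesis by simp
  qed
  obtain T where T: "orthogonal_transformation T" "\<And>x. norm x < 1 \<Longrightarrow> f x = T x"
    using isometry_ball_orthogonal[of f] nf df by (auto simp: H3_norm)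
  have "\<forall>x\<in>H3. g x = mobius (g 0) (T x)"
  proof
    fix x :: "real^3" assume that: "x \<in> H3"
    have "mobius (g 0) (f x) = g x" unfolding f_def
      using a Isom_H3_in_H3[OF g that] by (intro mobius_mobius_minus) (auto simp: H3_norm)
    with T(2)[of x] that show "g x = mobius (g 0) (T x)" by (simp add: H3_norm)
  qed
  with T(1) show ?thesis by (rule that)
qed

lemma continuous_on_mobius_orthogonal:
  fixes T :: "'a::euclidean_space \<Rightarrow> 'a"
  assumes "norm a < 1" "orthogonal_transformation T"
  shows "continuous_on (cball 0 1) (\<lambda>x. mobius a (T x))"
proof -
  have T: "continuous_on S T" for S
    using assms(2) by (simp add: linear_continuous_on linear_linear orthogonal_transformation_def)
  have "mobius_den a (T x) \<noteq> 0" if "norm x \<le> 1" for x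
    using mobius_den_pos[OF assms(1), of "T x"] that orthogonal_transformation_norm[OF assms(2)] by simp
  then show ?thesis unfolding mobius_def mobius_den_def
    by (intro continuous_intros T) auto
qed

text \<open>The boundary action is defined as a limit from inside the ball. The normal form is
  continuous on the closed ball, so the limit exists and is given by the same formula.\<close>

lemma bd_action_eqI:
  assumes g: "g \<in> carrier Isom_H3" and T: "orthogonal_transformation T"
    and gT: "\<forall>x\<in>H3. g x = mobius (g 0) (T x)" and xi: "\<xi> \<in> bdH3"
  shows "(g \<longlongrightarrow> bd_action g \<xi>) (at \<xi> within H3)" "bd_action g \<xi> = mobius (g 0) (T \<xi>)"
proof -
  have a: "norm (g 0) < 1" using Isom_H3_in_H3[OF g, of 0] by (simp add: H3_norm)
  have "((\<lambda>x. mobius (g 0) (T x)) \<longlongrightarrow> mobius (g 0) (T \<xi>)) (at \<xi> within H3)"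
    using continuous_on_mobius_orthogonal[OF a T] xi
    by (intro tendsto_within_subset[where S = "cball 0 1" and T = H3])
       (auto simp: continuous_on_def bdH3_def H3_def)
  then have t: "(g \<longlongrightarrow> mobius (g 0) (T \<xi>)) (at \<xi> within H3)"
  proof (rule Lim_transform_within[where d = 1])
    show "mobius (g 0) (T x) = g x" if "x \<in> H3" for x
      using gT that by metis
  qed simp
  have "\<not> trivial_limit (at \<xi> within H3)"
    using xi by (simp add: trivial_limit_within H3_def bdH3_def islimpt_ball)
  with t show "bd_action g \<xi> = mobius (g 0) (T \<xi>)"
    unfolding bd_action_def by (intro tendsto_Lim)
  with t show "(g \<longlongrightarrow> bd_action g \<xi>) (at \<xi> within H3)" by simp
qed

lemma bd_action_tendsto:
  assumes "g \<in> carrier Isom_H3" "\<xi> \<in> bdH3"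
  shows "(g \<longlongrightarrow> bd_action g \<xi>) (at \<xi> within H3)"
  using Isom_H3_decomp[OF assms(1)] bd_action_eqI(1) assms by metis

lemma bd_action_in:
  assumes "g \<in> carrier Isom_H3" "\<xi> \<in> bdH3"
  shows "bd_action g \<xi> \<in> bdH3"
proof -
  obtain T where T: "orthogonal_transformation T" "\<forall>x\<in>H3. g x = mobius (g 0) (T x)"
    using Isom_H3_decomp[OF assms(1)] by blast
  have "norm (g 0) < 1" using Isom_H3_in_H3[OF assms(1), of 0] by (simp add: H3_norm)
  then show ?thesis unfolding bd_action_eqI(2)[OF assms(1) T assms(2)]
    using assms(2) T(1) by (simp add: bdH3_def norm_mobius_sphere orthogonal_transformation_norm)
qed

lemma bd_action_unique:
  assumes "\<xi> \<in> bdH3" "(g \<longlongrightarrow> l) (at \<xi> within H3)"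
  shows "bd_action g \<xi> = l"
proof -
  have "\<not> trivial_limit (at \<xi> within H3)"
    using assms(1) by (simp add: trivial_limit_within H3_def bdH3_def islimpt_ball)
  with assms(2) show ?thesis unfolding bd_action_def by (intro tendsto_Lim)
qed

lemma bd_action_mult:
  assumes g: "g \<in> carrier Isom_H3" and h: "h \<in> carrier Isom_H3" and xi: "\<xi> \<in> bdH3"
  shows "bd_action (g \<otimes>\<^bsub>Isom_H3\<^esub> h) \<xi> = bd_action g (bd_action h \<xi>)"
proof (rule bd_action_unique[OF xi])
  have b: "bd_action h \<xi> \<in> bdH3" by (rule bd_action_in[OF h xi])
  have ev: "eventually (\<lambda>x. x \<in> H3) (at \<xi> within H3)" by (simp add: eventually_at_filter)
  \<comment> \<open>Limits compose because \<open>h\<close> maps the open ball into itself: its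
    values there never equal the boundary point being approached.\<close>
  have "filterlim h (at (bd_action h \<xi>) within H3) (at \<xi> within H3)"
    unfolding filterlim_at
  proof
    have "h x \<in> H3 \<and> h x \<noteq> bd_action h \<xi>" if "x \<in> H3" for x
      using Isom_H3_in_H3[OF h that] b by (auto simp: H3_def bdH3_def)
    then show "\<forall>\<^sub>F x in at \<xi> within H3. h x \<in> H3 \<and> h x \<noteq> bd_action h \<xi>"
      by (intro eventually_mono[OF ev])
  qed (rule bd_action_tendsto[OF h xi])
  then have "((\<lambda>x. g (h x)) \<longlongrightarrow> bd_action g (bd_action h \<xi>)) (at \<xi> within H3)"
    by (rule filterlim_compose[OF bd_action_tendsto[OF g b]])
  then show "(g \<otimes>\<^bsub>Isom_H3\<^esub> h \<longlongrightarrow> bd_action g (bd_action h \<xi>)) (at \<xi> within H3)"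
    by (rule Lim_transform_within[where d = 1]) (auto simp: Isom_H3_mult_apply g h)
qed

lemma bd_action_one: "\<xi> \<in> bdH3 \<Longrightarrow> bd_action \<one>\<^bsub>Isom_H3\<^esub> \<xi> = \<xi>"
  by (rule bd_action_unique, assumption)
     (rule Lim_transform_within[where d = 1 and f = "\<lambda>x. x"], auto simp: Isom_H3_one_apply)

lemma bd_action_inv:
  assumes "g \<in> carrier Isom_H3" "\<xi> \<in> bdH3"
  shows "bd_action (inv\<^bsub>Isom_H3\<^esub> g) (bd_action g \<xi>) = \<xi>"
    "bd_action g (bd_action (inv\<^bsub>Isom_H3\<^esub> g) \<xi>) = \<xi>"
proof -
  interpret I: group Isom_H3 by (rule group_Isom_H3)
  show "bd_action (inv\<^bsub>Isom_H3\<^esub> g) (bd_action g \<xi>) = \<xi>"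
    "bd_action g (bd_action (inv\<^bsub>Isom_H3\<^esub> g) \<xi>) = \<xi>"
    using assms by (simp_all add: bd_action_one flip: bd_action_mult)
qed

section \<open>The Poisson kernel and invariant integration\<close>

text \<open>The kernel of hyperbolic 3-space, with exponent 2 = dimension - 1; the Euclidean kernel
  of the ball is different.\<close>

definition poisson :: "real^3 \<Rightarrow> real^3 \<Rightarrow> real" where
  "poisson x \<xi> = ((1 - (norm x)\<^sup>2) / (norm (x - \<xi>))\<^sup>2)\<^sup>2"

lemma poisson_pos: "x \<in> H3 \<Longrightarrow> \<xi> \<in> bdH3 \<Longrightarrow> 0 < poisson x \<xi>"
  using one_minus_norm_pos[of x] by (auto simp: poisson_def H3_def bdH3_def)

lemma poisson_0: "\<xi> \<in> bdH3 \<Longrightarrow> poisson 0 \<xi> = 1"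
  by (simp add: poisson_def bdH3_def)

lemma poisson_mobius_center:
  assumes "norm a < 1" "\<xi> \<in> bdH3"
  shows "poisson a (mobius a \<xi>) = (mobius_den a \<xi> / (1 - (norm a)\<^sup>2))\<^sup>2"
proof -
  have q: "mobius_den a \<xi> > 0" using assms by (intro mobius_den_pos) (auto simp: bdH3_def)
  have s: "1 - (norm a)\<^sup>2 > 0" using assms by (simp add: power_less_one_iff)
  have "mobius_den a \<xi> * (norm (a - mobius a \<xi>))\<^sup>2 = (1 - (norm a)\<^sup>2)\<^sup>2"
    using norm_mobius_diff[of a 0 \<xi>] q assms by (simp add: mobius_den_def[of a 0] bdH3_def)
  then have "(norm (a - mobius a \<xi>))\<^sup>2 = (1 - (norm a)\<^sup>2)\<^sup>2 / mobius_den a \<xi>"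
    using q by (simp add: field_simps)
  then have "(1 - (norm a)\<^sup>2) / (norm (a - mobius a \<xi>))\<^sup>2 = mobius_den a \<xi> / (1 - (norm a)\<^sup>2)"
    using s q by (simp add: power2_eq_square[of "1 - (norm a)\<^sup>2"])
  then show ?thesis by (simp add: poisson_def)
qed

text \<open>Multiplicative cocycle. Both the numerator and the denominator of the kernel pick up the
  factor \<open>1 / mobius_den a x\<close>, which cancels and leaves a factor depending on
  \<open>\<xi>\<close> alone.\<close>

lemma poisson_mobius:
  assumes "norm a < 1" "x \<in> H3" "\<xi> \<in> bdH3"
  shows "poisson (mobius a x) (mobius a \<xi>) = poisson x \<xi> * poisson a (mobius a \<xi>)"
proof -
  have q: "mobius_den a x > 0" "mobius_den a \<xi> > 0"
    using assms by (auto intro!: mobius_den_pos simp: bdH3_def H3_def)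
  have s: "1 - (norm a)\<^sup>2 > 0" using assms by (simp add: power_less_one_iff)
  have "norm (x - \<xi>) > 0" using assms by (auto simp: bdH3_def H3_def)
  have 1: "(norm (mobius a x - mobius a \<xi>))\<^sup>2
      = (1 - (norm a)\<^sup>2)\<^sup>2 * (norm (x - \<xi>))\<^sup>2 / (mobius_den a x * mobius_den a \<xi>)"
    using norm_mobius_diff[of a x \<xi>] q by (simp add: field_simps)
  have 2: "1 - (norm (mobius a x))\<^sup>2 = (1 - (norm a)\<^sup>2) * (1 - (norm x)\<^sup>2) / mobius_den a x"
    using one_minus_norm_mobius[of a x] q by (simp add: field_simps)
  have "(1 - (norm (mobius a x))\<^sup>2) / (norm (mobius a x - mobius a \<xi>))\<^sup>2
     = ((1 - (norm x)\<^sup>2) / (norm (x - \<xi>))\<^sup>2) * (mobius_den a \<xi> / (1 - (norm a)\<^sup>2))"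
    unfolding 1 2 using q s by (simp add: power2_eq_square[of "1 - (norm a)\<^sup>2"])
  then show ?thesis
    unfolding poisson_mobius_center[OF assms(1,3)] by (simp only: poisson_def power_mult_distrib)
qed

lemma poisson_orthogonal:
  assumes "orthogonal_transformation T"
  shows "poisson (T x) (T \<xi>) = poisson x \<xi>"
proof -
  have "norm (T x - T \<xi>) = norm (x - \<xi>)"
    using assms orthogonal_transformation_norm[OF assms, of "x - \<xi>"]
    by (simp add: orthogonal_transformation_linear linear_diff)
  then show ?thesis
    using assms by (simp add: poisson_def orthogonal_transformation_norm)
qed

lemma poisson_Isom:
  assumes g: "g \<in> carrier Isom_H3" and x: "x \<in> H3" and xi: "\<xi> \<in> bdH3"
  shows "poisson (g x) (bd_action g \<xi>) = poisson x \<xi> * poisson (g 0) (bd_action g \<xi>)"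
proof -
  obtain T where T: "orthogonal_transformation T" "\<forall>x\<in>H3. g x = mobius (g 0) (T x)"
    using Isom_H3_decomp[OF g] by blast
  have "norm (g 0) < 1" using Isom_H3_in_H3[OF g, of 0] by (simp add: H3_norm)
  moreover have "T x \<in> H3" "T \<xi> \<in> bdH3"
    using x xi T(1) by (auto simp: H3_def bdH3_def orthogonal_transformation_norm)
  ultimately have "poisson (mobius (g 0) (T x)) (mobius (g 0) (T \<xi>))
      = poisson x \<xi> * poisson (g 0) (mobius (g 0) (T \<xi>))"
    using poisson_mobius[of "g 0" "T x" "T \<xi>"] by (simp only: poisson_orthogonal[OF T(1)])
  then show ?thesis
    using T(2)[rule_format, OF x] by (simp only: bd_action_eqI(2)[OF g T xi])
qed

text \<open>Passing from \<open>g\<close> to its inverse replaces a kernel value by a reciprocal.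
  This is what lets symmetry of the measure compare \<open>p\<close> with \<open>1 / p\<close> on a
  finite invariant set.\<close>

lemma poisson_inv:
  assumes g: "g \<in> carrier Isom_H3" and xi: "\<xi> \<in> bdH3"
  shows "poisson ((inv\<^bsub>Isom_H3\<^esub> g) 0) \<xi> * poisson (g 0) (bd_action g \<xi>) = 1"
proof -
  interpret I: group Isom_H3 by (rule group_Isom_H3)
  have "(inv\<^bsub>Isom_H3\<^esub> g) 0 \<in> H3"
    by (rule Isom_H3_in_H3[OF I.inv_closed[OF g] zero_in_H3])
  then have "poisson (g ((inv\<^bsub>Isom_H3\<^esub> g) 0)) (bd_action g \<xi>)
     = poisson ((inv\<^bsub>Isom_H3\<^esub> g) 0) \<xi> * poisson (g 0) (bd_action g \<xi>)"
    by (intro poisson_Isom[OF g _ xi])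
  moreover have "g ((inv\<^bsub>Isom_H3\<^esub> g) 0) = 0" by (rule Isom_H3_inv_apply(2)[OF g zero_in_H3])
  ultimately show ?thesis using poisson_0[OF bd_action_in[OF g xi]] by simp
qed

section \<open>Jacobians of Moebius maps and invariance of hyperbolic volume\<close>

text \<open>On a set \<open>A\<close> the identity computes the measure of \<open>A\<close> as the
  image of its preimage \<open>E\<close>. Finite measure of \<open>S\<close> makes these images
  measurable with finite measure; equality of the two measures then gives all nonnegative integrands
  at once.\<close>

lemma nn_integral_change_of_variables_self:
  fixes f :: "real^'n::{finite,wellorder} \<Rightarrow> real^'n::_"
  assumes S: "S \<in> sets borel" "emeasure lborel S < \<infinity>"
    and f: "\<And>x. x \<in> S \<Longrightarrow> (f has_derivative f' x) (at x)" "inj_on f S" "f ` S = S"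
    and J: "J \<in> borel_measurable (restrict_space lborel S)"
      "\<And>x. x \<in> S \<Longrightarrow> \<bar>det (matrix (f' x))\<bar> = J x"
    and F: "F \<in> borel_measurable (restrict_space lborel S)"
  shows "(\<integral>\<^sup>+x. F (f x) * ennreal (J x) \<partial>restrict_space lborel S) = (\<integral>\<^sup>+x. F x \<partial>restrict_space lborel S)"
proof -
  let ?R = "restrict_space lborel S"
  have Sl [simp]: "S \<inter> space lborel \<in> sets lborel" using S by simp
  have spR: "space ?R = S" by (simp add: space_restrict_space)
  have contf: "continuous_on S f"
    using f(1) by (meson continuous_at_imp_continuous_on has_derivative_continuous)
  have fm: "f \<in> measurable ?R ?R"
  proof (rule measurable_restrict_space2)
    show "f \<in> space ?R \<rightarrow> S" using f(3) spR by auto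
    have "f \<in> borel_measurable (restrict_space borel S)"
      by (rule borel_measurable_continuous_on_restrict[OF contf])
    then show "f \<in> measurable ?R lborel"
      by (simp add: measurable_def space_restrict_space sets_restrict_space)
  qed
  have Jn: "0 \<le> J x" if "x \<in> S" for x using J(2)[OF that] by linarith
  have "distr (density ?R J) ?R f = ?R"
  proof (rule measure_eqI)
    fix A assume "A \<in> sets (distr (density ?R J) ?R f)"
    then have A: "A \<in> sets ?R" by simp
    then have AS: "A \<subseteq> S" "A \<in> sets lborel"
      using S by (auto simp: sets_restrict_space_iff space_restrict_space)
    define E where "E = f -` A \<inter> S"
    have E: "E \<in> sets ?R" using measurable_sets[OF fm A] by (simp add: E_def spR)
    then have ES: "E \<subseteq> S" "E \<in> sets lborel"
      using S by (auto simp: sets_restrict_space_iff space_restrict_space)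
    have fE: "f ` E = A" using f(3) AS by (force simp: E_def)
    have "emeasure lborel A < \<infinity>"
      using emeasure_mono[of A S lborel] AS S by (simp add: order_le_less_trans)
    then have Al: "A \<in> lmeasurable" using AS by (auto simp: fmeasurable_def)
    have "((\<lambda>x. \<bar>det (matrix (f' x))\<bar>) has_integral measure lebesgue A) E"
    proof (subst has_measure_differentiable_image[symmetric, where f = f])
      show "E \<in> sets lebesgue" using ES by auto
      show "(f has_derivative f' x) (at x within E)" if "x \<in> E" for x
        using f(1) that ES by (meson has_derivative_at_withinI subsetD)
      show "inj_on f E" using f(2) ES(1) by (rule inj_on_subset)
    qed (simp add: fE Al)
    moreover have "\<bar>det (matrix (f' x))\<bar> = J x" if "x \<in> E" for x using J(2) that ES(1) by blast
    ultimately have "(J has_integral measure lebesgue A) E" by (rule has_integral_eq[rotated])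
    then have "(\<integral>\<^sup>+x. ennreal (J x) * indicator E x \<partial>lborel) = ennreal (measure lebesgue A)"
      using ES Jn by (intro nn_integral_has_integral_lebesgue') auto
    also have "\<dots> = emeasure lborel A"
      using emeasure_eq_measure2[OF Al] AS(2) by simp
    finally have *: "(\<integral>\<^sup>+x. ennreal (J x) * indicator E x \<partial>lborel) = emeasure lborel A" .
    have "emeasure (distr (density ?R J) ?R f) A = emeasure (density ?R J) E"
      using A fm by (subst emeasure_distr) (auto simp: E_def spR)
    also have "\<dots> = (\<integral>\<^sup>+x. ennreal (J x) * indicator E x \<partial>?R)"
      using J(1) E by (subst emeasure_density) auto
    also have "\<dots> = (\<integral>\<^sup>+x. ennreal (J x) * indicator E x \<partial>lborel)"
      using ES by (subst nn_integral_restrict_space[OF Sl]) (auto intro!: nn_integral_cong simp: indicator_def)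
    also have "\<dots> = emeasure ?R A"
      unfolding * using AS S by (subst emeasure_restrict_space) auto
    finally show "emeasure (distr (density ?R J) ?R f) A = emeasure ?R A" .
  qed simp
  then have "(\<integral>\<^sup>+x. F x \<partial>?R) = (\<integral>\<^sup>+x. F x \<partial>distr (density ?R J) ?R f)" by simp
  also have "\<dots> = (\<integral>\<^sup>+x. F (f x) \<partial>density ?R J)"
    using fm F by (intro nn_integral_distr) auto
  also have "\<dots> = (\<integral>\<^sup>+x. J x * F (f x) \<partial>?R)"
    using J(1) measurable_compose[OF fm F] by (intro nn_integral_density) auto
  finally show ?thesis by (simp add: mult.commute)
qed

text \<open>Recovers \<open>norm (L h)\<close> from difference quotients of squared distances, so
  that an exact distortion formula determines the length distortion of the derivative without an
  expression for the derivative.\<close>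

lemma has_derivative_norm_square_limit:
  fixes f :: "'a::real_normed_vector \<Rightarrow> 'b::real_inner"
  assumes "(f has_derivative L) (at x)"
  shows "((\<lambda>t::real. (norm (f (x + t *\<^sub>R h) - f x))\<^sup>2 / t\<^sup>2) \<longlongrightarrow> (norm (L h))\<^sup>2) (at 0)"
proof -
  have "((\<lambda>t. f (x + t *\<^sub>R h)) has_derivative (\<lambda>t. L (t *\<^sub>R h))) (at 0)"
    by (rule has_derivative_compose[of "\<lambda>t. x + t *\<^sub>R h", where g = f])
       (auto intro!: derivative_eq_intros assms)
  then have "((\<lambda>t. norm (f (x + t *\<^sub>R h) - f x - t *\<^sub>R L h) / norm t) \<longlongrightarrow> 0) (at 0)"
    using has_derivative_linear[OF assms] by (simp add: has_derivative_at linear_scale)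
  then have "((\<lambda>t. norm ((f (x + t *\<^sub>R h) - f x - t *\<^sub>R L h) /\<^sub>R t)) \<longlongrightarrow> 0) (at 0)"
    by (simp add: divide_inverse mult.commute)
  then have "((\<lambda>t. (f (x + t *\<^sub>R h) - f x - t *\<^sub>R L h) /\<^sub>R t) \<longlongrightarrow> 0) (at 0)"
    by (rule tendsto_norm_zero_cancel)
  then have "((\<lambda>t. (f (x + t *\<^sub>R h) - f x - t *\<^sub>R L h) /\<^sub>R t + L h) \<longlongrightarrow> 0 + L h) (at 0)"
    by (intro tendsto_intros)
  then have "((\<lambda>t. (f (x + t *\<^sub>R h) - f x) /\<^sub>R t) \<longlongrightarrow> L h) (at 0)"
    unfolding add_0 by (rule Lim_transform_eventually) (auto simp: eventually_at_filter scaleR_diff_right)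
  then have "((\<lambda>t. (norm ((f (x + t *\<^sub>R h) - f x) /\<^sub>R t))\<^sup>2) \<longlongrightarrow> (norm (L h))\<^sup>2) (at 0)"
    by (intro tendsto_intros)
  then show ?thesis
    by (simp only: norm_scaleR power_mult_distrib) (simp add: power_inverse divide_inverse mult.commute)
qed

lemma det_conformal:
  fixes L :: "real^'n::{finite,wellorder} \<Rightarrow> real^'n::_"
  assumes "linear L" "c > 0" "\<And>h. norm (L h) = c * norm h"
  shows "\<bar>det (matrix L)\<bar> = c ^ CARD('n)"
proof -
  define T where "T h = (1 / c) *\<^sub>R L h" for h
  have "linear T" unfolding T_def using assms(1) by (rule linear_compose_scale_right)
  then have T: "orthogonal_transformation T"
    using assms by (simp add: orthogonal_transformation T_def)
  have "L = (\<lambda>x. c *\<^sub>R x) \<circ> T" using assms(2) by (auto simp: T_def)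
  then have "matrix L = matrix ((*\<^sub>R) c) ** matrix T"
    using matrix_compose[OF \<open>linear T\<close> linear_scale_self[of c]] by simp
  then have "det (matrix L) = c ^ CARD('n) * det (matrix T)" by (simp add: det_mul)
  then show ?thesis using orthogonal_transformation_det[OF T] assms(2) by (simp add: abs_mult)
qed

text \<open>The hypothesis says that \<open>L\<close> preserves length along \<open>u\<close> and
  scales by \<open>c\<close> across it. Composition with \<open>D\<close>, which keeps
  \<open>u\<close> and scales by \<open>1 / c\<close> across, is orthogonal, so the determinant of
  \<open>L\<close> is the inverse of that of \<open>D\<close> up to sign.\<close>

lemma det_axial:
  fixes L :: "real^3 \<Rightarrow> real^3"
  assumes L: "linear L" and c: "c > 0" and u: "norm u = 1"
    and n: "\<And>h. (norm (L h))\<^sup>2 = c\<^sup>2 * (norm h)\<^sup>2 + (1 - c\<^sup>2) * (h \<bullet> u)\<^sup>2"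
  shows "\<bar>det (matrix L)\<bar> = c\<^sup>2"
proof -
  define D where "D h = (1 / c) *\<^sub>R h + (1 - 1 / c) *\<^sub>R ((h \<bullet> u) *\<^sub>R u)" for h :: "real^3"
  have D: "linear D"
    unfolding D_def by (rule linearI) (simp_all add: algebra_simps inner_add_left scaleR_add_left)
  have uu: "u \<bullet> u = 1" using u by (simp add: norm_eq_1)
  have Du: "D h \<bullet> u = h \<bullet> u" for h
    by (simp add: D_def inner_add_left uu algebra_simps)
  have ND: "c\<^sup>2 * (norm (D h))\<^sup>2 = (norm h)\<^sup>2 + (c\<^sup>2 - 1) * (h \<bullet> u)\<^sup>2" for h
  proof -
    have "c *\<^sub>R D h = h + (c - 1) *\<^sub>R ((h \<bullet> u) *\<^sub>R u)"
      using c by (simp add: D_def algebra_simps)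
    then have "(norm (c *\<^sub>R D h))\<^sup>2 = (norm (h + (c - 1) *\<^sub>R ((h \<bullet> u) *\<^sub>R u)))\<^sup>2" by simp
    then show ?thesis
      unfolding power2_norm_eq_inner
      by (simp add: inner_add_left inner_add_right uu inner_commute[of u h] power2_eq_square algebra_simps)
  qed
  have "orthogonal_transformation (L \<circ> D)"
    unfolding orthogonal_transformation
  proof (intro conjI allI)
    show "linear (L \<circ> D)" using D L by (rule linear_compose)
    fix v
    have "(norm ((L \<circ> D) v))\<^sup>2 = (norm v)\<^sup>2"
      using n[of "D v"] ND[of v] by (simp add: Du algebra_simps)
    then show "norm ((L \<circ> D) v) = norm v" by simp
  qed
  then have "\<bar>det (matrix (L \<circ> D))\<bar> = 1" by (rule orthogonal_transformation_det)
  then have 1: "\<bar>det (matrix L)\<bar> * \<bar>det (matrix D)\<bar> = 1"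
    by (simp add: matrix_compose[OF D L] det_mul abs_mult)
  have u3: "u$3 * u$3 = 1 - u$1 * u$1 - u$2 * u$2"
    using uu by (simp add: inner_vec_def sum_3)
  define b where "b = 1 / c"
  have "matrix D $ i $ j = (if i = j then b else 0) + (1 - b) * (u $ i * u $ j)" for i j
    by (simp add: matrix_def D_def inner_axis' b_def) (simp add: axis_def)
  then have m: "matrix D $ 1 $ 1 = b + (1 - b) * (u$1 * u$1)" "matrix D $ 2 $ 2 = b + (1 - b) * (u$2 * u$2)"
    "matrix D $ 3 $ 3 = b + (1 - b) * (u$3 * u$3)" "matrix D $ 1 $ 2 = (1 - b) * (u$1 * u$2)"
    "matrix D $ 2 $ 1 = (1 - b) * (u$1 * u$2)" "matrix D $ 1 $ 3 = (1 - b) * (u$1 * u$3)"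
    "matrix D $ 3 $ 1 = (1 - b) * (u$1 * u$3)" "matrix D $ 2 $ 3 = (1 - b) * (u$2 * u$3)"
    "matrix D $ 3 $ 2 = (1 - b) * (u$2 * u$3)"
    by (simp_all add: mult.commute)
  have "det (matrix D) = (b + (1 - b) * (u$1 * u$1)) * (b + (1 - b) * (u$2 * u$2)) * (b + (1 - b) * (u$3 * u$3))
      + 2 * ((1 - b) * (u$1 * u$2) * ((1 - b) * (u$2 * u$3)) * ((1 - b) * (u$1 * u$3)))
      - (b + (1 - b) * (u$1 * u$1)) * ((1 - b) * (u$2 * u$3))\<^sup>2
      - (b + (1 - b) * (u$2 * u$2)) * ((1 - b) * (u$1 * u$3))\<^sup>2
      - (b + (1 - b) * (u$3 * u$3)) * ((1 - b) * (u$1 * u$2))\<^sup>2"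
    unfolding det_3 m by algebra
  \<comment> \<open>Rank-one perturbation of a multiple of the identity: the determinant is
    \<open>b\<^sup>2 * (b + (1 - b) * (u \<bullet> u))\<close>, and \<open>u\<close> is a unit
    vector.\<close>
  also have "\<dots> = b\<^sup>2"
    using u3 by algebra
  finally have "det (matrix D) = b\<^sup>2" .
  with 1 c show ?thesis by (simp add: b_def power_divide abs_mult field_simps)
qed

lemma differentiable_mobius:
  fixes a x :: "'a::euclidean_space"
  assumes "mobius_den a x \<noteq> 0"
  shows "mobius a differentiable (at x)"
proof -
  have "(\<lambda>y. (1 / mobius_den a y) *\<^sub>R ((1 + 2 * (a \<bullet> y) + y \<bullet> y) *\<^sub>R a + (1 - a \<bullet> a) *\<^sub>R y)) differentiable (at x)"
    using assms unfolding mobius_den_def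
    by (intro differentiable_scaleR differentiable_divide differentiable_add differentiable_mult
        differentiable_inner differentiable_const differentiable_ident)
  then show ?thesis by (simp add: mobius_def[abs_def])
qed

lemma tendsto_mobius_den: "((\<lambda>t::real. mobius_den a (x + t *\<^sub>R h)) \<longlongrightarrow> mobius_den a x) (at 0)"
proof -
  have "((\<lambda>t::real. mobius_den a (x + t *\<^sub>R h)) \<longlongrightarrow> mobius_den a (x + 0 *\<^sub>R h)) (at 0)"
    unfolding mobius_den_def by (intro tendsto_intros)
  then show ?thesis by simp
qed

lemma det_derivative_mobius:
  fixes a x :: "real^'n::{finite,wellorder}"
  assumes a: "norm a < 1" and x: "norm x < 1" and L: "(mobius a has_derivative L) (at x)"
  shows "\<bar>det (matrix L)\<bar> = ((1 - (norm a)\<^sup>2) / mobius_den a x) ^ CARD('n)"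
proof (rule det_conformal)
  have q: "mobius_den a x > 0" using a x by (intro mobius_den_pos) auto
  have s: "1 - (norm a)\<^sup>2 > 0" using a by (simp add: power_less_one_iff)
  show "linear L" using has_derivative_linear[OF L] .
  show "(1 - (norm a)\<^sup>2) / mobius_den a x > 0" using q s by simp
  fix h
  let ?s = "1 - (norm a)\<^sup>2"
  have "((\<lambda>t. ?s\<^sup>2 * (norm h)\<^sup>2 / (mobius_den a (x + t *\<^sub>R h) * mobius_den a x))
      \<longlongrightarrow> ?s\<^sup>2 * (norm h)\<^sup>2 / (mobius_den a x * mobius_den a x)) (at (0::real))"
    using q by (intro tendsto_intros tendsto_mobius_den) auto
  moreover have "eventually (\<lambda>t. mobius_den a (x + t *\<^sub>R h) > 0) (at (0::real))"
    using order_tendstoD(1)[OF tendsto_mobius_den q] .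
  then have "eventually (\<lambda>t. ?s\<^sup>2 * (norm h)\<^sup>2 / (mobius_den a (x + t *\<^sub>R h) * mobius_den a x)
      = (norm (mobius a (x + t *\<^sub>R h) - mobius a x))\<^sup>2 / t\<^sup>2) (at (0::real))"
    using eventually_neq_at_within[of 0]
  proof eventually_elim
    case (elim t)
    have "mobius_den a (x + t *\<^sub>R h) * mobius_den a x * (norm (mobius a (x + t *\<^sub>R h) - mobius a x))\<^sup>2
        = ?s\<^sup>2 * (t\<^sup>2 * (norm h)\<^sup>2)"
      using norm_mobius_diff[of a "x + t *\<^sub>R h" x] q elim by (simp add: power_mult_distrib)
    with elim q show ?case by (simp add: field_simps)
  qed
  ultimately have "((\<lambda>t. (norm (mobius a (x + t *\<^sub>R h) - mobius a x))\<^sup>2 / t\<^sup>2)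
      \<longlongrightarrow> ?s\<^sup>2 * (norm h)\<^sup>2 / (mobius_den a x * mobius_den a x)) (at (0::real))"
    by (rule Lim_transform_eventually)
  from tendsto_unique[OF _ has_derivative_norm_square_limit[OF L] this]
  have "(norm (L h))\<^sup>2 = (?s / mobius_den a x * norm h)\<^sup>2"
    by (simp add: power_mult_distrib power_divide power2_eq_square)
  moreover have "0 \<le> ?s / mobius_den a x * norm h" using q s by (intro mult_nonneg_nonneg) auto
  ultimately show "norm (L h) = ?s / mobius_den a x * norm h"
    by (simp add: power2_eq_iff_nonneg)
qed

lemma continuous_on_mobius: "norm a < 1 \<Longrightarrow> continuous_on (cball 0 1) (mobius a)"
  for a :: "'a::euclidean_space"
  using continuous_on_mobius_orthogonal[OF _ orthogonal_transformation_id] .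

lemma inj_on_mobius: "norm a < 1 \<Longrightarrow> inj_on (mobius a) (cball 0 1)"
  by (rule inj_on_inverseI[where g = "mobius (- a)"]) (simp add: mobius_minus_mobius)

lemma mobius_image_H3: assumes "norm a < 1" shows "mobius a ` H3 = H3"
proof
  show "mobius a ` H3 \<subseteq> H3" using mobius_in_H3[OF assms] by blast
  show "H3 \<subseteq> mobius a ` H3"
  proof
    fix x assume x: "x \<in> H3"
    then have "mobius (- a) x \<in> H3" using assms by (intro mobius_in_H3) auto
    moreover have "mobius a (mobius (- a) x) = x"
      using x assms by (intro mobius_mobius_minus) (auto simp: H3_def)
    ultimately show "x \<in> mobius a ` H3" by (metis imageI)
  qed
qed

text \<open>Up to the constant 8 of the metric \<open>2 |dx| / (1 - |x|^2)\<close>, the density of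
  hyperbolic volume. The constant cancels from the walk.\<close>

definition hweight :: "real^3 \<Rightarrow> real" where
  "hweight x = 1 / (1 - (norm x)\<^sup>2) ^ 3"

definition hvol :: "(real^3) measure" where
  "hvol = density (restrict_space lborel H3) (\<lambda>x. ennreal (hweight x))"

lemma sets_H3 [measurable, simp]: "H3 \<in> sets borel" by (simp add: H3_def)

lemma space_hvol [simp]: "space hvol = H3"
  by (simp add: hvol_def space_restrict_space)

lemma sets_hvol: "sets hvol = sets (restrict_space borel H3)"
  by (simp add: hvol_def sets_restrict_space)

lemma measurable_hvol1: "f \<in> borel \<rightarrow>\<^sub>M N \<Longrightarrow> f \<in> hvol \<rightarrow>\<^sub>M N"
  by (simp add: measurable_cong_sets[OF sets_hvol refl] measurable_restrict_space1)

lemma continuous_on_measurable_hvol: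
  fixes f :: "real^3 \<Rightarrow> 'b::topological_space"
  shows "continuous_on H3 f \<Longrightarrow> f \<in> hvol \<rightarrow>\<^sub>M borel"
  using borel_measurable_continuous_on_restrict[of H3 f]
  by (simp add: measurable_cong_sets[OF sets_hvol refl])

lemma measurable_hvol2:
  "f \<in> N \<rightarrow>\<^sub>M borel \<Longrightarrow> (\<And>x. x \<in> space N \<Longrightarrow> f x \<in> H3) \<Longrightarrow> f \<in> N \<rightarrow>\<^sub>M hvol"
  by (simp add: measurable_cong_sets[OF refl sets_hvol] measurable_restrict_space2)

lemma hweight_measurable [measurable]: "hweight \<in> borel_measurable borel"
  unfolding hweight_def by measurable

lemma nn_integral_hvol:
  assumes "F \<in> borel_measurable hvol"
  shows "(\<integral>\<^sup>+x. F x \<partial>hvol) = (\<integral>\<^sup>+x. ennreal (hweight x) * F x \<partial>restrict_space lborel H3)"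
  using assms unfolding hvol_def by (subst nn_integral_density) (auto simp: measurable_restrict_space1)

text \<open>The Jacobian is the cube of \<open>(1 - (norm a)\<^sup>2) / mobius_den a x\<close>, and
  \<open>1 - (norm x)\<^sup>2\<close> is multiplied by exactly this factor under the map, so the
  cube in \<open>hweight\<close> compensates it.\<close>

lemma nn_integral_hvol_mobius:
  assumes a: "norm a < 1" and F: "F \<in> borel_measurable hvol"
  shows "(\<integral>\<^sup>+x. F (mobius a x) \<partial>hvol) = (\<integral>\<^sup>+x. F x \<partial>hvol)"
proof -
  let ?J = "\<lambda>x. ((1 - (norm a)\<^sup>2) / mobius_den a x) ^ 3"
  have fin: "emeasure lborel H3 < \<infinity>" unfolding H3_def by (rule emeasure_lborel_ball_finite)
  have q: "mobius_den a x > 0" if "x \<in> H3" for x using that a by (intro mobius_den_pos) (auto simp: H3_def)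
  have s: "1 - (norm a)\<^sup>2 > 0" using a by (simp add: power_less_one_iff)
  define L where "L x = (SOME L. (mobius a has_derivative L) (at x))" for x
  have L: "(mobius a has_derivative L x) (at x)" if "x \<in> H3" for x
  proof -
    have "mobius a differentiable (at x)" using q[OF that] by (intro differentiable_mobius) simp
    then show ?thesis unfolding L_def differentiable_def by (rule someI_ex)
  qed
  have Fm: "F \<in> borel_measurable (restrict_space lborel H3)"
    using F by (simp add: hvol_def)
  have contm: "continuous_on H3 (mobius a)"
    using continuous_on_mobius[OF a] by (rule continuous_on_subset) (auto simp: H3_def)
  have fm: "mobius a \<in> hvol \<rightarrow>\<^sub>M hvol"
    by (rule measurable_hvol2[OF continuous_on_measurable_hvol[OF contm]]) (simp add: mobius_in_H3 a)
  have "(\<integral>\<^sup>+x. F (mobius a x) \<partial>hvol)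
      = (\<integral>\<^sup>+x. ennreal (hweight x) * F (mobius a x) \<partial>restrict_space lborel H3)"
    using measurable_compose[OF fm F] by (rule nn_integral_hvol)
  also have "\<dots> = (\<integral>\<^sup>+x. (\<lambda>x. ennreal (hweight x) * F x) (mobius a x) * ennreal (?J x) \<partial>restrict_space lborel H3)"
  proof (rule nn_integral_cong)
    fix x assume "x \<in> space (restrict_space lborel H3)"
    then have x: "x \<in> H3" by (simp add: space_restrict_space)
    have 1: "1 - (norm (mobius a x))\<^sup>2 = (1 - (norm a)\<^sup>2) * (1 - (norm x)\<^sup>2) / mobius_den a x"
      using one_minus_norm_mobius[of a x] q[OF x] by (simp add: field_simps)
    have "hweight (mobius a x) * ?J x = hweight x"
      unfolding hweight_def 1 using q[OF x] s by (simp add: power_divide power_mult_distrib)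
    moreover have "0 \<le> hweight (mobius a x)" "0 \<le> ?J x"
      using one_minus_norm_pos[OF mobius_in_H3[OF a x]] q[OF x] s by (auto simp: hweight_def)
    ultimately have "ennreal (hweight x) = ennreal (hweight (mobius a x)) * ennreal (?J x)"
      by (simp flip: ennreal_mult)
    then show "ennreal (hweight x) * F (mobius a x) = ennreal (hweight (mobius a x)) * F (mobius a x) * ennreal (?J x)"
      by (simp add: mult_ac)
  qed
  also have "\<dots> = (\<integral>\<^sup>+x. ennreal (hweight x) * F x \<partial>restrict_space lborel H3)"
  proof (rule nn_integral_change_of_variables_self[where f' = L])
    show "(\<lambda>x. ennreal (hweight x) * F x) \<in> borel_measurable (restrict_space lborel H3)"
    proof -
      have "hweight \<in> borel_measurable (restrict_space lborel H3)"
        by (intro measurable_restrict_space1) simp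
      then show ?thesis using Fm by measurable
    qed
    show "inj_on (mobius a) H3"
      using inj_on_mobius[OF a] by (rule inj_on_subset) (auto simp: H3_def)
    show "?J \<in> borel_measurable (restrict_space lborel H3)"
      unfolding mobius_den_def by (intro measurable_restrict_space1) measurable
    show "\<bar>det (matrix (L x))\<bar> = ?J x" if "x \<in> H3" for x
      using det_derivative_mobius[OF a _ L[OF that]] that by (simp add: H3_def)
  qed (use L fin mobius_image_H3[OF a] in auto)
  also have "\<dots> = (\<integral>\<^sup>+x. F x \<partial>hvol)" using F by (rule nn_integral_hvol[symmetric])
  finally show ?thesis .
qed

lemma nn_integral_ball_orthogonal:
  fixes S :: "(real^'n::{finite,wellorder}) set"
  assumes T: "orthogonal_transformation T" and S: "S \<in> sets borel" "emeasure lborel S < \<infinity>" "T ` S = S"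
    and F: "F \<in> borel_measurable (restrict_space lborel S)"
  shows "(\<integral>\<^sup>+x. F (T x) \<partial>restrict_space lborel S) = (\<integral>\<^sup>+x. F x \<partial>restrict_space lborel S)"
proof -
  have "(\<integral>\<^sup>+x. F (T x) * ennreal 1 \<partial>restrict_space lborel S) = (\<integral>\<^sup>+x. F x \<partial>restrict_space lborel S)"
  proof (rule nn_integral_change_of_variables_self[where f' = "\<lambda>_. T"])
    show "(T has_derivative T) (at x)" for x
      using T by (simp add: linear_imp_has_derivative orthogonal_transformation_linear)
    show "inj_on T S" using orthogonal_transformation_inj[OF T] by (rule inj_on_subset) simp
    show "\<bar>det (matrix T)\<bar> = 1" using T by simp
  qed (use S F in auto)
  then show ?thesis by simp
qed

lemma orthogonal_image_ball:
  fixes T :: "'a::euclidean_space \<Rightarrow> 'a"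
  assumes "orthogonal_transformation T"
  shows "T ` ball 0 r = ball 0 r" "T ` (ball 0 r - {0}) = ball 0 r - {0}" "T ` sphere 0 r = sphere 0 r"
proof -
  have n: "norm (T x) = norm x" for x using assms by (rule orthogonal_transformation_norm)
  have *: "T ` {x. P (norm x)} = {x. P (norm x)}" for P
  proof (intro equalityI subsetI)
    fix y :: 'a assume y: "y \<in> {x. P (norm x)}"
    obtain x where "y = T x" using orthogonal_transformation_surj[OF assms] by (rule surjE)
    with y show "y \<in> T ` {x. P (norm x)}" by (auto simp: n)
  qed (auto simp: n)
  show "T ` ball 0 r = ball 0 r" using *[of "\<lambda>s. s < r"] by (simp add: ball_def)
  show "T ` (ball 0 r - {0}) = ball 0 r - {0}"
    using *[of "\<lambda>s. s < r \<and> s \<noteq> 0"] by (simp add: ball_def set_diff_eq)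
  show "T ` sphere 0 r = sphere 0 r" using *[of "\<lambda>s. s = r"] by (simp add: sphere_def)
qed

lemma nn_integral_hvol_orthogonal:
  assumes T: "orthogonal_transformation T" and F: "F \<in> borel_measurable hvol"
  shows "(\<integral>\<^sup>+x. F (T x) \<partial>hvol) = (\<integral>\<^sup>+x. F x \<partial>hvol)"
proof -
  have fin: "emeasure lborel H3 < \<infinity>" unfolding H3_def by (rule emeasure_lborel_ball_finite)
  have n: "norm (T x) = norm x" for x using T by (rule orthogonal_transformation_norm)
  have "continuous_on H3 T" using T by (simp add: linear_continuous_on linear_linear orthogonal_transformation_def)
  then have fm: "T \<in> hvol \<rightarrow>\<^sub>M hvol"
    by (intro measurable_hvol2[OF continuous_on_measurable_hvol]) (simp_all add: H3_def n)
  have Fm: "F \<in> borel_measurable (restrict_space lborel H3)" using F by (simp add: hvol_def)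
  have "(\<integral>\<^sup>+x. F (T x) \<partial>hvol)
      = (\<integral>\<^sup>+x. (\<lambda>x. ennreal (hweight x) * F x) (T x) \<partial>restrict_space lborel H3)"
    using measurable_compose[OF fm F] by (subst nn_integral_hvol) (simp_all add: hweight_def n)
  also have "\<dots> = (\<integral>\<^sup>+x. ennreal (hweight x) * F x \<partial>restrict_space lborel H3)"
  proof (rule nn_integral_ball_orthogonal[OF T _ fin])
    show "T ` H3 = H3" unfolding H3_def by (rule orthogonal_image_ball[OF T])
    have "hweight \<in> borel_measurable (restrict_space lborel H3)"
      by (intro measurable_restrict_space1) simp
    then show "(\<lambda>x. ennreal (hweight x) * F x) \<in> borel_measurable (restrict_space lborel H3)"
      using Fm by measurable
  qed simp
  also have "\<dots> = (\<integral>\<^sup>+x. F x \<partial>hvol)" using F by (rule nn_integral_hvol[symmetric])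
  finally show ?thesis .
qed

lemma Isom_H3_measurable:
  assumes g: "g \<in> carrier Isom_H3"
  shows "g \<in> hvol \<rightarrow>\<^sub>M hvol"
proof -
  obtain T where T: "orthogonal_transformation T" "\<forall>x\<in>H3. g x = mobius (g 0) (T x)"
    using Isom_H3_decomp[OF g] by blast
  have "norm (g 0) < 1" using Isom_H3_in_H3[OF g, of 0] by (simp add: H3_norm)
  from continuous_on_mobius_orthogonal[OF this T(1)]
  have "continuous_on H3 (\<lambda>x. mobius (g 0) (T x))" by (rule continuous_on_subset) (auto simp: H3_def)
  then have "continuous_on H3 g" using T(2) continuous_on_cong[of H3 H3 g "\<lambda>x. mobius (g 0) (T x)"] by metis
  then show ?thesis
    using Isom_H3_in_H3[OF g] by (intro measurable_hvol2[OF continuous_on_measurable_hvol]) auto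
qed

lemma nn_integral_hvol_Isom:
  assumes g: "g \<in> carrier Isom_H3" and F: "F \<in> borel_measurable hvol"
  shows "(\<integral>\<^sup>+x. F (g x) \<partial>hvol) = (\<integral>\<^sup>+x. F x \<partial>hvol)"
proof -
  obtain T where T: "orthogonal_transformation T" "\<forall>x\<in>H3. g x = mobius (g 0) (T x)"
    using Isom_H3_decomp[OF g] by blast
  have a: "norm (g 0) < 1" using Isom_H3_in_H3[OF g, of 0] by (simp add: H3_norm)
  have contm: "continuous_on H3 (mobius (g 0))"
    using continuous_on_mobius[OF a] by (rule continuous_on_subset) (auto simp: H3_def)
  have fm: "mobius (g 0) \<in> hvol \<rightarrow>\<^sub>M hvol"
    by (rule measurable_hvol2[OF continuous_on_measurable_hvol[OF contm]]) (simp add: mobius_in_H3 a)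
  have "(\<integral>\<^sup>+x. F (g x) \<partial>hvol) = (\<integral>\<^sup>+x. (\<lambda>x. F (mobius (g 0) x)) (T x) \<partial>hvol)"
    using T(2) by (intro nn_integral_cong) (metis space_hvol)
  also have "\<dots> = (\<integral>\<^sup>+x. F (mobius (g 0) x) \<partial>hvol)"
    using T(1) measurable_compose[OF fm F] by (rule nn_integral_hvol_orthogonal)
  also have "\<dots> = (\<integral>\<^sup>+x. F x \<partial>hvol)" using a F by (rule nn_integral_hvol_mobius)
  finally show ?thesis .
qed

section \<open>Rotation invariant measure on the sphere and its transformation under
  isometries\<close>

text \<open>The same push-forward of the ball as in \<open>round_area\<close>, differently scaled,
  so that the two have the same null sets by construction.\<close>

definition unif_sphere :: "(real^3) measure" where
  "unif_sphere = scale_measure (1 / emeasure lborel (ball 0 1 :: (real^3) set))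
     (distr (restrict_space lborel (ball 0 1 - {0})) bd_borel (\<lambda>x. x /\<^sub>R norm x))"

abbreviation (input) pball :: "(real^3) set" where "pball \<equiv> ball 0 1 - {0}"

lemma sets_bdH3 [measurable, simp]: "bdH3 \<in> sets borel"
  unfolding bdH3_def by (intro borel_closed) simp

lemma space_bd_borel [simp]: "space bd_borel = bdH3"
  by (simp add: bd_borel_def space_restrict_space)

lemma space_unif_sphere [simp]: "space unif_sphere = bdH3" by (simp add: unif_sphere_def space_scale_measure)

lemma sets_unif_sphere [simp, measurable_cong]: "sets unif_sphere = sets bd_borel"
  by (simp add: unif_sphere_def)

lemma measurable_bd_borel1: "f \<in> borel \<rightarrow>\<^sub>M N \<Longrightarrow> f \<in> bd_borel \<rightarrow>\<^sub>M N"
  by (simp add: bd_borel_def measurable_restrict_space1)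

lemma measurable_bd_borel2:
  "f \<in> N \<rightarrow>\<^sub>M borel \<Longrightarrow> (\<And>x. x \<in> space N \<Longrightarrow> f x \<in> bdH3) \<Longrightarrow> f \<in> N \<rightarrow>\<^sub>M bd_borel"
  by (simp add: bd_borel_def measurable_restrict_space2)

lemma continuous_on_measurable_bd_borel:
  fixes f :: "real^3 \<Rightarrow> 'b::topological_space"
  shows "continuous_on bdH3 f \<Longrightarrow> f \<in> bd_borel \<rightarrow>\<^sub>M borel"
  unfolding bd_borel_def by (rule borel_measurable_continuous_on_restrict)

lemma normalize_measurable: "(\<lambda>x. x /\<^sub>R norm x) \<in> restrict_space lborel pball \<rightarrow>\<^sub>M bd_borel"
proof (rule measurable_bd_borel2)
  show "(\<lambda>x. x /\<^sub>R norm x) \<in> restrict_space lborel pball \<rightarrow>\<^sub>M borel"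
    by (intro measurable_restrict_space1) simp
qed (auto simp: space_restrict_space bdH3_def)

lemma emeasure_unit_ball:
  "emeasure lborel (ball 0 1 :: (real^3) set) \<noteq> 0" "emeasure lborel (ball 0 1 :: (real^3) set) \<noteq> \<infinity>"
  using emeasure_lborel_ball_finite[of "0::real^3" 1] content_ball_pos[of 1 "0::real^3"]
  by (auto simp: measure_def)

lemma nn_integral_unif_sphere:
  assumes "F \<in> borel_measurable bd_borel"
  shows "(\<integral>\<^sup>+\<xi>. F \<xi> \<partial>unif_sphere)
    = 1 / emeasure lborel (ball 0 1 :: (real^3) set) * (\<integral>\<^sup>+x. F (x /\<^sub>R norm x) \<partial>restrict_space lborel pball)"
  unfolding unif_sphere_def using assms normalize_measurable
  by (simp add: nn_integral_scale_measure nn_integral_distr)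

lemma emeasure_pball: "emeasure lborel pball = emeasure lborel (ball 0 1 :: (real^3) set)"
  using emeasure_lborel_ball_finite[of "0::real^3" 1] by (subst emeasure_Diff) (auto simp: top.not_eq_extremum)

lemma prob_space_unif_sphere: "prob_space unif_sphere"
proof (rule prob_spaceI)
  have "(\<integral>\<^sup>+\<xi>. 1 \<partial>unif_sphere) = 1 / emeasure lborel (ball 0 1 :: (real^3) set) * emeasure lborel pball"
    by (subst nn_integral_unif_sphere) (simp_all add: emeasure_restrict_space space_restrict_space)
  also have "\<dots> = 1" unfolding emeasure_pball
    using emeasure_unit_ball
    by (subst mult.commute) (simp add: ennreal_times_divide ennreal_divide_self less_top)
  finally show "emeasure unif_sphere (space unif_sphere) = 1" by simp
qed

text \<open>The radial extension reduces changes of variables on the sphere to changes of variables on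
  the ball.\<close>

definition cone_map :: "(real^3 \<Rightarrow> real^3) \<Rightarrow> real^3 \<Rightarrow> real^3" where
  "cone_map f x = norm x *\<^sub>R f (x /\<^sub>R norm x)"

lemma norm_cone_mobius:
  assumes "norm a < 1" "x \<noteq> 0"
  shows "norm (cone_map (mobius a) x) = norm x" "cone_map (mobius a) x \<noteq> 0"
    "cone_map (mobius a) x /\<^sub>R norm (cone_map (mobius a) x) = mobius a (x /\<^sub>R norm x)"
proof -
  have "norm (mobius a (x /\<^sub>R norm x)) = 1" using assms by (intro norm_mobius_sphere) auto
  with assms show 1: "norm (cone_map (mobius a) x) = norm x" by (simp add: cone_map_def)
  with assms show "cone_map (mobius a) x \<noteq> 0" by auto
  from assms show "cone_map (mobius a) x /\<^sub>R norm (cone_map (mobius a) x) = mobius a (x /\<^sub>R norm x)"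
    unfolding 1 by (simp add: cone_map_def)
qed

lemma cone_mobius_inverse:
  assumes "norm a < 1" "x \<noteq> 0"
  shows "cone_map (mobius (- a)) (cone_map (mobius a) x) = x"
proof -
  let ?y = "cone_map (mobius a) x"
  have "cone_map (mobius (- a)) ?y = norm ?y *\<^sub>R mobius (- a) (?y /\<^sub>R norm ?y)"
    by (rule cone_map_def)
  also have "?y /\<^sub>R norm ?y = mobius a (x /\<^sub>R norm x)" by (rule norm_cone_mobius(3)[OF assms])
  also have "mobius (- a) (mobius a (x /\<^sub>R norm x)) = x /\<^sub>R norm x"
    using assms by (intro mobius_minus_mobius) auto
  also have "norm ?y = norm x" by (rule norm_cone_mobius(1)[OF assms])
  finally show ?thesis using assms by simp
qed

lemma cone_mobius_bij:
  assumes "norm a < 1"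
  shows "inj_on (cone_map (mobius a)) pball" "cone_map (mobius a) ` pball = pball"
proof -
  have a: "norm (- a) < 1" using assms by simp
  show "inj_on (cone_map (mobius a)) pball"
    by (rule inj_on_inverseI[where g = "cone_map (mobius (-a))"]) (simp add: cone_mobius_inverse assms)
  have "x \<in> cone_map (mobius a) ` pball" if "x \<in> pball" for x
  proof (rule image_eqI)
    show "x = cone_map (mobius a) (cone_map (mobius (- a)) x)"
      using cone_mobius_inverse[OF a, of x] that by simp
    show "cone_map (mobius (- a)) x \<in> pball"
      using norm_cone_mobius(1,2)[OF a, of x] that by auto
  qed
  moreover have "cone_map (mobius a) x \<in> pball" if "x \<in> pball" for x
    using norm_cone_mobius(1,2)[OF assms, of x] that by auto
  ultimately show "cone_map (mobius a) ` pball = pball" by (intro equalityI subsetI) auto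
qed

text \<open>In polar coordinates a squared distance is a radial part plus the product of the norms
  times an angular part. The cone map keeps the radial part and multiplies the angular part by
  \<open>l\<close>.\<close>

lemma norm_cone_mobius_diff:
  assumes a: "norm a < 1" and x: "x \<noteq> 0" and y: "y \<noteq> 0"
    and that: "l = ((1 - (norm a)\<^sup>2) / mobius_den a (x /\<^sub>R norm x)) * ((1 - (norm a)\<^sup>2) / mobius_den a (y /\<^sub>R norm y))"
  shows "(norm (cone_map (mobius a) y - cone_map (mobius a) x))\<^sup>2 =
    (1 - l) * (norm y - norm x)\<^sup>2 + l * (norm (y - x))\<^sup>2"
    (is "?lhs = _")
proof -
  define u where "u = x /\<^sub>R norm x"
  define v where "v = y /\<^sub>R norm y"
  have xu: "x = norm x *\<^sub>R u" "y = norm y *\<^sub>R v" using x y by (auto simp: u_def v_def)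
  have uv: "norm u = 1" "norm v = 1" using x y by (auto simp: u_def v_def)
  have q: "mobius_den a u > 0" "mobius_den a v > 0" using uv a by (auto intro!: mobius_den_pos)
  have l: "l = (1 - (norm a)\<^sup>2)\<^sup>2 / (mobius_den a u * mobius_den a v)"
    unfolding that u_def[symmetric] v_def[symmetric] by (simp add: power2_eq_square)
  have d: "(norm (mobius a u - mobius a v))\<^sup>2 = l * (norm (u - v))\<^sup>2"
    using norm_mobius_diff[of a u v] q unfolding l by (simp add: field_simps)
  have n: "norm (mobius a u) = 1" "norm (mobius a v) = 1" using uv a by (auto intro!: norm_mobius_sphere)
  have ip: "2 * (p \<bullet> q) = 2 - (norm (p - q))\<^sup>2" if "norm p = 1" "norm q = 1" for p q :: "real^3"
    using that by (simp add: dot_norm_neg)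
  have gen: "(norm (r *\<^sub>R p - s *\<^sub>R q))\<^sup>2 = (r - s)\<^sup>2 + r * s * (norm (p - q))\<^sup>2"
    if "norm p = 1" "norm q = 1" for p q :: "real^3" and r s :: real
  proof -
    have "(norm (r *\<^sub>R p - s *\<^sub>R q))\<^sup>2 = r\<^sup>2 + s\<^sup>2 - r * s * (2 * (p \<bullet> q))"
      using that unfolding power2_norm_eq_inner
      by (simp add: inner_diff_left inner_diff_right inner_commute[of q p] norm_eq_1 power2_eq_square algebra_simps)
    then show ?thesis unfolding ip[OF that] by (simp add: power2_eq_square algebra_simps)
  qed
  have "?lhs = (norm y - norm x)\<^sup>2 + norm y * norm x * (norm (mobius a v - mobius a u))\<^sup>2"
    unfolding cone_map_def u_def[symmetric] v_def[symmetric] by (rule gen) (use n in auto)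
  also have "(norm (mobius a v - mobius a u))\<^sup>2 = l * (norm (v - u))\<^sup>2"
    using d by (simp add: norm_minus_commute)
  finally have 1: "?lhs = (norm y - norm x)\<^sup>2 + l * (norm y * norm x * (norm (v - u))\<^sup>2)"
    by (simp only: mult_ac)
  have "(norm (y - x))\<^sup>2 = (norm (norm y *\<^sub>R v - norm x *\<^sub>R u))\<^sup>2" using xu by simp
  also have "\<dots> = (norm y - norm x)\<^sup>2 + norm y * norm x * (norm (v - u))\<^sup>2" by (rule gen) (use uv in auto)
  finally have 2: "norm y * norm x * (norm (v - u))\<^sup>2 = (norm (y - x))\<^sup>2 - (norm y - norm x)\<^sup>2" by simp
  show ?thesis unfolding 1 2 by (simp add: algebra_simps)
qed

lemma differentiable_cone_mobius:
  assumes a: "norm a < 1" and x: "x \<noteq> 0"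
  shows "cone_map (mobius a) differentiable (at x)"
proof -
  have "(\<lambda>x::real^3. (1 / norm x) *\<^sub>R x) differentiable (at x)"
    using x by (intro differentiable_scaleR differentiable_divide differentiable_const differentiable_ident
        differentiable_norm_at) auto
  then have n: "(\<lambda>x::real^3. x /\<^sub>R norm x) differentiable (at x)" by (simp add: divide_inverse)
  have "mobius_den a (x /\<^sub>R norm x) > 0" using a x by (intro mobius_den_pos) auto
  then have "mobius a differentiable (at (x /\<^sub>R norm x))" by (intro differentiable_mobius) simp
  from differentiable_chain_at[OF n this]
  have "(\<lambda>x. mobius a (x /\<^sub>R norm x)) differentiable (at x)" by (simp add: o_def)
  then have "(\<lambda>x. norm x *\<^sub>R mobius a (x /\<^sub>R norm x)) differentiable (at x)"
    using x by (intro differentiable_scaleR differentiable_norm_at) auto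
  then show ?thesis by (simp add: cone_map_def[abs_def])
qed

text \<open>The limit of \<open>l\<close> at \<open>x\<close> is the square of the conformal factor
  \<open>?c\<close>, so the derivative satisfies the hypothesis of \<open>det_axial\<close>. The
  radial direction is not scaled, hence a square instead of a cube: the Jacobian is that of the
  boundary map.\<close>

lemma det_derivative_cone_mobius:
  assumes a: "norm a < 1" and x: "x \<noteq> 0" and L: "(cone_map (mobius a) has_derivative L) (at x)"
  shows "\<bar>det (matrix L)\<bar> = ((1 - (norm a)\<^sup>2) / mobius_den a (x /\<^sub>R norm x))\<^sup>2"
proof (rule det_axial)
  let ?s = "1 - (norm a)\<^sup>2" and ?u = "x /\<^sub>R norm x"
  let ?c = "?s / mobius_den a ?u"
  have q: "mobius_den a ?u > 0" using a x by (intro mobius_den_pos) auto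
  have s: "?s > 0" using a by (simp add: power_less_one_iff)
  show "linear L" using has_derivative_linear[OF L] .
  show "?c > 0" using q s by simp
  show "norm ?u = 1" using x by simp
  fix h
  define l where "l t = ?c * (?s / mobius_den a ((x + t *\<^sub>R h) /\<^sub>R norm (x + t *\<^sub>R h)))" for t :: real
  have tx: "((\<lambda>t::real. x + t *\<^sub>R h) \<longlongrightarrow> x) (at 0)"
    by (auto intro!: tendsto_eq_intros)
  define w where "w t = (x + t *\<^sub>R h) /\<^sub>R norm (x + t *\<^sub>R h)" for t :: real
  have wt: "(w \<longlongrightarrow> ?u) (at 0)"
    unfolding w_def using x by (intro tendsto_intros tx) auto
  have "((\<lambda>t. mobius_den a (w t)) \<longlongrightarrow> mobius_den a ?u) (at 0)"
    unfolding mobius_den_def by (intro tendsto_add tendsto_mult tendsto_inner tendsto_const wt)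
  then have l: "(l \<longlongrightarrow> ?c * ?c) (at 0)"
    unfolding l_def w_def[symmetric] using q by (intro tendsto_mult tendsto_divide tendsto_const) auto
  have "(norm has_derivative (\<lambda>h. h \<bullet> sgn x)) (at x)"
    using has_derivative_norm[OF x] by (simp add: inner_commute)
  from has_derivative_norm_square_limit[OF this, of h]
  have r: "((\<lambda>t::real. (norm (x + t *\<^sub>R h) - norm x)\<^sup>2 / t\<^sup>2) \<longlongrightarrow> (h \<bullet> ?u)\<^sup>2) (at 0)"
    by (simp add: sgn_div_norm)
  have "((\<lambda>t. (1 - l t) * ((norm (x + t *\<^sub>R h) - norm x)\<^sup>2 / t\<^sup>2) + l t * (norm h)\<^sup>2)
     \<longlongrightarrow> (1 - ?c * ?c) * (h \<bullet> ?u)\<^sup>2 + ?c * ?c * (norm h)\<^sup>2) (at 0)"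
    by (intro tendsto_intros l r)
  moreover have "eventually (\<lambda>t::real. x + t *\<^sub>R h \<noteq> 0) (at 0)"
    by (rule tendsto_imp_eventually_ne[OF tx x])
  then have "eventually (\<lambda>t. (1 - l t) * ((norm (x + t *\<^sub>R h) - norm x)\<^sup>2 / t\<^sup>2) + l t * (norm h)\<^sup>2
      = (norm (cone_map (mobius a) (x + t *\<^sub>R h) - cone_map (mobius a) x))\<^sup>2 / t\<^sup>2) (at (0::real))"
    using eventually_neq_at_within[of 0]
  proof eventually_elim
    case (elim t)
    show ?case
      unfolding norm_cone_mobius_diff[OF a x elim(1) l_def]
      using elim by (simp add: power_mult_distrib add_divide_distrib)
  qed
  ultimately have "((\<lambda>t. (norm (cone_map (mobius a) (x + t *\<^sub>R h) - cone_map (mobius a) x))\<^sup>2 / t\<^sup>2)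
      \<longlongrightarrow> (1 - ?c * ?c) * (h \<bullet> ?u)\<^sup>2 + ?c * ?c * (norm h)\<^sup>2) (at (0::real))"
    by (rule Lim_transform_eventually)
  from tendsto_unique[OF _ has_derivative_norm_square_limit[OF L] this]
  show "(norm (L h))\<^sup>2 = ?c\<^sup>2 * (norm h)\<^sup>2 + (1 - ?c\<^sup>2) * (h \<bullet> ?u)\<^sup>2"
    by (simp add: power2_eq_square[of ?c])
qed

lemma nn_integral_unif_sphere_mobius_weighted:
  assumes a: "norm a < 1" and F: "F \<in> borel_measurable bd_borel"
  shows "(\<integral>\<^sup>+\<xi>. F (mobius a \<xi>) * ennreal (((1 - (norm a)\<^sup>2) / mobius_den a \<xi>)\<^sup>2) \<partial>unif_sphere)
    = (\<integral>\<^sup>+\<xi>. F \<xi> \<partial>unif_sphere)"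
proof -
  let ?J = "\<lambda>\<xi>. ((1 - (norm a)\<^sup>2) / mobius_den a \<xi>)\<^sup>2"
  let ?R = "restrict_space lborel pball"
  have contm: "continuous_on bdH3 (mobius a)"
    using continuous_on_mobius[OF a] by (rule continuous_on_subset) (auto simp: bdH3_def)
  have fm: "mobius a \<in> bd_borel \<rightarrow>\<^sub>M bd_borel"
    by (rule measurable_bd_borel2[OF continuous_on_measurable_bd_borel[OF contm]])
       (use a in \<open>simp add: bdH3_def norm_mobius_sphere\<close>)
  have Jm: "?J \<in> borel_measurable bd_borel"
    unfolding mobius_den_def by (intro measurable_bd_borel1) measurable
  define L where "L x = (SOME L. (cone_map (mobius a) has_derivative L) (at x))" for x
  have L: "(cone_map (mobius a) has_derivative L x) (at x)" if "x \<in> pball" for x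
  proof -
    have "cone_map (mobius a) differentiable (at x)" using that a by (intro differentiable_cone_mobius) auto
    then show ?thesis unfolding L_def differentiable_def by (rule someI_ex)
  qed
  have "(\<integral>\<^sup>+x. F (mobius a (x /\<^sub>R norm x)) * ennreal (?J (x /\<^sub>R norm x)) \<partial>?R)
     = (\<integral>\<^sup>+x. (\<lambda>x. F (x /\<^sub>R norm x)) (cone_map (mobius a) x) * ennreal (?J (x /\<^sub>R norm x)) \<partial>?R)"
    by (intro nn_integral_cong) (simp add: space_restrict_space norm_cone_mobius(3)[OF a])
  also have "\<dots> = (\<integral>\<^sup>+x. F (x /\<^sub>R norm x) \<partial>?R)"
  proof (rule nn_integral_change_of_variables_self[where f' = L])
    show "emeasure lborel pball < \<infinity>"
      unfolding emeasure_pball by (rule emeasure_lborel_ball_finite)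
    show "(\<lambda>x. ?J (x /\<^sub>R norm x)) \<in> borel_measurable ?R"
      using measurable_compose[OF normalize_measurable Jm] by simp
    show "(\<lambda>x. F (x /\<^sub>R norm x)) \<in> borel_measurable ?R"
      using measurable_compose[OF normalize_measurable F] by simp
    show "\<bar>det (matrix (L x))\<bar> = ?J (x /\<^sub>R norm x)" if "x \<in> pball" for x
      using that by (intro det_derivative_cone_mobius[OF a _ L]) auto
  qed (use L cone_mobius_bij[OF a] in auto)
  finally show ?thesis
    using F Jm measurable_compose[OF fm F] by (subst (1 2) nn_integral_unif_sphere) auto
qed

text \<open>The Poisson kernel at \<open>a\<close>, evaluated at \<open>mobius a \<xi>\<close>, is
  the reciprocal of the boundary Jacobian at \<open>\<xi>\<close>. The weighted formula applied to
  \<open>F\<close> times the kernel therefore loses its weight.\<close>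

lemma nn_integral_unif_sphere_mobius:
  assumes a: "norm a < 1" and F: "F \<in> borel_measurable bd_borel"
  shows "(\<integral>\<^sup>+\<xi>. F (mobius a \<xi>) \<partial>unif_sphere) = (\<integral>\<^sup>+\<xi>. F \<xi> * ennreal (poisson a \<xi>) \<partial>unif_sphere)"
proof -
  have Pm: "poisson a \<in> borel_measurable bd_borel"
    unfolding poisson_def by (intro measurable_bd_borel1) measurable
  have s: "1 - (norm a)\<^sup>2 > 0" using a by (simp add: power_less_one_iff)
  have "(\<integral>\<^sup>+\<xi>. F \<xi> * ennreal (poisson a \<xi>) \<partial>unif_sphere) =
    (\<integral>\<^sup>+\<xi>. F (mobius a \<xi>) * ennreal (poisson a (mobius a \<xi>)) *
        ennreal (((1 - (norm a)\<^sup>2) / mobius_den a \<xi>)\<^sup>2) \<partial>unif_sphere)"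
    using F Pm by (intro nn_integral_unif_sphere_mobius_weighted[OF a, symmetric]) auto
  also have "\<dots> = (\<integral>\<^sup>+\<xi>. F (mobius a \<xi>) \<partial>unif_sphere)"
  proof (rule nn_integral_cong)
    fix \<xi> assume "\<xi> \<in> space unif_sphere"
    then have xi: "\<xi> \<in> bdH3" by simp
    have q: "mobius_den a \<xi> > 0" using xi a by (intro mobius_den_pos) (auto simp: bdH3_def)
    have "poisson a (mobius a \<xi>) * ((1 - (norm a)\<^sup>2) / mobius_den a \<xi>)\<^sup>2 = 1"
      unfolding poisson_mobius_center[OF a xi] using q s by (simp flip: power_mult_distrib)
    then have "ennreal (poisson a (mobius a \<xi>)) * ennreal (((1 - (norm a)\<^sup>2) / mobius_den a \<xi>)\<^sup>2) = 1"
      by (simp add: poisson_def flip: ennreal_mult)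
    then show "F (mobius a \<xi>) * ennreal (poisson a (mobius a \<xi>)) * ennreal (((1 - (norm a)\<^sup>2) / mobius_den a \<xi>)\<^sup>2)
        = F (mobius a \<xi>)" by (simp add: mult.assoc)
  qed
  finally show ?thesis ..
qed

lemma nn_integral_unif_sphere_orthogonal:
  assumes T: "orthogonal_transformation T" and F: "F \<in> borel_measurable bd_borel"
  shows "(\<integral>\<^sup>+\<xi>. F (T \<xi>) \<partial>unif_sphere) = (\<integral>\<^sup>+\<xi>. F \<xi> \<partial>unif_sphere)"
proof -
  have n: "norm (T x) = norm x" for x using T by (rule orthogonal_transformation_norm)
  have "continuous_on bdH3 T" using T by (simp add: linear_continuous_on linear_linear orthogonal_transformation_def)
  then have fm: "T \<in> bd_borel \<rightarrow>\<^sub>M bd_borel"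
    by (intro measurable_bd_borel2[OF continuous_on_measurable_bd_borel]) (simp_all add: bdH3_def n)
  have "(\<integral>\<^sup>+x. F (T (x /\<^sub>R norm x)) \<partial>restrict_space lborel pball)
     = (\<integral>\<^sup>+x. (\<lambda>x. F (x /\<^sub>R norm x)) (T x) \<partial>restrict_space lborel pball)"
    using T by (simp add: n orthogonal_transformation_scaleR)
  also have "\<dots> = (\<integral>\<^sup>+x. F (x /\<^sub>R norm x) \<partial>restrict_space lborel pball)"
  proof (rule nn_integral_ball_orthogonal[OF T])
    show "emeasure lborel pball < \<infinity>"
      unfolding emeasure_pball by (rule emeasure_lborel_ball_finite)
    show "(\<lambda>x. F (x /\<^sub>R norm x)) \<in> borel_measurable (restrict_space lborel pball)"
      using measurable_compose[OF normalize_measurable F] by simp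
  qed (simp_all add: orthogonal_image_ball[OF T])
  finally show ?thesis
    using F measurable_compose[OF fm F] by (subst (1 2) nn_integral_unif_sphere) auto
qed

lemma bd_action_measurable:
  assumes g: "g \<in> carrier Isom_H3"
  shows "bd_action g \<in> bd_borel \<rightarrow>\<^sub>M bd_borel" "continuous_on bdH3 (bd_action g)"
proof -
  obtain T where T: "orthogonal_transformation T" "\<forall>x\<in>H3. g x = mobius (g 0) (T x)"
    using Isom_H3_decomp[OF g] by blast
  have "norm (g 0) < 1" using Isom_H3_in_H3[OF g, of 0] by (simp add: H3_norm)
  from continuous_on_mobius_orthogonal[OF this T(1)]
  have "continuous_on bdH3 (\<lambda>x. mobius (g 0) (T x))" by (rule continuous_on_subset) (auto simp: bdH3_def)
  then show c: "continuous_on bdH3 (bd_action g)"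
    using bd_action_eqI(2)[OF g T] continuous_on_cong[of bdH3 bdH3 "bd_action g" "\<lambda>x. mobius (g 0) (T x)"] by metis
  show "bd_action g \<in> bd_borel \<rightarrow>\<^sub>M bd_borel"
    using bd_action_in[OF g] by (intro measurable_bd_borel2[OF continuous_on_measurable_bd_borel[OF c]]) auto
qed

lemma nn_integral_unif_sphere_bd_action:
  assumes g: "g \<in> carrier Isom_H3" and F: "F \<in> borel_measurable bd_borel"
  shows "(\<integral>\<^sup>+\<xi>. F (bd_action g \<xi>) \<partial>unif_sphere) = (\<integral>\<^sup>+\<xi>. F \<xi> * ennreal (poisson (g 0) \<xi>) \<partial>unif_sphere)"
proof -
  obtain T where T: "orthogonal_transformation T" "\<forall>x\<in>H3. g x = mobius (g 0) (T x)"
    using Isom_H3_decomp[OF g] by blast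
  have a: "norm (g 0) < 1" using Isom_H3_in_H3[OF g, of 0] by (simp add: H3_norm)
  have contm: "continuous_on bdH3 (mobius (g 0))"
    using continuous_on_mobius[OF a] by (rule continuous_on_subset) (auto simp: bdH3_def)
  have fm: "mobius (g 0) \<in> bd_borel \<rightarrow>\<^sub>M bd_borel"
    by (rule measurable_bd_borel2[OF continuous_on_measurable_bd_borel[OF contm]])
       (use a in \<open>simp add: bdH3_def norm_mobius_sphere\<close>)
  have "(\<integral>\<^sup>+\<xi>. F (bd_action g \<xi>) \<partial>unif_sphere) = (\<integral>\<^sup>+\<xi>. (\<lambda>\<xi>. F (mobius (g 0) \<xi>)) (T \<xi>) \<partial>unif_sphere)"
    using bd_action_eqI(2)[OF g T] by (intro nn_integral_cong) (metis space_unif_sphere)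
  also have "\<dots> = (\<integral>\<^sup>+\<xi>. F (mobius (g 0) \<xi>) \<partial>unif_sphere)"
    using T(1) measurable_compose[OF fm F] by (rule nn_integral_unif_sphere_orthogonal)
  also have "\<dots> = (\<integral>\<^sup>+\<xi>. F \<xi> * ennreal (poisson (g 0) \<xi>) \<partial>unif_sphere)"
    using a F by (rule nn_integral_unif_sphere_mobius)
  finally show ?thesis .
qed

lemma nn_integral_poisson:
  assumes "x \<in> H3"
  shows "(\<integral>\<^sup>+\<xi>. ennreal (poisson x \<xi>) \<partial>unif_sphere) = 1"
proof -
  interpret prob_space unif_sphere by (rule prob_space_unif_sphere)
  show ?thesis
    using nn_integral_unif_sphere_mobius[of x "\<lambda>_. 1"] assms by (simp add: H3_norm emeasure_space_1 del: space_unif_sphere)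
qed

section \<open>Hyperbolic balls and the mean value property of the Poisson kernel\<close>

definition hball :: "real^3 \<Rightarrow> real \<Rightarrow> (real^3) set" where
  "hball x r = {y \<in> H3. hdist x y < r}"

lemma hdist_less_iff:
  assumes "x \<in> H3" "y \<in> H3" "0 < r"
  shows "hdist x y < r \<longleftrightarrow> 1 + 2 * hdefect x y < cosh r"
  using cosh_real_nonneg_less_iff[OF hdist_nonneg[OF assms(1,2)], of r] assms
  by (simp add: cosh_hdist)

lemma hball_alt: "x \<in> H3 \<Longrightarrow> 0 < r \<Longrightarrow> hball x r = {y \<in> H3. 1 + 2 * hdefect x y < cosh r}"
  by (auto simp: hball_def hdist_less_iff)

lemma hball_subset_H3: "hball x r \<subseteq> H3" by (auto simp: hball_def)

lemma center_in_hball: "x \<in> H3 \<Longrightarrow> 0 < r \<Longrightarrow> x \<in> hball x r"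
  by (simp add: hball_def)

lemma continuous_on_hdefect: "x \<in> H3 \<Longrightarrow> continuous_on H3 (hdefect x)"
  unfolding hdefect_def using one_minus_norm_pos
  by (intro continuous_intros) (auto dest!: one_minus_norm_pos)

lemma open_hball:
  assumes x: "x \<in> H3" and r: "0 < r"
  shows "open (hball x r)"
proof -
  have "continuous_on H3 (\<lambda>y. 1 + 2 * hdefect x y)"
    by (intro continuous_intros continuous_on_hdefect x)
  then have "open (H3 \<inter> (\<lambda>y. 1 + 2 * hdefect x y) -` {..<cosh r})"
    by (intro continuous_open_preimage) (auto simp: H3_def)
  moreover have "hball x r = H3 \<inter> (\<lambda>y. 1 + 2 * hdefect x y) -` {..<cosh r}"
    using hball_alt[OF x r] by auto
  ultimately show ?thesis by simp
qed

lemma hdist_measurable [measurable]: "(\<lambda>(x, y). hdist x y) \<in> borel_measurable (borel \<Otimes>\<^sub>M borel)"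
  unfolding hdist_def arcosh_def split_beta' by measurable

lemma hball_sets [measurable, simp]: "hball x r \<in> sets borel"
proof -
  have "(\<lambda>y. (x, y)) \<in> borel \<rightarrow>\<^sub>M borel \<Otimes>\<^sub>M borel" by measurable
  from measurable_compose[OF this hdist_measurable] have [measurable]: "hdist x \<in> borel_measurable borel" by simp
  show ?thesis unfolding hball_def by measurable
qed

lemma hball_sets_hvol [measurable, simp]: "hball x r \<in> sets hvol"
  using hball_subset_H3[of x r] by (simp add: sets_hvol sets_restrict_space_iff)

lemma norm_less_of_hball_0:
  assumes "y \<in> hball 0 r" "0 < r"
  shows "1 - (norm y)\<^sup>2 > 2 / (1 + cosh r)"
proof -
  have y: "y \<in> H3" using assms by (simp add: hball_def)
  have p: "1 - (norm y)\<^sup>2 > 0" by (rule one_minus_norm_pos[OF y])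
  have "cosh (hdist 0 y) < cosh r"
    using assms y by (simp add: hball_alt cosh_hdist)
  then have "(1 + (norm y)\<^sup>2) / (1 - (norm y)\<^sup>2) < cosh r" by (simp add: hdist_0_norm(1)[OF y])
  then have "1 + (norm y)\<^sup>2 < cosh r * (1 - (norm y)\<^sup>2)" using p by (simp add: field_simps)
  then have "2 < (1 + cosh r) * (1 - (norm y)\<^sup>2)" by (simp add: algebra_simps)
  moreover have "0 < 1 + cosh r" by (intro add_pos_pos) auto
  ultimately show ?thesis by (simp add: divide_less_eq mult.commute)
qed

lemma emeasure_hvol_hball:
  assumes x: "x \<in> H3"
  shows "emeasure hvol (hball x r) = emeasure hvol (hball 0 r)"
proof -
  have a: "norm x < 1" using x by (simp add: H3_norm)
  have "emeasure hvol (hball x r) = (\<integral>\<^sup>+y. indicator (hball x r) (mobius x y) \<partial>hvol)"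
    by (subst nn_integral_hvol_mobius[OF a]) auto
  also have "\<dots> = (\<integral>\<^sup>+y. indicator (hball 0 r) y \<partial>hvol)"
  proof (rule nn_integral_cong)
    fix y assume "y \<in> space hvol"
    then have y: "y \<in> H3" by simp
    have "hdist x (mobius x y) = hdist 0 y" using hdist_mobius[OF a zero_in_H3 y] by simp
    then show "indicator (hball x r) (mobius x y) = (indicator (hball 0 r) y :: ennreal)"
      using y mobius_in_H3[OF a y] by (simp add: hball_def indicator_def)
  qed
  finally show ?thesis by simp
qed

lemma emeasure_hvol_hball_finite:
  assumes x: "x \<in> H3"
  shows "emeasure hvol (hball x r) < \<infinity>"
proof (cases "0 < r")
  case True
  define c where "c = 2 / (1 + cosh r)"
  have c: "c > 0" using cosh_real_pos[of r] by (simp add: c_def add_pos_pos)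
  have "emeasure hvol (hball 0 r) = (\<integral>\<^sup>+y. ennreal (hweight y) * indicator (hball 0 r) y \<partial>restrict_space lborel H3)"
    by (subst nn_integral_hvol[symmetric]) auto
  also have "\<dots> \<le> (\<integral>\<^sup>+y. ennreal (1 / c ^ 3) \<partial>restrict_space lborel H3)"
  proof (rule nn_integral_mono)
    fix y
    show "ennreal (hweight y) * indicator (hball 0 r) y \<le> ennreal (1 / c ^ 3)"
    proof (cases "y \<in> hball 0 r")
      case y: True
      have "c < 1 - (norm y)\<^sup>2" using norm_less_of_hball_0[OF y True] by (simp add: c_def)
      then have "hweight y \<le> 1 / c ^ 3" unfolding hweight_def using c
        by (intro divide_left_mono power_mono mult_pos_pos zero_less_power) auto
      with y show ?thesis by (simp add: ennreal_leI)
    qed simp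
  qed
  also have "\<dots> = ennreal (1 / c ^ 3) * emeasure lborel H3"
    by (simp add: emeasure_restrict_space space_restrict_space)
  also have "\<dots> < \<infinity>"
    unfolding H3_def using emeasure_lborel_ball_finite[of "0::real^3" 1]
    by (auto simp: ennreal_mult_less_top)
  finally show ?thesis by (simp add: emeasure_hvol_hball[OF x])
next
  case False
  then have "hball x r = {}" using hdist_nonneg[OF x] by (force simp: hball_def)
  then show ?thesis by simp
qed

lemma emeasure_hvol_open_pos:
  assumes "open U" "U \<subseteq> H3" "U \<noteq> {}"
  shows "emeasure hvol U > 0"
proof -
  have U: "U \<in> sets borel" using assms by simp
  have Uh: "U \<in> sets hvol" using U assms by (simp add: sets_hvol sets_restrict_space_iff)
  have "0 < emeasure lborel U"
    using open_not_negligible[OF assms(1,3)] U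
    by (metis emeasure_completion negligible_iff_null_sets null_sets_completionI null_setsI sets_lborel zero_less_iff_neq_zero)
  also have "emeasure lborel U = (\<integral>\<^sup>+y. 1 * indicator U y \<partial>restrict_space lborel H3)"
    using U assms(2) by (simp add: emeasure_restrict_space sets_restrict_space_iff)
  also have "\<dots> \<le> (\<integral>\<^sup>+y. ennreal (hweight y) * indicator U y \<partial>restrict_space lborel H3)"
  proof (intro nn_integral_mono mult_right_mono)
    fix y assume "y \<in> space (restrict_space lborel H3)"
    then have y: "0 < 1 - (norm y)\<^sup>2" using one_minus_norm_pos[of y] by (simp add: space_restrict_space)
    moreover have "(1 - (norm y)\<^sup>2) ^ 3 \<le> 1" using y by (intro power_le_one) auto
    ultimately show "1 \<le> ennreal (hweight y)" unfolding hweight_def by simp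
  qed simp
  also have "\<dots> = emeasure hvol U" using Uh by (subst nn_integral_hvol[symmetric]) auto
  finally show ?thesis .
qed

lemma sigma_finite_hvol: "sigma_finite_measure hvol"
proof -
  have "finite_measure (restrict_space lborel H3)"
    using emeasure_lborel_ball_finite[of "0::real^3" 1]
    by (intro finite_measureI) (simp add: emeasure_restrict_space space_restrict_space H3_def)
  then interpret finite_measure "restrict_space lborel H3" .
  have "hweight \<in> borel_measurable (restrict_space lborel H3)" by (intro measurable_restrict_space1) simp
  then show ?thesis unfolding hvol_def
    by (subst sigma_finite_iff_density_finite) auto
qed

lemma pair_measurable_hvol:
  assumes "f \<in> borel \<Otimes>\<^sub>M borel \<rightarrow>\<^sub>M N"
  shows "f \<in> hvol \<Otimes>\<^sub>M hvol \<rightarrow>\<^sub>M N" "f \<in> hvol \<Otimes>\<^sub>M bd_borel \<rightarrow>\<^sub>M N"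
proof -
  have h: "(\<lambda>x. x) \<in> hvol \<rightarrow>\<^sub>M borel" by (rule measurable_hvol1) simp
  have b: "(\<lambda>x. x) \<in> bd_borel \<rightarrow>\<^sub>M borel" by (rule measurable_bd_borel1) simp
  have "(\<lambda>p. (fst p, snd p)) \<in> hvol \<Otimes>\<^sub>M hvol \<rightarrow>\<^sub>M borel \<Otimes>\<^sub>M borel"
    using measurable_compose[OF measurable_fst h] measurable_compose[OF measurable_snd h]
    by (intro measurable_Pair) auto
  from measurable_compose[OF this assms] show "f \<in> hvol \<Otimes>\<^sub>M hvol \<rightarrow>\<^sub>M N" by simp
  have "(\<lambda>p. (fst p, snd p)) \<in> hvol \<Otimes>\<^sub>M bd_borel \<rightarrow>\<^sub>M borel \<Otimes>\<^sub>M borel"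
    using measurable_compose[OF measurable_fst h] measurable_compose[OF measurable_snd b]
    by (intro measurable_Pair) auto
  from measurable_compose[OF this assms] show "f \<in> hvol \<Otimes>\<^sub>M bd_borel \<rightarrow>\<^sub>M N" by simp
qed

lemma poisson_measurable_pair: "(\<lambda>p. poisson (fst p) (snd p)) \<in> borel_measurable (borel \<Otimes>\<^sub>M borel)"
  unfolding poisson_def by measurable

lemma poisson_measurable [measurable]:
  "poisson x \<in> borel_measurable bd_borel" "(\<lambda>x. poisson x \<xi>) \<in> borel_measurable hvol"
  unfolding poisson_def by (intro measurable_bd_borel1 measurable_hvol1, measurable)+

text \<open>Rotation invariance of the ball makes the integral independent of \<open>\<eta>\<close>,
  so it equals its average over the sphere. Exchanging the integrals leaves the total mass of each
  kernel, which is 1; no Laplacian is involved.\<close>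

lemma nn_integral_poisson_hball_0:
  assumes eta: "\<eta> \<in> bdH3"
  shows "(\<integral>\<^sup>+z. indicator (hball 0 r) z * ennreal (poisson z \<eta>) \<partial>hvol) = emeasure hvol (hball 0 r)"
proof -
  interpret V: sigma_finite_measure hvol by (rule sigma_finite_hvol)
  interpret S: prob_space unif_sphere by (rule prob_space_unif_sphere)
  interpret P: pair_sigma_finite hvol unif_sphere ..
  let ?c = "\<lambda>\<eta>. \<integral>\<^sup>+z. indicator (hball 0 r) z * ennreal (poisson z \<eta>) \<partial>hvol"
  have rot: "?c \<zeta> = ?c \<eta>" if zeta: "\<zeta> \<in> bdH3" for \<zeta>
  proof -
    obtain T where T: "orthogonal_transformation T" "T \<zeta> = \<eta>"
    proof (rule orthogonal_transformation_exists)
      show "norm \<zeta> = norm \<eta>" using eta zeta by (simp add: bdH3_def)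
    qed
    have n: "norm (T z) = norm z" for z using T(1) by (rule orthogonal_transformation_norm)
    have "?c \<eta> = (\<integral>\<^sup>+z. (\<lambda>z. indicator (hball 0 r) z * ennreal (poisson z \<eta>)) (T z) \<partial>hvol)"
      by (rule nn_integral_hvol_orthogonal[OF T(1), symmetric]) measurable
    also have "\<dots> = ?c \<zeta>"
    proof (rule nn_integral_cong)
      fix z
      have "indicator (hball 0 r) (T z) = (indicator (hball 0 r) z :: ennreal)"
        by (simp add: hball_def hdist_def H3_def n indicator_def)
      then show "indicator (hball 0 r) (T z) * ennreal (poisson (T z) \<eta>) = indicator (hball 0 r) z * ennreal (poisson z \<zeta>)"
        using poisson_orthogonal[OF T(1), of z \<zeta>] T(2) by simp
    qed
    finally show ?thesis ..
  qed
  have m: "(\<lambda>(z, \<zeta>). indicator (hball 0 r) z * ennreal (poisson z \<zeta>)) \<in> borel_measurable (hvol \<Otimes>\<^sub>M unif_sphere)"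
  proof -
    have [measurable]: "(\<lambda>p. poisson (fst p) (snd p)) \<in> borel_measurable (hvol \<Otimes>\<^sub>M unif_sphere)"
      using pair_measurable_hvol(2)[OF poisson_measurable_pair]
      by (simp add: measurable_cong_sets[OF sets_pair_measure_cong[OF refl sets_unif_sphere] refl])
    show ?thesis unfolding split_beta' by measurable
  qed
  have "?c \<eta> = (\<integral>\<^sup>+\<zeta>. ?c \<eta> \<partial>unif_sphere)" using S.emeasure_space_1 by (simp del: space_unif_sphere)
  also have "\<dots> = (\<integral>\<^sup>+\<zeta>. ?c \<zeta> \<partial>unif_sphere)" by (rule nn_integral_cong) (simp add: rot)
  also have "\<dots> = (\<integral>\<^sup>+z. \<integral>\<^sup>+\<zeta>. indicator (hball 0 r) z * ennreal (poisson z \<zeta>) \<partial>unif_sphere \<partial>hvol)"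
    by (rule P.Fubini'[OF m])
  also have "\<dots> = (\<integral>\<^sup>+z. indicator (hball 0 r) z \<partial>hvol)"
  proof (rule nn_integral_cong)
    fix z assume "z \<in> space hvol"
    then have "(\<integral>\<^sup>+\<zeta>. ennreal (poisson z \<zeta>) \<partial>unif_sphere) = 1" by (intro nn_integral_poisson) simp
    moreover have "(\<integral>\<^sup>+\<zeta>. indicator (hball 0 r) z * ennreal (poisson z \<zeta>) \<partial>unif_sphere)
      = indicator (hball 0 r) z * (\<integral>\<^sup>+\<zeta>. ennreal (poisson z \<zeta>) \<partial>unif_sphere)"
      by (rule nn_integral_cmult) measurable
    ultimately show "(\<integral>\<^sup>+\<zeta>. indicator (hball 0 r) z * ennreal (poisson z \<zeta>) \<partial>unif_sphere) = indicator (hball 0 r) z" by simp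
  qed
  finally show ?thesis by simp
qed

text \<open>The translation taking 0 to \<open>x\<close> reduces to the ball around 0; by the
  cocycle identity it contributes the constant factor \<open>poisson x \<xi>\<close>.\<close>

lemma nn_integral_poisson_hball:
  assumes x: "x \<in> H3" and xi: "\<xi> \<in> bdH3"
  shows "(\<integral>\<^sup>+y. indicator (hball x r) y * ennreal (poisson y \<xi>) \<partial>hvol)
    = emeasure hvol (hball 0 r) * ennreal (poisson x \<xi>)"
proof -
  have a: "norm x < 1" "norm (- x) < 1" using x by (auto simp: H3_norm)
  define \<eta> where "\<eta> = mobius (- x) \<xi>"
  have eta: "\<eta> \<in> bdH3" "mobius x \<eta> = \<xi>"
    unfolding \<eta>_def using xi a by (auto simp: bdH3_def norm_mobius_sphere mobius_mobius_minus)
  have "(\<integral>\<^sup>+y. indicator (hball x r) y * ennreal (poisson y \<xi>) \<partial>hvol)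
      = (\<integral>\<^sup>+z. indicator (hball x r) (mobius x z) * ennreal (poisson (mobius x z) \<xi>) \<partial>hvol)"
    by (rule nn_integral_hvol_mobius[OF a(1), symmetric]) measurable
  also have "\<dots> = (\<integral>\<^sup>+z. (indicator (hball 0 r) z * ennreal (poisson z \<eta>)) * ennreal (poisson x \<xi>) \<partial>hvol)"
  proof (rule nn_integral_cong)
    fix z assume "z \<in> space hvol"
    then have z: "z \<in> H3" by simp
    have "hdist x (mobius x z) = hdist 0 z" using hdist_mobius[OF a(1) zero_in_H3 z] by simp
    then have 1: "indicator (hball x r) (mobius x z) = (indicator (hball 0 r) z :: ennreal)"
      using z mobius_in_H3[OF a(1) z] by (simp add: hball_def indicator_def)
    have "poisson (mobius x z) \<xi> = poisson z \<eta> * poisson x \<xi>"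
      using poisson_mobius[OF a(1) z eta(1)] eta(2) by simp
    then show "indicator (hball x r) (mobius x z) * ennreal (poisson (mobius x z) \<xi>)
      = (indicator (hball 0 r) z * ennreal (poisson z \<eta>)) * ennreal (poisson x \<xi>)"
      unfolding 1 using poisson_pos[OF z eta(1)] poisson_pos[OF x xi] by (simp add: ennreal_mult mult.assoc)
  qed
  also have "\<dots> = emeasure hvol (hball 0 r) * ennreal (poisson x \<xi>)"
    by (subst nn_integral_multc) (measurable, simp add: nn_integral_poisson_hball_0[OF eta(1)])
  finally show ?thesis .
qed

section \<open>Killed walks with symmetric kernels\<close>

lemma borel_measurable_nn_integral_count_space:
  fixes f :: "'i \<Rightarrow> 'x \<Rightarrow> ennreal"
  assumes I: "countable I" and m: "\<And>i. i \<in> I \<Longrightarrow> f i \<in> borel_measurable M"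
  shows "(\<lambda>x. \<integral>\<^sup>+i. f i x \<partial>count_space I) \<in> borel_measurable M"
proof -
  have "(\<lambda>x. \<Sum>i. if i \<in> to_nat_on I ` I then f (from_nat_into I i) x else 0)
      \<in> borel_measurable M"
  proof (rule borel_measurable_suminf_order)
    fix i
    have "f (from_nat_into I i) \<in> borel_measurable M" if "i \<in> to_nat_on I ` I"
      using that by (intro m from_nat_into) auto
    then show "(\<lambda>x. if i \<in> to_nat_on I ` I then f (from_nat_into I i) x else 0)
      \<in> borel_measurable M"
      by (cases "i \<in> to_nat_on I ` I") (simp_all del: image_iff)
  qed
  moreover have "(\<integral>\<^sup>+h. f h x \<partial>count_space I)
      = (\<Sum>i. if i \<in> to_nat_on I ` I then f (from_nat_into I i) x else 0)" for x
  proof -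
    have "(\<integral>\<^sup>+h. f h x \<partial>count_space I)
        = (\<integral>\<^sup>+h. f (from_nat_into I (to_nat_on I h)) x \<partial>count_space I)"
      using I by (intro nn_integral_cong) simp
    also have "\<dots> = (\<integral>\<^sup>+i. f (from_nat_into I i) x \<partial>count_space (to_nat_on I ` I))"
      by (rule nn_integral_bij_count_space[OF inj_on_imp_bij_betw[OF inj_on_to_nat_on[OF I]]])
    also have "\<dots> = (\<integral>\<^sup>+i. (if i \<in> to_nat_on I ` I then f (from_nat_into I i) x else 0) \<partial>count_space UNIV)"
      by (subst nn_integral_count_space_indicator) (auto intro!: nn_integral_cong simp: indicator_def)
    finally show ?thesis by (simp add: nn_integral_count_space_nat)
  qed
  ultimately show ?thesis by simp
qed

text \<open>Values in \<open>ennreal\<close> allow sums and integrals to be exchanged freely, also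
  against unbounded functions such as the Poisson kernel.\<close>

locale sym_kernel = sigma_finite_measure M for M :: "'x measure" +
  fixes k :: "'x \<Rightarrow> 'x \<Rightarrow> ennreal"
  assumes k_measurable: "(\<lambda>(x, y). k x y) \<in> borel_measurable (M \<Otimes>\<^sub>M M)"
    and k_sym: "x \<in> space M \<Longrightarrow> y \<in> space M \<Longrightarrow> k x y = k y x"
begin

definition kop :: "('x \<Rightarrow> ennreal) \<Rightarrow> 'x \<Rightarrow> ennreal" where
  "kop f x = (\<integral>\<^sup>+y. k x y * f y \<partial>M)"

lemma k_section_measurable: "x \<in> space M \<Longrightarrow> k x \<in> borel_measurable M"
  using measurable_compose[OF measurable_Pair1' k_measurable] by simp

lemma kop_measurable:
  assumes [measurable]: "f \<in> borel_measurable M"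
  shows "kop f \<in> borel_measurable M"
proof -
  note k_measurable[measurable]
  have "(\<lambda>(x, y). k x y * f y) \<in> borel_measurable (M \<Otimes>\<^sub>M M)" by measurable
  then show ?thesis unfolding kop_def[abs_def] by (rule borel_measurable_nn_integral)
qed

lemma kop_pow_measurable: "f \<in> borel_measurable M \<Longrightarrow> (kop ^^ n) f \<in> borel_measurable M"
  by (induction n) (auto intro: kop_measurable)

lemma kop_adjoint:
  assumes [measurable]: "f \<in> borel_measurable M" "g \<in> borel_measurable M"
  shows "(\<integral>\<^sup>+x. f x * kop g x \<partial>M) = (\<integral>\<^sup>+x. kop f x * g x \<partial>M)"
proof -
  interpret P: pair_sigma_finite M M ..
  note k_measurable[measurable]
  have "(\<integral>\<^sup>+x. f x * kop g x \<partial>M) = (\<integral>\<^sup>+x. \<integral>\<^sup>+y. f x * (k x y * g y) \<partial>M \<partial>M)"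
    unfolding kop_def using k_section_measurable
    by (intro nn_integral_cong nn_integral_cmult[symmetric]) measurable
  also have "\<dots> = (\<integral>\<^sup>+y. \<integral>\<^sup>+x. f x * (k x y * g y) \<partial>M \<partial>M)"
    by (rule P.Fubini'[symmetric]) measurable
  also have "\<dots> = (\<integral>\<^sup>+y. \<integral>\<^sup>+x. (k y x * f x) * g y \<partial>M \<partial>M)"
    by (intro nn_integral_cong) (simp add: k_sym mult_ac)
  also have "\<dots> = (\<integral>\<^sup>+x. kop f x * g x \<partial>M)"
    unfolding kop_def using k_section_measurable
    by (intro nn_integral_cong nn_integral_multc) measurable
  finally show ?thesis .
qed

lemma kop_pow_adjoint:
  assumes "f \<in> borel_measurable M" "g \<in> borel_measurable M"
  shows "(\<integral>\<^sup>+x. f x * (kop ^^ n) g x \<partial>M) = (\<integral>\<^sup>+x. (kop ^^ n) f x * g x \<partial>M)"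
  using assms
proof (induction n arbitrary: f)
  case (Suc n)
  have "(\<integral>\<^sup>+x. f x * (kop ^^ Suc n) g x \<partial>M) = (\<integral>\<^sup>+x. kop f x * (kop ^^ n) g x \<partial>M)"
    using Suc.prems by (simp add: kop_adjoint kop_pow_measurable)
  also have "\<dots> = (\<integral>\<^sup>+x. (kop ^^ n) (kop f) x * g x \<partial>M)"
    using Suc.prems by (intro Suc.IH kop_measurable)
  finally show ?case by (simp only: funpow_Suc_right o_apply)
qed simp

lemma kop_mono: "(\<And>x. x \<in> space M \<Longrightarrow> f x \<le> g x) \<Longrightarrow> kop f x \<le> kop g x"
  unfolding kop_def by (intro nn_integral_mono mult_left_mono) auto

lemma kop_cong: "(\<And>x. x \<in> space M \<Longrightarrow> f x = g x) \<Longrightarrow> kop f x = kop g x"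
  unfolding kop_def by (intro nn_integral_cong) auto

lemma kop_pow_mono:
  "(\<And>x. x \<in> space M \<Longrightarrow> f x \<le> g x) \<Longrightarrow> x \<in> space M \<Longrightarrow> (kop ^^ n) f x \<le> (kop ^^ n) g x"
  by (induction n arbitrary: x) (auto intro: kop_mono)

lemma kop_add:
  assumes "f \<in> borel_measurable M" "g \<in> borel_measurable M" "x \<in> space M"
  shows "kop (\<lambda>x. f x + g x) x = kop f x + kop g x"
  unfolding kop_def distrib_left using assms k_section_measurable[OF assms(3)]
  by (intro nn_integral_add) auto

lemma kop_sum:
  assumes "\<And>i. i \<in> I \<Longrightarrow> f i \<in> borel_measurable M" "x \<in> space M"
  shows "kop (\<lambda>x. \<Sum>i\<in>I. f i x) x = (\<Sum>i\<in>I. kop (f i) x)"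
  unfolding kop_def sum_distrib_left using assms k_section_measurable[OF assms(2)]
  by (intro nn_integral_sum) auto

lemma kop_cmult:
  assumes "f \<in> borel_measurable M" "x \<in> space M"
  shows "kop (\<lambda>x. c * f x) x = c * kop f x"
proof -
  have "kop (\<lambda>x. c * f x) x = (\<integral>\<^sup>+y. c * (k x y * f y) \<partial>M)"
    unfolding kop_def by (simp add: mult_ac)
  also have "\<dots> = c * kop f x"
    unfolding kop_def using assms k_section_measurable[OF assms(2)] by (intro nn_integral_cmult) auto
  finally show ?thesis .
qed

lemma kop_pow_cmult:
  assumes f: "f \<in> borel_measurable M" and x: "x \<in> space M"
  shows "(kop ^^ n) (\<lambda>x. c * f x) x = c * (kop ^^ n) f x"
  using x
proof (induction n arbitrary: x)
  case (Suc n)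
  have "(kop ^^ Suc n) (\<lambda>x. c * f x) x = kop (\<lambda>x. c * (kop ^^ n) f x) x"
    unfolding funpow.simps o_apply by (rule kop_cong) (simp add: Suc.IH)
  then show ?case using Suc.prems f by (simp add: kop_cmult kop_pow_measurable)
qed simp

lemma kop_count_space:
  assumes "countable I" and m: "\<And>i. i \<in> I \<Longrightarrow> f i \<in> borel_measurable M" and x: "x \<in> space M"
  shows "kop (\<lambda>x. \<integral>\<^sup>+i. f i x \<partial>count_space I) x = (\<integral>\<^sup>+i. kop (f i) x \<partial>count_space I)"
proof -
  have "kop (\<lambda>x. \<integral>\<^sup>+i. f i x \<partial>count_space I) x = (\<integral>\<^sup>+y. \<integral>\<^sup>+i. k x y * f i y \<partial>count_space I \<partial>M)"
    unfolding kop_def by (intro nn_integral_cong nn_integral_cmult[symmetric]) auto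
  also have "\<dots> = (\<integral>\<^sup>+i. kop (f i) x \<partial>count_space I)"
    unfolding kop_def using assms(1) m k_section_measurable[OF x]
    by (intro nn_integral_count_space_nn_integral) auto
  finally show ?thesis .
qed

lemma kop_pow_count_space:
  assumes "countable I" and m: "\<And>i. i \<in> I \<Longrightarrow> f i \<in> borel_measurable M" and x: "x \<in> space M"
  shows "(kop ^^ n) (\<lambda>x. \<integral>\<^sup>+i. f i x \<partial>count_space I) x = (\<integral>\<^sup>+i. (kop ^^ n) (f i) x \<partial>count_space I)"
  using x
proof (induction n arbitrary: x)
  case (Suc n)
  have "(kop ^^ Suc n) (\<lambda>x. \<integral>\<^sup>+i. f i x \<partial>count_space I) x
      = kop (\<lambda>x. \<integral>\<^sup>+i. (kop ^^ n) (f i) x \<partial>count_space I) x"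
    unfolding funpow.simps o_apply by (rule kop_cong) (simp add: Suc.IH)
  then show ?case using Suc.prems m assms(1) by (simp add: kop_count_space kop_pow_measurable)
qed simp

text \<open>Up to the normalisation \<open>c\<close>, the probability that the walk with killed kernel \<open>k\<close>,
  started from the density \<open>b g\<close>, is finally absorbed at \<open>h\<close>.\<close>

definition hit :: "ennreal \<Rightarrow> ('g \<Rightarrow> 'x \<Rightarrow> ennreal) \<Rightarrow> 'g \<Rightarrow> 'g \<Rightarrow> ennreal" where
  "hit c b g h = c * (\<Sum>n. \<integral>\<^sup>+x. b g x * (kop ^^ n) (b h) x \<partial>M)"

text \<open>Self-adjointness of the powers of the kernel; the roles of \<open>g\<close> and
  \<open>h\<close> can be exchanged because \<open>b\<close> is both starting density and absorption
  rate.\<close>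

lemma hit_sym:
  assumes "b g \<in> borel_measurable M" "b h \<in> borel_measurable M"
  shows "hit c b g h = hit c b h g"
  unfolding hit_def kop_pow_adjoint[OF assms] by (simp add: mult.commute)

lemma hit_ge:
  assumes "b g \<in> borel_measurable M" "b h \<in> borel_measurable M"
  shows "c * (\<integral>\<^sup>+x. b g x * (kop ^^ n) (b h) x \<partial>M) \<le> hit c b g h"
proof -
  have "(\<Sum>i\<in>{n}. \<integral>\<^sup>+x. b g x * (kop ^^ i) (b h) x \<partial>M) \<le> (\<Sum>i. \<integral>\<^sup>+x. b g x * (kop ^^ i) (b h) x \<partial>M)"
    by (rule sum_le_suminf) auto
  then show ?thesis unfolding hit_def by (intro mult_left_mono) auto
qed

lemma kop_pow_equivariant:
  assumes act: "act \<in> M \<rightarrow>\<^sub>M M" "\<And>F. F \<in> borel_measurable M \<Longrightarrow> (\<integral>\<^sup>+x. F (act x) \<partial>M) = (\<integral>\<^sup>+x. F x \<partial>M)"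
    "\<And>x y. x \<in> space M \<Longrightarrow> y \<in> space M \<Longrightarrow> k (act x) (act y) = k x y"
    and f: "f \<in> borel_measurable M" and x: "x \<in> space M"
  shows "(kop ^^ n) f (act x) = (kop ^^ n) (\<lambda>x. f (act x)) x"
  using x
proof (induction n arbitrary: x)
  case (Suc n)
  have ax: "act x \<in> space M" using act(1) Suc.prems by (rule measurable_space)
  have "(kop ^^ Suc n) f (act x) = (\<integral>\<^sup>+y. k (act x) y * (kop ^^ n) f y \<partial>M)" by (simp add: kop_def)
  also have "\<dots> = (\<integral>\<^sup>+y. k (act x) (act y) * (kop ^^ n) f (act y) \<partial>M)"
    using k_section_measurable[OF ax] kop_pow_measurable[OF f, of n] by (intro act(2)[symmetric]) auto
  also have "\<dots> = (\<integral>\<^sup>+y. k x y * (kop ^^ n) (\<lambda>x. f (act x)) y \<partial>M)"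
    using Suc by (intro nn_integral_cong) (simp add: act(3))
  also have "\<dots> = kop ((kop ^^ n) (\<lambda>x. f (act x))) x" by (rule kop_def[symmetric])
  finally show ?case by simp
qed simp

text \<open>Together with \<open>hit_sym\<close> this gives invariance of the hitting distribution
  under inversion: translating the pair of \<open>\<one>\<close> and the inverse of \<open>g\<close>
  by \<open>g\<close> gives the pair of \<open>g\<close> and \<open>\<one>\<close>, which is then
  swapped.\<close>

lemma hit_equivariant:
  assumes act: "act \<in> M \<rightarrow>\<^sub>M M" "\<And>F. F \<in> borel_measurable M \<Longrightarrow> (\<integral>\<^sup>+x. F (act x) \<partial>M) = (\<integral>\<^sup>+x. F x \<partial>M)"
    "\<And>x y. x \<in> space M \<Longrightarrow> y \<in> space M \<Longrightarrow> k (act x) (act y) = k x y"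
    and m: "b g' \<in> borel_measurable M" "b h' \<in> borel_measurable M"
    and b: "\<And>x. x \<in> space M \<Longrightarrow> b g' (act x) = b g x" "\<And>x. x \<in> space M \<Longrightarrow> b h' (act x) = b h x"
  shows "hit c b g' h' = hit c b g h"
proof -
  have "(\<integral>\<^sup>+x. b g' x * (kop ^^ n) (b h') x \<partial>M) = (\<integral>\<^sup>+x. b g x * (kop ^^ n) (b h) x \<partial>M)" for n
  proof -
    have "(\<integral>\<^sup>+x. b g' x * (kop ^^ n) (b h') x \<partial>M) = (\<integral>\<^sup>+x. b g' (act x) * (kop ^^ n) (b h') (act x) \<partial>M)"
      using m kop_pow_measurable[OF m(2), of n] by (intro act(2)[symmetric]) auto
    also have "\<dots> = (\<integral>\<^sup>+x. b g x * (kop ^^ n) (\<lambda>x. b h' (act x)) x \<partial>M)"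
      using b by (intro nn_integral_cong) (simp add: kop_pow_equivariant[OF act m(2)])
    also have "\<dots> = (\<integral>\<^sup>+x. b g x * (kop ^^ n) (b h) x \<partial>M)"
      using b kop_pow_mono[of "\<lambda>x. b h' (act x)" "b h"] kop_pow_mono[of "b h" "\<lambda>x. b h' (act x)"]
      by (intro nn_integral_cong arg_cong2[where f = "(*)"] antisym) auto
    finally show ?thesis .
  qed
  then show ?thesis unfolding hit_def by simp
qed

text \<open>Telescoping of \<open>s \<le> u - kop u\<close> without subtraction. The survival term
  is retained because the version with equality passes to the limit in it.\<close>

lemma sum_kop_pow_le:
  assumes m: "u \<in> borel_measurable M" "s \<in> borel_measurable M"
    and u: "\<And>x. x \<in> space M \<Longrightarrow> kop u x + s x \<le> u x" and x: "x \<in> space M"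
  shows "(\<Sum>n<N. (kop ^^ n) s x) + (kop ^^ N) u x \<le> u x"
  using x
proof (induction N arbitrary: x)
  case (Suc N)
  have "(\<Sum>n<Suc N. (kop ^^ n) s x) + (kop ^^ Suc N) u x
     = s x + kop (\<lambda>x. (\<Sum>n<N. (kop ^^ n) s x) + (kop ^^ N) u x) x"
    unfolding sum.lessThan_Suc_shift using m kop_pow_measurable Suc.prems
    by (subst kop_add) (auto simp: kop_sum add.assoc intro!: borel_measurable_sum)
  also have "\<dots> \<le> s x + kop u x" using Suc.IH by (intro add_left_mono kop_mono)
  also have "\<dots> \<le> u x" using u[OF Suc.prems] by (simp add: add.commute)
  finally show ?case .
qed simp

lemma sum_kop_pow_eq:
  assumes m: "u \<in> borel_measurable M" "s \<in> borel_measurable M"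
    and u: "\<And>x. x \<in> space M \<Longrightarrow> kop u x + s x = u x" and x: "x \<in> space M"
  shows "(\<Sum>n<N. (kop ^^ n) s x) + (kop ^^ N) u x = u x"
  using x
proof (induction N arbitrary: x)
  case (Suc N)
  have "(\<Sum>n<Suc N. (kop ^^ n) s x) + (kop ^^ Suc N) u x
     = s x + kop (\<lambda>x. (\<Sum>n<N. (kop ^^ n) s x) + (kop ^^ N) u x) x"
    unfolding sum.lessThan_Suc_shift using m kop_pow_measurable Suc.prems
    by (subst kop_add) (auto simp: kop_sum add.assoc intro!: borel_measurable_sum)
  also have "\<dots> = s x + kop u x" using Suc.IH by (intro arg_cong2[where f = "(+)"] kop_cong) auto
  also have "\<dots> = u x" using u[OF Suc.prems] by (simp add: add.commute)
  finally show ?case .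
qed simp

lemma nn_integral_hit:
  assumes I: "countable I" and m: "b g \<in> borel_measurable M" "\<And>i. i \<in> I \<Longrightarrow> b i \<in> borel_measurable M"
  shows "(\<integral>\<^sup>+h. hit c b g h * H h \<partial>count_space I)
    = c * (\<Sum>n. \<integral>\<^sup>+x. b g x * (kop ^^ n) (\<lambda>x. \<integral>\<^sup>+h. H h * b h x \<partial>count_space I) x \<partial>M)"
proof -
  have "(\<integral>\<^sup>+x. b g x * (kop ^^ n) (\<lambda>x. \<integral>\<^sup>+h. H h * b h x \<partial>count_space I) x \<partial>M)
    = (\<integral>\<^sup>+h. (\<integral>\<^sup>+x. b g x * (kop ^^ n) (b h) x \<partial>M) * H h \<partial>count_space I)" for n
  proof -
    have "(\<integral>\<^sup>+x. b g x * (kop ^^ n) (\<lambda>x. \<integral>\<^sup>+h. H h * b h x \<partial>count_space I) x \<partial>M)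
      = (\<integral>\<^sup>+x. \<integral>\<^sup>+h. b g x * (H h * (kop ^^ n) (b h) x) \<partial>count_space I \<partial>M)"
    proof (rule nn_integral_cong)
      fix x assume x: "x \<in> space M"
      have "(kop ^^ n) (\<lambda>x. \<integral>\<^sup>+h. H h * b h x \<partial>count_space I) x
          = (\<integral>\<^sup>+h. (kop ^^ n) (\<lambda>x. H h * b h x) x \<partial>count_space I)"
        using I m x by (intro kop_pow_count_space) auto
      also have "\<dots> = (\<integral>\<^sup>+h. H h * (kop ^^ n) (b h) x \<partial>count_space I)"
        using m x by (intro nn_integral_cong kop_pow_cmult) auto
      finally show "b g x * (kop ^^ n) (\<lambda>x. \<integral>\<^sup>+h. H h * b h x \<partial>count_space I) x
          = (\<integral>\<^sup>+h. b g x * (H h * (kop ^^ n) (b h) x) \<partial>count_space I)"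
        by (simp add: nn_integral_cmult)
    qed
    also have "\<dots> = (\<integral>\<^sup>+h. \<integral>\<^sup>+x. b g x * (H h * (kop ^^ n) (b h) x) \<partial>M \<partial>count_space I)"
      using I m kop_pow_measurable by (intro nn_integral_count_space_nn_integral) auto
    also have "\<dots> = (\<integral>\<^sup>+h. (\<integral>\<^sup>+x. b g x * (kop ^^ n) (b h) x \<partial>M) * H h \<partial>count_space I)"
    proof (rule nn_integral_cong)
      fix h assume "h \<in> space (count_space I)"
      then have "b h \<in> borel_measurable M" using m by simp
      then show "(\<integral>\<^sup>+x. b g x * (H h * (kop ^^ n) (b h) x) \<partial>M) = (\<integral>\<^sup>+x. b g x * (kop ^^ n) (b h) x \<partial>M) * H h"
        using m(1) kop_pow_measurable[of "b h" n]
        by (subst nn_integral_multc[symmetric]) (auto simp: mult_ac)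
    qed
    finally show ?thesis .
  qed
  then have "(\<Sum>n. \<integral>\<^sup>+x. b g x * (kop ^^ n) (\<lambda>x. \<integral>\<^sup>+h. H h * b h x \<partial>count_space I) x \<partial>M)
    = (\<integral>\<^sup>+h. (\<Sum>n. (\<integral>\<^sup>+x. b g x * (kop ^^ n) (b h) x \<partial>M) * H h) \<partial>count_space I)"
    by (simp only:) (rule nn_integral_suminf[symmetric], auto)
  also have "c * \<dots> = (\<integral>\<^sup>+h. hit c b g h * H h \<partial>count_space I)"
    unfolding hit_def by (subst nn_integral_cmult[symmetric]) (auto simp: mult.assoc ennreal_suminf_multc)
  finally show ?thesis ..
qed

lemma hit_source_measurable:
  assumes I: "countable I" and m: "\<And>i. i \<in> I \<Longrightarrow> b i \<in> borel_measurable M"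
  shows "(\<lambda>x. \<integral>\<^sup>+h. H h * b h x \<partial>count_space I) \<in> borel_measurable M"
  using m by (intro borel_measurable_nn_integral_count_space I borel_measurable_times) auto

text \<open>Optional stopping for a nonnegative function \<open>u\<close> with boundary values
  \<open>H\<close>: the survival term is dropped, which asks for no bound on \<open>u\<close> but
  leaves only an inequality.\<close>

lemma hit_superharmonic:
  assumes I: "countable I" and m: "b g \<in> borel_measurable M" "\<And>i. i \<in> I \<Longrightarrow> b i \<in> borel_measurable M"
    and um: "u \<in> borel_measurable M"
    and u: "\<And>x. x \<in> space M \<Longrightarrow> kop u x + (\<integral>\<^sup>+h. H h * b h x \<partial>count_space I) \<le> u x"
  shows "(\<integral>\<^sup>+h. hit c b g h * H h \<partial>count_space I) \<le> c * (\<integral>\<^sup>+x. b g x * u x \<partial>M)"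
proof -
  let ?s = "\<lambda>x. \<integral>\<^sup>+h. H h * b h x \<partial>count_space I"
  have sm: "?s \<in> borel_measurable M" using I m by (intro hit_source_measurable)
  have "(\<Sum>n<N. \<integral>\<^sup>+x. b g x * (kop ^^ n) ?s x \<partial>M) \<le> (\<integral>\<^sup>+x. b g x * u x \<partial>M)" for N
  proof -
    have "(\<Sum>n<N. \<integral>\<^sup>+x. b g x * (kop ^^ n) ?s x \<partial>M) = (\<integral>\<^sup>+x. b g x * (\<Sum>n<N. (kop ^^ n) ?s x) \<partial>M)"
      using m(1) kop_pow_measurable[OF sm] by (subst nn_integral_sum[symmetric]) (auto simp: sum_distrib_left)
    also have "\<dots> \<le> (\<integral>\<^sup>+x. b g x * u x \<partial>M)"
    proof (intro nn_integral_mono mult_left_mono)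
      fix x assume x: "x \<in> space M"
      have "(\<Sum>n<N. (kop ^^ n) ?s x) + (kop ^^ N) u x \<le> u x"
        using um sm u x by (intro sum_kop_pow_le)
      then show "(\<Sum>n<N. (kop ^^ n) ?s x) \<le> u x"
        by (rule order_trans[rotated]) simp
    qed simp
    finally show ?thesis .
  qed
  then have "(\<Sum>n. \<integral>\<^sup>+x. b g x * (kop ^^ n) ?s x \<partial>M) \<le> (\<integral>\<^sup>+x. b g x * u x \<partial>M)"
    by (intro suminf_le_const) auto
  then have "c * (\<Sum>n. \<integral>\<^sup>+x. b g x * (kop ^^ n) ?s x \<partial>M) \<le> c * (\<integral>\<^sup>+x. b g x * u x \<partial>M)"
    by (rule mult_left_mono) simp
  also have "c * (\<Sum>n. \<integral>\<^sup>+x. b g x * (kop ^^ n) ?s x \<partial>M) = (\<integral>\<^sup>+h. hit c b g h * H h \<partial>count_space I)"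
    using I m by (intro nn_integral_hit[symmetric])
  finally show ?thesis .
qed

text \<open>For the constant 1 the survival term is the probability of not being absorbed within
  \<open>n\<close> steps. If it tends to 0, no mass is lost.\<close>

lemma hit_total:
  assumes I: "countable I" and m: "b g \<in> borel_measurable M" "\<And>i. i \<in> I \<Longrightarrow> b i \<in> borel_measurable M"
    and u: "\<And>x. x \<in> space M \<Longrightarrow> kop (\<lambda>_. 1) x + (\<integral>\<^sup>+h. b h x \<partial>count_space I) = 1"
    and lim: "(\<lambda>n. \<integral>\<^sup>+x. b g x * (kop ^^ n) (\<lambda>_. 1) x \<partial>M) \<longlonglongrightarrow> 0"
  shows "(\<integral>\<^sup>+h. hit c b g h \<partial>count_space I) = c * (\<integral>\<^sup>+x. b g x \<partial>M)"
proof -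
  let ?s = "\<lambda>x. \<integral>\<^sup>+h. 1 * b h x \<partial>count_space I"
  have sm: "?s \<in> borel_measurable M" using I m(2) by (rule hit_source_measurable)
  have eq: "(\<Sum>n<N. \<integral>\<^sup>+x. b g x * (kop ^^ n) ?s x \<partial>M) + (\<integral>\<^sup>+x. b g x * (kop ^^ N) (\<lambda>_. 1) x \<partial>M)
      = (\<integral>\<^sup>+x. b g x \<partial>M)" for N
  proof -
    have "(\<Sum>n<N. \<integral>\<^sup>+x. b g x * (kop ^^ n) ?s x \<partial>M) + (\<integral>\<^sup>+x. b g x * (kop ^^ N) (\<lambda>_. 1) x \<partial>M)
      = (\<integral>\<^sup>+x. b g x * ((\<Sum>n<N. (kop ^^ n) ?s x) + (kop ^^ N) (\<lambda>_. 1) x) \<partial>M)"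
      using m(1) kop_pow_measurable[OF sm] kop_pow_measurable[of "\<lambda>_. 1"] unfolding distrib_left sum_distrib_left
      by (subst nn_integral_add) (auto simp: nn_integral_sum)
    also have "\<dots> = (\<integral>\<^sup>+x. b g x \<partial>M)"
    proof (rule nn_integral_cong)
      fix x assume x: "x \<in> space M"
      have "(\<Sum>n<N. (kop ^^ n) ?s x) + (kop ^^ N) (\<lambda>_. 1) x = 1"
        using sum_kop_pow_eq[OF _ sm _ x, of "\<lambda>_. 1" N] u by simp
      then show "b g x * ((\<Sum>n<N. (kop ^^ n) ?s x) + (kop ^^ N) (\<lambda>_. 1) x) = b g x" by simp
    qed
    finally show ?thesis .
  qed
  have "(\<lambda>N. (\<Sum>n<N. \<integral>\<^sup>+x. b g x * (kop ^^ n) ?s x \<partial>M) + (\<integral>\<^sup>+x. b g x * (kop ^^ N) (\<lambda>_. 1) x \<partial>M))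
     \<longlonglongrightarrow> (\<Sum>n. \<integral>\<^sup>+x. b g x * (kop ^^ n) ?s x \<partial>M) + 0"
    by (intro tendsto_add lim summable_LIMSEQ) auto
  then have "(\<integral>\<^sup>+x. b g x \<partial>M) = (\<Sum>n. \<integral>\<^sup>+x. b g x * (kop ^^ n) ?s x \<partial>M)"
    unfolding eq by (simp add: LIMSEQ_const_iff)
  then have "c * (\<integral>\<^sup>+x. b g x \<partial>M) = c * (\<Sum>n. \<integral>\<^sup>+x. b g x * (kop ^^ n) ?s x \<partial>M)" by simp
  also have "\<dots> = (\<integral>\<^sup>+h. hit c b g h * 1 \<partial>count_space I)"
    using I m by (intro nn_integral_hit[symmetric])
  finally show ?thesis by simp
qed

end

section \<open>A symmetric random walk on the lattice\<close>

lemma hball_Isom: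
  assumes g: "g \<in> carrier Isom_H3" and x: "x \<in> H3" and z: "z \<in> H3"
  shows "g z \<in> hball (g x) r \<longleftrightarrow> z \<in> hball x r"
  using Isom_H3_in_H3[OF g z] Isom_H3_hdist[OF g x z] z by (simp add: hball_def)

lemma hball_overlap:
  assumes "x \<in> H3" "y \<in> H3" "z \<in> hball x r" "z \<in> hball y s"
  shows "hdist x y < r + s"
  using assms hdist_triangle[of x z y] by (auto simp: hball_def hdist_commute)

lemma Isom_H3_inv_mult_0:
  assumes g: "g \<in> carrier Isom_H3" and h: "h \<in> carrier Isom_H3"
  shows "(inv\<^bsub>Isom_H3\<^esub> g \<otimes>\<^bsub>Isom_H3\<^esub> h) 0 = (inv\<^bsub>Isom_H3\<^esub> g) (h 0)"
    "hdist 0 ((inv\<^bsub>Isom_H3\<^esub> g \<otimes>\<^bsub>Isom_H3\<^esub> h) 0) = hdist (g 0) (h 0)"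
proof -
  interpret I: group Isom_H3 by (rule group_Isom_H3)
  show 1: "(inv\<^bsub>Isom_H3\<^esub> g \<otimes>\<^bsub>Isom_H3\<^esub> h) 0 = (inv\<^bsub>Isom_H3\<^esub> g) (h 0)"
    by (rule Isom_H3_mult_apply[OF I.inv_closed[OF g] h zero_in_H3])
  have "hdist ((inv\<^bsub>Isom_H3\<^esub> g) (g 0)) ((inv\<^bsub>Isom_H3\<^esub> g) (h 0)) = hdist (g 0) (h 0)"
    by (rule Isom_H3_hdist[OF I.inv_closed[OF g] Isom_H3_in_H3[OF g zero_in_H3] Isom_H3_in_H3[OF h zero_in_H3]])
  then show "hdist 0 ((inv\<^bsub>Isom_H3\<^esub> g \<otimes>\<^bsub>Isom_H3\<^esub> h) 0) = hdist (g 0) (h 0)"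
    unfolding 1 Isom_H3_inv_apply(1)[OF g zero_in_H3] .
qed

text \<open>The orbit of 0 is indexed by group elements: \<open>finite_orbit\<close> is proper
  discontinuity, and \<open>orbit_dense\<close> says that the balls of radius \<open>D\<close>
  around the orbit cover the space.\<close>

locale cocompact_action =
  fixes \<Gamma> :: "(real^3 \<Rightarrow> real^3) set" and D :: real
  assumes subgroup_Gamma: "subgroup \<Gamma> Isom_H3"
    and D_pos: "0 < D"
    and finite_orbit: "finite {g \<in> \<Gamma>. hdist 0 (g 0) < r}"
    and orbit_dense: "x \<in> H3 \<Longrightarrow> \<exists>g\<in>\<Gamma>. x \<in> hball (g 0) D"
begin

sublocale I: group Isom_H3 by (rule group_Isom_H3)

lemma in_carrier: "g \<in> \<Gamma> \<Longrightarrow> g \<in> carrier Isom_H3"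
  using subgroup.mem_carrier[OF subgroup_Gamma] .

lemma orbit_in_H3: "g \<in> \<Gamma> \<Longrightarrow> g 0 \<in> H3"
  using Isom_H3_in_H3[OF in_carrier zero_in_H3] .

lemma mult_in: "g \<in> \<Gamma> \<Longrightarrow> h \<in> \<Gamma> \<Longrightarrow> g \<otimes>\<^bsub>Isom_H3\<^esub> h \<in> \<Gamma>"
  using subgroup.m_closed[OF subgroup_Gamma] .

lemma inv_in: "g \<in> \<Gamma> \<Longrightarrow> inv\<^bsub>Isom_H3\<^esub> g \<in> \<Gamma>"
  using subgroup.m_inv_closed[OF subgroup_Gamma] .

lemma one_in: "\<one>\<^bsub>Isom_H3\<^esub> \<in> \<Gamma>"
  using subgroup.one_closed[OF subgroup_Gamma] .

lemma one_0: "\<one>\<^bsub>Isom_H3\<^esub> 0 = 0"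
  by (rule Isom_H3_one_apply[OF zero_in_H3])

lemma countable_Gamma: "countable \<Gamma>"
proof -
  have "\<Gamma> = (\<Union>n::nat. {g \<in> \<Gamma>. hdist 0 (g 0) < real n})" using reals_Archimedean2 by auto
  moreover have "countable (\<Union>n::nat. {g \<in> \<Gamma>. hdist 0 (g 0) < real n})"
    by (rule countable_UN[OF countableI_type countable_finite[OF finite_orbit]])
  ultimately show ?thesis by simp
qed

definition overlap :: nat where "overlap = card {g \<in> \<Gamma>. hdist 0 (g 0) < 2 * D}"

lemma overlap_pos: "0 < overlap"
proof -
  have "\<one>\<^bsub>Isom_H3\<^esub> \<in> {g \<in> \<Gamma>. hdist 0 (g 0) < 2 * D}" using one_in one_0 D_pos by simp
  then show ?thesis using finite_orbit[of "2 * D"] unfolding overlap_def card_gt_0_iff by blast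
qed

text \<open>If two balls share \<open>x\<close>, their centres are less than \<open>2 * D\<close>
  apart. Translating one fixed centre back to 0 injects the balls through \<open>x\<close> into the
  set counted by \<open>overlap\<close>.\<close>

lemma card_near:
  assumes x: "x \<in> H3"
  shows "finite {g \<in> \<Gamma>. x \<in> hball (g 0) D}" "card {g \<in> \<Gamma>. x \<in> hball (g 0) D} \<le> overlap"
proof -
  obtain g where g: "g \<in> \<Gamma>" "x \<in> hball (g 0) D" using orbit_dense[OF x] by blast
  let ?f = "\<lambda>h. inv\<^bsub>Isom_H3\<^esub> g \<otimes>\<^bsub>Isom_H3\<^esub> h"
  have inj: "inj_on ?f {g \<in> \<Gamma>. x \<in> hball (g 0) D}"
    using g(1) in_carrier by (intro inj_onI) (simp add: I.Units_l_cancel)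
  have sub: "?f ` {g \<in> \<Gamma>. x \<in> hball (g 0) D} \<subseteq> {g \<in> \<Gamma>. hdist 0 (g 0) < 2 * D}"
  proof safe
    fix h assume h: "h \<in> \<Gamma>" "x \<in> hball (h 0) D"
    show "?f h \<in> \<Gamma>" using g h by (intro mult_in inv_in)
    show "hdist 0 (?f h 0) < 2 * D"
      unfolding Isom_H3_inv_mult_0(2)[OF in_carrier[OF g(1)] in_carrier[OF h(1)]]
      using hball_overlap[OF orbit_in_H3[OF g(1)] orbit_in_H3[OF h(1)] g(2) h(2)] by simp
  qed
  show "finite {g \<in> \<Gamma>. x \<in> hball (g 0) D}"
    using inj sub finite_orbit by (rule inj_on_finite)
  show "card {g \<in> \<Gamma>. x \<in> hball (g 0) D} \<le> overlap"
    unfolding overlap_def using inj sub finite_orbit by (rule card_inj_on_le)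
qed

text \<open>Connectedness of the ball model. If balls around \<open>g 0\<close> and
  \<open>h 0\<close> meet, then \<open>g\<close> and \<open>h\<close> differ by a generator, so the
  union of the balls over the generated subgroup and the union over its complement are disjoint open
  sets covering the space.\<close>

lemma generate_near:
  "generate Isom_H3 {g \<in> \<Gamma>. hball 0 D \<inter> hball (g 0) D \<noteq> {}} = \<Gamma>" (is "generate _ ?S = _")
proof
  let ?W = "generate Isom_H3 ?S"
  show W: "?W \<subseteq> \<Gamma>"
    using subgroup_Gamma by (intro I.generate_subgroup_incl) auto
  have trans: "h \<in> ?W" if "g \<in> ?W" "h \<in> \<Gamma>" "z \<in> hball (g 0) D" "z \<in> hball (h 0) D" for g h z
  proof -
    have g: "g \<in> \<Gamma>" using that(1) W by auto
    have gc: "g \<in> carrier Isom_H3" and hc: "h \<in> carrier Isom_H3" using g that(2) in_carrier by auto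
    let ?i = "inv\<^bsub>Isom_H3\<^esub> g"
    have z: "z \<in> H3" using that(3) by (simp add: hball_def)
    have "?i z \<in> hball (?i (g 0)) D" "?i z \<in> hball (?i (h 0)) D"
      using hball_Isom[OF I.inv_closed[OF gc] orbit_in_H3[OF g] z]
        hball_Isom[OF I.inv_closed[OF gc] orbit_in_H3[OF that(2)] z] that(3,4) by auto
    then have "?i \<otimes>\<^bsub>Isom_H3\<^esub> h \<in> ?S"
      using mult_in[OF inv_in[OF g] that(2)]
      unfolding Isom_H3_inv_apply(1)[OF gc zero_in_H3]
      by (auto simp: Isom_H3_inv_mult_0(1)[OF gc hc])
    then have "g \<otimes>\<^bsub>Isom_H3\<^esub> (?i \<otimes>\<^bsub>Isom_H3\<^esub> h) \<in> ?W"
      by (intro generate.eng that(1) generate.incl)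
    then show "h \<in> ?W" using gc hc by (simp add: I.m_assoc[symmetric])
  qed
  define U where "U A = (\<Union>g\<in>A. hball (g 0) D)" for A :: "(real^3 \<Rightarrow> real^3) set"
  have "open (U A)" if "A \<subseteq> \<Gamma>" for A
    unfolding U_def using that D_pos orbit_in_H3 by (intro open_UN ballI open_hball) auto
  then have op: "open (U ?W)" "open (U (\<Gamma> - ?W))" using W by auto
  have cov: "H3 \<subseteq> U ?W \<union> U (\<Gamma> - ?W)" unfolding U_def using orbit_dense by blast
  have "connected H3" unfolding H3_def by (intro convex_connected convex_ball)
  moreover have "U ?W \<inter> U (\<Gamma> - ?W) \<inter> H3 = {}" unfolding U_def using trans by blast
  ultimately have "U ?W \<inter> H3 = {} \<or> U (\<Gamma> - ?W) \<inter> H3 = {}"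
    using op cov by (intro connectedD)
  moreover have "0 \<in> U ?W"
    unfolding U_def using center_in_hball[OF zero_in_H3 D_pos] one_0
    by (intro UN_I[of "\<one>\<^bsub>Isom_H3\<^esub>"] generate.one) simp
  ultimately have "U (\<Gamma> - ?W) \<inter> H3 = {}" using zero_in_H3 by blast
  moreover have "g 0 \<in> U (\<Gamma> - ?W) \<inter> H3" if "g \<in> \<Gamma> - ?W" for g
    using that orbit_in_H3[of g] center_in_hball[OF orbit_in_H3 D_pos, of g] by (auto simp: U_def)
  ultimately show "\<Gamma> \<subseteq> ?W" by blast
qed

section \<open>The killed kernel and its balance equations\<close>

definition volD :: real where "volD = measure hvol (hball 0 D)"
definition vol2D :: real where "vol2D = measure hvol (hball 0 (2 * D))"

lemma vol: "emeasure hvol (hball 0 D) = ennreal volD" "0 < volD"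
  "emeasure hvol (hball 0 (2 * D)) = ennreal vol2D" "0 < vol2D"
proof -
  have f: "emeasure hvol (hball 0 r) = ennreal (measure hvol (hball 0 r))" for r
    using emeasure_hvol_hball_finite[OF zero_in_H3, of r]
    by (intro emeasure_eq_ennreal_measure) auto
  have p: "0 < measure hvol (hball 0 r)" if "0 < r" for r
    using emeasure_hvol_open_pos[OF open_hball[OF zero_in_H3 that] hball_subset_H3]
      center_in_hball[OF zero_in_H3 that] f[of r] by (metis emptyE ennreal_less_zero_iff)
  show "emeasure hvol (hball 0 D) = ennreal volD" "0 < volD"
    "emeasure hvol (hball 0 (2 * D)) = ennreal vol2D" "0 < vol2D"
    unfolding volD_def vol2D_def using f p D_pos by auto
qed

definition near_count :: "real^3 \<Rightarrow> real^3 \<Rightarrow> ennreal" where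
  "near_count x y = (\<integral>\<^sup>+g. indicator (hball (g 0) D) x * indicator (hball (g 0) D) y \<partial>count_space \<Gamma>)"

text \<open>The uniform jump of hyperbolic length below \<open>2 * D\<close>, minus the share absorbed by the
  orbit. Absorption through the product of two indicators keeps the kernel symmetric, while the
  absorbed mass is uniform on a ball around an orbit point, so harmonic functions are preserved.\<close>

definition ker :: "real^3 \<Rightarrow> real^3 \<Rightarrow> ennreal" where
  "ker x y = ennreal (1 / vol2D) * (indicator (hball x (2 * D)) y - ennreal (1 / real overlap) * near_count x y)"

text \<open>The jump mass that the summand of \<open>g\<close> in \<open>near_count\<close> removes
  from the kernel at \<open>x\<close>; integrating the second indicator accounts for the factor
  \<open>volD\<close>.\<close>

definition bump :: "(real^3 \<Rightarrow> real^3) \<Rightarrow> real^3 \<Rightarrow> ennreal" where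
  "bump g x = ennreal (volD / (real overlap * vol2D)) * indicator (hball (g 0) D) x"

lemma near_count_sum: "near_count x y = (\<integral>\<^sup>+g. indicator {g. x \<in> hball (g 0) D \<and> y \<in> hball (g 0) D} g \<partial>count_space \<Gamma>)"
  unfolding near_count_def by (intro nn_integral_cong) (auto simp: indicator_def)

text \<open>At most \<open>overlap\<close> balls contain \<open>x\<close>, and two points of one
  such ball are less than \<open>2 * D\<close> apart. Hence the subtraction in \<open>ker\<close>,
  which \<open>ennreal\<close> would truncate at 0, is a genuine one.\<close>

lemma near_count_le:
  assumes "x \<in> H3" "y \<in> H3"
  shows "ennreal (1 / real overlap) * near_count x y \<le> indicator (hball x (2 * D)) y"
proof (cases "y \<in> hball x (2 * D)")
  case True
  have "near_count x y \<le> (\<integral>\<^sup>+g. indicator {g \<in> \<Gamma>. x \<in> hball (g 0) D} g \<partial>count_space \<Gamma>)"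
    unfolding near_count_sum by (intro nn_integral_mono) (auto simp: indicator_def)
  also have "\<dots> = ennreal (real (card {g \<in> \<Gamma>. x \<in> hball (g 0) D}))"
    using card_near(1)[OF assms(1)] by (subst nn_integral_indicator) (auto simp: emeasure_count_space_finite ennreal_of_nat_eq_real_of_nat)
  also have "\<dots> \<le> ennreal (real overlap)"
    using card_near(2)[OF assms(1)] by (intro ennreal_leI) simp
  finally have "ennreal (1 / real overlap) * near_count x y \<le> ennreal (1 / real overlap) * ennreal (real overlap)"
    by (rule mult_left_mono) simp
  also have "\<dots> = 1" using overlap_pos by (simp flip: ennreal_mult)
  finally show ?thesis using True by simp
next
  case False
  have "\<not> (x \<in> hball (g 0) D \<and> y \<in> hball (g 0) D)" if "g \<in> \<Gamma>" for g
  proof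
    assume *: "x \<in> hball (g 0) D \<and> y \<in> hball (g 0) D"
    then have "hdist x (g 0) < D" "hdist (g 0) y < D" by (auto simp: hball_def hdist_commute)
    then have "hdist x y < 2 * D" using hdist_triangle[OF assms(1) orbit_in_H3[OF that] assms(2)] by simp
    with False assms show False by (simp add: hball_def)
  qed
  then have "near_count x y = (\<integral>\<^sup>+g. 0 \<partial>count_space \<Gamma>)"
    unfolding near_count_sum by (intro nn_integral_cong) (auto simp: indicator_def)
  then show ?thesis by simp
qed

lemma near_count_measurable: "(\<lambda>(x, y). near_count x y) \<in> borel_measurable (borel \<Otimes>\<^sub>M borel)"
  unfolding near_count_def split_beta'
  by (intro borel_measurable_nn_integral_count_space countable_Gamma) measurable

lemma ker_measurable: "(\<lambda>(x, y). ker x y) \<in> borel_measurable (hvol \<Otimes>\<^sub>M hvol)"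
proof (rule pair_measurable_hvol(1))
  note near_count_measurable[measurable]
  have "(\<lambda>(x, y). indicator (hball x (2 * D)) y :: ennreal) = (\<lambda>(x, y). indicator {p. snd p \<in> H3 \<and> hdist (fst p) (snd p) < 2 * D} (x, y))"
    by (auto simp: fun_eq_iff indicator_def hball_def)
  also have "\<dots> \<in> borel_measurable (borel \<Otimes>\<^sub>M borel)" by measurable
  finally have [measurable]: "(\<lambda>(x, y). indicator (hball x (2 * D)) y :: ennreal) \<in> borel_measurable (borel \<Otimes>\<^sub>M borel)" .
  show "(\<lambda>(x, y). ker x y) \<in> borel_measurable (borel \<Otimes>\<^sub>M borel)"
    unfolding ker_def by measurable
qed

lemma ker_sym: "x \<in> H3 \<Longrightarrow> y \<in> H3 \<Longrightarrow> ker x y = ker y x"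
  unfolding ker_def near_count_def by (simp add: hball_def hdist_commute mult.commute indicator_def)

sublocale K: sym_kernel hvol ker
proof (intro sym_kernel.intro sym_kernel_axioms.intro)
  show "sigma_finite_measure hvol" by (rule sigma_finite_hvol)
qed (use ker_measurable ker_sym in auto)

lemma bump_measurable [measurable]: "bump g \<in> borel_measurable hvol"
  unfolding bump_def by measurable

text \<open>The mean value property over the ball of radius \<open>2 * D\<close> around
  \<open>x\<close> gives \<open>f x\<close>. The mass removed is uniform on balls around orbit
  points, where the same property gives \<open>f (g 0)\<close>: exactly the absorbed
  contribution.\<close>

lemma kernel_balance:
  assumes f: "f \<in> borel_measurable hvol"
    and mean: "\<And>z r. z \<in> H3 \<Longrightarrow> (\<integral>\<^sup>+y. indicator (hball z r) y * f y \<partial>hvol) = emeasure hvol (hball 0 r) * f z"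
    and x: "x \<in> H3"
  shows "K.kop f x + (\<integral>\<^sup>+g. f (g 0) * bump g x \<partial>count_space \<Gamma>) = f x"
proof -
  let ?n = "\<lambda>y. ennreal (1 / vol2D) * (ennreal (1 / real overlap) * near_count x y)"
  have [measurable]: "near_count x \<in> borel_measurable hvol"
  proof -
    have "(\<lambda>y. (x, y)) \<in> borel \<rightarrow>\<^sub>M borel \<Otimes>\<^sub>M borel" by measurable
    from measurable_compose[OF this near_count_measurable] show ?thesis by (intro measurable_hvol1) simp
  qed
  note f[measurable]
  have [measurable]: "ker x \<in> borel_measurable hvol" using x by (intro K.k_section_measurable) simp
  have "(\<integral>\<^sup>+y. near_count x y * f y \<partial>hvol)
      = (\<integral>\<^sup>+y. \<integral>\<^sup>+g. indicator (hball (g 0) D) x * (indicator (hball (g 0) D) y * f y) \<partial>count_space \<Gamma> \<partial>hvol)"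
    unfolding near_count_def by (intro nn_integral_cong) (simp add: nn_integral_multc[symmetric] mult.assoc)
  also have "\<dots> = (\<integral>\<^sup>+g. \<integral>\<^sup>+y. indicator (hball (g 0) D) x * (indicator (hball (g 0) D) y * f y) \<partial>hvol \<partial>count_space \<Gamma>)"
    using countable_Gamma by (intro nn_integral_count_space_nn_integral) measurable
  also have "\<dots> = (\<integral>\<^sup>+g. indicator (hball (g 0) D) x * (ennreal volD * f (g 0)) \<partial>count_space \<Gamma>)"
  proof (rule nn_integral_cong)
    fix g assume "g \<in> space (count_space \<Gamma>)"
    then have "(\<integral>\<^sup>+y. indicator (hball (g 0) D) y * f y \<partial>hvol) = ennreal volD * f (g 0)"
      using mean[OF orbit_in_H3] vol(1) by simp
    moreover have "(\<lambda>y. indicator (hball (g 0) D) y * f y) \<in> borel_measurable hvol" by measurable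
    ultimately show "(\<integral>\<^sup>+y. indicator (hball (g 0) D) x * (indicator (hball (g 0) D) y * f y) \<partial>hvol)
        = indicator (hball (g 0) D) x * (ennreal volD * f (g 0))"
      by (simp add: nn_integral_cmult)
  qed
  finally have n: "(\<integral>\<^sup>+y. near_count x y * f y \<partial>hvol)
      = (\<integral>\<^sup>+g. indicator (hball (g 0) D) x * (ennreal volD * f (g 0)) \<partial>count_space \<Gamma>)" .
  have "(\<integral>\<^sup>+g. f (g 0) * bump g x \<partial>count_space \<Gamma>)
      = (\<integral>\<^sup>+g. ennreal (1 / vol2D) * (ennreal (1 / real overlap) * (indicator (hball (g 0) D) x * (ennreal volD * f (g 0)))) \<partial>count_space \<Gamma>)"
  proof (rule nn_integral_cong)
    fix g
    have "ennreal (volD / (real overlap * vol2D)) = ennreal (1 / vol2D) * (ennreal (1 / real overlap) * ennreal volD)"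
      using vol overlap_pos by (simp add: mult.commute flip: ennreal_mult)
    then show "f (g 0) * bump g x = ennreal (1 / vol2D) * (ennreal (1 / real overlap) * (indicator (hball (g 0) D) x * (ennreal volD * f (g 0))))"
      unfolding bump_def by (simp add: mult_ac)
  qed
  also have "\<dots> = (\<integral>\<^sup>+y. ?n y * f y \<partial>hvol)"
    using n by (simp add: nn_integral_cmult mult.assoc)
  finally have 1: "(\<integral>\<^sup>+g. f (g 0) * bump g x \<partial>count_space \<Gamma>) = (\<integral>\<^sup>+y. ?n y * f y \<partial>hvol)" .
  have "K.kop f x + (\<integral>\<^sup>+y. ?n y * f y \<partial>hvol) = (\<integral>\<^sup>+y. (ker x y + ?n y) * f y \<partial>hvol)"
    unfolding K.kop_def distrib_right by (rule nn_integral_add[symmetric]) measurable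
  also have "\<dots> = (\<integral>\<^sup>+y. ennreal (1 / vol2D) * (indicator (hball x (2 * D)) y * f y) \<partial>hvol)"
  proof (rule nn_integral_cong)
    fix y assume "y \<in> space hvol"
    then have y: "y \<in> H3" by simp
    show "(ker x y + ?n y) * f y = ennreal (1 / vol2D) * (indicator (hball x (2 * D)) y * f y)"
      unfolding ker_def distrib_left[symmetric] diff_add_cancel_ennreal[OF near_count_le[OF x y]] by (rule mult.assoc)
  qed
  also have "\<dots> = ennreal (1 / vol2D) * (ennreal vol2D * f x)"
    by (subst nn_integral_cmult) (measurable, simp add: mean x vol(3))
  also have "\<dots> = f x"
    using vol(4) by (simp add: mult.assoc[symmetric] flip: ennreal_mult)
  finally show ?thesis unfolding 1 .
qed

lemma kernel_balance_1: "x \<in> H3 \<Longrightarrow> K.kop (\<lambda>_. 1) x + (\<integral>\<^sup>+g. bump g x \<partial>count_space \<Gamma>) = 1"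
proof -
  assume x: "x \<in> H3"
  have "(\<integral>\<^sup>+y. indicator (hball z r) y * 1 \<partial>hvol) = emeasure hvol (hball 0 r) * 1" if "z \<in> H3" for z r
    using emeasure_hvol_hball[OF that, of r] by simp
  from kernel_balance[OF _ this x] show ?thesis by simp
qed

lemma kernel_balance_poisson:
  "x \<in> H3 \<Longrightarrow> \<xi> \<in> bdH3 \<Longrightarrow>
    K.kop (\<lambda>x. ennreal (poisson x \<xi>)) x + (\<integral>\<^sup>+g. ennreal (poisson (g 0) \<xi>) * bump g x \<partial>count_space \<Gamma>) = ennreal (poisson x \<xi>)"
  by (rule kernel_balance) (measurable, simp_all add: nn_integral_poisson_hball)

text \<open>Bound for the survival probability of one step: every point lies in at least one ball
  around an orbit point, and each such ball absorbs with the probability subtracted here.\<close>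

definition escape :: real where "escape = 1 - volD / (real overlap * vol2D)"

lemma nn_integral_bump_ge:
  assumes x: "x \<in> H3"
  shows "ennreal (volD / (real overlap * vol2D)) \<le> (\<integral>\<^sup>+g. bump g x \<partial>count_space \<Gamma>)"
proof -
  obtain g where g: "g \<in> \<Gamma>" "x \<in> hball (g 0) D" using orbit_dense[OF x] by blast
  have "bump g x \<le> (\<integral>\<^sup>+g. bump g x \<partial>count_space \<Gamma>)"
    using g(1) by (rule nn_integral_ge_point)
  then show ?thesis using g(2) by (simp add: bump_def)
qed

lemma escape_bounds: "0 \<le> escape" "escape < 1"
proof -
  have "ennreal (volD / (real overlap * vol2D)) \<le> (\<integral>\<^sup>+g. bump g 0 \<partial>count_space \<Gamma>)"
    by (rule nn_integral_bump_ge[OF zero_in_H3])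
  also have "\<dots> \<le> K.kop (\<lambda>_. 1) 0 + (\<integral>\<^sup>+g. bump g 0 \<partial>count_space \<Gamma>)" by simp
  also have "\<dots> = 1" by (rule kernel_balance_1[OF zero_in_H3])
  finally have "ennreal (volD / (real overlap * vol2D)) \<le> 1" .
  then show "0 \<le> escape" by (simp add: escape_def)
  show "escape < 1" using vol overlap_pos by (simp add: escape_def)
qed

lemma kop_1_le:
  assumes x: "x \<in> H3"
  shows "K.kop (\<lambda>_. 1) x \<le> ennreal escape"
proof -
  let ?p = "volD / (real overlap * vol2D)"
  have "K.kop (\<lambda>_. 1) x + ennreal ?p \<le> 1"
    using kernel_balance_1[OF x] nn_integral_bump_ge[OF x] by (metis add_left_mono)
  then have "K.kop (\<lambda>_. 1) x + ennreal ?p - ennreal ?p \<le> 1 - ennreal ?p"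
    by (rule ennreal_minus_mono) simp
  then show ?thesis
    using vol overlap_pos ennreal_minus[of ?p 1] by (simp add: escape_def)
qed

lemma kop_pow_1_le:
  assumes "x \<in> H3"
  shows "(K.kop ^^ n) (\<lambda>_. 1) x \<le> ennreal (escape ^ n)"
  using assms
proof (induction n arbitrary: x)
  case (Suc n)
  have "(K.kop ^^ Suc n) (\<lambda>_. 1) x \<le> K.kop (\<lambda>_. ennreal (escape ^ n) * 1) x"
    unfolding funpow.simps o_apply using Suc.IH by (intro K.kop_mono) simp
  also have "\<dots> = ennreal (escape ^ n) * K.kop (\<lambda>_. 1) x"
    using Suc.prems by (intro K.kop_cmult) auto
  also have "\<dots> \<le> ennreal (escape ^ n) * ennreal escape"
    using kop_1_le[OF Suc.prems] by (rule mult_left_mono) simp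
  also have "\<dots> = ennreal (escape ^ Suc n)"
    using escape_bounds by (simp add: mult.commute flip: ennreal_mult)
  finally show ?case .
qed simp

section \<open>The step distribution: mass, superharmonicity, symmetry and support\<close>

text \<open>The reciprocal of the integral of \<open>bump g\<close>, so that \<open>rate\<close>
  times \<open>bump g\<close> is the uniform probability density on the ball around
  \<open>g 0\<close>.\<close>

definition rate :: real where "rate = real overlap * vol2D / volD\<^sup>2"

lemma nn_integral_bump_mean:
  assumes g: "g \<in> \<Gamma>" and f: "f \<in> borel_measurable hvol"
    and mean: "(\<integral>\<^sup>+y. indicator (hball (g 0) D) y * f y \<partial>hvol) = emeasure hvol (hball 0 D) * f (g 0)"
  shows "ennreal rate * (\<integral>\<^sup>+x. bump g x * f x \<partial>hvol) = f (g 0)"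
proof -
  note f[measurable]
  have "(\<lambda>x. indicator (hball (g 0) D) x * f x) \<in> borel_measurable hvol" by measurable
  then have "(\<integral>\<^sup>+x. bump g x * f x \<partial>hvol) = ennreal (volD / (real overlap * vol2D)) * (ennreal volD * f (g 0))"
    unfolding bump_def mult.assoc by (simp add: nn_integral_cmult mean vol(1))
  then have "ennreal rate * (\<integral>\<^sup>+x. bump g x * f x \<partial>hvol)
      = ennreal (rate * (volD / (real overlap * vol2D)) * volD) * f (g 0)"
    (is "_ = ennreal (rate * ?p * volD) * _")
  proof -
    have "0 \<le> rate" "0 \<le> ?p" "0 \<le> volD" using vol overlap_pos by (simp_all add: rate_def)
    then have "ennreal (rate * ?p * volD) = ennreal rate * ennreal ?p * ennreal volD"
      by (simp only: ennreal_mult mult_nonneg_nonneg)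
    then show ?thesis using \<open>(\<integral>\<^sup>+x. bump g x * f x \<partial>hvol) = _\<close> by (simp only: mult.assoc)
  qed
  also have "rate * (volD / (real overlap * vol2D)) * volD = 1"
    using vol overlap_pos by (simp add: rate_def power2_eq_square)
  finally show ?thesis by simp
qed

lemma nn_integral_bump: "g \<in> \<Gamma> \<Longrightarrow> ennreal rate * (\<integral>\<^sup>+x. bump g x \<partial>hvol) = 1"
  using nn_integral_bump_mean[of g "\<lambda>_. 1"] emeasure_hvol_hball[OF orbit_in_H3, of g D] by simp

text \<open>The walk starts from a uniform point of the ball around 0 instead of 0 itself. Start and
  absorption are then governed by the same functions \<open>bump\<close>, and a mean value over the
  starting ball still evaluates harmonic functions at 0.\<close>

definition step :: "(real^3 \<Rightarrow> real^3) \<Rightarrow> ennreal" where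
  "step g = K.hit (ennreal rate) bump \<one>\<^bsub>Isom_H3\<^esub> g"

lemma nn_integral_step: "(\<integral>\<^sup>+g. step g \<partial>count_space \<Gamma>) = 1"
proof -
  have "(\<lambda>n. \<integral>\<^sup>+x. bump \<one>\<^bsub>Isom_H3\<^esub> x * (K.kop ^^ n) (\<lambda>_. 1) x \<partial>hvol) \<longlonglongrightarrow> 0"
  proof (rule tendsto_sandwich[OF _ _ tendsto_const])
    have fin: "(\<integral>\<^sup>+x. bump \<one>\<^bsub>Isom_H3\<^esub> x \<partial>hvol) \<noteq> \<infinity>"
      using nn_integral_bump[OF one_in] by (auto simp: ennreal_mult_top split: if_splits)
    show "\<forall>\<^sub>F n in sequentially. (\<integral>\<^sup>+x. bump \<one>\<^bsub>Isom_H3\<^esub> x * (K.kop ^^ n) (\<lambda>_. 1) x \<partial>hvol)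
       \<le> ennreal (escape ^ n) * (\<integral>\<^sup>+x. bump \<one>\<^bsub>Isom_H3\<^esub> x \<partial>hvol)"
    proof (rule always_eventually, rule allI)
      fix n
      have "(\<integral>\<^sup>+x. bump \<one>\<^bsub>Isom_H3\<^esub> x * (K.kop ^^ n) (\<lambda>_. 1) x \<partial>hvol)
         \<le> (\<integral>\<^sup>+x. ennreal (escape ^ n) * bump \<one>\<^bsub>Isom_H3\<^esub> x \<partial>hvol)"
        unfolding mult.commute[of "ennreal (escape ^ n)"]
        by (intro nn_integral_mono mult_left_mono kop_pow_1_le) auto
      then show "(\<integral>\<^sup>+x. bump \<one>\<^bsub>Isom_H3\<^esub> x * (K.kop ^^ n) (\<lambda>_. 1) x \<partial>hvol)
         \<le> ennreal (escape ^ n) * (\<integral>\<^sup>+x. bump \<one>\<^bsub>Isom_H3\<^esub> x \<partial>hvol)"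
        by (simp add: nn_integral_cmult)
    qed
    have "(\<lambda>n. ennreal (escape ^ n)) \<longlonglongrightarrow> ennreal 0"
      using escape_bounds by (intro tendsto_ennrealI LIMSEQ_power_zero) auto
    then have "(\<lambda>n. (\<integral>\<^sup>+x. bump \<one>\<^bsub>Isom_H3\<^esub> x \<partial>hvol) * ennreal (escape ^ n))
        \<longlonglongrightarrow> (\<integral>\<^sup>+x. bump \<one>\<^bsub>Isom_H3\<^esub> x \<partial>hvol) * ennreal 0"
      using fin by (intro ennreal_tendsto_cmult) (auto simp: less_top)
    then show "(\<lambda>n. ennreal (escape ^ n) * (\<integral>\<^sup>+x. bump \<one>\<^bsub>Isom_H3\<^esub> x \<partial>hvol)) \<longlonglongrightarrow> 0"
      by (simp add: mult.commute)
  qed simp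
  then have "(\<integral>\<^sup>+g. step g \<partial>count_space \<Gamma>) = ennreal rate * (\<integral>\<^sup>+x. bump \<one>\<^bsub>Isom_H3\<^esub> x \<partial>hvol)"
    unfolding step_def using kernel_balance_1
    by (intro K.hit_total countable_Gamma) auto
  then show ?thesis using nn_integral_bump[OF one_in] by simp
qed

lemma nn_integral_step_poisson:
  assumes xi: "\<xi> \<in> bdH3"
  shows "(\<integral>\<^sup>+g. step g * ennreal (poisson (g 0) \<xi>) \<partial>count_space \<Gamma>) \<le> 1"
proof -
  have "(\<integral>\<^sup>+g. step g * ennreal (poisson (g 0) \<xi>) \<partial>count_space \<Gamma>)
     \<le> ennreal rate * (\<integral>\<^sup>+x. bump \<one>\<^bsub>Isom_H3\<^esub> x * ennreal (poisson x \<xi>) \<partial>hvol)"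
    unfolding step_def using kernel_balance_poisson[OF _ xi]
    by (intro K.hit_superharmonic countable_Gamma) auto
  also have "\<dots> = ennreal (poisson (\<one>\<^bsub>Isom_H3\<^esub> 0) \<xi>)"
    using nn_integral_poisson_hball[OF orbit_in_H3[OF one_in] xi] one_in
    by (intro nn_integral_bump_mean) auto
  also have "\<dots> = 1" by (simp add: one_0 poisson_0 xi)
  finally show ?thesis .
qed

lemma bump_equivariant:
  assumes "g \<in> \<Gamma>" "h \<in> \<Gamma>" "x \<in> H3"
  shows "bump (g \<otimes>\<^bsub>Isom_H3\<^esub> h) (g x) = bump h x"
  unfolding bump_def Isom_H3_mult_apply[OF in_carrier[OF assms(1)] in_carrier[OF assms(2)] zero_in_H3]
  using hball_Isom[OF in_carrier[OF assms(1)] orbit_in_H3[OF assms(2)] assms(3)]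
  by (simp add: indicator_def)

lemma near_count_equivariant:
  assumes g: "g \<in> \<Gamma>" and x: "x \<in> H3" and y: "y \<in> H3"
  shows "near_count (g x) (g y) = near_count x y"
proof -
  have bij: "bij_betw (\<lambda>h. g \<otimes>\<^bsub>Isom_H3\<^esub> h) \<Gamma> \<Gamma>"
  proof (rule bij_betwI[where g = "\<lambda>h. inv\<^bsub>Isom_H3\<^esub> g \<otimes>\<^bsub>Isom_H3\<^esub> h"])
  qed (use g in_carrier mult_in inv_in in \<open>auto simp: I.m_assoc[symmetric]\<close>)
  have "near_count (g x) (g y) = (\<integral>\<^sup>+h. indicator (hball ((g \<otimes>\<^bsub>Isom_H3\<^esub> h) 0) D) (g x) *
      indicator (hball ((g \<otimes>\<^bsub>Isom_H3\<^esub> h) 0) D) (g y) \<partial>count_space \<Gamma>)"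
    unfolding near_count_def by (rule nn_integral_bij_count_space[OF bij, symmetric])
  also have "\<dots> = near_count x y"
    unfolding near_count_def
  proof (rule nn_integral_cong)
    fix h assume "h \<in> space (count_space \<Gamma>)"
    then have h: "h \<in> \<Gamma>" by simp
    show "indicator (hball ((g \<otimes>\<^bsub>Isom_H3\<^esub> h) 0) D) (g x) * indicator (hball ((g \<otimes>\<^bsub>Isom_H3\<^esub> h) 0) D) (g y)
      = (indicator (hball (h 0) D) x * indicator (hball (h 0) D) y :: ennreal)"
      unfolding Isom_H3_mult_apply[OF in_carrier[OF g] in_carrier[OF h] zero_in_H3]
      using hball_Isom[OF in_carrier[OF g] orbit_in_H3[OF h] x] hball_Isom[OF in_carrier[OF g] orbit_in_H3[OF h] y]
      by (simp add: indicator_def)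
  qed
  finally show ?thesis .
qed

lemma ker_equivariant:
  assumes g: "g \<in> \<Gamma>" and x: "x \<in> H3" and y: "y \<in> H3"
  shows "ker (g x) (g y) = ker x y"
  unfolding ker_def near_count_equivariant[OF assms]
  using hball_Isom[OF in_carrier[OF g] x y] by (simp add: indicator_def)

lemma step_inv:
  assumes g: "g \<in> \<Gamma>"
  shows "step (inv\<^bsub>Isom_H3\<^esub> g) = step g"
proof -
  have gc: "g \<in> carrier Isom_H3" using g by (rule in_carrier)
  have "step (inv\<^bsub>Isom_H3\<^esub> g) = K.hit (ennreal rate) bump (g \<otimes>\<^bsub>Isom_H3\<^esub> \<one>\<^bsub>Isom_H3\<^esub>) (g \<otimes>\<^bsub>Isom_H3\<^esub> inv\<^bsub>Isom_H3\<^esub> g)"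
    unfolding step_def
  proof (rule K.hit_equivariant[symmetric])
    show "g \<in> hvol \<rightarrow>\<^sub>M hvol" by (rule Isom_H3_measurable[OF gc])
  qed (use g one_in inv_in in \<open>auto simp: nn_integral_hvol_Isom[OF gc] ker_equivariant bump_equivariant\<close>)
  also have "\<dots> = K.hit (ennreal rate) bump g \<one>\<^bsub>Isom_H3\<^esub>" using gc by simp
  also have "\<dots> = step g" unfolding step_def by (rule K.hit_sym) auto
  finally show ?thesis .
qed

lemma step_pos:
  assumes g: "g \<in> \<Gamma>" and o: "hball 0 D \<inter> hball (g 0) D \<noteq> {}"
  shows "0 < step g"
proof -
  let ?p = "ennreal (volD / (real overlap * vol2D))"
  have "open (hball 0 D \<inter> hball (g 0) D)"
    using D_pos orbit_in_H3[OF g] by (intro open_Int open_hball) auto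
  then have "0 < emeasure hvol (hball 0 D \<inter> hball (g 0) D)"
    using o hball_subset_H3 by (intro emeasure_hvol_open_pos) auto
  moreover have "0 < ennreal rate" "0 < ?p" using vol overlap_pos by (auto simp: rate_def)
  ultimately have "0 < ennreal rate * (?p * ?p * emeasure hvol (hball 0 D \<inter> hball (g 0) D))"
    by (simp add: ennreal_zero_less_mult_iff)
  \<comment> \<open>Only the summand with no jump at all is used: the starting point may lie in both
    balls and be absorbed at \<open>g\<close> at once.\<close>
  also have "?p * ?p * emeasure hvol (hball 0 D \<inter> hball (g 0) D) = (\<integral>\<^sup>+x. bump \<one>\<^bsub>Isom_H3\<^esub> x * (K.kop ^^ 0) (bump g) x \<partial>hvol)"
    by (subst nn_integral_cmult_indicator[symmetric])
       (auto intro!: nn_integral_cong simp: bump_def one_0 indicator_def)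
  also have "ennreal rate * \<dots> \<le> step g" unfolding step_def by (intro K.hit_ge) auto
  finally show ?thesis .
qed

end

section \<open>Finite second moment of homomorphisms to the integers\<close>

text \<open>With \<open>s = sqrt q\<close>, one factor \<open>s ^ n\<close> makes one factor
  \<open>Suc n\<close> bounded and the other makes the remaining series converge.\<close>

lemma summable_square_geometric:
  fixes q :: real
  assumes "0 \<le> q" "q < 1"
  shows "summable (\<lambda>n. (real (Suc n))\<^sup>2 * q ^ n)"
proof -
  define s where "s = sqrt q"
  have s: "0 \<le> s" "s < 1" using assms by (auto simp: s_def)
  have sm: "summable (\<lambda>n. real (Suc n) * s ^ n)"
    using geometric_deriv_sums[of s] s by (auto simp: sums_iff)
  then have "Bseq (\<lambda>n. real (Suc n) * s ^ n)"
    by (intro convergent_imp_Bseq) (auto simp: convergent_def dest: summable_LIMSEQ_zero)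
  then obtain K where K: "\<And>n. norm (real (Suc n) * s ^ n) \<le> K" by (rule BseqE) blast
  show ?thesis
  proof (rule summable_comparison_test')
    show "summable (\<lambda>n. K * (real (Suc n) * s ^ n))" using sm by (rule summable_mult)
    fix n
    have "q ^ n = s ^ n * s ^ n" using assms by (simp add: s_def flip: power_mult_distrib)
    then have "norm ((real (Suc n))\<^sup>2 * q ^ n) = norm (real (Suc n) * s ^ n) * (real (Suc n) * s ^ n)"
      using s by (simp add: power2_eq_square)
    also have "\<dots> \<le> K * (real (Suc n) * s ^ n)"
      using K[of n] s by (intro mult_right_mono) auto
    finally show "norm ((real (Suc n))\<^sup>2 * q ^ n) \<le> K * (real (Suc n) * s ^ n)" .
  qed
qed

context cocompact_action
begin

lemma hom_inv_mult:
  fixes \<phi> :: "_ \<Rightarrow> int"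
  assumes hom: "\<forall>g\<in>\<Gamma>. \<forall>h\<in>\<Gamma>. \<phi> (g \<otimes>\<^bsub>Isom_H3\<^esub> h) = \<phi> g + \<phi> h"
    and g: "g \<in> \<Gamma>" and h: "h \<in> \<Gamma>"
  shows "\<phi> (inv\<^bsub>Isom_H3\<^esub> g \<otimes>\<^bsub>Isom_H3\<^esub> h) = \<phi> h - \<phi> g" "\<phi> \<one>\<^bsub>Isom_H3\<^esub> = 0"
    "\<phi> (inv\<^bsub>Isom_H3\<^esub> g) = - \<phi> g"
proof -
  show 1: "\<phi> \<one>\<^bsub>Isom_H3\<^esub> = 0" using hom[rule_format, OF one_in one_in] by simp
  show 2: "\<phi> (inv\<^bsub>Isom_H3\<^esub> g) = - \<phi> g"
    using hom[rule_format, OF g inv_in[OF g]] 1 in_carrier[OF g] by simp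
  show "\<phi> (inv\<^bsub>Isom_H3\<^esub> g \<otimes>\<^bsub>Isom_H3\<^esub> h) = \<phi> h - \<phi> g"
    using hom[rule_format, OF inv_in[OF g] h] 2 by simp
qed

text \<open>A jump is shorter than \<open>2 * D\<close> and both its ends are within
  \<open>D\<close> of orbit points, so those orbit points are less than \<open>4 * D\<close> apart
  and \<open>\<phi>\<close> changes by at most \<open>C\<close>. The extra 1 in \<open>Suc n\<close>
  accounts for the absorption.\<close>

lemma kop_pow_bump_spread:
  fixes \<phi> :: "_ \<Rightarrow> int"
  assumes hom: "\<forall>g\<in>\<Gamma>. \<forall>h\<in>\<Gamma>. \<phi> (g \<otimes>\<^bsub>Isom_H3\<^esub> h) = \<phi> g + \<phi> h"
    and C: "\<forall>g\<in>\<Gamma>. hdist 0 (g 0) < 4 * D \<longrightarrow> \<bar>real_of_int (\<phi> g)\<bar> \<le> C"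
    and g: "g \<in> \<Gamma>" and h: "h \<in> \<Gamma>" and x: "x \<in> hball (h 0) D"
    and nz: "(K.kop ^^ n) (bump g) x \<noteq> 0"
  shows "\<bar>real_of_int (\<phi> g - \<phi> h)\<bar> \<le> C * real (Suc n)"
  using h x nz
proof (induction n arbitrary: h x)
  case 0
  then have xg: "x \<in> hball (g 0) D" by (auto simp: bump_def indicator_def split: if_splits)
  then have "hdist (h 0) (g 0) < 4 * D"
    using hball_overlap[OF orbit_in_H3[OF 0(1)] orbit_in_H3[OF g] 0(2) xg] D_pos by linarith
  then show ?case
    using C[rule_format, OF mult_in[OF inv_in[OF 0(1)] g]] hom_inv_mult(1)[OF hom 0(1) g]
      Isom_H3_inv_mult_0(2)[OF in_carrier[OF 0(1)] in_carrier[OF g]] by simp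
next
  case (Suc n)
  have xH: "x \<in> H3" using Suc.prems(2) by (simp add: hball_def)
  have "\<exists>y\<in>H3. ker x y * (K.kop ^^ n) (bump g) y \<noteq> 0"
  proof (rule ccontr)
    assume "\<not> ?thesis"
    then have "(K.kop ^^ Suc n) (bump g) x = (\<integral>\<^sup>+y. 0 \<partial>hvol)"
      unfolding funpow.simps o_apply K.kop_def[of "(K.kop ^^ n) (bump g)"] by (intro nn_integral_cong) auto
    with Suc.prems show False by simp
  qed
  then obtain y where y: "y \<in> H3" "ker x y \<noteq> 0" "(K.kop ^^ n) (bump g) y \<noteq> 0" by auto
  have xy: "hdist x y < 2 * D"
  proof (rule ccontr)
    assume "\<not> ?thesis"
    then have "ker x y = 0" by (simp add: ker_def hball_def)
    with y show False by simp
  qed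
  obtain h' where h': "h' \<in> \<Gamma>" "y \<in> hball (h' 0) D" using orbit_dense[OF y(1)] by blast
  have "hdist (h 0) (h' 0) \<le> hdist (h 0) x + hdist x (h' 0)"
    using orbit_in_H3 Suc.prems(1) h' xH by (intro hdist_triangle) auto
  also have "hdist x (h' 0) \<le> hdist x y + hdist y (h' 0)"
    using orbit_in_H3 h' xH y by (intro hdist_triangle) auto
  finally have "hdist (h 0) (h' 0) < 4 * D"
    using xy Suc.prems(2) h'(2) by (simp add: hball_def hdist_commute)
  then have "\<bar>real_of_int (\<phi> h' - \<phi> h)\<bar> \<le> C"
    using C[rule_format, OF mult_in[OF inv_in[OF Suc.prems(1)] h'(1)]] hom_inv_mult(1)[OF hom Suc.prems(1) h'(1)]
      Isom_H3_inv_mult_0(2)[OF in_carrier[OF Suc.prems(1)] in_carrier[OF h'(1)]] by simp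
  moreover have "\<bar>real_of_int (\<phi> g - \<phi> h')\<bar> \<le> C * real (Suc n)"
    using h' y(3) by (intro Suc.IH)
  ultimately show ?case by (simp add: algebra_simps)
qed

text \<open>Absorption after \<open>n\<close> jumps is exponentially unlikely, whereas
  \<open>\<phi>\<close> grows at most linearly in \<open>n\<close>.\<close>

lemma nn_integral_step_square:
  fixes \<phi> :: "_ \<Rightarrow> int"
  assumes hom: "\<forall>g\<in>\<Gamma>. \<forall>h\<in>\<Gamma>. \<phi> (g \<otimes>\<^bsub>Isom_H3\<^esub> h) = \<phi> g + \<phi> h"
  shows "(\<integral>\<^sup>+g. step g * ennreal ((real_of_int (\<phi> g))\<^sup>2) \<partial>count_space \<Gamma>) < \<infinity>"
proof -
  let ?H = "\<lambda>g. ennreal ((real_of_int (\<phi> g))\<^sup>2)"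
  \<comment> \<open>A maximum over a finite set, since only finitely many elements move 0 by less
    than \<open>4 * D\<close>.\<close>
  define C where "C = Max ((\<lambda>g. \<bar>real_of_int (\<phi> g)\<bar>) ` {g \<in> \<Gamma>. hdist 0 (g 0) < 4 * D})"
  have C: "\<forall>g\<in>\<Gamma>. hdist 0 (g 0) < 4 * D \<longrightarrow> \<bar>real_of_int (\<phi> g)\<bar> \<le> C"
    unfolding C_def using finite_orbit by (intro ballI impI Max_ge) auto
  define c where "c n = (C * real (Suc n))\<^sup>2" for n
  have bound: "(\<integral>\<^sup>+x. bump \<one>\<^bsub>Isom_H3\<^esub> x * (K.kop ^^ n) (\<lambda>x. \<integral>\<^sup>+h. ?H h * bump h x \<partial>count_space \<Gamma>) x \<partial>hvol)
      \<le> ennreal (c n * escape ^ n) * (\<integral>\<^sup>+x. bump \<one>\<^bsub>Isom_H3\<^esub> x \<partial>hvol)" for n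
  proof -
    have "(\<integral>\<^sup>+x. bump \<one>\<^bsub>Isom_H3\<^esub> x * (K.kop ^^ n) (\<lambda>x. \<integral>\<^sup>+h. ?H h * bump h x \<partial>count_space \<Gamma>) x \<partial>hvol)
       \<le> (\<integral>\<^sup>+x. ennreal (c n * escape ^ n) * bump \<one>\<^bsub>Isom_H3\<^esub> x \<partial>hvol)"
    proof (rule nn_integral_mono)
      fix x assume "x \<in> space hvol"
      then have x: "x \<in> H3" by simp
      show "bump \<one>\<^bsub>Isom_H3\<^esub> x * (K.kop ^^ n) (\<lambda>x. \<integral>\<^sup>+h. ?H h * bump h x \<partial>count_space \<Gamma>) x
         \<le> ennreal (c n * escape ^ n) * bump \<one>\<^bsub>Isom_H3\<^esub> x"
      proof (cases "x \<in> hball (\<one>\<^bsub>Isom_H3\<^esub> 0) D")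
        case True
        have "(K.kop ^^ n) (\<lambda>x. \<integral>\<^sup>+h. ?H h * bump h x \<partial>count_space \<Gamma>) x
            = (\<integral>\<^sup>+h. (K.kop ^^ n) (\<lambda>x. ?H h * bump h x) x \<partial>count_space \<Gamma>)"
          using x by (intro K.kop_pow_count_space countable_Gamma) auto
        also have "\<dots> = (\<integral>\<^sup>+h. ?H h * (K.kop ^^ n) (bump h) x \<partial>count_space \<Gamma>)"
          using x by (intro nn_integral_cong K.kop_pow_cmult) auto
        also have "\<dots> \<le> (\<integral>\<^sup>+h. ennreal (c n) * (K.kop ^^ n) (bump h) x \<partial>count_space \<Gamma>)"
        proof (rule nn_integral_mono)
          fix h assume "h \<in> space (count_space \<Gamma>)"
          then have h: "h \<in> \<Gamma>" by simp
          show "?H h * (K.kop ^^ n) (bump h) x \<le> ennreal (c n) * (K.kop ^^ n) (bump h) x"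
          proof (cases "(K.kop ^^ n) (bump h) x = 0")
            case False
            have "\<bar>real_of_int (\<phi> h - \<phi> \<one>\<^bsub>Isom_H3\<^esub>)\<bar> \<le> C * real (Suc n)"
              using hom C h one_in True False by (rule kop_pow_bump_spread)
            then have "\<bar>real_of_int (\<phi> h)\<bar>\<^sup>2 \<le> c n"
              unfolding c_def using hom_inv_mult(2)[OF hom h h] by (intro power_mono) auto
            then show ?thesis by (intro mult_right_mono ennreal_leI) auto
          qed simp
        qed
        also have "\<dots> = ennreal (c n) * (K.kop ^^ n) (\<lambda>x. \<integral>\<^sup>+h. bump h x \<partial>count_space \<Gamma>) x"
          using x by (subst K.kop_pow_count_space[OF countable_Gamma]) (auto simp: nn_integral_cmult)
        also have "\<dots> \<le> ennreal (c n) * (K.kop ^^ n) (\<lambda>_. 1) x"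
        proof (intro mult_left_mono K.kop_pow_mono)
          fix y assume "y \<in> space hvol"
          then have "(\<integral>\<^sup>+h. bump h y \<partial>count_space \<Gamma>) \<le> K.kop (\<lambda>_. 1) y + (\<integral>\<^sup>+h. bump h y \<partial>count_space \<Gamma>)" by simp
          also have "\<dots> = 1" using \<open>y \<in> space hvol\<close> by (intro kernel_balance_1) simp
          finally show "(\<integral>\<^sup>+h. bump h y \<partial>count_space \<Gamma>) \<le> 1" .
        qed (use x in auto)
        also have "\<dots> \<le> ennreal (c n) * ennreal (escape ^ n)"
          using kop_pow_1_le[OF x] by (rule mult_left_mono) simp
        also have "\<dots> = ennreal (c n * escape ^ n)"
          using escape_bounds by (intro ennreal_mult[symmetric]) (auto simp: c_def)
        finally show ?thesis by (subst mult.commute) (rule mult_right_mono, simp_all)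
      qed (simp add: bump_def)
    qed
    then show ?thesis by (simp add: nn_integral_cmult)
  qed
  have "summable (\<lambda>n. C\<^sup>2 * ((real (Suc n))\<^sup>2 * escape ^ n))"
    using escape_bounds by (intro summable_mult summable_square_geometric)
  then have sm: "summable (\<lambda>n. c n * escape ^ n)"
    by (simp add: c_def power_mult_distrib mult.assoc)
  let ?E = "\<integral>\<^sup>+x. bump \<one>\<^bsub>Isom_H3\<^esub> x \<partial>hvol"
  have "(\<integral>\<^sup>+g. step g * ?H g \<partial>count_space \<Gamma>) = ennreal rate *
     (\<Sum>n. \<integral>\<^sup>+x. bump \<one>\<^bsub>Isom_H3\<^esub> x * (K.kop ^^ n) (\<lambda>x. \<integral>\<^sup>+h. ?H h * bump h x \<partial>count_space \<Gamma>) x \<partial>hvol)"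
    unfolding step_def by (intro K.nn_integral_hit countable_Gamma) auto
  also have "\<dots> \<le> ennreal rate * (\<Sum>n. ennreal (c n * escape ^ n) * ?E)"
    using bound by (intro mult_left_mono suminf_le) auto
  also have "\<dots> = (\<Sum>n. ennreal (c n * escape ^ n)) * (ennreal rate * ?E)"
    by (simp add: mult_ac)
  also have "\<dots> = (\<Sum>n. ennreal (c n * escape ^ n))"
    using nn_integral_bump[OF one_in] by simp
  also have "\<dots> = ennreal (\<Sum>n. c n * escape ^ n)"
    using escape_bounds sm by (intro suminf_ennreal2) (auto simp: c_def)
  also have "\<dots> < \<infinity>" by simp
  finally show ?thesis .
qed

definition step_pmf :: "(real^3 \<Rightarrow> real^3) pmf" where
  "step_pmf = embed_pmf (\<lambda>g. if g \<in> \<Gamma> then enn2real (step g) else 0)"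

lemma ennreal_step: "g \<in> \<Gamma> \<Longrightarrow> ennreal (enn2real (step g)) = step g"
proof -
  assume "g \<in> \<Gamma>"
  then have "step g \<le> (\<integral>\<^sup>+g. step g \<partial>count_space \<Gamma>)" by (rule nn_integral_ge_point)
  then have "step g < \<infinity>" unfolding nn_integral_step using ennreal_one_less_top order_le_less_trans by (metis infinity_ennreal_def)
  then show ?thesis by simp
qed

lemma pmf_step_pmf: "pmf step_pmf g = (if g \<in> \<Gamma> then enn2real (step g) else 0)"
  unfolding step_pmf_def
proof (rule pmf_embed_pmf)
  have "(\<integral>\<^sup>+g. ennreal (if g \<in> \<Gamma> then enn2real (step g) else 0) \<partial>count_space UNIV) = (\<integral>\<^sup>+g. step g \<partial>count_space \<Gamma>)"
    unfolding nn_integral_count_space_indicator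
    by (subst (2) nn_integral_count_space_indicator) (auto intro!: nn_integral_cong simp: ennreal_step indicator_def)
  then show "(\<integral>\<^sup>+g. ennreal (if g \<in> \<Gamma> then enn2real (step g) else 0) \<partial>count_space UNIV) = 1"
    by (simp add: nn_integral_step)
qed simp

lemma set_step_pmf: "set_pmf step_pmf \<subseteq> \<Gamma>"
  by (auto simp: set_pmf_iff pmf_step_pmf split: if_splits)

lemma nn_integral_step_pmf: "(\<integral>\<^sup>+g. f g \<partial>step_pmf) = (\<integral>\<^sup>+g. step g * f g \<partial>count_space \<Gamma>)"
  unfolding nn_integral_measure_pmf
  by (subst (2) nn_integral_count_space_indicator)
     (auto intro!: nn_integral_cong simp: pmf_step_pmf ennreal_step indicator_def)

lemma pmf_step_pmf_inv: "g \<in> \<Gamma> \<Longrightarrow> pmf step_pmf (inv\<^bsub>Isom_H3\<^esub> g) = pmf step_pmf g"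
  by (simp add: pmf_step_pmf step_inv inv_in)

lemma generate_step_pmf: "generate Isom_H3 (set_pmf step_pmf) = \<Gamma>"
proof
  show "generate Isom_H3 (set_pmf step_pmf) \<subseteq> \<Gamma>"
    using subgroup_Gamma set_step_pmf by (intro I.generate_subgroup_incl)
  have "{g \<in> \<Gamma>. hball 0 D \<inter> hball (g 0) D \<noteq> {}} \<subseteq> set_pmf step_pmf"
  proof
    fix g assume g: "g \<in> {g \<in> \<Gamma>. hball 0 D \<inter> hball (g 0) D \<noteq> {}}"
    then have "0 < step g" by (intro step_pos) auto
    then have "0 < ennreal (pmf step_pmf g)" using g by (simp add: pmf_step_pmf ennreal_step)
    then show "g \<in> set_pmf step_pmf" by (simp add: set_pmf_iff)
  qed
  from I.mono_generate[OF this] show "\<Gamma> \<subseteq> generate Isom_H3 (set_pmf step_pmf)"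
    unfolding generate_near .
qed

end

section \<open>From a discrete cocompact group to the conditions of
  \<open>cocompact_action\<close>\<close>

lemma hball_subset_ball:
  assumes x: "x \<in> H3" and e: "0 < e"
  obtains r where "0 < r" "hball x r \<subseteq> ball x e"
proof
  \<comment> \<open>The radius for which membership in the ball means
    \<open>hdefect x y < e\<^sup>2\<close>. As the denominator of \<open>hdefect\<close> is at most
    1 on \<open>H3\<close>, the Euclidean distance is then below \<open>e\<close>.\<close>
  show r: "0 < arcosh (1 + 2 * e\<^sup>2)" using e by simp
  show "hball x (arcosh (1 + 2 * e\<^sup>2)) \<subseteq> ball x e"
  proof
    fix y assume "y \<in> hball x (arcosh (1 + 2 * e\<^sup>2))"
    then have y: "y \<in> H3" "hdefect x y < e\<^sup>2" using x r by (auto simp: hball_alt)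
    have p: "0 < (1 - (norm x)\<^sup>2) * (1 - (norm y)\<^sup>2)" "(1 - (norm x)\<^sup>2) * (1 - (norm y)\<^sup>2) \<le> 1"
      using one_minus_norm_pos[OF x] one_minus_norm_pos[OF y(1)] by (auto intro: mult_le_one)
    have "(norm (x - y))\<^sup>2 = hdefect x y * ((1 - (norm x)\<^sup>2) * (1 - (norm y)\<^sup>2))"
      using nonzero_mult_div_cancel_right[OF less_imp_neq[OF p(1), symmetric]]
      by (simp only: hdefect_def times_divide_eq_left)
    also have "\<dots> \<le> hdefect x y * 1"
      using p hdefect_nonneg[OF x y(1)] by (intro mult_left_mono) auto
    finally have "(norm (x - y))\<^sup>2 < e\<^sup>2" using y(2) by simp
    then show "y \<in> ball x e" using e by (simp add: dist_norm power_less_imp_less_base)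
  qed
qed

lemma hball_0_totally_bounded:
  assumes "0 < r" "0 < e"
  obtains Z where "finite Z" "Z \<subseteq> H3" "hball 0 r \<subseteq> (\<Union>z\<in>Z. hball z e)"
proof -
  define c where "c = 2 / (1 + cosh r)"
  have c: "0 < c" unfolding c_def by (intro divide_pos_pos add_pos_pos) auto
  define K where "K = cball (0::real^3) (sqrt (1 - c))"
  have "K \<subseteq> H3"
  proof
    fix y assume "y \<in> K"
    then have "norm y \<le> sqrt (1 - c)" by (simp add: K_def)
    also have "\<dots> < 1" using c real_sqrt_less_mono[of "1 - c" 1] by simp
    finally show "y \<in> H3" by (simp add: H3_norm)
  qed
  have sub: "hball 0 r \<subseteq> K"
  proof
    fix y assume "y \<in> hball 0 r"
    then have "c < 1 - (norm y)\<^sup>2" using norm_less_of_hball_0[OF _ assms(1), of y] by (simp add: c_def)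
    then have "(norm y)\<^sup>2 \<le> 1 - c" by simp
    then show "y \<in> K" by (simp add: K_def real_le_rsqrt)
  qed
  have "compact K" by (simp add: K_def)
  moreover have "open (hball z e)" if "z \<in> K" for z
    using that \<open>K \<subseteq> H3\<close> assms by (intro open_hball) auto
  moreover have "K \<subseteq> (\<Union>z\<in>K. hball z e)"
    using \<open>K \<subseteq> H3\<close> center_in_hball assms(2) by blast
  ultimately obtain Z where "Z \<subseteq> K" "finite Z" "K \<subseteq> (\<Union>z\<in>Z. hball z e)"
    by (rule compactE_image)
  with \<open>K \<subseteq> H3\<close> sub that[of Z] show ?thesis by blast
qed

text \<open>A neighbourhood of the identity for pointwise convergence restricts only finitely many
  coordinates. These form \<open>F\<close>, and \<open>e\<close> is the least radius allowed at
  them.\<close>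

lemma discrete_isometry_group_isolated:
  assumes "discrete_isometry_group \<Gamma>"
  obtains F e where "finite F" "F \<subseteq> H3" "0 < e"
    "\<And>g. g \<in> \<Gamma> \<Longrightarrow> (\<And>x. x \<in> F \<Longrightarrow> g x \<in> hball x e) \<Longrightarrow> g = \<one>\<^bsub>Isom_H3\<^esub>"
proof -
  have sg: "subgroup \<Gamma> Isom_H3"
    and disc: "subtopology (product_topology (\<lambda>_. top_of_set H3) H3) \<Gamma> = discrete_topology \<Gamma>"
    using assms by (auto simp: discrete_isometry_group_def)
  have one: "\<one>\<^bsub>Isom_H3\<^esub> \<in> \<Gamma>" using sg by (rule subgroup.one_closed)
  then have "openin (subtopology (product_topology (\<lambda>_. top_of_set H3) H3) \<Gamma>) {\<one>\<^bsub>Isom_H3\<^esub>}"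
    unfolding disc by simp
  then obtain W where W: "openin (product_topology (\<lambda>_. top_of_set H3) H3) W" "W \<inter> \<Gamma> = {\<one>\<^bsub>Isom_H3\<^esub>}"
    by (auto simp: openin_subtopology)
  then have "\<one>\<^bsub>Isom_H3\<^esub> \<in> W" by blast
  with W(1) obtain U where U: "finite {i \<in> H3. U i \<noteq> H3}" "\<forall>i\<in>H3. openin (top_of_set H3) (U i)"
    "\<one>\<^bsub>Isom_H3\<^esub> \<in> Pi\<^sub>E H3 U" "Pi\<^sub>E H3 U \<subseteq> W"
    unfolding openin_product_topology_alt by (auto simp: topspace_subtopology)
  define F where "F = {i \<in> H3. U i \<noteq> H3}"
  have "\<exists>r>0. hball x r \<subseteq> U x" if x: "x \<in> H3" for x
  proof -
    have "x \<in> U x" using PiE_mem[OF U(3) x] Isom_H3_one_apply[OF x] by simp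
    moreover have "open (U x)" using U(2) x by (auto simp: H3_def openin_open_eq)
    ultimately obtain e where e: "0 < e" "ball x e \<subseteq> U x" using openE by blast
    obtain r where "0 < r" "hball x r \<subseteq> ball x e" using hball_subset_ball[OF x e(1)] by blast
    with e show ?thesis by blast
  qed
  then obtain r where r: "\<And>x. x \<in> H3 \<Longrightarrow> 0 < r x \<and> hball x (r x) \<subseteq> U x" by metis
  define e where "e = Min (insert 1 (r ` F))"
  have F: "finite F" "F \<subseteq> H3" using U(1) by (auto simp: F_def)
  show ?thesis
  proof
    show "finite F" "F \<subseteq> H3" by (rule F)+
    show "0 < e" using F r unfolding e_def by (subst Min_gr_iff) auto
    fix g assume g: "g \<in> \<Gamma>" and gF: "\<And>x. x \<in> F \<Longrightarrow> g x \<in> hball x e"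
    have gc: "g \<in> carrier Isom_H3" using subgroup.mem_carrier[OF sg g] .
    have "g \<in> Pi\<^sub>E H3 U"
    proof (rule PiE_I)
      fix x assume x: "x \<in> H3"
      show "g x \<in> U x"
      proof (cases "x \<in> F")
        case True
        then have "e \<le> r x" unfolding e_def using F by (intro Min_le) auto
        with gF[OF True] have "g x \<in> hball x (r x)" by (simp add: hball_def)
        with r[OF x] show ?thesis by blast
      next
        case False
        with x have "U x = H3" by (simp add: F_def)
        then show ?thesis using Isom_H3_in_H3[OF gc x] by simp
      qed
    next
      fix x assume "x \<notin> H3"
      then show "g x = undefined" using gc by (auto simp: carrier_Isom_H3 Bij_def extensional_def)
    qed
    then have "g \<in> W \<inter> \<Gamma>" using U(4) g by blast
    with W(2) show "g = \<one>\<^bsub>Isom_H3\<^esub>" by blast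
  qed
qed

text \<open>Pigeonhole. Elements of bounded displacement send the finite set \<open>F\<close> into
  one ball, covered by finitely many balls of radius \<open>e / 2\<close>. Two elements choosing the
  same small ball for every point of \<open>F\<close> differ by an element that is
  \<open>e\<close>-close to the identity on \<open>F\<close>.\<close>

lemma discrete_isometry_group_finite:
  assumes "discrete_isometry_group \<Gamma>"
  shows "finite {g \<in> \<Gamma>. hdist 0 (g 0) < r}"
proof -
  interpret I: group Isom_H3 by (rule group_Isom_H3)
  have sg: "subgroup \<Gamma> Isom_H3" using assms by (simp add: discrete_isometry_group_def)
  have gc: "g \<in> carrier Isom_H3" if "g \<in> \<Gamma>" for g using subgroup.mem_carrier[OF sg that] .
  obtain F e where F: "finite F" "F \<subseteq> H3" "0 < e"
    "\<And>g. g \<in> \<Gamma> \<Longrightarrow> (\<And>x. x \<in> F \<Longrightarrow> g x \<in> hball x e) \<Longrightarrow> g = \<one>\<^bsub>Isom_H3\<^esub>"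
    using discrete_isometry_group_isolated[OF assms] by metis
  \<comment> \<open>Large enough for the images of all points of \<open>F\<close>; the absolute
    value of \<open>r\<close> and the inserted 1 keep it positive.\<close>
  define R where "R = Max (insert 1 ((\<lambda>x. \<bar>r\<bar> + hdist 0 x) ` F))"
  have R: "0 < R" "x \<in> F \<Longrightarrow> r + hdist 0 x \<le> R" for x
  proof -
    show "0 < R" using F(1) unfolding R_def by (subst Max_gr_iff) auto
    assume "x \<in> F"
    then have "\<bar>r\<bar> + hdist 0 x \<le> R" unfolding R_def using F(1) by (intro Max_ge) auto
    then show "r + hdist 0 x \<le> R" by simp
  qed
  obtain Z where Z: "finite Z" "Z \<subseteq> H3" "hball 0 R \<subseteq> (\<Union>z\<in>Z. hball z (e / 2))"
    using hball_0_totally_bounded[OF R(1), of "e / 2"] F(3) by auto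
  have "\<exists>z\<in>Z. g x \<in> hball z (e / 2)" if g: "g \<in> \<Gamma>" "hdist 0 (g 0) < r" and x: "x \<in> F" for g x
  proof -
    have xH: "x \<in> H3" using x F(2) by blast
    have "hdist 0 (g x) \<le> hdist 0 (g 0) + hdist (g 0) (g x)"
      using gc[OF g(1)] xH Isom_H3_in_H3 by (intro hdist_triangle) auto
    also have "hdist (g 0) (g x) = hdist 0 x" by (rule Isom_H3_hdist[OF gc[OF g(1)] zero_in_H3 xH])
    finally have "hdist 0 (g x) < R" using g(2) R(2)[OF x] by simp
    then have "g x \<in> hball 0 R" using Isom_H3_in_H3[OF gc[OF g(1)] xH] by (simp add: hball_def)
    then show ?thesis using Z(3) by blast
  qed
  then obtain c where c: "\<And>g x. g \<in> \<Gamma> \<Longrightarrow> hdist 0 (g 0) < r \<Longrightarrow> x \<in> F \<Longrightarrow> c g x \<in> Z \<and> g x \<in> hball (c g x) (e / 2)"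
    by metis
  let ?S = "{g \<in> \<Gamma>. hdist 0 (g 0) < r}"
  have "inj_on (\<lambda>g. restrict (c g) F) ?S"
  proof (rule inj_onI)
    fix g h assume g: "g \<in> ?S" and h: "h \<in> ?S" and eq: "restrict (c g) F = restrict (c h) F"
    let ?i = "inv\<^bsub>Isom_H3\<^esub> g"
    have gG: "g \<in> carrier Isom_H3" and hG: "h \<in> carrier Isom_H3" using g h gc by auto
    have "?i \<otimes>\<^bsub>Isom_H3\<^esub> h = \<one>\<^bsub>Isom_H3\<^esub>"
    proof (rule F(4))
      show "?i \<otimes>\<^bsub>Isom_H3\<^esub> h \<in> \<Gamma>"
        using g h subgroup.m_closed[OF sg] subgroup.m_inv_closed[OF sg] by auto
      fix x assume x: "x \<in> F"
      then have xH: "x \<in> H3" using F(2) by blast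
      have "c g x = c h x" using fun_cong[OF eq, of x] x by simp
      then have "g x \<in> hball (c g x) (e / 2)" "h x \<in> hball (c g x) (e / 2)" "c g x \<in> H3"
        using c[of g x] c[of h x] g h x Z(2) by auto
      then have "hdist (g x) (h x) < e"
        using hdist_triangle[of "g x" "c g x" "h x"] by (auto simp: hball_def hdist_commute)
      then have "h x \<in> hball (g x) e" using Isom_H3_in_H3[OF hG xH] by (simp add: hball_def)
      then have "?i (h x) \<in> hball (?i (g x)) e"
        using hball_Isom[OF I.inv_closed[OF gG] Isom_H3_in_H3[OF gG xH] Isom_H3_in_H3[OF hG xH]] by simp
      then show "(?i \<otimes>\<^bsub>Isom_H3\<^esub> h) x \<in> hball x e"
        unfolding Isom_H3_inv_apply(1)[OF gG xH] Isom_H3_mult_apply[OF I.inv_closed[OF gG] hG xH] .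
    qed
    then show "g = h" using gG hG by (metis I.inv_closed I.inv_equality I.inv_inv)
  qed
  moreover have "(\<lambda>g. restrict (c g) F) ` ?S \<subseteq> F \<rightarrow>\<^sub>E Z" using c by auto
  moreover have "finite (F \<rightarrow>\<^sub>E Z)" using F(1) Z(1) by (intro finite_PiE) auto
  ultimately show ?thesis by (rule inj_on_finite)
qed

text \<open>The images of the balls around 0 of integer radius are open in the quotient and cover
  it; compactness bounds the radius that is required.\<close>

lemma cocompact_lattice_action:
  assumes "cocompact_lattice \<Gamma>"
  obtains D where "cocompact_action \<Gamma> D"
proof -
  interpret I: group Isom_H3 by (rule group_Isom_H3)
  have disc: "discrete_isometry_group \<Gamma>" and comp: "compact_space (quotient_space \<Gamma>)"
    using assms by (auto simp: cocompact_lattice_def)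
  have sg: "subgroup \<Gamma> Isom_H3" using disc by (simp add: discrete_isometry_group_def)
  have gc: "g \<in> carrier Isom_H3" if "g \<in> \<Gamma>" for g using subgroup.mem_carrier[OF sg that] .
  define U where "U n = orbit_of \<Gamma> ` hball 0 (real (Suc n))" for n
  have mem: "orbit_of \<Gamma> x \<in> U n \<longleftrightarrow> (\<exists>g\<in>\<Gamma>. x \<in> hball (g 0) (real (Suc n)))" if x: "x \<in> H3" for x n
  proof
    assume "orbit_of \<Gamma> x \<in> U n"
    then obtain y where y: "y \<in> hball 0 (real (Suc n))" "orbit_of \<Gamma> x = orbit_of \<Gamma> y" by (auto simp: U_def)
    have "x \<in> orbit_of \<Gamma> x"
      unfolding orbit_of_def using subgroup.one_closed[OF sg] Isom_H3_one_apply[OF x] by (metis imageI)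
    then obtain g where g: "g \<in> \<Gamma>" "x = g y" unfolding y(2) by (auto simp: orbit_of_def)
    then have "x \<in> hball (g 0) (real (Suc n))"
      using hball_Isom[OF gc[OF g(1)] zero_in_H3, of y] y(1) by (auto simp: hball_def)
    with g show "\<exists>g\<in>\<Gamma>. x \<in> hball (g 0) (real (Suc n))" by blast
  next
    assume "\<exists>g\<in>\<Gamma>. x \<in> hball (g 0) (real (Suc n))"
    then obtain g where g: "g \<in> \<Gamma>" "x \<in> hball (g 0) (real (Suc n))" by blast
    let ?i = "inv\<^bsub>Isom_H3\<^esub> g"
    have G: "g \<in> carrier Isom_H3" using gc g by blast
    have i: "?i \<in> \<Gamma>" using subgroup.m_inv_closed[OF sg g(1)] .
    have "?i x \<in> hball (?i (g 0)) (real (Suc n))"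
      using hball_Isom[OF I.inv_closed[OF G] Isom_H3_in_H3[OF G zero_in_H3] x] g(2) by simp
    then have 1: "?i x \<in> hball 0 (real (Suc n))" unfolding Isom_H3_inv_apply(1)[OF G zero_in_H3] .
    have "orbit_of \<Gamma> (?i x) = orbit_of \<Gamma> x"
    proof
      show "orbit_of \<Gamma> (?i x) \<subseteq> orbit_of \<Gamma> x"
      proof
        fix z assume "z \<in> orbit_of \<Gamma> (?i x)"
        then obtain h where h: "h \<in> \<Gamma>" "z = h (?i x)" by (auto simp: orbit_of_def)
        then have "z = (h \<otimes>\<^bsub>Isom_H3\<^esub> ?i) x" by (simp add: Isom_H3_mult_apply[OF gc[OF h(1)] gc[OF i] x])
        then show "z \<in> orbit_of \<Gamma> x" using subgroup.m_closed[OF sg h(1) i] by (auto simp: orbit_of_def)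
      qed
      show "orbit_of \<Gamma> x \<subseteq> orbit_of \<Gamma> (?i x)"
      proof
        fix z assume "z \<in> orbit_of \<Gamma> x"
        then obtain h where h: "h \<in> \<Gamma>" "z = h x" by (auto simp: orbit_of_def)
        have "(h \<otimes>\<^bsub>Isom_H3\<^esub> g) (?i x) = h (g (?i x))"
          by (rule Isom_H3_mult_apply[OF gc[OF h(1)] G Isom_H3_in_H3[OF gc[OF i] x]])
        then have "z = (h \<otimes>\<^bsub>Isom_H3\<^esub> g) (?i x)" using h(2) Isom_H3_inv_apply(2)[OF G x] by simp
        then show "z \<in> orbit_of \<Gamma> (?i x)" using subgroup.m_closed[OF sg h(1) g(1)] by (auto simp: orbit_of_def)
      qed
    qed
    then show "orbit_of \<Gamma> x \<in> U n" using 1 unfolding U_def by (metis imageI)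
  qed
  have top: "topspace (quotient_space \<Gamma>) = orbit_of \<Gamma> ` H3"
    using quotient_map_orbit_of[of \<Gamma>] by (auto simp: quotient_map_def)
  have op: "openin (quotient_space \<Gamma>) (U n)" for n
    unfolding openin_quotient_space
  proof
    show "U n \<subseteq> orbit_of \<Gamma> ` H3" unfolding U_def using hball_subset_H3 by blast
    have "{x \<in> H3. orbit_of \<Gamma> x \<in> U n} = (\<Union>g\<in>\<Gamma>. hball (g 0) (real (Suc n)))"
      using mem hball_subset_H3 by blast
    moreover have "open (\<Union>g\<in>\<Gamma>. hball (g 0) (real (Suc n)))"
      using Isom_H3_in_H3[OF gc zero_in_H3] by (intro open_UN ballI open_hball) auto
    ultimately show "openin (top_of_set H3) {x \<in> H3. orbit_of \<Gamma> x \<in> U n}"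
      using hball_subset_H3 by (intro open_openin_trans) (auto simp: H3_def)
  qed
  have "\<exists>\<F>. finite \<F> \<and> \<F> \<subseteq> range U \<and> topspace (quotient_space \<Gamma>) \<subseteq> \<Union>\<F>"
  proof (rule compact_space_alt[THEN iffD1, OF comp, rule_format], rule conjI)
    show "topspace (quotient_space \<Gamma>) \<subseteq> \<Union> (range U)"
    proof
      fix z assume "z \<in> topspace (quotient_space \<Gamma>)"
      then obtain x where x: "x \<in> H3" "z = orbit_of \<Gamma> x" unfolding top by blast
      obtain n :: nat where "hdist 0 x < real n" using reals_Archimedean2 by blast
      then have "x \<in> hball 0 (real (Suc n))" using x by (simp add: hball_def)
      then show "z \<in> \<Union> (range U)" unfolding U_def x(2) by blast
    qed
  qed (use op in auto)
  then obtain \<F> where "finite \<F>" "\<F> \<subseteq> range U" and cov: "topspace (quotient_space \<Gamma>) \<subseteq> \<Union>\<F>" by blast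
  then obtain A where A: "finite A" "\<F> = U ` A" using finite_subset_image[of \<F> U UNIV] by auto
  define D where "D = real (Suc (Max (insert 0 A)))"
  have "cocompact_action \<Gamma> D"
  proof (rule cocompact_action.intro)
    show "subgroup \<Gamma> Isom_H3" by (rule sg)
    show "0 < D" by (simp add: D_def)
    show "finite {g \<in> \<Gamma>. hdist 0 (g 0) < r}" for r by (rule discrete_isometry_group_finite[OF disc])
    fix x assume x: "x \<in> H3"
    then have "orbit_of \<Gamma> x \<in> \<Union>\<F>" using cov unfolding top by blast
    then obtain n where n: "n \<in> A" "orbit_of \<Gamma> x \<in> U n" using A by blast
    then obtain g where g: "g \<in> \<Gamma>" "x \<in> hball (g 0) (real (Suc n))" using mem[OF x] by blast
    have "n \<le> Max (insert 0 A)" using A(1) n(1) by (intro Max_ge) auto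
    then have "x \<in> hball (g 0) D" using g(2) by (auto simp: hball_def D_def)
    with g(1) show "\<exists>g\<in>\<Gamma>. x \<in> hball (g 0) D" by blast
  qed
  then show ?thesis by (rule that)
qed

section \<open>Recurrence on the integers\<close>

text \<open>This is \<open>1 - |k| / L\<close> on the interval from \<open>- L\<close> to
  \<open>L\<close>. Writing it through absolute values reduces its second differences to those of
  the absolute value.\<close>

definition tent :: "int \<Rightarrow> int \<Rightarrow> real" where
  "tent L k = real_of_int (\<bar>k + L\<bar> + \<bar>k - L\<bar> - 2 * \<bar>k\<bar>) / (2 * real_of_int L)"

lemma tent_0: "0 < L \<Longrightarrow> tent L 0 = 1"
  by (simp add: tent_def)

lemma tent_outside: "0 < L \<Longrightarrow> k \<notin> {- L..L} \<Longrightarrow> tent L k = 0"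
  by (auto simp: tent_def)

text \<open>With step \<open>j\<close>, the second difference of the absolute value lives on fewer
  than \<open>2 * |j|\<close> points and is at most \<open>2 * |j|\<close> there. The resulting
  square is where the second moment enters.\<close>

lemma sum_abs_second_difference_le:
  fixes a j :: int
  assumes "finite I"
  shows "(\<Sum>k\<in>I. \<bar>\<bar>k + a + j\<bar> + \<bar>k + a - j\<bar> - 2 * \<bar>k + a\<bar>\<bar>) \<le> 4 * j\<^sup>2"
proof -
  let ?d = "\<lambda>k. \<bar>\<bar>k + a + j\<bar> + \<bar>k + a - j\<bar> - 2 * \<bar>k + a\<bar>\<bar>"
  let ?J = "{- a - \<bar>j\<bar><..<- a + \<bar>j\<bar>}"
  have z: "?d k = 0" if "k \<notin> ?J" for k
    using that by (smt (verit) greaterThanLessThan_iff)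
  have "(\<Sum>k\<in>I. ?d k) = (\<Sum>k\<in>I \<inter> ?J. ?d k)"
    using assms z by (intro sum.mono_neutral_right) blast+
  also have "\<dots> \<le> (\<Sum>k\<in>?J. ?d k)" by (intro sum_mono2) auto
  also have "\<dots> \<le> (\<Sum>k\<in>?J. 2 * \<bar>j\<bar>)"
    by (rule sum_mono) (smt (verit) greaterThanLessThan_iff)
  also have "\<dots> = int (card ?J) * (2 * \<bar>j\<bar>)" by (rule sum_constant)
  also have "\<dots> \<le> 2 * \<bar>j\<bar> * (2 * \<bar>j\<bar>)" by (intro mult_right_mono) auto
  finally show ?thesis by (simp add: power2_eq_square abs_mult_self_eq)
qed

lemma sum_tent_second_difference_le:
  assumes L: "0 < L" and I: "finite I"
  shows "(\<Sum>k\<in>I. \<bar>tent L (k + j) + tent L (k - j) - 2 * tent L k\<bar>) \<le> 8 * (real_of_int j)\<^sup>2 / real_of_int L"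
proof -
  define d where "d a k = real_of_int (\<bar>k + a + j\<bar> + \<bar>k + a - j\<bar> - 2 * \<bar>k + a\<bar>)" for a k
  have s: "(\<Sum>k\<in>I. \<bar>d a k\<bar>) \<le> 4 * (real_of_int j)\<^sup>2" for a
  proof -
    have "(\<Sum>k\<in>I. \<bar>d a k\<bar>) = real_of_int (\<Sum>k\<in>I. \<bar>\<bar>k + a + j\<bar> + \<bar>k + a - j\<bar> - 2 * \<bar>k + a\<bar>\<bar>)"
      by (simp add: d_def)
    also have "\<dots> \<le> real_of_int (4 * j\<^sup>2)"
      using sum_abs_second_difference_le[OF I, of a j] by (simp only: of_int_le_iff)
    finally show ?thesis by simp
  qed
  have "tent L (k + j) + tent L (k - j) - 2 * tent L k = (d L k + d (- L) k - 2 * d 0 k) / (2 * real_of_int L)" for k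
    unfolding tent_def d_def using L
    by (simp add: add_divide_distrib diff_divide_distrib algebra_simps)
  then have "\<bar>tent L (k + j) + tent L (k - j) - 2 * tent L k\<bar> \<le> (\<bar>d L k\<bar> + \<bar>d (- L) k\<bar> + 2 * \<bar>d 0 k\<bar>) / (2 * real_of_int L)" for k
    using L by (simp add: abs_divide divide_right_mono)
  then have "(\<Sum>k\<in>I. \<bar>tent L (k + j) + tent L (k - j) - 2 * tent L k\<bar>)
     \<le> (\<Sum>k\<in>I. (\<bar>d L k\<bar> + \<bar>d (- L) k\<bar> + 2 * \<bar>d 0 k\<bar>) / (2 * real_of_int L))"
    by (rule sum_mono)
  also have "\<dots> = ((\<Sum>k\<in>I. \<bar>d L k\<bar>) + (\<Sum>k\<in>I. \<bar>d (- L) k\<bar>) + 2 * (\<Sum>k\<in>I. \<bar>d 0 k\<bar>)) / (2 * real_of_int L)"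
    by (simp add: sum.distrib sum_distrib_left flip: sum_divide_distrib)
  also have "\<dots> \<le> (16 * (real_of_int j)\<^sup>2) / (2 * real_of_int L)"
    using s[of L] s[of "-L"] s[of 0] L by (intro divide_right_mono) auto
  finally show ?thesis using L by simp
qed

text \<open>Summation by parts moves the second difference from \<open>E\<close>, of which only the
  bounds 0 and 1 are known, onto the tent, where its total mass is known.\<close>

lemma sum_tent_by_parts:
  fixes E :: "int \<Rightarrow> real"
  assumes L: "0 < L" and E: "\<And>k. 0 \<le> E k" "\<And>k. E k \<le> 1"
  shows "(\<Sum>k\<in>{- L..L}. tent L k * (E (k + j) + E (k - j) - 2 * E k)) \<le> 8 * (real_of_int j)\<^sup>2 / real_of_int L"
proof -
  \<comment> \<open>Widened by \<open>|j|\<close> so that it contains every shifted support that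
    occurs.\<close>
  define I where "I = {- L - \<bar>j\<bar>..L + \<bar>j\<bar>}"
  have shift: "(\<Sum>k\<in>{- L..L}. tent L k * E (k + i)) = (\<Sum>k\<in>I. tent L (k - i) * E k)" if "\<bar>i\<bar> \<le> \<bar>j\<bar>" for i
  proof -
    have "(\<Sum>k\<in>{- L..L}. tent L k * E (k + i)) = (\<Sum>k\<in>{- L + i..L + i}. tent L (k - i) * E k)"
      by (rule sum.reindex_bij_witness[of _ "\<lambda>k. k - i" "\<lambda>k. k + i"]) auto
    also have "\<dots> = (\<Sum>k\<in>I. tent L (k - i) * E k)"
      using that L by (intro sum.mono_neutral_left) (auto simp: I_def intro!: tent_outside)
    finally show ?thesis .
  qed
  have "(\<Sum>k\<in>{- L..L}. tent L k * (E (k + j) + E (k - j) - 2 * E k))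
     = (\<Sum>k\<in>{- L..L}. tent L k * E (k + j)) + (\<Sum>k\<in>{- L..L}. tent L k * E (k + - j)) - 2 * (\<Sum>k\<in>{- L..L}. tent L k * E (k + 0))"
    by (simp add: algebra_simps sum.distrib sum_subtractf sum_distrib_left)
  also have "\<dots> = (\<Sum>k\<in>I. tent L (k - j) * E k) + (\<Sum>k\<in>I. tent L (k - - j) * E k) - 2 * (\<Sum>k\<in>I. tent L (k - 0) * E k)"
    by (simp only: shift abs_minus_cancel order_refl abs_zero abs_ge_zero)
  also have "\<dots> = (\<Sum>k\<in>I. (tent L (k + j) + tent L (k - j) - 2 * tent L k) * E k)"
    by (simp add: algebra_simps sum.distrib sum_subtractf sum_distrib_left)
  also have "\<dots> \<le> (\<Sum>k\<in>I. \<bar>tent L (k + j) + tent L (k - j) - 2 * tent L k\<bar>)"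
  proof (rule sum_mono)
    fix k
    have "(tent L (k + j) + tent L (k - j) - 2 * tent L k) * E k
       \<le> \<bar>tent L (k + j) + tent L (k - j) - 2 * tent L k\<bar> * E k"
      using E(1) by (intro mult_right_mono) auto
    also have "\<dots> \<le> \<bar>tent L (k + j) + tent L (k - j) - 2 * tent L k\<bar> * 1"
      using E(2) by (intro mult_left_mono) auto
    finally show "(tent L (k + j) + tent L (k - j) - 2 * tent L k) * E k
       \<le> \<bar>tent L (k + j) + tent L (k - j) - 2 * tent L k\<bar>" by simp
  qed
  also have "\<dots> \<le> 8 * (real_of_int j)\<^sup>2 / real_of_int L"
    by (rule sum_tent_second_difference_le[OF L]) (simp add: I_def)
  finally show ?thesis .
qed

text \<open>The probability that the walk with step law \<open>p\<close>, started at
  \<open>k\<close>, differs from 0 at all times from 0 to \<open>n\<close>.\<close>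

fun avoid :: "int pmf \<Rightarrow> nat \<Rightarrow> int \<Rightarrow> real" where
  "avoid p 0 k = (if k = 0 then 0 else 1)"
| "avoid p (Suc n) k = (if k = 0 then 0 else measure_pmf.expectation p (\<lambda>j. avoid p n (k + j)))"

lemma avoid_0 [simp]: "avoid p n 0 = 0" by (cases n) auto

lemma pmf_expectation_bounds:
  fixes f :: "'a \<Rightarrow> real"
  assumes "\<And>x. 0 \<le> f x" "\<And>x. f x \<le> 1"
  shows "integrable (measure_pmf p) f" "0 \<le> measure_pmf.expectation p f" "measure_pmf.expectation p f \<le> 1"
proof -
  show i: "integrable (measure_pmf p) f"
    using assms by (intro measure_pmf.integrable_const_bound[where B = 1]) auto
  show "0 \<le> measure_pmf.expectation p f" using assms by simp
  show "measure_pmf.expectation p f \<le> 1"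
    using i assms by (intro measure_pmf.integral_le_const) auto
qed

lemma avoid_bounds: "0 \<le> avoid p n k" "avoid p n k \<le> 1"
proof -
  have "0 \<le> avoid p n k \<and> avoid p n k \<le> 1"
    by (induction n arbitrary: k) (auto intro: pmf_expectation_bounds)
  then show "0 \<le> avoid p n k" "avoid p n k \<le> 1" by auto
qed

lemma avoid_integrable: "integrable (measure_pmf p) (\<lambda>j. avoid p n (k + j))"
  by (rule pmf_expectation_bounds) (rule avoid_bounds)+

lemma avoid_decreasing: "avoid p (Suc n) k \<le> avoid p n k"
proof (induction n arbitrary: k)
  case 0
  show ?case using avoid_bounds[of p "Suc 0" k] by (cases "k = 0") auto
next
  case (Suc n)
  show ?case
  proof (cases "k = 0")
    case False
    then show ?thesis
      unfolding avoid.simps(2)[of p "Suc n"] avoid.simps(2)[of p n k]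
      using Suc.IH by (auto intro!: integral_mono avoid_integrable simp del: avoid.simps)
  qed simp
qed

lemma avoid_convergent: "convergent (\<lambda>n. avoid p n k)"
proof (rule Bseq_monoseq_convergent)
  show "Bseq (\<lambda>n. avoid p n k)"
    using avoid_bounds by (intro BseqI'[of _ 1]) simp
  show "monoseq (\<lambda>n. avoid p n k)"
    by (intro decseq_imp_monoseq decseq_SucI avoid_decreasing)
qed

text \<open>Recurrence of centred walks: pairing the subharmonic function \<open>avoid p n\<close> with
  a tent function of slope \<open>1 / L\<close> costs only \<open>O(1 / L)\<close>, because the second differences of the
  tent have total mass \<open>O(1 / L)\<close>.\<close>

lemma symmetric_walk_recurrent:
  assumes sym: "\<And>j. pmf p (- j) = pmf p j"
    and m2: "(\<integral>\<^sup>+j. ennreal ((real_of_int j)\<^sup>2) \<partial>measure_pmf p) < \<infinity>"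
  shows "(\<lambda>n. measure_pmf.expectation p (avoid p n)) \<longlonglongrightarrow> 0"
proof -
  define c where "c n = measure_pmf.expectation p (avoid p n)" for n
  define M where "M = measure_pmf.expectation p (\<lambda>j. (real_of_int j)\<^sup>2)"
  have c0: "0 \<le> c n" for n unfolding c_def using avoid_bounds by (intro pmf_expectation_bounds)
  have i2: "integrable (measure_pmf p) (\<lambda>j. (real_of_int j)\<^sup>2)"
    using m2 by (intro integrableI_bounded) auto
  have pm: "map_pmf uminus p = p"
  proof (rule pmf_eqI)
    fix j
    have "pmf (map_pmf uminus p) (- (- j)) = pmf p (- j)"
      by (rule pmf_map_inj') (simp add: inj_def)
    then show "pmf (map_pmf uminus p) j = pmf p j" by (simp add: sym)
  qed
  have flip: "measure_pmf.expectation p f = measure_pmf.expectation p (\<lambda>j. f (- j))" for f :: "int \<Rightarrow> real"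
    by (subst pm[symmetric]) (rule integral_map_pmf)
  have key: "c n \<le> 4 * M / real_of_int L + (\<Sum>k\<in>{- L..L}. tent L k * (avoid p n k - avoid p (Suc n) k))"
    if L: "0 < L" for L n
  proof -
    let ?E = "avoid p n"
    let ?P = "\<lambda>k. measure_pmf.expectation p (\<lambda>j. ?E (k + j))"
    \<comment> \<open>Away from 0, averaging \<open>avoid p n\<close> gives
      \<open>avoid p (Suc n)\<close>. At 0 it gives \<open>c n\<close> instead of 0, and there the
      tent has the value 1; this isolates \<open>c n\<close>.\<close>
    have "(\<Sum>k\<in>{- L..L}. tent L k * (?P k - ?E k))
       = (\<Sum>k\<in>{- L..L}. (if k = 0 then c n else 0) + tent L k * (avoid p (Suc n) k - ?E k))"
      by (intro sum.cong) (auto simp: tent_0[OF L] c_def)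
    also have "\<dots> = c n + (\<Sum>k\<in>{- L..L}. tent L k * (avoid p (Suc n) k - ?E k))"
      using L by (simp add: sum.distrib del: avoid.simps)
    finally have 1: "c n = (\<Sum>k\<in>{- L..L}. tent L k * (?P k - ?E k)) + (\<Sum>k\<in>{- L..L}. tent L k * (?E k - avoid p (Suc n) k))"
      by (simp add: algebra_simps sum_subtractf del: avoid.simps)
    have int1: "integrable (measure_pmf p) (\<lambda>j. ?E (k + j))" for k by (rule avoid_integrable)
    have int2: "integrable (measure_pmf p) (\<lambda>j. ?E (k - j))" for k
      by (rule pmf_expectation_bounds) (rule avoid_bounds)+
    \<comment> \<open>Symmetry of \<open>p\<close> replaces a first difference by a second
      difference.\<close>
    have "2 * ?P k = measure_pmf.expectation p (\<lambda>j. ?E (k + j) + ?E (k - j))" for k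
      using flip[of "\<lambda>j. ?E (k + j)"] int1 int2 by simp
    then have "2 * (\<Sum>k\<in>{- L..L}. tent L k * (?P k - ?E k))
       = (\<Sum>k\<in>{- L..L}. tent L k * measure_pmf.expectation p (\<lambda>j. ?E (k + j) + ?E (k - j) - 2 * ?E k))"
      using int1 int2 unfolding sum_distrib_left by (intro sum.cong refl) (simp add: algebra_simps)
    also have "\<dots> = measure_pmf.expectation p (\<lambda>j. \<Sum>k\<in>{- L..L}. tent L k * (?E (k + j) + ?E (k - j) - 2 * ?E k))"
      using int1 int2 by (subst Bochner_Integration.integral_sum) auto
    also have "\<dots> \<le> measure_pmf.expectation p (\<lambda>j. 8 / real_of_int L * (real_of_int j)\<^sup>2)"
    proof (rule integral_mono)
      show "integrable (measure_pmf p) (\<lambda>j. \<Sum>k\<in>{- L..L}. tent L k * (?E (k + j) + ?E (k - j) - 2 * ?E k))"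
        using int1 int2 by (intro Bochner_Integration.integrable_sum integrable_mult_right) auto
      show "integrable (measure_pmf p) (\<lambda>j. 8 / real_of_int L * (real_of_int j)\<^sup>2)" using i2 by simp
      show "(\<Sum>k\<in>{- L..L}. tent L k * (?E (k + j) + ?E (k - j) - 2 * ?E k)) \<le> 8 / real_of_int L * (real_of_int j)\<^sup>2" for j
        using sum_tent_by_parts[OF L, of ?E j] avoid_bounds by (simp add: field_simps)
    qed
    also have "\<dots> = 2 * (4 * M / real_of_int L)" by (simp add: M_def)
    finally have "(\<Sum>k\<in>{- L..L}. tent L k * (?P k - ?E k)) \<le> 4 * M / real_of_int L" by linarith
    with 1 show ?thesis by simp
  qed
  show ?thesis unfolding c_def[symmetric]
  proof (rule LIMSEQ_I)
    fix e :: real assume e: "0 < e"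
    have M0: "0 \<le> M" by (simp add: M_def)
    obtain l :: nat where l: "8 * M / e < real l" using reals_Archimedean2 by blast
    define L where "L = int (Suc l)"
    have L: "0 < L" "4 * M / real_of_int L < e / 2"
    proof -
      show "0 < L" by (simp add: L_def)
      have "8 * M < e * real_of_int L" using l e by (simp add: L_def field_simps)
      then show "4 * M / real_of_int L < e / 2" using \<open>0 < L\<close> by (simp add: field_simps)
    qed
    \<comment> \<open>With \<open>L\<close> fixed the correction is a finite sum of differences of
      convergent sequences, so it vanishes as \<open>n\<close> grows. \<open>L\<close> has to be
      chosen before \<open>n\<close>.\<close>
    have "(\<lambda>n. \<Sum>k\<in>{- L..L}. tent L k * (avoid p n k - avoid p (Suc n) k)) \<longlonglongrightarrow> (\<Sum>k\<in>{- L..L}. tent L k * (lim (\<lambda>n. avoid p n k) - lim (\<lambda>n. avoid p n k)))"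
    proof (intro tendsto_sum tendsto_mult tendsto_diff tendsto_const)
      fix k
      show a: "(\<lambda>n. avoid p n k) \<longlonglongrightarrow> lim (\<lambda>n. avoid p n k)"
        using avoid_convergent by (simp add: convergent_LIMSEQ_iff)
      show "(\<lambda>n. avoid p (Suc n) k) \<longlonglongrightarrow> lim (\<lambda>n. avoid p n k)" by (rule LIMSEQ_Suc[OF a])
    qed
    then have "(\<lambda>n. \<Sum>k\<in>{- L..L}. tent L k * (avoid p n k - avoid p (Suc n) k)) \<longlonglongrightarrow> 0" by (simp del: avoid.simps)
    then have "eventually (\<lambda>n. (\<Sum>k\<in>{- L..L}. tent L k * (avoid p n k - avoid p (Suc n) k)) < e / 2) sequentially"
      using e by (intro order_tendstoD) auto
    then obtain n0 where n0: "\<And>n. n \<ge> n0 \<Longrightarrow> (\<Sum>k\<in>{- L..L}. tent L k * (avoid p n k - avoid p (Suc n) k)) < e / 2"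
      by (auto simp: eventually_sequentially)
    show "\<exists>no. \<forall>n\<ge>no. norm (c n - 0) < e"
    proof (intro exI allI impI)
      fix n assume "n \<ge> n0"
      with key[OF L(1), of n] n0[of n] L(2) c0[of n] show "norm (c n - 0) < e"
        by (simp del: avoid.simps)
    qed
  qed
qed

section \<open>The first return to the kernel of a homomorphism\<close>

lemma nn_integral_count_space_split:
  assumes "B \<subseteq> A"
  shows "(\<integral>\<^sup>+x. f x \<partial>count_space A) = (\<integral>\<^sup>+x. f x \<partial>count_space (A - B)) + (\<integral>\<^sup>+x. f x \<partial>count_space B)"
proof -
  have "(\<integral>\<^sup>+x. f x * indicator A x \<partial>count_space UNIV)
    = (\<integral>\<^sup>+x. f x * indicator (A - B) x + f x * indicator B x \<partial>count_space UNIV)"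
    using assms by (intro nn_integral_cong) (auto simp: indicator_def)
  also have "\<dots> = (\<integral>\<^sup>+x. f x * indicator (A - B) x \<partial>count_space UNIV) + (\<integral>\<^sup>+x. f x * indicator B x \<partial>count_space UNIV)"
    by (rule nn_integral_add) auto
  finally show ?thesis
    by (cases "A = UNIV"; cases "B = UNIV") (auto simp: nn_integral_count_space_indicator)
qed

lemma (in group) map_pmf_inv_symmetric:
  assumes H: "subgroup H G" and support: "set_pmf m \<subseteq> H"
    and symmetric: "\<And>g. g \<in> H \<Longrightarrow> pmf m (inv g) = pmf m g"
  shows "map_pmf (\<lambda>g. inv g) m = m"
proof (rule pmf_eqI)
  fix g
  show "pmf (map_pmf (\<lambda>g. inv g) m) g = pmf m g"
  proof (cases "g \<in> H")
    case True
    have eq: "((\<lambda>g. inv g) -` {g}) \<inter> set_pmf m = {inv g} \<inter> set_pmf m"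
      using support True subgroup.mem_carrier[OF H] by auto
    have "pmf (map_pmf (\<lambda>g. inv g) m) g = measure m (((\<lambda>g. inv g) -` {g}) \<inter> set_pmf m)"
      by (simp add: pmf_map measure_Int_set_pmf)
    also have "\<dots> = pmf m (inv g)"
      unfolding eq by (simp only: measure_Int_set_pmf measure_pmf_single)
    finally show ?thesis using True by (simp add: symmetric)
  next
    case False
    have "g \<notin> set_pmf (map_pmf (\<lambda>g. inv g) m)" using False support subgroup.m_inv_closed[OF H] by auto
    then have "pmf (map_pmf (\<lambda>g. inv g) m) g = 0" by (simp only: set_pmf_iff not_not)
    moreover have "pmf m g = 0" using False support by (auto simp: set_pmf_iff)
    ultimately show ?thesis by simp
  qed
qed

locale symmetric_hom_walk = group G for G :: "('a, 'b) monoid_scheme" (structure) +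
  fixes \<Gamma> :: "'a set" and m :: "'a pmf" and \<phi> :: "'a \<Rightarrow> int"
  assumes subgroup_Gamma: "subgroup \<Gamma> G"
    and countable_Gamma: "countable \<Gamma>"
    and support: "set_pmf m \<subseteq> \<Gamma>"
    and symmetric: "g \<in> \<Gamma> \<Longrightarrow> pmf m (inv g) = pmf m g"
    and generates: "generate G (set_pmf m) = \<Gamma>"
    and hom: "g \<in> \<Gamma> \<Longrightarrow> h \<in> \<Gamma> \<Longrightarrow> \<phi> (g \<otimes> h) = \<phi> g + \<phi> h"
    and second_moment: "(\<integral>\<^sup>+g. ennreal ((real_of_int (\<phi> g))\<^sup>2) \<partial>measure_pmf m) < \<infinity>"
begin

lemma in_carrier: "g \<in> \<Gamma> \<Longrightarrow> g \<in> carrier G" using subgroup.mem_carrier[OF subgroup_Gamma] .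
lemma mult_in: "g \<in> \<Gamma> \<Longrightarrow> h \<in> \<Gamma> \<Longrightarrow> g \<otimes> h \<in> \<Gamma>" using subgroup.m_closed[OF subgroup_Gamma] .
lemma inv_in: "g \<in> \<Gamma> \<Longrightarrow> inv g \<in> \<Gamma>" using subgroup.m_inv_closed[OF subgroup_Gamma] .
lemma one_in: "\<one> \<in> \<Gamma>" using subgroup.one_closed[OF subgroup_Gamma] .

lemma hom_one: "\<phi> \<one> = 0" using hom[OF one_in one_in] by simp
lemma hom_inv: "g \<in> \<Gamma> \<Longrightarrow> \<phi> (inv g) = - \<phi> g"
  using hom[OF _ inv_in, of g g] hom_one in_carrier[of g] by simp

definition N where "N = {g \<in> \<Gamma>. \<phi> g = 0}"

lemma N_sub: "N \<subseteq> \<Gamma>" by (auto simp: N_def)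

lemma N_mult_iff: "g \<in> N \<Longrightarrow> h \<in> \<Gamma> \<Longrightarrow> g \<otimes> h \<in> N \<longleftrightarrow> h \<in> N"
  by (auto simp: N_def hom mult_in)

lemma subgroup_N: "subgroup N G"
  using one_in hom_one by (intro subgroupI) (auto simp: N_def in_carrier hom mult_in inv_in hom_inv)

definition jump :: "'a \<Rightarrow> 'a \<Rightarrow> ennreal" where "jump x y = ennreal (pmf m (inv x \<otimes> y))"

lemma jump_sym: "x \<in> \<Gamma> \<Longrightarrow> y \<in> \<Gamma> \<Longrightarrow> jump x y = jump y x"
  using symmetric[OF mult_in[OF inv_in], of x y] by (simp add: jump_def inv_mult_group in_carrier)

lemma jump_translate: "g \<in> \<Gamma> \<Longrightarrow> x \<in> \<Gamma> \<Longrightarrow> y \<in> \<Gamma> \<Longrightarrow> jump (g \<otimes> x) (g \<otimes> y) = jump x y"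
proof -
  assume g: "g \<in> \<Gamma>" and x: "x \<in> \<Gamma>" and y: "y \<in> \<Gamma>"
  have "inv g \<otimes> (g \<otimes> y) = y" using g y by (simp add: in_carrier m_assoc[symmetric])
  then have "inv (g \<otimes> x) \<otimes> (g \<otimes> y) = inv x \<otimes> y"
    using g x y by (simp add: inv_mult_group in_carrier m_assoc)
  then show ?thesis by (simp add: jump_def)
qed

lemma jump_step: "x \<in> \<Gamma> \<Longrightarrow> s \<in> \<Gamma> \<Longrightarrow> jump x (x \<otimes> s) = ennreal (pmf m s)"
  by (simp add: jump_def in_carrier m_assoc[symmetric])

lemma bij_translate: "g \<in> \<Gamma> \<Longrightarrow> bij_betw (\<lambda>h. g \<otimes> h) \<Gamma> \<Gamma>"
  by (rule bij_betwI[where g = "\<lambda>h. inv g \<otimes> h"])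
     (auto simp: in_carrier mult_in inv_in m_assoc[symmetric])

lemma nn_integral_jump:
  assumes x: "x \<in> \<Gamma>"
  shows "(\<integral>\<^sup>+y. jump x y * f y \<partial>count_space \<Gamma>) = (\<integral>\<^sup>+s. f (x \<otimes> s) \<partial>measure_pmf m)"
proof -
  have "(\<integral>\<^sup>+y. jump x y * f y \<partial>count_space \<Gamma>) = (\<integral>\<^sup>+s. jump x (x \<otimes> s) * f (x \<otimes> s) \<partial>count_space \<Gamma>)"
    by (rule nn_integral_bij_count_space[OF bij_translate[OF x], symmetric])
  also have "\<dots> = (\<integral>\<^sup>+s. ennreal (pmf m s) * f (x \<otimes> s) \<partial>count_space \<Gamma>)"
    using x by (intro nn_integral_cong) (simp add: jump_step)
  also have "\<dots> = (\<integral>\<^sup>+s. ennreal (pmf m s) * f (x \<otimes> s) \<partial>count_space UNIV)"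
    using support by (intro nn_integral_count_space_eq) (auto simp: set_pmf_iff)
  finally show ?thesis by (simp add: nn_integral_measure_pmf)
qed

text \<open>Second use of the killed walk: the states are the elements outside \<open>N\<close>, and
  a jump into \<open>N\<close> is the absorption.\<close>

sublocale K: sym_kernel "count_space (\<Gamma> - N)" jump
proof (intro sym_kernel.intro sym_kernel_axioms.intro)
  have c: "countable (\<Gamma> - N)" using countable_Gamma by simp
  then show "sigma_finite_measure (count_space (\<Gamma> - N))" by (rule sigma_finite_measure_count_space_countable)
  show "(\<lambda>(x, y). jump x y) \<in> borel_measurable (count_space (\<Gamma> - N) \<Otimes>\<^sub>M count_space (\<Gamma> - N))"
    by (simp add: pair_measure_countable c)
qed (auto simp: jump_sym)

text \<open>Either the first jump already lands in \<open>N\<close>, or the walk makes an excursion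
  outside \<open>N\<close>, for which \<open>jump \<one>\<close> is the starting density.\<close>

definition ret :: "'a \<Rightarrow> ennreal" where "ret h = jump \<one> h + K.hit 1 jump \<one> h"

lemma kop_plus:
  assumes x: "x \<in> \<Gamma>"
  shows "K.kop f x + (\<integral>\<^sup>+h. f h * jump h x \<partial>count_space N) = (\<integral>\<^sup>+s. f (x \<otimes> s) \<partial>measure_pmf m)"
proof -
  have "(\<integral>\<^sup>+h. f h * jump h x \<partial>count_space N) = (\<integral>\<^sup>+h. jump x h * f h \<partial>count_space N)"
    using N_sub x by (intro nn_integral_cong) (auto simp: mult.commute jump_sym)
  then show ?thesis
    unfolding K.kop_def nn_integral_jump[OF x, symmetric] nn_integral_count_space_split[OF N_sub] by simp
qed

lemma countable_N: "countable N" using countable_subset[OF N_sub countable_Gamma] .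

lemma nn_integral_ret_le:
  assumes H: "\<And>x. x \<in> \<Gamma> \<Longrightarrow> (\<integral>\<^sup>+s. H (x \<otimes> s) \<partial>measure_pmf m) \<le> H x"
  shows "(\<integral>\<^sup>+h. ret h * H h \<partial>count_space N) \<le> H \<one>"
proof -
  have "(\<integral>\<^sup>+h. K.hit 1 jump \<one> h * H h \<partial>count_space N) \<le> 1 * (\<integral>\<^sup>+x. jump \<one> x * H x \<partial>count_space (\<Gamma> - N))"
  proof (rule K.hit_superharmonic[OF countable_N])
    fix x assume "x \<in> space (count_space (\<Gamma> - N))"
    then have x: "x \<in> \<Gamma>" by simp
    show "K.kop H x + (\<integral>\<^sup>+h. H h * jump h x \<partial>count_space N) \<le> H x"
      unfolding kop_plus[OF x] by (rule H[OF x])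
  qed auto
  then have "(\<integral>\<^sup>+h. ret h * H h \<partial>count_space N)
      \<le> (\<integral>\<^sup>+h. jump \<one> h * H h \<partial>count_space N) + (\<integral>\<^sup>+x. jump \<one> x * H x \<partial>count_space (\<Gamma> - N))"
    unfolding ret_def distrib_right by (simp add: nn_integral_add add_left_mono)
  also have "\<dots> = (\<integral>\<^sup>+s. H (\<one> \<otimes> s) \<partial>measure_pmf m)"
    unfolding nn_integral_jump[OF one_in, symmetric] nn_integral_count_space_split[OF N_sub] by (rule add.commute)
  also have "\<dots> \<le> H \<one>" by (rule H[OF one_in])
  finally show ?thesis .
qed

section \<open>Mass, symmetry and support of the return distribution\<close>

definition proj :: "int pmf" where "proj = map_pmf \<phi> m"

lemma proj_sym: "pmf proj (- j) = pmf proj j"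
proof -
  have m: "map_pmf (\<lambda>g. inv g) m = m"
    using subgroup_Gamma support symmetric by (rule map_pmf_inv_symmetric)
  have "map_pmf uminus proj = map_pmf (\<lambda>g. \<phi> (inv g)) m"
    unfolding proj_def map_pmf_comp using support by (intro map_pmf_cong) (auto simp: hom_inv)
  also have "\<dots> = map_pmf \<phi> (map_pmf (\<lambda>g. inv g) m)" by (simp add: map_pmf_comp)
  also have "\<dots> = proj" by (simp add: m proj_def)
  finally have "pmf proj (- j) = pmf (map_pmf uminus proj) (- j)" by simp
  also have "\<dots> = pmf proj j" by (rule pmf_map_inj') (simp add: inj_def)
  finally show ?thesis .
qed

lemma nn_integral_avoid:
  assumes "x \<in> \<Gamma>"
  shows "(\<integral>\<^sup>+s. ennreal (avoid proj n (\<phi> (x \<otimes> s))) \<partial>measure_pmf m)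
    = ennreal (measure_pmf.expectation proj (\<lambda>j. avoid proj n (\<phi> x + j)))"
proof -
  have "(\<integral>\<^sup>+s. ennreal (avoid proj n (\<phi> (x \<otimes> s))) \<partial>measure_pmf m)
     = (\<integral>\<^sup>+s. ennreal (avoid proj n (\<phi> x + \<phi> s)) \<partial>measure_pmf m)"
    using support assms by (intro nn_integral_cong_AE) (auto simp: AE_measure_pmf_iff hom)
  also have "\<dots> = (\<integral>\<^sup>+j. ennreal (avoid proj n (\<phi> x + j)) \<partial>measure_pmf proj)"
    unfolding proj_def by simp
  also have "\<dots> = ennreal (measure_pmf.expectation proj (\<lambda>j. avoid proj n (\<phi> x + j)))"
    by (intro nn_integral_eq_integral avoid_integrable) (auto intro: avoid_bounds)
  finally show ?thesis .
qed

lemma kop_avoid: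
  assumes x: "x \<in> \<Gamma>"
  shows "K.kop (\<lambda>y. ennreal (avoid proj n (\<phi> y))) x = ennreal (measure_pmf.expectation proj (\<lambda>j. avoid proj n (\<phi> x + j)))"
proof -
  have "(\<integral>\<^sup>+h. ennreal (avoid proj n (\<phi> h)) * jump h x \<partial>count_space N) = (\<integral>\<^sup>+h. 0 \<partial>count_space N)"
    by (intro nn_integral_cong) (simp add: N_def)
  then show ?thesis
    using kop_plus[OF x, of "\<lambda>y. ennreal (avoid proj n (\<phi> y))"] by (simp add: nn_integral_avoid[OF x])
qed

text \<open>Whether the walk is in \<open>N\<close> is visible from \<open>\<phi>\<close> alone, so
  survival outside \<open>N\<close> is the avoidance probability of the projected walk.\<close>

lemma kop_pow_1:
  assumes "x \<in> \<Gamma> - N"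
  shows "(K.kop ^^ n) (\<lambda>_. 1) x = ennreal (avoid proj n (\<phi> x))"
  using assms
proof (induction n arbitrary: x)
  case 0
  then show ?case by (simp add: N_def)
next
  case (Suc n)
  have "(K.kop ^^ Suc n) (\<lambda>_. 1) x = K.kop (\<lambda>y. ennreal (avoid proj n (\<phi> y))) x"
    unfolding funpow.simps o_apply by (rule K.kop_cong) (simp add: Suc.IH)
  also have "\<dots> = ennreal (avoid proj (Suc n) (\<phi> x))"
    using Suc.prems by (subst kop_avoid) (auto simp: N_def)
  finally show ?case .
qed

text \<open>Recurrence of the projected walk makes the return to \<open>N\<close> certain, so that
  the returns carry full mass.\<close>

lemma nn_integral_ret: "(\<integral>\<^sup>+h. ret h \<partial>count_space N) = 1"
proof -
  have "(\<lambda>n. \<integral>\<^sup>+x. jump \<one> x * (K.kop ^^ n) (\<lambda>_. 1) x \<partial>count_space (\<Gamma> - N)) \<longlonglongrightarrow> 0"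
  proof -
    have "(\<integral>\<^sup>+x. jump \<one> x * (K.kop ^^ n) (\<lambda>_. 1) x \<partial>count_space (\<Gamma> - N))
       = ennreal (measure_pmf.expectation proj (avoid proj n))" for n
    proof -
      have "(\<integral>\<^sup>+x. jump \<one> x * (K.kop ^^ n) (\<lambda>_. 1) x \<partial>count_space (\<Gamma> - N))
         = K.kop (\<lambda>y. ennreal (avoid proj n (\<phi> y))) \<one>"
        unfolding K.kop_def[of "\<lambda>y. ennreal (avoid proj n (\<phi> y))"]
        by (intro nn_integral_cong) (simp add: kop_pow_1)
      then show ?thesis using kop_avoid[OF one_in] hom_one by simp
    qed
    moreover have "(\<integral>\<^sup>+j. ennreal ((real_of_int j)\<^sup>2) \<partial>measure_pmf proj) < \<infinity>"
      using second_moment by (simp add: proj_def)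
    then have "(\<lambda>n. ennreal (measure_pmf.expectation proj (avoid proj n))) \<longlonglongrightarrow> ennreal 0"
      by (intro tendsto_ennrealI symmetric_walk_recurrent proj_sym)
    ultimately show ?thesis by simp
  qed
  then have "(\<integral>\<^sup>+h. K.hit 1 jump \<one> h \<partial>count_space N) = 1 * (\<integral>\<^sup>+x. jump \<one> x \<partial>count_space (\<Gamma> - N))"
  proof (rule K.hit_total[OF countable_N, rotated -1])
    fix x assume "x \<in> space (count_space (\<Gamma> - N))"
    then have "x \<in> \<Gamma>" by simp
    from kop_plus[OF this, of "\<lambda>_. 1"] show "K.kop (\<lambda>_. 1) x + (\<integral>\<^sup>+h. jump h x \<partial>count_space N) = 1"
      by (simp add: measure_pmf.emeasure_space_1[simplified])
  qed auto
  then have "(\<integral>\<^sup>+h. ret h \<partial>count_space N)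
      = (\<integral>\<^sup>+h. jump \<one> h \<partial>count_space N) + (\<integral>\<^sup>+x. jump \<one> x \<partial>count_space (\<Gamma> - N))"
    unfolding ret_def by (simp add: nn_integral_add)
  also have "\<dots> = (\<integral>\<^sup>+y. jump \<one> y * 1 \<partial>count_space \<Gamma>)"
    unfolding nn_integral_count_space_split[OF N_sub] by (simp add: add.commute)
  also have "\<dots> = 1"
    unfolding nn_integral_jump[OF one_in] by (simp add: measure_pmf.emeasure_space_1[simplified])
  finally show ?thesis .
qed

lemma ret_inv:
  assumes h: "h \<in> N"
  shows "ret (inv h) = ret h"
proof -
  have hG: "h \<in> \<Gamma>" using h N_sub by auto
  have hc: "h \<in> carrier G" using in_carrier[OF hG] .
  have bij: "bij_betw (\<lambda>x. h \<otimes> x) (\<Gamma> - N) (\<Gamma> - N)"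
  proof (rule bij_betwI[where g = "\<lambda>x. inv h \<otimes> x"])
    have hi: "inv h \<in> N" using subgroup.m_inv_closed[OF subgroup_N h] .
    show "(\<lambda>x. h \<otimes> x) \<in> \<Gamma> - N \<rightarrow> \<Gamma> - N" using mult_in[OF hG] N_mult_iff[OF h] by auto
    show "(\<lambda>x. inv h \<otimes> x) \<in> \<Gamma> - N \<rightarrow> \<Gamma> - N" using mult_in[OF inv_in[OF hG]] N_mult_iff[OF hi] by auto
  qed (use hc in_carrier in \<open>auto simp: m_assoc[symmetric]\<close>)
  have "K.hit 1 jump \<one> (inv h) = K.hit 1 jump (h \<otimes> \<one>) (h \<otimes> inv h)"
  proof (rule K.hit_equivariant[symmetric])
    show "(\<integral>\<^sup>+x. F (h \<otimes> x) \<partial>count_space (\<Gamma> - N)) = (\<integral>\<^sup>+x. F x \<partial>count_space (\<Gamma> - N))" for F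
      by (rule nn_integral_bij_count_space[OF bij])
    show "(\<lambda>x. h \<otimes> x) \<in> count_space (\<Gamma> - N) \<rightarrow>\<^sub>M count_space (\<Gamma> - N)"
      using bij by (auto simp: bij_betw_def)
    show "jump (h \<otimes> x) (h \<otimes> y) = jump x y"
      if "x \<in> space (count_space (\<Gamma> - N))" "y \<in> space (count_space (\<Gamma> - N))" for x y
      using that by (intro jump_translate[OF hG]) auto
    show "jump (h \<otimes> \<one>) (h \<otimes> x) = jump \<one> x" if "x \<in> space (count_space (\<Gamma> - N))" for x
      using that one_in by (intro jump_translate[OF hG]) auto
    show "jump (h \<otimes> inv h) (h \<otimes> x) = jump (inv h) x" if "x \<in> space (count_space (\<Gamma> - N))" for x
      using that inv_in[OF hG] by (intro jump_translate[OF hG]) auto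
  qed auto
  also have "\<dots> = K.hit 1 jump h \<one>" using hc by simp
  also have "\<dots> = K.hit 1 jump \<one> h" by (rule K.hit_sym) auto
  moreover have "jump \<one> (inv h) = jump \<one> h" using symmetric[OF hG] hc by (simp add: jump_def)
  ultimately show ?thesis by (simp add: ret_def)
qed

lemma ret_ge_jump: "s \<in> N \<Longrightarrow> 0 < pmf m s \<Longrightarrow> 0 < ret s"
  using in_carrier[of s] N_sub by (auto simp: ret_def jump_def intro!: add_pos_nonneg)

lemma ret_pos:
  assumes x: "x \<in> \<Gamma> - N" and pos: "0 < (K.kop ^^ n) (jump \<one>) x" and y: "y \<in> N" "0 < jump x y"
  shows "0 < ret y"
proof -
  have yG: "y \<in> \<Gamma>" using y N_sub by auto
  have "0 < jump y x * (K.kop ^^ n) (jump \<one>) x"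
    using pos y(2) x yG by (simp add: ennreal_zero_less_mult_iff jump_sym)
  also have "\<dots> \<le> (\<integral>\<^sup>+z. jump y z * (K.kop ^^ n) (jump \<one>) z \<partial>count_space (\<Gamma> - N))"
    using x by (rule nn_integral_ge_point)
  \<comment> \<open>The excursion is run backwards, from \<open>y\<close> through \<open>x\<close>
    to \<open>\<one>\<close>; symmetry of the hitting distribution then turns it round.\<close>
  also have "\<dots> \<le> K.hit 1 jump y \<one>" using K.hit_ge[of jump y \<one> 1 n] by simp
  also have "\<dots> = K.hit 1 jump \<one> y" by (rule K.hit_sym) auto
  also have "\<dots> \<le> ret y" by (simp add: ret_def)
  finally show ?thesis .
qed

text \<open>A word in the support of \<open>m\<close> with value in \<open>N\<close> is cut at its
  visits to \<open>N\<close>; each piece is a return of positive probability, so the word is a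
  product of elements of the support of \<open>ret\<close>.\<close>

lemma generate_ret: "generate G {h \<in> N. 0 < ret h} = N"
proof
  let ?W = "generate G {h \<in> N. 0 < ret h}"
  show WN: "?W \<subseteq> N" by (rule generate_subgroup_incl[OF _ subgroup_N]) auto
  \<comment> \<open>By symmetry of \<open>jump\<close>, a path from \<open>x\<close> to
    \<open>\<one>\<close> outside \<open>N\<close> is the same as a path from \<open>\<one>\<close>
    to \<open>x\<close>.\<close>
  define reach where "reach x \<longleftrightarrow> x \<in> \<Gamma> - N \<and> (\<exists>n. 0 < (K.kop ^^ n) (jump \<one>) x)" for x
  \<comment> \<open>Here \<open>w\<close> plays the part of the last position in \<open>N\<close> on
    the path to \<open>g\<close>. The set is closed under right multiplication by the support, and
    so is all of \<open>\<Gamma>\<close>.\<close>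
  define T where "T = {g \<in> \<Gamma>. if g \<in> N then g \<in> ?W else \<exists>w\<in>?W. reach (inv w \<otimes> g)}"
  have TG: "T \<subseteq> \<Gamma>" by (auto simp: T_def)
  have step: "g \<otimes> s \<in> T" if g: "g \<in> T" and s: "s \<in> set_pmf m" for g s
  proof -
    have sG: "s \<in> \<Gamma>" using s support by auto
    have ps: "0 < pmf m s" using s by (simp add: set_pmf_iff pmf_pos)
    have gG: "g \<in> \<Gamma>" using g TG by auto
    have c: "g \<in> carrier G" "s \<in> carrier G" using gG sG in_carrier by auto
    have gsG: "g \<otimes> s \<in> \<Gamma>" by (rule mult_in[OF gG sG])
    show ?thesis
    proof (cases "g \<in> N")
      case gN: True
      then have gW: "g \<in> ?W" using g by (simp add: T_def)
      show ?thesis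
      proof (cases "s \<in> N")
        case True
        then have "s \<in> ?W" using ret_ge_jump[OF True ps] by (intro generate.incl) simp
        then have "g \<otimes> s \<in> ?W" by (rule generate.eng[OF gW])
        then show ?thesis using gsG N_mult_iff[OF gN sG] True by (simp add: T_def)
      next
        case False
        have "inv g \<otimes> (g \<otimes> s) = s" using c by (simp add: m_assoc[symmetric])
        moreover have "0 < (K.kop ^^ 0) (jump \<one>) s" using ps c by (simp add: jump_def)
        then have "reach s" unfolding reach_def using sG False by blast
        ultimately have "\<exists>w\<in>?W. reach (inv w \<otimes> (g \<otimes> s))" using gW by force
        then show ?thesis using gsG N_mult_iff[OF gN sG] False by (simp add: T_def)
      qed
    next
      case False
      then obtain w n where w: "w \<in> ?W" "inv w \<otimes> g \<in> \<Gamma> - N" "0 < (K.kop ^^ n) (jump \<one>) (inv w \<otimes> g)"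
        using g by (auto simp: T_def reach_def)
      let ?x = "inv w \<otimes> g"
      have wN: "w \<in> N" using w(1) WN by auto
      have wG: "w \<in> \<Gamma>" using wN N_sub by auto
      have wc: "w \<in> carrier G" using in_carrier[OF wG] .
      have xs: "?x \<otimes> s \<in> \<Gamma>" by (rule mult_in[OF _ sG]) (use w(2) in simp)
      have j: "0 < jump ?x (?x \<otimes> s)"
        using ps w(2) sG by (simp add: jump_step)
      have eq: "w \<otimes> (?x \<otimes> s) = g \<otimes> s" "?x \<otimes> s = inv w \<otimes> (g \<otimes> s)"
        using c wc by (simp_all add: m_assoc[symmetric])
      have iff: "?x \<otimes> s \<in> N \<longleftrightarrow> g \<otimes> s \<in> N"
        using N_mult_iff[OF wN xs] eq(1) by simp
      show ?thesis
      proof (cases "g \<otimes> s \<in> N")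
        case True
        then have "?x \<otimes> s \<in> ?W"
          using ret_pos[OF w(2,3) _ j] iff by (intro generate.incl) simp
        then have "g \<otimes> s \<in> ?W" using generate.eng[OF w(1)] eq(1) by metis
        with True gsG show ?thesis by (simp add: T_def)
      next
        case False
        have "0 < jump (?x \<otimes> s) ?x * (K.kop ^^ n) (jump \<one>) ?x"
          using j w(2,3) xs by (simp add: ennreal_zero_less_mult_iff jump_sym)
        also have "\<dots> \<le> (K.kop ^^ Suc n) (jump \<one>) (?x \<otimes> s)"
          unfolding funpow.simps o_apply K.kop_def[of "(K.kop ^^ n) (jump \<one>)"]
          using w(2) by (rule nn_integral_ge_point)
        finally have "reach (inv w \<otimes> (g \<otimes> s))"
          unfolding reach_def eq(2)[symmetric] using xs False iff by blast
        with w(1) False gsG show ?thesis by (auto simp: T_def)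
      qed
    qed
  qed
  have inv_supp: "inv s \<in> set_pmf m" if "s \<in> set_pmf m" for s
    using that support symmetric[of s] by (auto simp: set_pmf_iff)
  have "\<forall>g\<in>T. g \<otimes> h \<in> T" if "h \<in> generate G (set_pmf m)" for h
    using that
  proof induction
    case one
    show ?case using TG in_carrier by auto
  next
    case (incl s)
    then show ?case using step by blast
  next
    case (inv s)
    then show ?case using step inv_supp by blast
  next
    case (eng h1 h2)
    show ?case
    proof
      fix g assume g: "g \<in> T"
      have "h1 \<in> \<Gamma>" "h2 \<in> \<Gamma>" "g \<in> \<Gamma>" using eng(1,2) g TG generates by auto
      then have "g \<otimes> (h1 \<otimes> h2) = (g \<otimes> h1) \<otimes> h2" by (simp add: m_assoc in_carrier)
      then show "g \<otimes> (h1 \<otimes> h2) \<in> T" using eng(3,4) g by auto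
    qed
  qed
  moreover have "\<one> \<in> T"
    using one_in hom_one generate.one[of G] by (auto simp: T_def N_def)
  ultimately have "\<one> \<otimes> h \<in> T" if "h \<in> \<Gamma>" for h
    using that generates by blast
  then have "h \<in> T" if "h \<in> \<Gamma>" for h using that in_carrier[OF that] by force
  then show "N \<subseteq> ?W" using N_sub by (auto simp: T_def split: if_splits)
qed

definition ret_pmf :: "'a pmf" where
  "ret_pmf = embed_pmf (\<lambda>g. if g \<in> N then enn2real (ret g) else 0)"

lemma ennreal_ret: "g \<in> N \<Longrightarrow> ennreal (enn2real (ret g)) = ret g"
proof -
  assume "g \<in> N"
  then have "ret g \<le> (\<integral>\<^sup>+g. ret g \<partial>count_space N)" by (rule nn_integral_ge_point)
  also have "\<dots> < \<infinity>" by (simp add: nn_integral_ret)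
  finally show ?thesis by simp
qed

lemma pmf_ret_pmf: "pmf ret_pmf g = (if g \<in> N then enn2real (ret g) else 0)"
  unfolding ret_pmf_def
proof (rule pmf_embed_pmf)
  have "(\<integral>\<^sup>+g. ennreal (if g \<in> N then enn2real (ret g) else 0) \<partial>count_space UNIV)
     = (\<integral>\<^sup>+g. ennreal (if g \<in> N then enn2real (ret g) else 0) \<partial>count_space N)"
    by (rule nn_integral_count_space_eq) auto
  also have "\<dots> = (\<integral>\<^sup>+g. ret g \<partial>count_space N)"
    by (intro nn_integral_cong) (simp add: ennreal_ret)
  finally show "(\<integral>\<^sup>+g. ennreal (if g \<in> N then enn2real (ret g) else 0) \<partial>count_space UNIV) = 1"
    by (simp add: nn_integral_ret)
qed simp

lemma set_ret_pmf: "set_pmf ret_pmf = {h \<in> N. 0 < ret h}"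
proof -
  have "enn2real (ret h) \<noteq> 0 \<longleftrightarrow> 0 < ret h" if "h \<in> N" for h
    using ennreal_ret[OF that] by (metis enn2real_0 ennreal_0 zero_less_iff_neq_zero)
  then show ?thesis by (auto simp: set_pmf_iff pmf_ret_pmf split: if_splits)
qed

lemma pmf_ret_pmf_inv: "h \<in> N \<Longrightarrow> pmf ret_pmf (inv h) = pmf ret_pmf h"
  using subgroup.m_inv_closed[OF subgroup_N] by (simp add: pmf_ret_pmf ret_inv)

lemma nn_integral_ret_pmf: "(\<integral>\<^sup>+g. f g \<partial>measure_pmf ret_pmf) = (\<integral>\<^sup>+g. ret g * f g \<partial>count_space N)"
proof -
  have "(\<integral>\<^sup>+g. f g \<partial>measure_pmf ret_pmf) = (\<integral>\<^sup>+g. ennreal (pmf ret_pmf g) * f g \<partial>count_space N)"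
    unfolding nn_integral_measure_pmf by (rule nn_integral_count_space_eq) (auto simp: pmf_ret_pmf)
  also have "\<dots> = (\<integral>\<^sup>+g. ret g * f g \<partial>count_space N)"
    by (intro nn_integral_cong) (simp add: pmf_ret_pmf ennreal_ret)
  finally show ?thesis .
qed

end

section \<open>Uniqueness of the stationary measure\<close>

lemma infsum_ennreal_eq_nn_integral:
  fixes f :: "'a \<Rightarrow> ennreal"
  assumes A: "countable A"
  shows "infsum f A = (\<integral>\<^sup>+x. f x \<partial>count_space A)"
proof -
  have s: "infsum f A = (SUP F\<in>{F. finite F \<and> F \<subseteq> A}. sum f F)"
    by (rule nonneg_infsum_complete) simp
  show ?thesis
  proof (rule antisym)
    show "infsum f A \<le> (\<integral>\<^sup>+x. f x \<partial>count_space A)"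
      unfolding s
    proof (rule SUP_least)
      fix F assume F: "F \<in> {F. finite F \<and> F \<subseteq> A}"
      then have "sum f F = (\<integral>\<^sup>+x. f x \<partial>count_space F)" by (simp add: nn_integral_count_space_finite)
      also have "\<dots> \<le> (\<integral>\<^sup>+x. f x \<partial>count_space (A - F)) + (\<integral>\<^sup>+x. f x \<partial>count_space F)" by simp
      also have "\<dots> = (\<integral>\<^sup>+x. f x \<partial>count_space A)"
        using F by (intro nn_integral_count_space_split[symmetric]) auto
      finally show "sum f F \<le> (\<integral>\<^sup>+x. f x \<partial>count_space A)" .
    qed
    let ?I = "to_nat_on A ` A" and ?g = "from_nat_into A"
    have "(\<integral>\<^sup>+x. f x \<partial>count_space A) = (\<integral>\<^sup>+x. f (?g (to_nat_on A x)) \<partial>count_space A)"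
      using A by (intro nn_integral_cong) simp
    also have "\<dots> = (\<integral>\<^sup>+i. f (?g i) \<partial>count_space ?I)"
      by (rule nn_integral_bij_count_space[OF inj_on_imp_bij_betw[OF inj_on_to_nat_on[OF A]]])
    also have "\<dots> = (\<integral>\<^sup>+i. (if i \<in> ?I then f (?g i) else 0) \<partial>count_space UNIV)"
      by (subst nn_integral_count_space_indicator) (auto intro!: nn_integral_cong simp: indicator_def)
    also have "\<dots> = (SUP n. \<Sum>i<n. if i \<in> ?I then f (?g i) else 0)"
      by (simp add: nn_integral_count_space_nat suminf_eq_SUP)
    also have "\<dots> \<le> infsum f A"
    proof (rule SUP_least)
      fix n
      let ?J = "{i. i < n \<and> i \<in> ?I}"
      have "(\<Sum>i<n. if i \<in> ?I then f (?g i) else 0) = (\<Sum>i\<in>?J. f (?g i))"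
        by (rule sum.mono_neutral_cong_right) auto
      also have "\<dots> = sum f (?g ` ?J)"
        using A by (subst sum.reindex) (auto simp: inj_on_def)
      also have "\<dots> \<le> infsum f A"
        unfolding s using A by (intro SUP_upper) auto
      finally show "(\<Sum>i<n. if i \<in> ?I then f (?g i) else 0) \<le> infsum f A" .
    qed
    finally show "(\<integral>\<^sup>+x. f x \<partial>count_space A) \<le> infsum f A" .
  qed
qed

lemma stationary_iff:
  "stationary m \<nu> \<longleftrightarrow> prob_space \<nu> \<and> sets \<nu> = sets bd_borel \<and>
     (\<forall>A\<in>sets bd_borel. (\<integral>\<^sup>+g. emeasure (distr \<nu> bd_borel (bd_action g)) A \<partial>measure_pmf m) = emeasure \<nu> A)"
proof -
  have "(\<Sum>\<^sub>\<infinity>g\<in>set_pmf m. ennreal (pmf m g) * F g) = (\<integral>\<^sup>+g. F g \<partial>measure_pmf m)" for F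
    unfolding nn_integral_measure_pmf infsum_ennreal_eq_nn_integral[OF countable_set_pmf]
    by (rule nn_integral_count_space_eq) (auto simp: set_pmf_iff)
  then show ?thesis by (simp add: stationary_def)
qed

section \<open>Contraction near the boundary and its effect on measures without atoms\<close>

lemma mobius_fixed: "norm a < 1 \<Longrightarrow> a \<noteq> 0 \<Longrightarrow> mobius a (a /\<^sub>R norm a) = a /\<^sub>R norm a"
proof -
  assume a: "norm a < 1" "a \<noteq> 0"
  define r where "r = norm a"
  have r: "0 < r" using a by (simp add: r_def)
  have aa: "a \<bullet> a = r\<^sup>2" by (simp add: r_def power2_norm_eq_inner)
  have ip: "a \<bullet> (a /\<^sub>R r) = r" "(a /\<^sub>R r) \<bullet> (a /\<^sub>R r) = 1"
    using r by (simp_all add: aa power2_eq_square field_simps)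
  have den: "mobius_den a (a /\<^sub>R r) = (1 + r)\<^sup>2"
    unfolding mobius_den_def ip aa by (simp add: power2_eq_square algebra_simps)
  have "mobius a (a /\<^sub>R r) = (1 / (1 + r)\<^sup>2) *\<^sub>R ((1 + 2 * r + 1) *\<^sub>R a + (1 - r\<^sup>2) *\<^sub>R (a /\<^sub>R r))"
    unfolding mobius_def den ip aa ..
  also have "\<dots> = ((1 + 2 * r + 1 + (1 - r\<^sup>2) / r) / (1 + r)\<^sup>2) *\<^sub>R a"
    by (simp add: scaleR_add_left[symmetric] divide_inverse mult.commute)
  also have "(1 + 2 * r + 1 + (1 - r\<^sup>2) / r) / (1 + r)\<^sup>2 = 1 / r"
    using r by (simp add: field_simps) (simp add: power2_eq_square power3_eq_cube algebra_simps)?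
  finally show ?thesis by (simp add: r_def divide_inverse)
qed

text \<open>North-south dynamics: outside a cap around the repelling point \<open>\<zeta>\<close>, the isometry \<open>g\<close> is
  close to the radial projection of \<open>g 0\<close>.\<close>

lemma bd_action_contraction:
  assumes g: "g \<in> carrier Isom_H3" and g0: "g 0 \<noteq> 0"
  obtains \<zeta> where "\<zeta> \<in> bdH3"
    "\<And>\<xi> e. \<xi> \<in> bdH3 \<Longrightarrow> 0 < e \<Longrightarrow> e \<le> norm (\<xi> - \<zeta>) \<Longrightarrow> 1 - norm (g 0) \<le> e / 2 \<Longrightarrow>
       norm (bd_action g \<xi> - g 0 /\<^sub>R norm (g 0)) \<le> 4 * (1 - norm (g 0)) / e"
proof -
  define a where "a = g 0"
  define u where "u = a /\<^sub>R norm a"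
  define r where "r = norm a"
  have a: "norm a < 1" "a \<noteq> 0" using Isom_H3_in_H3[OF g zero_in_H3] g0 by (auto simp: H3_norm a_def)
  have r: "0 < r" "r < 1" using a by (auto simp: r_def)
  have u: "norm u = 1" using a by (simp add: u_def)
  obtain T where T: "orthogonal_transformation T" "\<forall>x\<in>H3. g x = mobius (g 0) (T x)"
    using Isom_H3_decomp[OF g] by blast
  \<comment> \<open>\<open>u\<close> is the attracting fixed point of the translation part and
    \<open>- u\<close> the repelling one; \<open>\<zeta>\<close> is pulled back through the rotation
    part.\<close>
  obtain \<zeta> where z: "T \<zeta> = - u" using orthogonal_transformation_surj[OF T(1)] by (metis surjD)
  have nT: "norm (T x) = norm x" for x using T(1) by (rule orthogonal_transformation_norm)
  show ?thesis
  proof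
    show "\<zeta> \<in> bdH3" using nT[of \<zeta>] z u by (simp add: bdH3_def)
    fix \<xi> :: "real^3" and e :: real
    assume xi: "\<xi> \<in> bdH3" and e: "0 < e" "e \<le> norm (\<xi> - \<zeta>)" "1 - norm (g 0) \<le> e / 2"
    have Txi: "norm (T \<xi>) = 1" using xi nT by (simp add: bdH3_def)
    have "T (\<xi> - \<zeta>) = T \<xi> + u"
      using T(1) z by (simp add: orthogonal_transformation_linear linear_diff)
    then have d: "e \<le> norm (T \<xi> + u)" using e(2) nT[of "\<xi> - \<zeta>"] by simp
    have "u - a = (1 - r) *\<^sub>R u" using a by (simp add: u_def r_def algebra_simps)
    then have ua: "norm (u - a) = 1 - r" using u r by simp
    have "norm (T \<xi> + u) \<le> norm (T \<xi> + a) + norm (u - a)"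
      using norm_triangle_ineq[of "T \<xi> + a" "u - a"] by simp
    then have low: "e / 2 \<le> norm (T \<xi> + a)" using d ua e(3) by (simp add: r_def a_def)
    have den1: "mobius_den a (T \<xi>) = (norm (T \<xi> + a))\<^sup>2"
      using Txi by (simp add: mobius_den_def power2_norm_eq_inner inner_add_left inner_add_right inner_commute norm_eq_1)
    have "a \<bullet> u = r" using a by (simp add: u_def r_def dot_square_norm power2_eq_square)
    then have den2: "mobius_den a u = (1 + r)\<^sup>2"
      using u by (simp add: mobius_den_def norm_eq_1 r_def dot_square_norm power2_eq_square algebra_simps)
    have nz: "mobius_den a (T \<xi>) \<noteq> 0" "mobius_den a u \<noteq> 0"
      using low e(1) r by (auto simp: den1 den2)
    have "mobius a u = u" unfolding u_def using a by (intro mobius_fixed)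
    \<comment> \<open>The distortion formula for \<open>T \<xi>\<close> and the fixed point
      \<open>u\<close>, whose denominators are squares of \<open>norm (T \<xi> + a)\<close> and of
      \<open>1 + r\<close>.\<close>
    then have "(norm (T \<xi> + a) * (1 + r) * norm (mobius a (T \<xi>) - u))\<^sup>2
        = ((1 - r) * (1 + r) * norm (T \<xi> - u))\<^sup>2"
      using norm_mobius_diff[OF nz]
      by (simp add: den1 den2 power_mult_distrib r_def[symmetric]) (simp add: power2_eq_square algebra_simps)
    then have "norm (T \<xi> + a) * (1 + r) * norm (mobius a (T \<xi>) - u) = (1 - r) * (1 + r) * norm (T \<xi> - u)"
      using r by (simp add: power2_eq_iff_nonneg)
    then have "norm (T \<xi> + a) * norm (mobius a (T \<xi>) - u) = (1 - r) * norm (T \<xi> - u)"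
      using r by simp
    moreover have "norm (T \<xi> - u) \<le> 2" using norm_triangle_ineq4[of "T \<xi>" u] Txi u by simp
    then have "(1 - r) * norm (T \<xi> - u) \<le> (1 - r) * 2" using r by (intro mult_left_mono) auto
    moreover have "e / 2 * norm (mobius a (T \<xi>) - u) \<le> norm (T \<xi> + a) * norm (mobius a (T \<xi>) - u)"
      using low by (intro mult_right_mono) auto
    ultimately have "e / 2 * norm (mobius a (T \<xi>) - u) \<le> 2 * (1 - r)" by linarith
    then have "norm (mobius a (T \<xi>) - u) \<le> 4 * (1 - r) / e" using e(1) by (simp add: field_simps)
    then show "norm (bd_action g \<xi> - g 0 /\<^sub>R norm (g 0)) \<le> 4 * (1 - norm (g 0)) / e"
      unfolding bd_action_eqI(2)[OF g T xi] by (simp add: a_def[symmetric] u_def r_def)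
  qed
qed

lemma compact_bdH3: "compact bdH3" by (simp add: bdH3_def)

text \<open>Continuity from above gives a small cap around each point. The double radius leaves room
  to move the centre, so a finite subcover yields one radius for all centres.\<close>

lemma uniformly_small_caps:
  assumes "prob_space \<nu>" and s: "sets \<nu> = sets bd_borel"
    and atomless: "\<And>\<xi>. \<xi> \<in> bdH3 \<Longrightarrow> measure \<nu> {\<xi>} = 0" and e: "0 < e"
  obtains d where "0 < d" "\<And>\<zeta>. \<zeta> \<in> bdH3 \<Longrightarrow> measure \<nu> (ball \<zeta> d \<inter> bdH3) < e"
proof -
  interpret prob_space \<nu> by fact
  have bs: "ball \<zeta> d \<inter> bdH3 \<in> sets \<nu>" for \<zeta> d
    unfolding s bd_borel_def by (subst sets_restrict_space_iff) auto
  have "\<exists>d>0. measure \<nu> (ball \<zeta> (2 * d) \<inter> bdH3) < e" if z: "\<zeta> \<in> bdH3" for \<zeta>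
  proof -
    have "(\<lambda>n. measure \<nu> (ball \<zeta> (inverse (real (Suc n))) \<inter> bdH3)) \<longlonglongrightarrow> measure \<nu> (\<Inter>n. ball \<zeta> (inverse (real (Suc n))) \<inter> bdH3)"
    proof (rule finite_Lim_measure_decseq)
      show "decseq (\<lambda>n. ball \<zeta> (inverse (real (Suc n))) \<inter> bdH3)"
        by (intro decseq_SucI Int_mono subset_ball) (auto simp: field_simps)
    qed (use bs in auto)
    also have "(\<Inter>n. ball \<zeta> (inverse (real (Suc n))) \<inter> bdH3) = {\<zeta>}"
    proof
      show "(\<Inter>n. ball \<zeta> (inverse (real (Suc n))) \<inter> bdH3) \<subseteq> {\<zeta>}"
      proof
        fix x assume x: "x \<in> (\<Inter>n. ball \<zeta> (inverse (real (Suc n))) \<inter> bdH3)"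
        have "dist \<zeta> x < inverse (real (Suc n))" for n using x by auto
        then have "dist \<zeta> x \<le> 0" using reals_Archimedean[of "dist \<zeta> x"] by (meson less_asym not_le)
        then show "x \<in> {\<zeta>}" by simp
      qed
    qed (use z in auto)
    finally have "(\<lambda>n. measure \<nu> (ball \<zeta> (inverse (real (Suc n))) \<inter> bdH3)) \<longlonglongrightarrow> 0" using atomless[OF z] by simp
    then have "eventually (\<lambda>n. measure \<nu> (ball \<zeta> (inverse (real (Suc n))) \<inter> bdH3) < e) sequentially"
      using e by (rule order_tendstoD)
    then obtain n where "measure \<nu> (ball \<zeta> (inverse (real (Suc n))) \<inter> bdH3) < e"
      by (auto simp: eventually_sequentially)
    then show ?thesis by (intro exI[of _ "inverse (real (Suc n)) / 2"]) simp
  qed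
  then obtain d where d: "\<And>\<zeta>. \<zeta> \<in> bdH3 \<Longrightarrow> 0 < d \<zeta> \<and> measure \<nu> (ball \<zeta> (2 * d \<zeta>) \<inter> bdH3) < e" by metis
  have "bdH3 \<subseteq> (\<Union>\<zeta>\<in>bdH3. ball \<zeta> (d \<zeta>))" using d by (force intro: centre_in_ball[THEN iffD2])
  then obtain Z where Z: "Z \<subseteq> bdH3" "finite Z" "bdH3 \<subseteq> (\<Union>\<zeta>\<in>Z. ball \<zeta> (d \<zeta>))"
    by (rule compactE_image[OF compact_bdH3, rotated 1]) auto
  define c where "c = Min (insert 1 (d ` Z))"
  show ?thesis
  proof
    show "0 < c" unfolding c_def using Z d by (subst Min_gr_iff) auto
    fix \<zeta> assume "\<zeta> \<in> bdH3"
    then obtain z where z: "z \<in> Z" "\<zeta> \<in> ball z (d z)" using Z(3) by blast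
    have "c \<le> d z" unfolding c_def using z(1) Z(2) by (intro Min_le) auto
    have "ball \<zeta> c \<subseteq> ball z (2 * d z)"
    proof
      fix x assume "x \<in> ball \<zeta> c"
      then show "x \<in> ball z (2 * d z)"
        using z(2) \<open>c \<le> d z\<close> dist_triangle[of z x \<zeta>] by simp
    qed
    then have "measure \<nu> (ball \<zeta> c \<inter> bdH3) \<le> measure \<nu> (ball z (2 * d z) \<inter> bdH3)"
      using bs by (intro finite_measure_mono) auto
    also have "\<dots> < e" using d z(1) Z(1) by blast
    finally show "measure \<nu> (ball \<zeta> c \<inter> bdH3) < e" .
  qed
qed

text \<open>Since \<open>cosh\<close> of the distance of \<open>x\<close> from 0 is
  \<open>(1 + |x|^2) / (1 - |x|^2)\<close>, Euclidean distance at least \<open>d\<close> from the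
  sphere bounds it by \<open>2 / d\<close>. The added 1 makes the inequality strict.\<close>

lemma finite_orbit_norm:
  assumes "\<And>r. finite {g \<in> N. hdist 0 (g 0) < r}" and N: "N \<subseteq> carrier Isom_H3" and d: "0 < d"
  shows "finite {g \<in> N. d \<le> 1 - norm (g 0)}"
proof (rule finite_subset)
  show "finite {g \<in> N. hdist 0 (g 0) < arcosh (2 / d) + 1}" by (rule assms)
  show "{g \<in> N. d \<le> 1 - norm (g 0)} \<subseteq> {g \<in> N. hdist 0 (g 0) < arcosh (2 / d) + 1}"
  proof safe
    fix g assume g: "g \<in> N" "d \<le> 1 - norm (g 0)"
    have y: "g 0 \<in> H3" using Isom_H3_in_H3[OF _ zero_in_H3] g N by blast
    let ?n = "norm (g 0)"
    have n: "0 \<le> ?n" "?n < 1" using y by (auto simp: H3_norm)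
    then have n2: "?n\<^sup>2 \<le> ?n" "0 \<le> ?n\<^sup>2" by (auto simp: power2_eq_square mult_left_le)
    have d1: "d \<le> 1" using g(2) n(1) by linarith
    have "cosh (hdist 0 (g 0)) = (1 + ?n\<^sup>2) / (1 - ?n\<^sup>2)" by (rule hdist_0_norm[OF y])
    also have "\<dots> \<le> 2 / d"
      using n n2 g(2) d by (intro frac_le) auto
    also have "\<dots> = cosh (arcosh (2 / d))" using d d1 by (simp add: field_simps)
    finally have "hdist 0 (g 0) \<le> arcosh (2 / d)"
      using hdist_nonneg[OF zero_in_H3 y] d d1 by (subst (asm) cosh_real_nonneg_le_iff) (auto simp: field_simps)
    then show "hdist 0 (g 0) < arcosh (2 / d) + 1" by simp
  qed
qed

text \<open>When \<open>g 0\<close> is close to the sphere, \<open>bd_action g\<close> sends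
  everything outside one small cap close to the projection of \<open>g 0\<close>. The cap has small
  mass, and elsewhere uniform continuity of \<open>f\<close> applies.\<close>

lemma integral_bd_action_near_boundary:
  assumes P: "prob_space \<nu>" and s: "sets \<nu> = sets bd_borel"
    and atomless: "\<And>\<xi>. \<xi> \<in> bdH3 \<Longrightarrow> measure \<nu> {\<xi>} = 0"
    and fin: "\<And>r. finite {g \<in> N. hdist 0 (g 0) < r}" and N: "N \<subseteq> carrier Isom_H3"
    and f: "continuous_on bdH3 f" "\<And>\<xi>. \<xi> \<in> bdH3 \<Longrightarrow> 0 \<le> f \<xi>" "\<And>\<xi>. \<xi> \<in> bdH3 \<Longrightarrow> f \<xi> \<le> (1::real)"
    and e: "0 < e"
  shows "finite {g \<in> N. e < \<bar>(\<integral>\<xi>. f (bd_action g \<xi>) \<partial>\<nu>) - f (g 0 /\<^sub>R norm (g 0))\<bar>}"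
proof -
  interpret prob_space \<nu> by fact
  have sp: "space \<nu> = bdH3" using sets_eq_imp_space_eq[OF s] by simp
  obtain d1 where d1: "0 < d1" "\<And>x y. x \<in> bdH3 \<Longrightarrow> y \<in> bdH3 \<Longrightarrow> dist y x < d1 \<Longrightarrow> dist (f y) (f x) < e / 2"
    using compact_uniformly_continuous[OF f(1) compact_bdH3] e unfolding uniformly_continuous_on_def
    by (metis half_gt_zero)
  obtain d2 where d2: "0 < d2" "\<And>\<zeta>. \<zeta> \<in> bdH3 \<Longrightarrow> measure \<nu> (ball \<zeta> d2 \<inter> bdH3) < e / 2"
    using uniformly_small_caps[OF P s, of "e / 2"] atomless e by (metis half_gt_zero)
  \<comment> \<open>In order: the smallness asked for by the contraction estimate with cap radius
    \<open>d2\<close>, the exclusion of \<open>g 0 = 0\<close>, and a contraction error below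
    \<open>d1\<close>.\<close>
  define d where "d = min (d2 / 2) (min (1 / 2) (d1 * d2 / 8))"
  have d: "0 < d" using d1 d2 by (simp add: d_def)
  show ?thesis
  proof (rule finite_subset)
    show "finite {g \<in> N. d \<le> 1 - norm (g 0)}" using fin N d by (rule finite_orbit_norm)
    have "\<bar>(\<integral>\<xi>. f (bd_action g \<xi>) \<partial>\<nu>) - f (g 0 /\<^sub>R norm (g 0))\<bar> \<le> e"
      if g: "g \<in> N" and dg: "1 - norm (g 0) < d" for g
    proof -
      have gc: "g \<in> carrier Isom_H3" using g N by auto
      have "g 0 \<noteq> 0" using dg by (auto simp: d_def)
      then have uB: "g 0 /\<^sub>R norm (g 0) \<in> bdH3" by (simp add: bdH3_def)
      let ?u = "g 0 /\<^sub>R norm (g 0)"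
      obtain \<zeta> where z: "\<zeta> \<in> bdH3" "\<And>\<xi> e. \<xi> \<in> bdH3 \<Longrightarrow> 0 < e \<Longrightarrow> e \<le> norm (\<xi> - \<zeta>) \<Longrightarrow> 1 - norm (g 0) \<le> e / 2 \<Longrightarrow>
         norm (bd_action g \<xi> - ?u) \<le> 4 * (1 - norm (g 0)) / e"
        using bd_action_contraction[OF gc \<open>g 0 \<noteq> 0\<close>] by metis
      have fm: "(\<lambda>\<xi>. f (bd_action g \<xi>)) \<in> borel_measurable \<nu>"
        using measurable_compose[OF bd_action_measurable(1)[OF gc] continuous_on_measurable_bd_borel[OF f(1)]]
        by (simp add: measurable_cong_sets[OF s refl])
      have b: "\<bar>f (bd_action g \<xi>) - f ?u\<bar> \<le> e / 2 + indicator (ball \<zeta> d2 \<inter> bdH3) \<xi>" if xi: "\<xi> \<in> bdH3" for \<xi>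
      proof (cases "\<xi> \<in> ball \<zeta> d2")
        case True
        have "0 \<le> f (bd_action g \<xi>)" "f (bd_action g \<xi>) \<le> 1" "0 \<le> f ?u" "f ?u \<le> 1"
          using f(2,3) bd_action_in[OF gc xi] uB by auto
        then show ?thesis using True xi e by (simp add: abs_le_iff)
      next
        case False
        then have "norm (bd_action g \<xi> - ?u) \<le> 4 * (1 - norm (g 0)) / d2"
          using dg xi d2(1) by (intro z(2)) (auto simp: d_def dist_norm norm_minus_commute)
        also have "\<dots> < d1"
        proof -
          define p where "p = d1 * d2"
          have "0 < p" using d1(1) d2(1) by (simp add: p_def)
          moreover have "1 - norm (g 0) < p / 8" using dg by (simp add: d_def p_def)
          ultimately have "4 * (1 - norm (g 0)) < p" by argo
          then have "4 * (1 - norm (g 0)) < d1 * d2" by (simp add: p_def)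
          then show ?thesis using d2(1) by (simp add: field_simps)
        qed
        finally have "dist (f (bd_action g \<xi>)) (f ?u) < e / 2"
          using d1(2)[OF uB bd_action_in[OF gc xi]] by (simp add: dist_norm)
        then show ?thesis using False by (simp add: dist_real_def)
      qed
      have int: "integrable \<nu> (\<lambda>\<xi>. f (bd_action g \<xi>))"
        using f(2,3) bd_action_in[OF gc] fm sp by (intro integrable_const_bound[where B = 1]) (auto intro!: AE_I2)
      have bs: "ball \<zeta> d2 \<inter> bdH3 \<in> sets \<nu>"
        unfolding s bd_borel_def by (subst sets_restrict_space_iff) auto
      have ii: "integrable \<nu> (indicator (ball \<zeta> d2 \<inter> bdH3) :: _ \<Rightarrow> real)"
        using bs by (intro integrable_real_indicator) (auto simp: emeasure_eq_measure)
      have "integrable \<nu> (\<lambda>\<xi>. e / 2 + indicator (ball \<zeta> d2 \<inter> bdH3) \<xi>)"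
        by (intro Bochner_Integration.integrable_add ii) simp
      note int = int this ii
      have "\<bar>(\<integral>\<xi>. f (bd_action g \<xi>) \<partial>\<nu>) - f ?u\<bar> = \<bar>\<integral>\<xi>. f (bd_action g \<xi>) - f ?u \<partial>\<nu>\<bar>"
        using int by (simp add: prob_space)
      also have "\<dots> \<le> (\<integral>\<xi>. \<bar>f (bd_action g \<xi>) - f ?u\<bar> \<partial>\<nu>)" by (rule integral_abs_bound)
      also have "\<dots> \<le> (\<integral>\<xi>. e / 2 + indicator (ball \<zeta> d2 \<inter> bdH3) \<xi> \<partial>\<nu>)"
        using int b sp bs by (intro integral_mono) auto
      also have "\<dots> = e / 2 + measure \<nu> (ball \<zeta> d2 \<inter> bdH3)"
        using ii bs sp by (subst Bochner_Integration.integral_add) (auto simp: prob_space[unfolded sp] Int_absorb2)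
      also have "\<dots> \<le> e" using d2(2)[OF z(1)] by simp
      finally show ?thesis .
    qed
    then show "{g \<in> N. e < \<bar>(\<integral>\<xi>. f (bd_action g \<xi>) \<partial>\<nu>) - f (g 0 /\<^sub>R norm (g 0))\<bar>} \<subseteq> {g \<in> N. d \<le> 1 - norm (g 0)}"
      by force
  qed
qed

section \<open>Integration against stationary measures\<close>

lemma nn_integral_pmf_support:
  "(\<integral>\<^sup>+k. f k \<partial>measure_pmf m) = (\<integral>\<^sup>+k. ennreal (pmf m k) * f k \<partial>count_space (set_pmf m))"
  unfolding nn_integral_measure_pmf by (rule nn_integral_count_space_eq) (auto simp: set_pmf_iff)

lemma nn_integral_pmf_swap:
  assumes "\<And>k. k \<in> set_pmf m \<Longrightarrow> f k \<in> borel_measurable M"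
  shows "(\<integral>\<^sup>+x. \<integral>\<^sup>+k. f k x \<partial>measure_pmf m \<partial>M) = (\<integral>\<^sup>+k. \<integral>\<^sup>+x. f k x \<partial>M \<partial>measure_pmf m)"
proof -
  have "(\<integral>\<^sup>+x. \<integral>\<^sup>+k. f k x \<partial>measure_pmf m \<partial>M)
     = (\<integral>\<^sup>+k. \<integral>\<^sup>+x. ennreal (pmf m k) * f k x \<partial>M \<partial>count_space (set_pmf m))"
    unfolding nn_integral_pmf_support[of m]
    using assms by (intro nn_integral_count_space_nn_integral) auto
  also have "\<dots> = (\<integral>\<^sup>+k. ennreal (pmf m k) * (\<integral>\<^sup>+x. f k x \<partial>M) \<partial>count_space (set_pmf m))"
    using assms by (intro nn_integral_cong nn_integral_cmult) auto
  finally show ?thesis by (simp only: nn_integral_pmf_support[of m])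
qed

text \<open>Stationarity is stated for sets. Reading it as \<open>\<nu> = m \<bind> K\<close> in the
  Giry monad transfers it to integrals.\<close>

lemma nn_integral_stationary:
  assumes st: "stationary m \<nu>" and m: "set_pmf m \<subseteq> carrier Isom_H3" and F: "F \<in> borel_measurable bd_borel"
  shows "(\<integral>\<^sup>+\<xi>. F \<xi> \<partial>\<nu>) = (\<integral>\<^sup>+k. \<integral>\<^sup>+\<xi>. F (bd_action k \<xi>) \<partial>\<nu> \<partial>measure_pmf m)"
proof -
  have P: "prob_space \<nu>" and s: "sets \<nu> = sets bd_borel"
    and e: "\<And>A. A \<in> sets bd_borel \<Longrightarrow> (\<integral>\<^sup>+g. emeasure (distr \<nu> bd_borel (bd_action g)) A \<partial>measure_pmf m) = emeasure \<nu> A"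
    using st by (auto simp: stationary_iff)
  have bm: "bd_action k \<in> \<nu> \<rightarrow>\<^sub>M bd_borel" if "k \<in> set_pmf m" for k
    using bd_action_measurable(1) that m by (auto simp: measurable_cong_sets[OF s refl])
  \<comment> \<open>Off the support the value \<open>\<nu>\<close> is a default that makes
    \<open>K\<close> a probability kernel everywhere.\<close>
  define K where "K k = (if k \<in> set_pmf m then distr \<nu> bd_borel (bd_action k) else \<nu>)" for k
  have K: "K k \<in> space (subprob_algebra bd_borel)" for k
    using bm[of k] P s unfolding K_def
    by (auto simp: space_subprob_algebra intro!: prob_space_imp_subprob_space prob_space.prob_space_distr)
  then have Km: "K \<in> measure_pmf m \<rightarrow>\<^sub>M subprob_algebra bd_borel" by simp
  have "\<nu> = measure_pmf m \<bind> K"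
  proof (rule measure_eqI)
    show "sets \<nu> = sets (measure_pmf m \<bind> K)"
      using K by (subst sets_bind[where N = bd_borel]) (auto simp: s space_subprob_algebra)
    fix A assume "A \<in> sets \<nu>"
    then have A: "A \<in> sets bd_borel" by (simp add: s)
    have "emeasure (measure_pmf m \<bind> K) A = (\<integral>\<^sup>+k. emeasure (K k) A \<partial>measure_pmf m)"
      using Km A by (intro emeasure_bind) auto
    also have "\<dots> = (\<integral>\<^sup>+k. emeasure (distr \<nu> bd_borel (bd_action k)) A \<partial>measure_pmf m)"
      by (intro nn_integral_cong_AE) (auto simp: AE_measure_pmf_iff K_def)
    finally show "emeasure \<nu> A = emeasure (measure_pmf m \<bind> K) A" using e[OF A] by simp
  qed
  then have "(\<integral>\<^sup>+\<xi>. F \<xi> \<partial>\<nu>) = (\<integral>\<^sup>+k. \<integral>\<^sup>+\<xi>. F \<xi> \<partial>K k \<partial>measure_pmf m)"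
    using nn_integral_bind[OF F Km] by simp
  also have "\<dots> = (\<integral>\<^sup>+k. \<integral>\<^sup>+\<xi>. F (bd_action k \<xi>) \<partial>\<nu> \<partial>measure_pmf m)"
    using bm F by (intro nn_integral_cong_AE) (auto simp: AE_measure_pmf_iff K_def nn_integral_distr)
  finally show ?thesis .
qed

text \<open>The cone over a point lies in a hyperplane through 0, which is a null set.\<close>

lemma unif_sphere_atomless:
  assumes xi: "\<xi> \<in> bdH3"
  shows "measure unif_sphere {\<xi>} = 0"
proof -
  obtain b where b: "b \<noteq> 0" "orthogonal \<xi> b"
    using orthogonal_to_vector_exists[of \<xi>] by auto
  have s: "{\<xi>} \<in> sets bd_borel"
    using xi unfolding bd_borel_def by (subst sets_restrict_space_iff) auto
  have "(\<integral>\<^sup>+x. indicator {\<xi>} (x /\<^sub>R norm x) \<partial>restrict_space lborel pball) \<le> (\<integral>\<^sup>+x. indicator {x. b \<bullet> x = 0} x \<partial>lborel)"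
    unfolding nn_integral_restrict_space[of pball lborel, simplified]
  proof (rule nn_integral_mono)
    fix x
    have "b \<bullet> x = 0" if "x /\<^sub>R norm x = \<xi>" "x \<noteq> 0"
      using b(2) that by (auto simp: orthogonal_def inner_commute)
    then show "indicator {\<xi>} (x /\<^sub>R norm x) * indicator pball x \<le> (indicator {x. b \<bullet> x = 0} x :: ennreal)"
      by (auto simp: indicator_def)
  qed
  also have "\<dots> = emeasure lborel {x. b \<bullet> x = 0}" by (rule nn_integral_indicator) simp
  also have "\<dots> = 0"
  proof -
    have "{x. b \<bullet> x = 0} \<in> null_sets lebesgue"
      using negligible_hyperplane[of b 0] b(1) by (simp add: negligible_iff_null_sets)
    then have "emeasure lebesgue {x. b \<bullet> x = 0} = 0" by auto
    then show ?thesis by simp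
  qed
  finally have "(\<integral>\<^sup>+\<zeta>. indicator {\<xi>} \<zeta> \<partial>unif_sphere) = 0"
    using s by (subst nn_integral_unif_sphere) auto
  then show ?thesis using s by (simp add: measure_def)
qed

section \<open>Stationarity, maximum principle and absence of atoms\<close>

text \<open>Used for the fibre group with its return distribution and, in the proof that this group
  is infinite, for the lattice with its step distribution.\<close>

locale boundary_walk =
  fixes N :: "(real^3 \<Rightarrow> real^3) set" and m :: "(real^3 \<Rightarrow> real^3) pmf"
  assumes subgroup_N: "subgroup N Isom_H3"
    and infinite_N: "infinite N"
    and finite_orbit: "finite {g \<in> N. hdist 0 (g 0) < r}"
    and support: "set_pmf m \<subseteq> N"
    and symmetric: "g \<in> N \<Longrightarrow> pmf m (inv\<^bsub>Isom_H3\<^esub> g) = pmf m g"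
    and generates: "generate Isom_H3 (set_pmf m) = N"
    and superharmonic: "\<xi> \<in> bdH3 \<Longrightarrow> (\<integral>\<^sup>+g. ennreal (poisson (g 0) \<xi>) \<partial>measure_pmf m) \<le> 1"
begin

sublocale I: group Isom_H3 by (rule group_Isom_H3)

abbreviation mul (infixl "\<cdot>" 70) where "g \<cdot> h \<equiv> g \<otimes>\<^bsub>Isom_H3\<^esub> h"
abbreviation iv where "iv g \<equiv> inv\<^bsub>Isom_H3\<^esub> g"
abbreviation e where "e \<equiv> \<one>\<^bsub>Isom_H3\<^esub>"

lemma N_carrier: "N \<subseteq> carrier Isom_H3" using subgroup.subset[OF subgroup_N] .
lemma in_carrier: "g \<in> N \<Longrightarrow> g \<in> carrier Isom_H3" using N_carrier by blast
lemma supp_in: "k \<in> set_pmf m \<Longrightarrow> k \<in> N" using support by blast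
lemma supp_carrier: "set_pmf m \<subseteq> carrier Isom_H3" using support N_carrier by blast
lemma mult_in: "g \<in> N \<Longrightarrow> h \<in> N \<Longrightarrow> g \<cdot> h \<in> N" using subgroup.m_closed[OF subgroup_N] .
lemma inv_in: "g \<in> N \<Longrightarrow> iv g \<in> N" using subgroup.m_inv_closed[OF subgroup_N] .
lemma one_in: "e \<in> N" using subgroup.one_closed[OF subgroup_N] .

lemma supp_inv: "k \<in> set_pmf m \<Longrightarrow> iv k \<in> set_pmf m"
  using symmetric[OF supp_in, of k] by (simp add: set_pmf_iff)

lemma generates_closed:
  assumes "h \<in> N" and step: "\<forall>g\<in>Z. \<forall>k\<in>set_pmf m. g \<cdot> k \<in> Z" and ZN: "Z \<subseteq> N"
  shows "g \<in> Z \<Longrightarrow> g \<cdot> h \<in> Z"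
proof -
  have "h \<in> generate Isom_H3 (set_pmf m)" using assms(1) generates by simp
  then have "\<forall>g\<in>Z. g \<cdot> h \<in> Z"
  proof induction
    case one
    show ?case using ZN in_carrier by auto
  next
    case (incl k)
    then show ?case using step by blast
  next
    case (inv k)
    then show ?case using step supp_inv by blast
  next
    case (eng h1 h2)
    show ?case
    proof
      fix g assume g: "g \<in> Z"
      have "h1 \<in> N" "h2 \<in> N" "g \<in> N" using eng(1,2) g ZN generates by auto
      then have "g \<cdot> (h1 \<cdot> h2) = (g \<cdot> h1) \<cdot> h2" by (simp add: I.m_assoc in_carrier)
      then show "g \<cdot> (h1 \<cdot> h2) \<in> Z" using eng(3,4) g by auto
    qed
  qed
  then show "g \<in> Z \<Longrightarrow> g \<cdot> h \<in> Z" by blast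
qed

text \<open>The average of the push-forwards has the averaged Poisson kernel as its density, which
  is at most 1. It is therefore at most \<open>unif_sphere\<close> on every set; applying this to a
  set and to its complement, with equal total masses, gives equality.\<close>

lemma stationary_unif_sphere: "stationary m unif_sphere"
  unfolding stationary_iff
proof (intro conjI ballI)
  show P: "prob_space unif_sphere" by (rule prob_space_unif_sphere)
  show "sets unif_sphere = sets bd_borel" by simp
  interpret prob_space unif_sphere by fact
  define L where "L A = (\<integral>\<^sup>+g. emeasure (distr unif_sphere bd_borel (bd_action g)) A \<partial>measure_pmf m)" for A
  define F where "F \<xi> = (\<integral>\<^sup>+g. ennreal (poisson (g 0) \<xi>) \<partial>measure_pmf m)" for \<xi>
  have bm: "bd_action k \<in> unif_sphere \<rightarrow>\<^sub>M bd_borel" if "k \<in> set_pmf m" for k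
    using bd_action_measurable(1)[of k] that supp_carrier by (auto simp: measurable_cong_sets[OF sets_unif_sphere refl])
  have L: "L A = (\<integral>\<^sup>+\<xi>. indicator A \<xi> * F \<xi> \<partial>unif_sphere)" if A: "A \<in> sets bd_borel" for A
  proof -
    have "L A = (\<integral>\<^sup>+k. \<integral>\<^sup>+\<xi>. indicator A \<xi> * ennreal (poisson (k 0) \<xi>) \<partial>unif_sphere \<partial>measure_pmf m)"
      unfolding L_def
    proof (intro nn_integral_cong_AE, unfold AE_measure_pmf_iff, intro ballI)
      fix k assume k: "k \<in> set_pmf m"
      then have kc: "k \<in> carrier Isom_H3" using supp_carrier by blast
      have "emeasure (distr unif_sphere bd_borel (bd_action k)) A = (\<integral>\<^sup>+\<xi>. indicator A (bd_action k \<xi>) \<partial>unif_sphere)"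
      proof -
        have "(\<integral>\<^sup>+\<xi>. indicator A (bd_action k \<xi>) \<partial>unif_sphere)
            = (\<integral>\<^sup>+\<xi>. indicator A \<xi> \<partial>distr unif_sphere bd_borel (bd_action k))"
          using A bm[OF k] by (intro nn_integral_distr[symmetric]) auto
        then show ?thesis using A by simp
      qed
      also have "\<dots> = (\<integral>\<^sup>+\<xi>. indicator A \<xi> * ennreal (poisson (k 0) \<xi>) \<partial>unif_sphere)"
        using A by (intro nn_integral_unif_sphere_bd_action[OF kc]) auto
      finally show "emeasure (distr unif_sphere bd_borel (bd_action k)) A = (\<integral>\<^sup>+\<xi>. indicator A \<xi> * ennreal (poisson (k 0) \<xi>) \<partial>unif_sphere)" .
    qed
    also have "\<dots> = (\<integral>\<^sup>+\<xi>. \<integral>\<^sup>+k. indicator A \<xi> * ennreal (poisson (k 0) \<xi>) \<partial>measure_pmf m \<partial>unif_sphere)"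
      using A by (intro nn_integral_pmf_swap[symmetric]) (auto simp: measurable_cong_sets[OF sets_unif_sphere refl])
    also have "\<dots> = (\<integral>\<^sup>+\<xi>. indicator A \<xi> * F \<xi> \<partial>unif_sphere)"
      unfolding F_def by (intro nn_integral_cong nn_integral_cmult) simp
    finally show ?thesis .
  qed
  have Le: "L A \<le> emeasure unif_sphere A" if A: "A \<in> sets bd_borel" for A
  proof -
    have "L A \<le> (\<integral>\<^sup>+\<xi>. indicator A \<xi> * 1 \<partial>unif_sphere)"
      unfolding L[OF A] using superharmonic by (intro nn_integral_mono mult_left_mono) (auto simp: F_def)
    then show ?thesis using A by simp
  qed
  fix A assume A: "A \<in> sets bd_borel"
  then have Ac: "bdH3 - A \<in> sets bd_borel" using sets.compl_sets[OF A] by simp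
  have A_sub: "A \<subseteq> bdH3" using sets.sets_into_space[OF A] by simp
  have "emeasure (distr unif_sphere bd_borel (bd_action k)) A + emeasure (distr unif_sphere bd_borel (bd_action k)) (bdH3 - A) = 1"
    if "k \<in> set_pmf m" for k
  proof -
    have "prob_space (distr unif_sphere bd_borel (bd_action k))" using P bm[OF that] by (simp add: prob_space.prob_space_distr)
    then have "emeasure (distr unif_sphere bd_borel (bd_action k)) bdH3 = 1"
      using prob_space.emeasure_space_1 by fastforce
    moreover have "emeasure (distr unif_sphere bd_borel (bd_action k)) A + emeasure (distr unif_sphere bd_borel (bd_action k)) (bdH3 - A)
      = emeasure (distr unif_sphere bd_borel (bd_action k)) (A \<union> (bdH3 - A))"
      using A Ac by (intro plus_emeasure) auto
    ultimately show ?thesis using A_sub by (simp add: Un_absorb1)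
  qed
  then have "(\<integral>\<^sup>+k. emeasure (distr unif_sphere bd_borel (bd_action k)) A + emeasure (distr unif_sphere bd_borel (bd_action k)) (bdH3 - A) \<partial>measure_pmf m)
      = (\<integral>\<^sup>+k. 1 \<partial>measure_pmf m)"
    by (intro nn_integral_cong_AE) (auto simp: AE_measure_pmf_iff)
  then have sum: "L A + L (bdH3 - A) = 1"
    unfolding L_def by (simp add: nn_integral_add measure_pmf.emeasure_space_1[simplified])
  have sum2: "emeasure unif_sphere A + emeasure unif_sphere (bdH3 - A) = 1"
    using A Ac A_sub emeasure_space_1 by (subst plus_emeasure) (auto simp: Un_absorb1)
  show "L A = emeasure unif_sphere A"
  proof (rule antisym[OF Le[OF A]])
    have fin: "emeasure unif_sphere (bdH3 - A) \<noteq> \<infinity>" by simp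
    have "emeasure unif_sphere A + emeasure unif_sphere (bdH3 - A) \<le> L A + emeasure unif_sphere (bdH3 - A)"
      using sum sum2 Le[OF Ac] by (metis add_left_mono)
    then show "emeasure unif_sphere A \<le> L A" using fin by (simp add: ennreal_add_left_cancel_le add.commute)
  qed
qed

text \<open>The Poisson-type integral of \<open>f\<close>, as a function of \<open>g\<close>, is
  bounded and harmonic for right multiplication by the support of \<open>m\<close>.\<close>

lemma integral_stationary:
  assumes st: "stationary m \<nu>"
    and f: "continuous_on bdH3 f" "\<forall>\<xi>\<in>bdH3. 0 \<le> f \<xi> \<and> f \<xi> \<le> (1::real)"
    and g: "g \<in> N"
  shows "(\<integral>\<xi>. f (bd_action g \<xi>) \<partial>\<nu>) = measure_pmf.expectation m (\<lambda>k. \<integral>\<xi>. f (bd_action (g \<cdot> k) \<xi>) \<partial>\<nu>)"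
    "0 \<le> (\<integral>\<xi>. f (bd_action g \<xi>) \<partial>\<nu>)" "(\<integral>\<xi>. f (bd_action g \<xi>) \<partial>\<nu>) \<le> 1"
proof -
  have P: "prob_space \<nu>" and s: "sets \<nu> = sets bd_borel" using st by (auto simp: stationary_iff)
  interpret prob_space \<nu> by fact
  have sp: "space \<nu> = bdH3" using sets_eq_imp_space_eq[OF s] by simp
  have fm: "f \<in> borel_measurable bd_borel" by (rule continuous_on_measurable_bd_borel[OF f(1)])
  have fbm: "(\<lambda>\<xi>. f (bd_action g \<xi>)) \<in> borel_measurable bd_borel" if "g \<in> N" for g
    using measurable_compose[OF bd_action_measurable(1)[OF in_carrier[OF that]] fm] .
  have fb: "0 \<le> f (bd_action g \<xi>)" "f (bd_action g \<xi>) \<le> 1" if "g \<in> N" "\<xi> \<in> bdH3" for g \<xi>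
    using f(2) bd_action_in[OF in_carrier[OF that(1)] that(2)] by auto
  have int: "integrable \<nu> (\<lambda>\<xi>. f (bd_action g \<xi>))" if "g \<in> N" for g
    using fbm[OF that] fb[OF that] sp
    by (intro integrable_const_bound[where B = 1]) (auto simp: measurable_cong_sets[OF s refl] intro!: AE_I2)
  define h where "h g = (\<integral>\<xi>. f (bd_action g \<xi>) \<partial>\<nu>)" for g
  have h: "0 \<le> h g" "h g \<le> 1" if "g \<in> N" for g
  proof -
    show "0 \<le> h g" unfolding h_def using fb[OF that] sp by (intro integral_nonneg_AE AE_I2) auto
    show "h g \<le> 1" unfolding h_def using int[OF that] fb[OF that] sp by (intro integral_le_const) (auto intro!: AE_I2)
  qed
  have nn: "(\<integral>\<^sup>+\<xi>. ennreal (f (bd_action g \<xi>)) \<partial>\<nu>) = ennreal (h g)" if "g \<in> N" for g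
    unfolding h_def using int[OF that] fb[OF that] sp by (intro nn_integral_eq_integral AE_I2) auto
  have "ennreal (h g) = (\<integral>\<^sup>+k. \<integral>\<^sup>+\<xi>. ennreal (f (bd_action g (bd_action k \<xi>))) \<partial>\<nu> \<partial>measure_pmf m)"
    unfolding nn[OF g, symmetric] using fbm[OF g]
    by (intro nn_integral_stationary[OF st supp_carrier]) auto
  also have "\<dots> = (\<integral>\<^sup>+k. ennreal (h (g \<cdot> k)) \<partial>measure_pmf m)"
  proof (intro nn_integral_cong_AE, unfold AE_measure_pmf_iff, intro ballI)
    fix k assume k: "k \<in> set_pmf m"
    have "(\<integral>\<^sup>+\<xi>. ennreal (f (bd_action g (bd_action k \<xi>))) \<partial>\<nu>) = (\<integral>\<^sup>+\<xi>. ennreal (f (bd_action (g \<cdot> k) \<xi>)) \<partial>\<nu>)"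
      using sp by (intro nn_integral_cong) (simp add: bd_action_mult in_carrier g supp_in[OF k])
    then show "(\<integral>\<^sup>+\<xi>. ennreal (f (bd_action g (bd_action k \<xi>))) \<partial>\<nu>) = ennreal (h (g \<cdot> k))"
      using nn[OF mult_in[OF g supp_in[OF k]]] by simp
  qed
  also have "\<dots> = ennreal (measure_pmf.expectation m (\<lambda>k. h (g \<cdot> k)))"
  proof (rule nn_integral_eq_integral)
    show "AE k in measure_pmf m. 0 \<le> h (g \<cdot> k)"
      unfolding AE_measure_pmf_iff using h(1) mult_in[OF g] supp_in by blast
    have "AE k in measure_pmf m. norm (h (g \<cdot> k)) \<le> 1"
      unfolding AE_measure_pmf_iff using h mult_in[OF g] supp_in by (auto simp: abs_le_iff)
    then show "integrable (measure_pmf m) (\<lambda>k. h (g \<cdot> k))"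
      by (intro measure_pmf.integrable_const_bound) auto
  qed
  moreover have "0 \<le> measure_pmf.expectation m (\<lambda>k. h (g \<cdot> k))"
    using h(1) mult_in[OF g] supp_in by (intro integral_nonneg_AE) (auto simp: AE_measure_pmf_iff)
  ultimately have "h g = measure_pmf.expectation m (\<lambda>k. h (g \<cdot> k))" using h(1)[OF g] by simp
  then show "(\<integral>\<xi>. f (bd_action g \<xi>) \<partial>\<nu>) = measure_pmf.expectation m (\<lambda>k. \<integral>\<xi>. f (bd_action (g \<cdot> k) \<xi>) \<partial>\<nu>)"
    by (simp add: h_def)
  show "0 \<le> (\<integral>\<xi>. f (bd_action g \<xi>) \<partial>\<nu>)" "(\<integral>\<xi>. f (bd_action g \<xi>) \<partial>\<nu>) \<le> 1"
    using h[OF g] by (auto simp: h_def)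
qed

text \<open>The maximum principle: a harmonic function vanishing at infinity attains its supremum.\<close>

lemma harmonic_nonpos:
  assumes harm: "\<And>g. g \<in> N \<Longrightarrow> D g = measure_pmf.expectation m (\<lambda>k. D (g \<cdot> k))"
    and bdd: "\<And>g. g \<in> N \<Longrightarrow> \<bar>D g\<bar> \<le> B"
    and fin: "\<And>c. 0 < c \<Longrightarrow> finite {g \<in> N. c < D g}" and g: "g \<in> N"
  shows "D g \<le> (0::real)"
proof (rule ccontr)
  assume "\<not> D g \<le> 0"
  then have pos: "0 < D g" by simp
  define S where "S = {h \<in> N. D g / 2 < D h}"
  have S: "finite S" "g \<in> S" using fin[of "D g / 2"] pos g by (auto simp: S_def)
  define M where "M = Max (D ` S)"
  have gM: "D g \<le> M" unfolding M_def using S by (intro Max_ge) auto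
  have M: "D h \<le> M" if "h \<in> N" for h
  proof (cases "h \<in> S")
    case True
    then show ?thesis unfolding M_def using S by (intro Max_ge) auto
  next
    case False
    then show ?thesis using that gM pos by (auto simp: S_def)
  qed
  have "M \<in> D ` S" unfolding M_def using S by (intro Max_in) auto
  then obtain g0 where g0: "g0 \<in> N" "D g0 = M" by (auto simp: S_def)
  \<comment> \<open>The maximisers. Harmonicity closes them under right multiplication by the
    support, so they would be all of \<open>N\<close>, whereas \<open>S\<close> contains them and is
    finite.\<close>
  define Z where "Z = {h \<in> N. D h = M}"
  have ZN: "Z \<subseteq> N" by (auto simp: Z_def)
  have step: "h \<cdot> k \<in> Z" if h: "h \<in> Z" and k: "k \<in> set_pmf m" for h k
  proof -
    have hN: "h \<in> N" and hM: "D h = M" using h by (auto simp: Z_def)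
    have int: "integrable (measure_pmf m) (\<lambda>k. D (h \<cdot> k))"
      using bdd mult_in[OF hN] supp_in
      by (intro measure_pmf.integrable_const_bound[where B = B]) (auto simp: AE_measure_pmf_iff)
    have "measure_pmf.expectation m (\<lambda>k. M - D (h \<cdot> k)) = 0"
      using int harm[OF hN] hM by simp
    moreover have "AE k in measure_pmf m. 0 \<le> M - D (h \<cdot> k)"
      using M mult_in[OF hN] supp_in by (auto simp: AE_measure_pmf_iff)
    ultimately have "AE k in measure_pmf m. M - D (h \<cdot> k) = 0"
      using int by (subst (asm) integral_nonneg_eq_0_iff_AE) auto
    then show ?thesis using k mult_in[OF hN supp_in[OF k]] by (auto simp: AE_measure_pmf_iff Z_def)
  qed
  have "N \<subseteq> Z"
  proof
    fix h assume h: "h \<in> N"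
    have "g0 \<cdot> (iv g0 \<cdot> h) \<in> Z"
    proof (rule generates_closed)
      show "iv g0 \<cdot> h \<in> N" by (rule mult_in[OF inv_in[OF g0(1)] h])
      show "g0 \<in> Z" using g0 by (simp add: Z_def)
      show "\<forall>g\<in>Z. \<forall>k\<in>set_pmf m. g \<cdot> k \<in> Z" using step by blast
    qed (rule ZN)
    then show "h \<in> Z" using in_carrier[OF h] in_carrier[OF g0(1)] by (simp add: I.m_assoc[symmetric])
  qed
  then have "N \<subseteq> S" using gM pos by (auto simp: Z_def S_def)
  then show False using S(1) infinite_N finite_subset by blast
qed

text \<open>Both integrals approach the same value, that of \<open>f\<close> at the projection of
  \<open>g 0\<close>, so their difference vanishes at infinity and the maximum principle applies at
  the identity.\<close>

lemma stationary_agree: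
  assumes st: "stationary m \<nu>" "stationary m \<nu>'"
    and atomless: "\<And>\<xi>. \<xi> \<in> bdH3 \<Longrightarrow> measure \<nu> {\<xi>} = 0" "\<And>\<xi>. \<xi> \<in> bdH3 \<Longrightarrow> measure \<nu>' {\<xi>} = 0"
    and f: "continuous_on bdH3 f" "\<forall>\<xi>\<in>bdH3. 0 \<le> f \<xi> \<and> f \<xi> \<le> (1::real)"
  shows "(\<integral>\<xi>. f \<xi> \<partial>\<nu>) \<le> (\<integral>\<xi>. f \<xi> \<partial>\<nu>')"
proof -
  have P: "prob_space \<nu>" "prob_space \<nu>'" and s: "sets \<nu> = sets bd_borel" "sets \<nu>' = sets bd_borel"
    using st by (auto simp: stationary_iff)
  have sp: "space \<nu> = bdH3" "space \<nu>' = bdH3" using s[THEN sets_eq_imp_space_eq] by auto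
  define D where "D g = (\<integral>\<xi>. f (bd_action g \<xi>) \<partial>\<nu>) - (\<integral>\<xi>. f (bd_action g \<xi>) \<partial>\<nu>')" for g
  note 1 = integral_stationary[OF st(1) f] and 2 = integral_stationary[OF st(2) f]
  have "D e \<le> 0"
  proof (rule harmonic_nonpos[OF _ _ _ one_in])
    fix g assume g: "g \<in> N"
    have i: "integrable (measure_pmf m) (\<lambda>k. \<integral>\<xi>. f (bd_action (g \<cdot> k) \<xi>) \<partial>\<mu>)" if "\<mu> = \<nu> \<or> \<mu> = \<nu>'" for \<mu>
      using that 1(2,3)[OF mult_in[OF g supp_in]] 2(2,3)[OF mult_in[OF g supp_in]]
      by (intro measure_pmf.integrable_const_bound[where B = 1]) (auto simp: AE_measure_pmf_iff)
    show "D g = measure_pmf.expectation m (\<lambda>k. D (g \<cdot> k))"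
      unfolding D_def using 1(1)[OF g] 2(1)[OF g] i by simp
    show "\<bar>D g\<bar> \<le> 1" using 1(2,3)[OF g] 2(2,3)[OF g] by (simp add: D_def abs_le_iff)
  next
    fix c :: real assume c: "0 < c"
    let ?u = "\<lambda>g. f (g 0 /\<^sub>R norm (g 0))"
    have "finite {g \<in> N. c / 2 < \<bar>(\<integral>\<xi>. f (bd_action g \<xi>) \<partial>\<nu>) - ?u g\<bar>}"
      using P(1) s(1) atomless(1) finite_orbit N_carrier f c by (intro integral_bd_action_near_boundary) auto
    moreover have "finite {g \<in> N. c / 2 < \<bar>(\<integral>\<xi>. f (bd_action g \<xi>) \<partial>\<nu>') - ?u g\<bar>}"
      using P(2) s(2) atomless(2) finite_orbit N_carrier f c by (intro integral_bd_action_near_boundary) auto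
    moreover have tri: "c / 2 < \<bar>p - u\<bar> \<or> c / 2 < \<bar>q - u\<bar>" if "c < p - q" for p q u :: real
      using that by arith
    have "{g \<in> N. c < D g} \<subseteq> {g \<in> N. c / 2 < \<bar>(\<integral>\<xi>. f (bd_action g \<xi>) \<partial>\<nu>) - ?u g\<bar>}
        \<union> {g \<in> N. c / 2 < \<bar>(\<integral>\<xi>. f (bd_action g \<xi>) \<partial>\<nu>') - ?u g\<bar>}"
      unfolding D_def using tri by blast
    ultimately show "finite {g \<in> N. c < D g}" by (meson finite_UnI finite_subset)
  qed
  moreover have "(\<integral>\<xi>. f (bd_action e \<xi>) \<partial>\<mu>) = (\<integral>\<xi>. f \<xi> \<partial>\<mu>)" if "space \<mu> = bdH3" for \<mu>
    using that by (intro Bochner_Integration.integral_cong) (auto simp: bd_action_one)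
  ultimately show ?thesis using sp by (simp add: D_def)
qed

text \<open>The average of \<open>p + 1 / p\<close> over \<open>A\<close> and \<open>m\<close>, where \<open>p\<close> is the Poisson kernel, is at most
  \<open>2\<close> by symmetry of \<open>m\<close>, which forces \<open>p = 1\<close>.\<close>

lemma poisson_1_invariant:
  assumes A: "finite A" "A \<noteq> {}" "A \<subseteq> bdH3" and inv: "\<forall>k\<in>set_pmf m. bd_action k ` A = A"
  shows "\<forall>k\<in>set_pmf m. \<forall>a\<in>A. poisson (k 0) a = 1"
proof -
  define F where "F k = (\<Sum>a\<in>A. poisson (k 0) a)" for k :: "real^3 \<Rightarrow> real^3"
  have pp: "0 < poisson (k 0) a" if "k \<in> N" "a \<in> A" for k a
    using poisson_pos[OF Isom_H3_in_H3[OF in_carrier[OF that(1)] zero_in_H3]] that(2) A(3) by blast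
  have F0: "0 \<le> F k" if "k \<in> N" for k
    unfolding F_def using pp[OF that] by (intro sum_nonneg less_imp_le) auto
  have "(\<integral>\<^sup>+k. ennreal (F k) \<partial>measure_pmf m) = (\<integral>\<^sup>+k. (\<Sum>a\<in>A. ennreal (poisson (k 0) a)) \<partial>measure_pmf m)"
    unfolding F_def using pp supp_in
    by (intro nn_integral_cong_AE) (auto simp: AE_measure_pmf_iff sum_ennreal less_imp_le)
  also have "\<dots> = (\<Sum>a\<in>A. \<integral>\<^sup>+k. ennreal (poisson (k 0) a) \<partial>measure_pmf m)"
    by (rule nn_integral_sum) simp
  also have "\<dots> \<le> (\<Sum>a\<in>A. 1)" using superharmonic A(3) by (intro sum_mono) auto
  finally have le: "(\<integral>\<^sup>+k. ennreal (F k) \<partial>measure_pmf m) \<le> ennreal (real (card A))"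
    by (simp add: ennreal_of_nat_eq_real_of_nat)
  have AE0: "AE k in measure_pmf m. 0 \<le> F k" using F0 supp_in by (auto simp: AE_measure_pmf_iff)
  have intF: "integrable (measure_pmf m) F"
  proof (rule integrableI_nonneg)
    show "(\<integral>\<^sup>+k. ennreal (F k) \<partial>measure_pmf m) < \<infinity>" using le by (rule order_le_less_trans) simp
  qed (use AE0 in auto)
  have EF: "measure_pmf.expectation m F \<le> real (card A)"
    using le nn_integral_eq_integral[OF intF AE0] by (simp add: integral_nonneg_AE AE0)
  have mi: "map_pmf iv m = m"
    using subgroup_N support symmetric by (rule I.map_pmf_inv_symmetric)
  have intF': "integrable (measure_pmf m) (\<lambda>k. F (iv k))"
  proof -
    have "integrable (measure_pmf (map_pmf iv m)) F" using intF by (simp only: mi)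
    then show ?thesis by (simp add: map_pmf_rep_eq integrable_distr_eq)
  qed
  have EF': "measure_pmf.expectation m (\<lambda>k. F (iv k)) = measure_pmf.expectation m F"
    using integral_map_pmf[of iv m F] by (simp add: mi)
  \<comment> \<open>Since \<open>k\<close> permutes \<open>A\<close>, the reciprocals supplied by
    \<open>poisson_inv\<close> can be summed over \<open>A\<close> itself.\<close>
  have F': "F (iv k) = (\<Sum>a\<in>A. 1 / poisson (k 0) a)" if k: "k \<in> set_pmf m" for k
  proof -
    have kc: "k \<in> carrier Isom_H3" using k supp_carrier by blast
    have inj: "inj_on (bd_action k) A"
      using A(3) bd_action_inv(1)[OF kc] by (intro inj_on_inverseI[where g = "bd_action (iv k)"]) blast
    have "F (iv k) = (\<Sum>a\<in>A. 1 / poisson (k 0) (bd_action k a))"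
      unfolding F_def
    proof (rule sum.cong)
      fix a assume a: "a \<in> A"
      then have "bd_action k a \<in> A" using inv k by blast
      then have "0 < poisson (k 0) (bd_action k a)" using pp[OF supp_in[OF k]] by blast
      moreover have "poisson ((iv k) 0) a * poisson (k 0) (bd_action k a) = 1"
        using a A(3) by (intro poisson_inv[OF kc]) auto
      ultimately show "poisson ((iv k) 0) a = 1 / poisson (k 0) (bd_action k a)" by (simp add: field_simps)
    qed simp
    also have "\<dots> = (\<Sum>a\<in>bd_action k ` A. 1 / poisson (k 0) a)"
      by (simp add: sum.reindex[OF inj])
    finally show ?thesis using inv k by simp
  qed
  \<comment> \<open>Pointwise nonnegative, because \<open>t + 1 / t \<ge> 2\<close> for positive
    \<open>t\<close>; yet its mean is at most 0, since \<open>F\<close> has mean at most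
    \<open>card A\<close> and the same mean after inversion.\<close>
  define G where "G k = (\<Sum>a\<in>A. poisson (k 0) a + 1 / poisson (k 0) a - 2)" for k :: "real^3 \<Rightarrow> real^3"
  have amgm: "0 \<le> t + 1 / t - 2" "t + 1 / t - 2 = 0 \<Longrightarrow> t = 1" if "0 < t" for t :: real
  proof -
    have "t + 1 / t - 2 = (t - 1)\<^sup>2 / t" using that by (simp add: power2_eq_square field_simps)
    then show "0 \<le> t + 1 / t - 2" "t + 1 / t - 2 = 0 \<Longrightarrow> t = 1" using that by auto
  qed
  have G: "G k = F k + F (iv k) - 2 * real (card A)" if "k \<in> set_pmf m" for k
    unfolding F'[OF that] by (simp add: G_def F_def sum.distrib sum_subtractf)
  have G0: "AE k in measure_pmf m. 0 \<le> G k"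
    unfolding AE_measure_pmf_iff G_def using pp supp_in by (intro ballI sum_nonneg amgm(1)) blast
  have AEG: "AE k in measure_pmf m. F k + F (iv k) - 2 * real (card A) = G k"
    by (simp add: AE_measure_pmf_iff G)
  have "integrable (measure_pmf m) (\<lambda>k. F k + F (iv k) - 2 * real (card A))" using intF intF' by simp
  then have intG: "integrable (measure_pmf m) G"
    using AEG by (subst (asm) integrable_cong_AE[where g = G]) auto
  have "measure_pmf.expectation m G = measure_pmf.expectation m (\<lambda>k. F k + F (iv k) - 2 * real (card A))"
    using AEG by (intro integral_cong_AE) (auto simp: eq_commute)
  also have "\<dots> \<le> 0" using intF intF' EF EF' by simp
  finally have "measure_pmf.expectation m G = 0"
    using integral_nonneg_AE[OF G0] by simp
  then have Gz: "AE k in measure_pmf m. G k = 0"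
    using integral_nonneg_eq_0_iff_AE[OF intG G0] by simp
  show ?thesis
  proof (intro ballI)
    fix k a assume k: "k \<in> set_pmf m" and a: "a \<in> A"
    have "G k = 0" using Gz k by (simp add: AE_measure_pmf_iff)
    then have "poisson (k 0) a + 1 / poisson (k 0) a - 2 = 0"
      unfolding G_def using a A(1) pp[OF supp_in[OF k]] amgm(1)
      by (subst (asm) sum_nonneg_eq_0_iff) auto
    then show "poisson (k 0) a = 1" using amgm(2)[OF pp[OF supp_in[OF k] a]] by simp
  qed
qed

text \<open>If the Poisson kernel at \<open>a\<close> equals \<open>1\<close> along \<open>N\<close>, then all orbits converge to \<open>a\<close>, so the
  harmonic function obtained from \<open>norm (\<xi> - a)\<close> vanishes at infinity and hence everywhere.\<close>

lemma no_finite_invariant: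
  assumes A: "finite A" "A \<noteq> {}" "A \<subseteq> bdH3" and inv: "\<forall>k\<in>set_pmf m. bd_action k ` A = A"
  shows False
proof -
  obtain a where a: "a \<in> A" using A(2) by blast
  have aB: "a \<in> bdH3" using a A(3) by blast
  \<comment> \<open>The cocycle identity propagates the value 1 along products as long as the
    factors permute \<open>A\<close>; that is why both conditions are carried together.\<close>
  define Z where "Z = {g \<in> N. bd_action g ` A = A \<and> (\<forall>a\<in>A. poisson (g 0) a = 1)}"
  have ZN: "Z \<subseteq> N" by (auto simp: Z_def)
  have step: "\<forall>g\<in>Z. \<forall>k\<in>set_pmf m. g \<cdot> k \<in> Z"
  proof (intro ballI)
    fix g k assume g: "g \<in> Z" and k: "k \<in> set_pmf m"
    have gN: "g \<in> N" and gA: "bd_action g ` A = A" and gp: "\<forall>a\<in>A. poisson (g 0) a = 1" using g by (auto simp: Z_def)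
    have c: "g \<in> carrier Isom_H3" "k \<in> carrier Isom_H3" using gN k supp_in in_carrier by auto
    have "bd_action (g \<cdot> k) ` A = bd_action g ` bd_action k ` A"
      unfolding image_image using A(3) bd_action_mult[OF c] by (intro image_cong) auto
    then have 1: "bd_action (g \<cdot> k) ` A = A" using inv k gA by simp
    have "poisson ((g \<cdot> k) 0) b = 1" if b: "b \<in> A" for b
    proof -
      obtain b' where b': "b' \<in> A" "b = bd_action g b'" using b gA by blast
      have "b' \<in> bdH3" using b'(1) A(3) by blast
      then have "poisson (g (k 0)) (bd_action g b') = poisson (k 0) b' * poisson (g 0) (bd_action g b')"
        by (rule poisson_Isom[OF c(1) Isom_H3_in_H3[OF c(2) zero_in_H3]])
      also have "\<dots> = 1" using poisson_1_invariant[OF A inv] k b'(1) gp b b'(2) by simp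
      finally show ?thesis unfolding Isom_H3_mult_apply[OF c zero_in_H3] b'(2) .
    qed
    with 1 show "g \<cdot> k \<in> Z" using mult_in[OF gN supp_in[OF k]] by (simp add: Z_def)
  qed
  have e0: "e 0 = 0" by (rule Isom_H3_one_apply[OF zero_in_H3])
  have "e \<in> Z"
  proof -
    have "bd_action e ` A = A"
      using A(3) bd_action_one by (metis (no_types, lifting) image_cong image_ident subsetD)
    moreover have "poisson (e 0) b = 1" if "b \<in> A" for b
      unfolding e0 using that A(3) by (intro poisson_0) blast
    ultimately show ?thesis by (simp add: Z_def one_in)
  qed
  then have "e \<cdot> g \<in> Z" if "g \<in> N" for g using that step ZN by (intro generates_closed)
  then have NZ: "g \<in> Z" if "g \<in> N" for g using that in_carrier[OF that] by force
  define f where "f \<xi> = norm (\<xi> - a) / 2" for \<xi> :: "real^3"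
  have f: "continuous_on bdH3 f" unfolding f_def by (intro continuous_intros) auto
  have fb: "\<forall>\<xi>\<in>bdH3. 0 \<le> f \<xi> \<and> f \<xi> \<le> 1"
  proof
    fix \<xi> assume "\<xi> \<in> bdH3"
    then show "0 \<le> f \<xi> \<and> f \<xi> \<le> 1"
      using norm_triangle_ineq4[of \<xi> a] aB by (simp add: f_def bdH3_def)
  qed
  interpret U: prob_space unif_sphere by (rule prob_space_unif_sphere)
  define D where "D g = (\<integral>\<xi>. f (bd_action g \<xi>) \<partial>unif_sphere)" for g
  have D: "D g = measure_pmf.expectation m (\<lambda>k. D (g \<cdot> k))" "0 \<le> D g" "D g \<le> 1" if "g \<in> N" for g
    unfolding D_def using integral_stationary[OF stationary_unif_sphere f fb that] by auto
  have "D e \<le> 0"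
  proof (rule harmonic_nonpos[OF _ _ _ one_in])
    fix c :: real assume c: "0 < c"
    \<comment> \<open>If the kernel at \<open>z\<close> and \<open>a\<close> is 1, then
      \<open>|z - a|^2 = 1 - |z|^2\<close>, which is at most \<open>2 * (1 - |z|)\<close>. The
      second entry thus bounds \<open>|z - a|\<close> by \<open>c / 2\<close>, and the first bounds
      the error of projecting \<open>z\<close> radially.\<close>
    define d where "d = min (c / 2) ((c / 2)\<^sup>2 / 2)"
    have d: "0 < d" using c by (simp add: d_def)
    have "finite {g \<in> N. c / 2 < \<bar>(\<integral>\<xi>. f (bd_action g \<xi>) \<partial>unif_sphere) - f (g 0 /\<^sub>R norm (g 0))\<bar>}"
      using unif_sphere_atomless finite_orbit N_carrier f fb c U.prob_space_axioms
      by (intro integral_bd_action_near_boundary) auto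
    moreover have "finite {g \<in> N. d \<le> 1 - norm (g 0)}" using finite_orbit N_carrier d by (rule finite_orbit_norm)
    \<comment> \<open>The elements with \<open>g 0 = 0\<close>, for which the radial projection is
      not defined.\<close>
    moreover have "finite {g \<in> N. 1 \<le> 1 - norm (g 0)}" using finite_orbit N_carrier by (rule finite_orbit_norm) simp
    moreover have "f (g 0 /\<^sub>R norm (g 0)) \<le> c / 2" if g: "g \<in> N" and small: "1 - norm (g 0) < d" and nz: "\<not> 1 \<le> 1 - norm (g 0)" for g
    proof -
      define z where "z = g 0"
      have z: "norm z < 1" "z \<noteq> 0" using Isom_H3_in_H3[OF in_carrier[OF g] zero_in_H3] nz by (auto simp: z_def H3_norm)
      have "poisson z a = 1" using NZ[OF g] a by (simp add: Z_def z_def)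
      define X where "X = (1 - (norm z)\<^sup>2) / (norm (z - a))\<^sup>2"
      have "X\<^sup>2 = 1" using \<open>poisson z a = 1\<close> by (simp add: poisson_def X_def)
      moreover have "0 \<le> X"
        unfolding X_def using z(1) by (intro divide_nonneg_nonneg) (auto simp: power_le_one_iff)
      ultimately have "X = 1" by (auto simp: power2_eq_1_iff)
      then have "(norm (z - a))\<^sup>2 = 1 - (norm z)\<^sup>2" by (auto simp: X_def divide_eq_1_iff)
      also have "\<dots> = (1 - norm z) * (1 + norm z)" by (simp add: power2_eq_square algebra_simps)
      also have "\<dots> \<le> (1 - norm z) * 2" using z(1) by (intro mult_left_mono) auto
      also have "\<dots> \<le> (c / 2)\<^sup>2" using small by (simp add: d_def z_def)
      finally have za: "norm (z - a) \<le> c / 2" using c by (simp add: power2_le_iff_abs_le)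
      have "z /\<^sub>R norm z - z = (1 - norm z) *\<^sub>R (z /\<^sub>R norm z)"
        using z(2) by (simp add: algebra_simps)
      then have "norm (z /\<^sub>R norm z - z) = 1 - norm z" using z by simp
      moreover have "norm (z /\<^sub>R norm z - a) \<le> norm (z /\<^sub>R norm z - z) + norm (z - a)"
        using norm_triangle_ineq[of "z /\<^sub>R norm z - z" "z - a"] by simp
      ultimately have "norm (z /\<^sub>R norm z - a) \<le> c" using za small by (simp add: d_def z_def)
      then show ?thesis by (simp add: f_def z_def)
    qed
    ultimately show "finite {g \<in> N. c < D g}"
    proof -
      assume fin: "finite {g \<in> N. c / 2 < \<bar>(\<integral>\<xi>. f (bd_action g \<xi>) \<partial>unif_sphere) - f (g 0 /\<^sub>R norm (g 0))\<bar>}"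
        "finite {g \<in> N. d \<le> 1 - norm (g 0)}" "finite {g \<in> N. 1 \<le> 1 - norm (g 0)}"
      assume small: "\<And>g. g \<in> N \<Longrightarrow> 1 - norm (g 0) < d \<Longrightarrow> \<not> 1 \<le> 1 - norm (g 0) \<Longrightarrow> f (g 0 /\<^sub>R norm (g 0)) \<le> c / 2"
      have "g \<in> {g \<in> N. c / 2 < \<bar>(\<integral>\<xi>. f (bd_action g \<xi>) \<partial>unif_sphere) - f (g 0 /\<^sub>R norm (g 0))\<bar>}
          \<union> {g \<in> N. d \<le> 1 - norm (g 0)} \<union> {g \<in> N. 1 \<le> 1 - norm (g 0)}" if g: "g \<in> N" "c < D g" for g
      proof (rule ccontr)
        assume "\<not> ?thesis"
        then have "\<not> c / 2 < \<bar>D g - f (g 0 /\<^sub>R norm (g 0))\<bar>" "f (g 0 /\<^sub>R norm (g 0)) \<le> c / 2"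
          using g(1) small[OF g(1)] by (auto simp: D_def)
        then show False using g(2) by linarith
      qed
      then have "{g \<in> N. c < D g} \<subseteq> {g \<in> N. c / 2 < \<bar>(\<integral>\<xi>. f (bd_action g \<xi>) \<partial>unif_sphere) - f (g 0 /\<^sub>R norm (g 0))\<bar>}
          \<union> {g \<in> N. d \<le> 1 - norm (g 0)} \<union> {g \<in> N. 1 \<le> 1 - norm (g 0)}" by blast
      then show ?thesis using fin by (meson finite_UnI finite_subset)
    qed
  next
    fix g assume g: "g \<in> N"
    show "D g = measure_pmf.expectation m (\<lambda>k. D (g \<cdot> k))" by (rule D(1)[OF g])
    show "\<bar>D g\<bar> \<le> 1" using D(2,3)[OF g] by simp
  qed
  then have "D e = 0" using D(2)[OF one_in] by simp
  moreover have "D e = (\<integral>\<xi>. f \<xi> \<partial>unif_sphere)"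
    unfolding D_def by (intro Bochner_Integration.integral_cong) (auto simp: bd_action_one)
  ultimately have z: "(\<integral>\<xi>. f \<xi> \<partial>unif_sphere) = 0" by simp
  have fm: "f \<in> borel_measurable unif_sphere"
    using continuous_on_measurable_bd_borel[OF f] by (simp add: measurable_cong_sets[OF sets_unif_sphere refl])
  have "integrable unif_sphere f"
    using fb fm by (intro U.integrable_const_bound[where B = 1]) (auto intro!: AE_I2)
  then have "AE \<xi> in unif_sphere. f \<xi> = 0"
    using z fb by (subst (asm) integral_nonneg_eq_0_iff_AE) (auto intro!: AE_I2)
  \<comment> \<open>A vanishing integral of the distance to \<open>a\<close> would concentrate the
    rotation invariant measure at \<open>a\<close>.\<close>
  then have "AE \<xi> in unif_sphere. \<xi> \<in> {a}" by (simp add: f_def)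
  moreover have "{a} \<in> sets unif_sphere"
    using aB by (simp add: bd_borel_def sets_restrict_space_iff)
  ultimately have "measure unif_sphere {a} = 1" by (simp add: U.prob_eq_1)
  then show False using unif_sphere_atomless[OF aB] by simp
qed

text \<open>Stationarity writes the maximal mass \<open>M\<close> of a point as an average of masses
  of translated points, none above \<open>M\<close>. All of them equal \<open>M\<close>, so the
  finite set of heaviest points is invariant.\<close>

lemma stationary_atomless:
  assumes st: "stationary m \<nu>" and xi: "\<xi> \<in> bdH3"
  shows "measure \<nu> {\<xi>} = 0"
proof (rule ccontr)
  assume nz: "measure \<nu> {\<xi>} \<noteq> 0"
  have P: "prob_space \<nu>" and s: "sets \<nu> = sets bd_borel" using st by (auto simp: stationary_iff)
  interpret prob_space \<nu> by fact
  have sp: "space \<nu> = bdH3" using sets_eq_imp_space_eq[OF s] by simp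
  have sing: "{x} \<in> sets \<nu>" if "x \<in> bdH3" for x
    using that by (simp add: s bd_borel_def sets_restrict_space_iff)
  define w where "w x = measure \<nu> {x}" for x
  have fin: "finite {x \<in> bdH3. c \<le> w x}" if c: "0 < c" for c
  proof (rule ccontr)
    assume inf: "infinite {x \<in> bdH3. c \<le> w x}"
    obtain n :: nat where n: "1 / c < real n" using reals_Archimedean2 by blast
    obtain B where B: "finite B" "card B = n" "B \<subseteq> {x \<in> bdH3. c \<le> w x}"
      using infinite_arbitrarily_large[OF inf, of n] by blast
    have "real n * c = (\<Sum>x\<in>B. c)" using B by simp
    also have "\<dots> \<le> (\<Sum>x\<in>B. w x)" using B by (intro sum_mono) auto
    also have "\<dots> = measure \<nu> B"
      unfolding w_def using B sing by (intro finite_measure_eq_sum_singleton[symmetric]) auto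
    also have "\<dots> \<le> 1" by (rule prob_le_1)
    finally show False using n c by (simp add: field_simps)
  qed
  have w: "0 < w \<xi>" using nz by (simp add: w_def zero_less_measure_iff)
  let ?S = "{x \<in> bdH3. w \<xi> \<le> w x}"
  have S: "finite ?S" "\<xi> \<in> ?S" using fin[OF w] xi by auto
  define M where "M = Max (w ` ?S)"
  have xM: "w \<xi> \<le> M" unfolding M_def using S by (intro Max_ge) auto
  have M: "w x \<le> M" if "x \<in> bdH3" for x
  proof (cases "x \<in> ?S")
    case True
    then show ?thesis unfolding M_def using S by (intro Max_ge) auto
  qed (use that xM in auto)
  have "M \<in> w ` ?S" unfolding M_def using S by (intro Max_in) auto
  then obtain x0 where x0: "x0 \<in> bdH3" "w x0 = M" by auto
  define A where "A = {x \<in> bdH3. w x = M}"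
  have A: "finite A" "A \<noteq> {}" "A \<subseteq> bdH3"
    using x0 xM by (auto simp: A_def intro!: finite_subset[OF _ S(1)])
  have sub: "bd_action (iv k) ` A \<subseteq> A" if k: "k \<in> set_pmf m" for k
  proof
    fix y assume "y \<in> bd_action (iv k) ` A"
    then obtain a where a: "a \<in> A" "y = bd_action (iv k) a" by blast
    have aB: "a \<in> bdH3" using a A by blast
    have yB: "bd_action (iv j) a \<in> bdH3" if "j \<in> set_pmf m" for j
      using bd_action_in[OF I.inv_closed aB] supp_carrier that by blast
    have w1: "w (bd_action (iv j) a) \<le> M" if "j \<in> set_pmf m" for j using M yB[OF that] by blast
    have ae: "{a} \<in> sets bd_borel" using sing[OF aB] s by simp
    have "ennreal M = (\<integral>\<^sup>+\<xi>. indicator {a} \<xi> \<partial>\<nu>)"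
      using a sing[OF aB] by (simp add: A_def w_def emeasure_eq_measure)
    also have "\<dots> = (\<integral>\<^sup>+j. \<integral>\<^sup>+\<xi>. indicator {a} (bd_action j \<xi>) \<partial>\<nu> \<partial>measure_pmf m)"
      using ae by (intro nn_integral_stationary[OF st supp_carrier]) auto
    also have "\<dots> = (\<integral>\<^sup>+j. ennreal (w (bd_action (iv j) a)) \<partial>measure_pmf m)"
    proof (intro nn_integral_cong_AE, unfold AE_measure_pmf_iff, intro ballI)
      fix j assume j: "j \<in> set_pmf m"
      have jc: "j \<in> carrier Isom_H3" using j supp_carrier by blast
      have "(\<integral>\<^sup>+\<xi>. indicator {a} (bd_action j \<xi>) \<partial>\<nu>) = (\<integral>\<^sup>+\<xi>. indicator {bd_action (iv j) a} \<xi> \<partial>\<nu>)"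
      proof (rule nn_integral_cong)
        fix x assume "x \<in> space \<nu>"
        then have x: "x \<in> bdH3" by (simp add: sp)
        have "bd_action j x = a \<longleftrightarrow> x = bd_action (iv j) a"
          using bd_action_inv(1)[OF jc x] bd_action_inv(2)[OF jc aB] by auto
        then show "indicator {a} (bd_action j x) = (indicator {bd_action (iv j) a} x :: ennreal)"
          by (simp add: indicator_def)
      qed
      then show "(\<integral>\<^sup>+\<xi>. indicator {a} (bd_action j \<xi>) \<partial>\<nu>) = ennreal (w (bd_action (iv j) a))"
        using sing[OF yB[OF j]] by (simp add: w_def emeasure_eq_measure)
    qed
    also have "\<dots> = ennreal (measure_pmf.expectation m (\<lambda>j. w (bd_action (iv j) a)))"
      by (intro nn_integral_eq_integral measure_pmf.integrable_const_bound[where B = 1]) (auto simp: w_def)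
    finally have "M = measure_pmf.expectation m (\<lambda>j. w (bd_action (iv j) a))"
      using w xM by (subst (asm) ennreal_inj) (auto simp: w_def)
    moreover have int: "integrable (measure_pmf m) (\<lambda>j. w (bd_action (iv j) a))"
      by (intro measure_pmf.integrable_const_bound[where B = 1]) (auto simp: w_def)
    ultimately have "measure_pmf.expectation m (\<lambda>j. M - w (bd_action (iv j) a)) = 0" by simp
    then have "AE j in measure_pmf m. M - w (bd_action (iv j) a) = 0"
      using w1 int by (subst (asm) integral_nonneg_eq_0_iff_AE) (auto simp: AE_measure_pmf_iff)
    then have "w y = M" using k a(2) by (simp add: AE_measure_pmf_iff)
    then show "y \<in> A" using yB[OF k] a(2) by (simp add: A_def)
  qed
  have "\<forall>k\<in>set_pmf m. bd_action k ` A = A"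
  proof
    fix k assume k: "k \<in> set_pmf m"
    have kc: "k \<in> carrier Isom_H3" using k supp_carrier by blast
    \<comment> \<open>The inclusion was shown for inverses; the support is closed under inversion,
      and an injective self-map of a finite set is onto.\<close>
    have "bd_action (iv (iv k)) ` A \<subseteq> A" by (rule sub[OF supp_inv[OF k]])
    then have le: "bd_action k ` A \<subseteq> A" using kc by simp
    have "inj_on (bd_action k) A"
      using A(3) bd_action_inv(1)[OF kc] by (intro inj_on_inverseI[where g = "bd_action (iv k)"]) blast
    then show "bd_action k ` A = A" using endo_inj_surj[OF A(1) le] by blast
  qed
  with A show False by (rule no_finite_invariant)
qed

text \<open>Equality of integrals of continuous functions passes to closed sets by approximating
  indicators, and the closed sets form an intersection-stable generator.\<close>

lemma stationary_unique:
  assumes st: "stationary m \<nu>"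
  shows "\<nu> = unif_sphere"
proof -
  have P: "prob_space \<nu>" and s: "sets \<nu> = sets bd_borel" using st by (auto simp: stationary_iff)
  interpret V: prob_space \<nu> by fact
  interpret U: prob_space unif_sphere by (rule prob_space_unif_sphere)
  have sp: "space \<nu> = bdH3" using sets_eq_imp_space_eq[OF s] by simp
  have eq: "(\<integral>\<xi>. f \<xi> \<partial>\<nu>) = (\<integral>\<xi>. f \<xi> \<partial>unif_sphere)"
    if "continuous_on bdH3 f" "\<forall>\<xi>\<in>bdH3. 0 \<le> f \<xi> \<and> f \<xi> \<le> (1::real)" for f
    using stationary_agree[of \<nu> unif_sphere f] stationary_agree[of unif_sphere \<nu> f]
      st stationary_unif_sphere stationary_atomless[OF st] unif_sphere_atomless that
    by (intro antisym) auto
  have closed_eq: "measure \<nu> C = measure unif_sphere C" if C: "closed C" "C \<subseteq> bdH3" "C \<noteq> {}" for C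
  proof -
    \<comment> \<open>Continuous functions with values between 0 and 1 that tend pointwise to the
      indicator of \<open>C\<close>.\<close>
    define f where "f n \<xi> = max 0 (1 - real n * infdist \<xi> C)" for n and \<xi> :: "real^3"
    have fc: "continuous_on bdH3 (f n)" for n
      unfolding f_def by (intro continuous_intros)
    have f01: "0 \<le> f n \<xi>" "f n \<xi> \<le> 1" for n \<xi>
      using infdist_nonneg[of \<xi> C] by (auto simp: f_def)
    have lim: "(\<lambda>n. f n \<xi>) \<longlonglongrightarrow> indicator C \<xi>" for \<xi>
    proof (cases "\<xi> \<in> C")
      case False
      then have p: "0 < infdist \<xi> C" using C infdist_pos_not_in_closed[of C \<xi>] by auto
      obtain k :: nat where k: "1 / infdist \<xi> C < real k" using reals_Archimedean2 by blast
      have "f n \<xi> = 0" if "k \<le> n" for n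
      proof -
        have "1 / infdist \<xi> C < real n" using k that by simp
        then show ?thesis using p by (simp add: f_def field_simps)
      qed
      then have "eventually (\<lambda>n. f n \<xi> = 0) sequentially" by (auto simp: eventually_sequentially)
      then show ?thesis using False by (simp add: tendsto_eventually)
    qed (simp add: f_def)
    have conv: "(\<lambda>n. \<integral>\<xi>. f n \<xi> \<partial>\<mu>) \<longlonglongrightarrow> measure \<mu> C"
      if "prob_space \<mu>" "sets \<mu> = sets bd_borel" for \<mu>
    proof -
      interpret prob_space \<mu> by fact
      have Cs: "C \<in> sets \<mu>"
        using C that(2) by (simp add: bd_borel_def sets_restrict_space_iff)
      have m: "f n \<in> borel_measurable \<mu>" for n
        using continuous_on_measurable_bd_borel[OF fc] by (simp add: measurable_cong_sets[OF that(2) refl])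
      have "(\<lambda>n. \<integral>\<xi>. f n \<xi> \<partial>\<mu>) \<longlonglongrightarrow> (\<integral>\<xi>. indicator C \<xi> \<partial>\<mu>)"
        using Cs m lim f01 by (intro integral_dominated_convergence[where w = "\<lambda>_. 1"]) (auto simp: abs_le_iff intro: order_trans[of _ 0])
      then show ?thesis using Cs sets.sets_into_space[OF Cs] by (simp add: Int_absorb2)
    qed
    have "(\<integral>\<xi>. f n \<xi> \<partial>\<nu>) = (\<integral>\<xi>. f n \<xi> \<partial>unif_sphere)" for n
      using fc f01 by (intro eq) auto
    then show ?thesis
      using conv[OF P s] conv[OF U.prob_space_axioms sets_unif_sphere] LIMSEQ_unique by force
  qed
  let ?E = "{C. closed C \<and> C \<subseteq> bdH3}"
  have gen: "sets bd_borel = sigma_sets bdH3 ?E"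
  proof -
    have b: "sets (borel :: (real^3) measure) = sigma_sets UNIV {S. closed S}"
      by (simp add: borel_eq_closed)
    have "sets bd_borel = (\<inter>) bdH3 ` sigma_sets UNIV {S. closed S}"
      by (simp add: bd_borel_def sets_restrict_space b)
    also have "\<dots> = sigma_sets bdH3 ((\<inter>) bdH3 ` {S. closed S})"
      using sets_bdH3 by (intro sigma_sets_Int) (auto simp: b)
    also have "((\<inter>) bdH3 ` {S. closed S}) = ?E"
      using compact_imp_closed[OF compact_bdH3] by (auto intro: closed_Int)
    finally show ?thesis .
  qed
  show ?thesis
  proof (rule measure_eqI_generator_eq[where E = ?E and \<Omega> = bdH3 and A = "\<lambda>_. bdH3"])
    show "Int_stable ?E" by (auto simp: Int_stable_def)
    show "?E \<subseteq> Pow bdH3" by auto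
    show "emeasure \<nu> C = emeasure unif_sphere C" if "C \<in> ?E" for C
      using that closed_eq[of C] by (cases "C = {}") (auto simp: V.emeasure_eq_measure U.emeasure_eq_measure)
    show "sets \<nu> = sigma_sets bdH3 ?E" "sets unif_sphere = sigma_sets bdH3 ?E" using s gen by auto
    show "range (\<lambda>_. bdH3) \<subseteq> ?E" using compact_imp_closed[OF compact_bdH3] by auto
  qed auto
qed

lemma associated_stationary_unif_sphere: "associated_stationary_measure m unif_sphere"
  using stationary_unif_sphere stationary_unique by (auto simp: associated_stationary_measure_def)

text \<open>An orbit point \<open>g 0\<close> converges to the boundary; commuting elements fix its limit points.\<close>

lemma not_commutative:
  assumes comm: "\<And>g h. g \<in> N \<Longrightarrow> h \<in> N \<Longrightarrow> g \<cdot> h = h \<cdot> g"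
  shows False
proof -
  obtain s :: "nat \<Rightarrow> real^3 \<Rightarrow> real^3" where s: "inj s" "range s \<subseteq> N"
    using infinite_countable_subset[OF infinite_N] by blast
  have sN: "s n \<in> N" for n using s(2) by blast
  have sH: "s n 0 \<in> H3" for n using Isom_H3_in_H3[OF in_carrier[OF sN] zero_in_H3] .
  have lim1: "(\<lambda>n. 1 - norm (s n 0)) \<longlonglongrightarrow> 0"
  proof (rule LIMSEQ_I)
    fix d :: real assume d: "0 < d"
    have "finite {g \<in> N. d \<le> 1 - norm (g 0)}" using finite_orbit N_carrier d by (rule finite_orbit_norm)
    then have "finite (s -` {g \<in> N. d \<le> 1 - norm (g 0)})" using s(1) by (intro finite_vimageI)
    then have "\<exists>k. \<forall>n\<in>s -` {g \<in> N. d \<le> 1 - norm (g 0)}. n < k"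
      by (simp only: finite_nat_set_iff_bounded)
    then obtain k where k: "\<forall>n\<in>s -` {g \<in> N. d \<le> 1 - norm (g 0)}. n < k" ..
    show "\<exists>no. \<forall>n\<ge>no. norm (1 - norm (s n 0) - 0) < d"
    proof (intro exI allI impI)
      fix n assume "k \<le> n"
      then have "\<not> d \<le> 1 - norm (s n 0)" using k sN[of n] by force
      then show "norm (1 - norm (s n 0) - 0) < d" using sH[of n] by (simp add: H3_norm)
    qed
  qed
  have "compact (cball (0::real^3) 1)" by simp
  moreover have "\<forall>n. s n 0 \<in> cball 0 1" using sH by (simp add: H3_norm less_imp_le)
  ultimately obtain \<eta> r where r: "strict_mono r" "((\<lambda>n. s n 0) \<circ> r) \<longlonglongrightarrow> \<eta>"
    unfolding compact_def by meson
  define t where "t n = s (r n)" for n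
  have t: "(\<lambda>n. t n 0) \<longlonglongrightarrow> \<eta>" using r(2) by (simp add: o_def t_def)
  have tN: "t n \<in> N" for n using sN by (simp add: t_def)
  have tH: "t n 0 \<in> H3" for n using sH by (simp add: t_def)
  have lim2: "(\<lambda>n. 1 - norm (t n 0)) \<longlonglongrightarrow> 0"
    using LIMSEQ_subseq_LIMSEQ[OF lim1 r(1)] by (simp add: o_def t_def)
  have "(\<lambda>n. 1 - norm (t n 0)) \<longlonglongrightarrow> 1 - norm \<eta>" by (intro tendsto_intros t)
  from LIMSEQ_unique[OF this lim2] have eta: "\<eta> \<in> bdH3" by (simp add: bdH3_def)
  have fix_eta: "bd_action h \<eta> = \<eta>" if h: "h \<in> N" for h
  proof -
    have hc: "h \<in> carrier Isom_H3" using in_carrier[OF h] .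
    have hH: "h 0 \<in> H3" using Isom_H3_in_H3[OF hc zero_in_H3] .
    have "filterlim (\<lambda>n. t n 0) (at \<eta> within H3) sequentially"
    proof -
      have "t n 0 \<noteq> \<eta>" for n using tH[of n] eta by (auto simp: H3_norm bdH3_def)
      then show ?thesis unfolding filterlim_at using t tH by simp
    qed
    from filterlim_compose[OF bd_action_tendsto[OF hc eta] this]
    have 1: "(\<lambda>n. h (t n 0)) \<longlonglongrightarrow> bd_action h \<eta>" .
    have eqn: "h (t n 0) = t n (h 0)" for n
      using comm[OF h tN[of n]] Isom_H3_mult_apply[OF hc in_carrier[OF tN[of n]] zero_in_H3]
        Isom_H3_mult_apply[OF in_carrier[OF tN[of n]] hc zero_in_H3] by simp
    \<comment> \<open>By commutativity \<open>h (t n 0)\<close> is \<open>t n (h 0)\<close>, which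
      keeps a fixed hyperbolic distance from \<open>t n 0\<close>. Near the sphere this forces the
      Euclidean distance to 0, so \<open>h\<close> fixes the limit.\<close>
    define C where "C = hdefect (h 0) 0"
    have "(norm (t n (h 0) - t n 0))\<^sup>2 \<le> C * (2 * (1 - norm (t n 0)))" for n
    proof -
      have tc: "t n \<in> carrier Isom_H3" using in_carrier[OF tN] .
      have yH: "t n (h 0) \<in> H3" using Isom_H3_in_H3[OF tc hH] .
      have "hdefect (t n (h 0)) (t n 0) = C"
        unfolding C_def using Isom_H3_hdist[OF tc hH zero_in_H3] hdefect_eq_iff[OF yH tH hH zero_in_H3] by simp
      moreover have p: "0 < 1 - (norm (t n (h 0)))\<^sup>2" "0 < 1 - (norm (t n 0))\<^sup>2"
        using one_minus_norm_pos yH tH by auto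
      ultimately have "(norm (t n (h 0) - t n 0))\<^sup>2 = C * ((1 - (norm (t n (h 0)))\<^sup>2) * (1 - (norm (t n 0))\<^sup>2))"
        by (auto simp: hdefect_def)
      also have "\<dots> \<le> C * (1 * (2 * (1 - norm (t n 0))))"
      proof (intro mult_left_mono mult_mono)
        have "1 - (norm (t n 0))\<^sup>2 = (1 + norm (t n 0)) * (1 - norm (t n 0))" by (simp add: power2_eq_square algebra_simps)
        also have "\<dots> \<le> 2 * (1 - norm (t n 0))" using tH[of n] by (intro mult_right_mono) (auto simp: H3_norm)
        finally show "1 - (norm (t n 0))\<^sup>2 \<le> 2 * (1 - norm (t n 0))" .
        show "0 \<le> C" unfolding C_def by (rule hdefect_nonneg[OF hH zero_in_H3])
      qed (use p in auto)
      finally show ?thesis by simp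
    qed
    moreover have "(\<lambda>n. C * (2 * (1 - norm (t n 0)))) \<longlonglongrightarrow> C * (2 * 0)" by (intro tendsto_intros lim2)
    ultimately have "(\<lambda>n. (norm (t n (h 0) - t n 0))\<^sup>2) \<longlonglongrightarrow> 0"
      by (intro tendsto_sandwich[OF _ _ tendsto_const[of 0], of "\<lambda>n. (norm (t n (h 0) - t n 0))\<^sup>2"]) auto
    then have "(\<lambda>n. sqrt ((norm (t n (h 0) - t n 0))\<^sup>2)) \<longlonglongrightarrow> sqrt 0" by (rule tendsto_real_sqrt)
    then have "(\<lambda>n. t n (h 0) - t n 0) \<longlonglongrightarrow> 0" by (simp add: tendsto_norm_zero_iff)
    from tendsto_add[OF this t] have "(\<lambda>n. t n (h 0)) \<longlonglongrightarrow> \<eta>" by simp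
    then show ?thesis using 1 unfolding eqn by (rule LIMSEQ_unique[rotated])
  qed
  show False
  proof (rule no_finite_invariant)
    show "\<forall>k\<in>set_pmf m. bd_action k ` {\<eta>} = {\<eta>}" using fix_eta supp_in by auto
  qed (use eta in auto)
qed

end

section \<open>From the boundary walk to the theorem\<close>

text \<open>The density of \<open>L\<close> is positive everywhere on the sphere, so its null sets
  are null for \<open>round_area\<close>, which differs from \<open>unif_sphere\<close> by a scalar
  only.\<close>

lemma absolutely_continuous_unif_sphere:
  assumes "smooth_volume_measure L"
  shows "absolutely_continuous L unif_sphere"
proof -
  obtain U f where U: "open U" "bdH3 \<subseteq> U" "\<forall>k. cont_diff_on k U f" and f: "\<forall>\<xi>\<in>bdH3. 0 < f \<xi>"
    and L: "L = density round_area (\<lambda>\<xi>. ennreal (f \<xi>))"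
    using assms unfolding smooth_volume_measure_def by blast
  let ?C = "distr (restrict_space lborel pball) bd_borel (\<lambda>x. x /\<^sub>R norm x)"
  have "continuous_on U f" using U(3) cont_diff_on.simps(1) by blast
  then have "continuous_on bdH3 f" using U(2) by (rule continuous_on_subset)
  then have "f \<in> borel_measurable bd_borel" by (rule continuous_on_measurable_bd_borel)
  then have fm: "f \<in> borel_measurable round_area" by (simp add: round_area_def)
  have sp: "space round_area = bdH3" by (simp add: round_area_def space_scale_measure)
  show ?thesis
    unfolding absolutely_continuous_def
  proof
    fix A assume "A \<in> null_sets L"
    then have A: "A \<in> sets round_area" and ae: "AE \<xi> in round_area. \<xi> \<in> A \<longrightarrow> ennreal (f \<xi>) = 0"
      using fm unfolding L by (auto simp: null_sets_density_iff)
    have "AE \<xi> in round_area. \<xi> \<notin> A"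
      using ae AE_space
    proof eventually_elim
      case (elim \<xi>)
      show ?case
      proof
        assume "\<xi> \<in> A"
        then have "ennreal (f \<xi>) = 0" using elim(1) by blast
        moreover have "0 < f \<xi>" using f elim(2) sp by blast
        ultimately show False by simp
      qed
    qed
    then have "A \<in> null_sets round_area" using AE_iff_null_sets[OF A] by simp
    then have "emeasure round_area A = 0" by auto
    then have "emeasure ?C A = 0" by (simp add: round_area_def)
    then have "emeasure unif_sphere A = 0" by (simp add: unif_sphere_def)
    moreover have "A \<in> sets unif_sphere" using A by (simp add: round_area_def)
    ultimately show "A \<in> null_sets unif_sphere" by (simp add: null_sets_def)
  qed
qed

text \<open>By the cocycle identity the factor \<open>poisson (x 0) \<xi>\<close> comes out of the
  integral and the boundary point moves to \<open>\<eta>\<close>. Superharmonicity at the identity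
  for every boundary point thus gives it at every group element.\<close>

lemma poisson_translate_le:
  assumes m: "set_pmf m \<subseteq> carrier Isom_H3"
    and super: "\<forall>\<xi>\<in>bdH3. (\<integral>\<^sup>+g. ennreal (poisson (g 0) \<xi>) \<partial>measure_pmf m) \<le> 1"
    and x: "x \<in> carrier Isom_H3" and xi: "\<xi> \<in> bdH3"
  shows "(\<integral>\<^sup>+s. ennreal (poisson ((x \<otimes>\<^bsub>Isom_H3\<^esub> s) 0) \<xi>) \<partial>measure_pmf m) \<le> ennreal (poisson (x 0) \<xi>)"
proof -
  interpret I: group Isom_H3 by (rule group_Isom_H3)
  define \<eta> where "\<eta> = bd_action (inv\<^bsub>Isom_H3\<^esub> x) \<xi>"
  have eta: "\<eta> \<in> bdH3" unfolding \<eta>_def by (rule bd_action_in[OF I.inv_closed[OF x] xi])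
  have xe: "bd_action x \<eta> = \<xi>" unfolding \<eta>_def by (rule bd_action_inv(2)[OF x xi])
  have x0: "0 \<le> poisson (x 0) \<xi>" using poisson_pos[OF Isom_H3_in_H3[OF x zero_in_H3] xi] by simp
  have "(\<integral>\<^sup>+s. ennreal (poisson ((x \<otimes>\<^bsub>Isom_H3\<^esub> s) 0) \<xi>) \<partial>measure_pmf m)
     = (\<integral>\<^sup>+s. ennreal (poisson (x 0) \<xi>) * ennreal (poisson (s 0) \<eta>) \<partial>measure_pmf m)"
  proof (intro nn_integral_cong_AE, unfold AE_measure_pmf_iff, intro ballI)
    fix s assume "s \<in> set_pmf m"
    then have s: "s \<in> carrier Isom_H3" using m by blast
    have "poisson ((x \<otimes>\<^bsub>Isom_H3\<^esub> s) 0) \<xi> = poisson (s 0) \<eta> * poisson (x 0) \<xi>"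
      using poisson_Isom[OF x Isom_H3_in_H3[OF s zero_in_H3] eta]
      unfolding xe Isom_H3_mult_apply[OF x s zero_in_H3] .
    then show "ennreal (poisson ((x \<otimes>\<^bsub>Isom_H3\<^esub> s) 0) \<xi>) = ennreal (poisson (x 0) \<xi>) * ennreal (poisson (s 0) \<eta>)"
      using x0 by (simp add: mult.commute ennreal_mult'')
  qed
  also have "\<dots> = ennreal (poisson (x 0) \<xi>) * (\<integral>\<^sup>+s. ennreal (poisson (s 0) \<eta>) \<partial>measure_pmf m)"
    by (rule nn_integral_cmult) simp
  also have "\<dots> \<le> ennreal (poisson (x 0) \<xi>) * 1"
    using super eta by (intro mult_left_mono) auto
  finally show ?thesis by simp
qed

lemma normal_quotient_integer_hom:
  assumes G: "group G" and N: "N \<lhd> G" and iso: "(G Mod N) \<cong> integer_group"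
  obtains \<phi> :: "'a \<Rightarrow> int" where
    "\<forall>g\<in>carrier G. \<forall>h\<in>carrier G. \<phi> (g \<otimes>\<^bsub>G\<^esub> h) = \<phi> g + \<phi> h"
    "{g \<in> carrier G. \<phi> g = 0} = N"
proof -
  interpret N: normal N G by (rule N)
  obtain \<psi> where \<psi>: "\<psi> \<in> iso (G Mod N) integer_group" using iso by (auto simp: is_iso_def)
  interpret F: group "G Mod N" by (rule N.factorgroup_is_group)
  have hom: "\<psi> \<in> hom (G Mod N) integer_group" and bij: "bij_betw \<psi> (carrier (G Mod N)) UNIV"
    using \<psi> by (auto simp: iso_def integer_group_def)
  have inj: "inj_on \<psi> (carrier (G Mod N))" using bij by (simp add: bij_betw_def)
  have in_F: "N #>\<^bsub>G\<^esub> g \<in> carrier (G Mod N)" if "g \<in> carrier G" for g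
    using that by (auto simp: FactGroup_def RCOSETS_def)
  define \<phi> where "\<phi> g = \<psi> (N #>\<^bsub>G\<^esub> g)" for g
  have h: "\<phi> (g \<otimes>\<^bsub>G\<^esub> h) = \<phi> g + \<phi> h" if "g \<in> carrier G" "h \<in> carrier G" for g h
  proof -
    have "N #>\<^bsub>G\<^esub> (g \<otimes>\<^bsub>G\<^esub> h) = (N #>\<^bsub>G\<^esub> g) \<otimes>\<^bsub>G Mod N\<^esub> (N #>\<^bsub>G\<^esub> h)"
      using that by (simp add: N.rcos_sum FactGroup_def)
    then show ?thesis using hom_mult[OF hom in_F[OF that(1)] in_F[OF that(2)]]
      by (simp add: \<phi>_def integer_group_def)
  qed
  have one: "\<psi> N = 0"
    using hom_one[OF hom F.is_group group_integer_group] by (simp add: FactGroup_def integer_group_def)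
  have "{g \<in> carrier G. \<phi> g = 0} = N"
  proof (intro equalityI subsetI)
    fix g assume "g \<in> {g \<in> carrier G. \<phi> g = 0}"
    then have g: "g \<in> carrier G" "\<psi> (N #>\<^bsub>G\<^esub> g) = \<psi> N" using one by (auto simp: \<phi>_def)
    have "N \<in> carrier (G Mod N)" using F.one_closed by (simp add: FactGroup_def)
    then have "N #>\<^bsub>G\<^esub> g = N" using inj_onD[OF inj g(2) in_F[OF g(1)]] by blast
    then show "g \<in> N" using g(1) N.rcos_self[OF g(1)] N.is_subgroup by metis
  next
    fix g assume g: "g \<in> N"
    then have "N #>\<^bsub>G\<^esub> g = N" by (intro N.coset_join2 N.is_subgroup N.mem_carrier)
    then show "g \<in> {g \<in> carrier G. \<phi> g = 0}" using g N.mem_carrier one by (simp add: \<phi>_def)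
  qed
  then show ?thesis using that[of \<phi>] h by blast
qed

lemma torsion_free_finite_subgroup:
  assumes G: "group G" and tf: "torsion_free G \<Gamma>" and N: "subgroup N G" "N \<subseteq> \<Gamma>" "finite N"
  shows "N = {\<one>\<^bsub>G\<^esub>}"
proof -
  interpret G: group G by (rule G)
  have "g = \<one>\<^bsub>G\<^esub>" if g: "g \<in> N" for g
  proof -
    have gc: "g \<in> carrier G" using subgroup.mem_carrier[OF N(1) g] .
    have "g [^]\<^bsub>G\<^esub> n \<in> N" for n :: nat
      by (induction n) (auto intro: g subgroup.one_closed[OF N(1)] subgroup.m_closed[OF N(1)])
    then have "range (\<lambda>n::nat. g [^]\<^bsub>G\<^esub> n) \<subseteq> N" by blast
    then have "\<not> inj (\<lambda>n::nat. g [^]\<^bsub>G\<^esub> n)"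
      using N(3) finite_subset range_inj_infinite by blast
    then obtain i j :: nat where ij: "i < j" "g [^]\<^bsub>G\<^esub> i = g [^]\<^bsub>G\<^esub> j"
      unfolding inj_def by (metis linorder_neqE_nat)
    have "g [^]\<^bsub>G\<^esub> i \<otimes>\<^bsub>G\<^esub> g [^]\<^bsub>G\<^esub> (j - i) = g [^]\<^bsub>G\<^esub> i"
    proof -
      have "g [^]\<^bsub>G\<^esub> i \<otimes>\<^bsub>G\<^esub> g [^]\<^bsub>G\<^esub> (j - i) = g [^]\<^bsub>G\<^esub> (i + (j - i))"
        using gc by (rule G.nat_pow_mult)
      also have "i + (j - i) = j" using ij(1) by simp
      finally show ?thesis using ij(2) by simp
    qed
    then have "g [^]\<^bsub>G\<^esub> (j - i) = \<one>\<^bsub>G\<^esub>" using gc by simp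
    then show ?thesis using tf g N(2) ij(1) unfolding torsion_free_def by (meson subsetD zero_less_diff)
  qed
  then show ?thesis using subgroup.one_closed[OF N(1)] by blast
qed

theorem proposition6p5:
  fixes \<Gamma> N :: "(real^3 \<Rightarrow> real^3) set"
    and S :: "(real^3) set set"
    and p :: "(real^3) set \<Rightarrow> complex"
    and x0 :: "real^3"
    and Leb :: "(real^3) measure"
  assumes "cocompact_lattice \<Gamma>"
    and "torsion_free Isom_H3 \<Gamma>"
    and "surface_fibration_over_circle (quotient_space \<Gamma>) S p"
    and "x0 \<in> H3" and "orbit_of \<Gamma> x0 \<in> S"
    and "N = pi1_in_lattice \<Gamma> S x0"
    and "N \<lhd> Isom_H3\<lparr>carrier := \<Gamma>\<rparr>"
    and "infinite (rcosets\<^bsub>Isom_H3\<lparr>carrier := \<Gamma>\<rparr>\<^esub> N)"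
    and "(Isom_H3\<lparr>carrier := \<Gamma>\<rparr> Mod N) \<cong> integer_group"
    and "smooth_volume_measure Leb"
  shows "\<exists>m :: (real^3 \<Rightarrow> real^3) pmf.
           set_pmf m \<subseteq> N \<and> generate Isom_H3 (set_pmf m) = N \<and>
           (\<exists>\<nu>. associated_stationary_measure m \<nu> \<and> absolutely_continuous Leb \<nu>)"
proof -
  let ?G = "Isom_H3\<lparr>carrier := \<Gamma>\<rparr>"
  obtain D where "cocompact_action \<Gamma> D" using cocompact_lattice_action[OF assms(1)] by blast
  then interpret C: cocompact_action \<Gamma> D .
  have grpG: "group ?G" using C.subgroup_Gamma group_Isom_H3 by (rule subgroup.subgroup_is_group)
  obtain \<phi> :: "_ \<Rightarrow> int" where "\<forall>g\<in>carrier ?G. \<forall>h\<in>carrier ?G. \<phi> (g \<otimes>\<^bsub>?G\<^esub> h) = \<phi> g + \<phi> h"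
    and "{g \<in> carrier ?G. \<phi> g = 0} = N"
    by (rule normal_quotient_integer_hom[OF grpG assms(7,9)])
  then have hom: "\<forall>g\<in>\<Gamma>. \<forall>h\<in>\<Gamma>. \<phi> (g \<otimes>\<^bsub>Isom_H3\<^esub> h) = \<phi> g + \<phi> h"
    and N: "{g \<in> \<Gamma>. \<phi> g = 0} = N" by auto
  interpret W: symmetric_hom_walk Isom_H3 \<Gamma> C.step_pmf \<phi>
  proof (intro symmetric_hom_walk.intro symmetric_hom_walk_axioms.intro)
    show "(\<integral>\<^sup>+g. ennreal ((real_of_int (\<phi> g))\<^sup>2) \<partial>measure_pmf C.step_pmf) < \<infinity>"
      unfolding C.nn_integral_step_pmf by (rule C.nn_integral_step_square[OF hom])
  qed (use group_Isom_H3 C.subgroup_Gamma C.countable_Gamma C.set_step_pmf C.pmf_step_pmf_inv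
      C.generate_step_pmf hom in auto)
  have WN: "W.N = N" unfolding W.N_def by (rule N)
  have NG: "N \<subseteq> \<Gamma>" using N by blast
  have sgN: "subgroup N Isom_H3" using W.subgroup_N by (simp only: WN)
  have superG: "\<forall>\<xi>\<in>bdH3. (\<integral>\<^sup>+g. ennreal (poisson (g 0) \<xi>) \<partial>measure_pmf C.step_pmf) \<le> 1"
    unfolding C.nn_integral_step_pmf using C.nn_integral_step_poisson by blast
  have infG: "infinite \<Gamma>"
  proof
    assume "finite \<Gamma>"
    then have "finite (rcosets\<^bsub>?G\<^esub> N)" by (simp add: RCOSETS_def)
    with assms(8) show False by simp
  qed
  \<comment> \<open>A finite \<open>N\<close> would be trivial, as the group is torsion-free. Then
    \<open>\<phi>\<close> is injective and the lattice commutative, which the boundary walk of the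
    lattice itself excludes.\<close>
  have infN: "infinite N"
  proof
    assume "finite N"
    then have N1: "N = {\<one>\<^bsub>Isom_H3\<^esub>}"
      using torsion_free_finite_subgroup[OF group_Isom_H3 assms(2) sgN NG] by simp
    interpret B: boundary_walk \<Gamma> C.step_pmf
    proof (rule boundary_walk.intro)
      show "(\<integral>\<^sup>+g. ennreal (poisson (g 0) \<xi>) \<partial>measure_pmf C.step_pmf) \<le> 1" if "\<xi> \<in> bdH3" for \<xi>
        using superG that by blast
    qed (use C.subgroup_Gamma infG C.finite_orbit C.set_step_pmf C.pmf_step_pmf_inv C.generate_step_pmf in auto)
    show False
    proof (rule B.not_commutative)
      fix g h assume g: "g \<in> \<Gamma>" and h: "h \<in> \<Gamma>"
      let ?x = "inv\<^bsub>Isom_H3\<^esub> (h \<otimes>\<^bsub>Isom_H3\<^esub> g) \<otimes>\<^bsub>Isom_H3\<^esub> (g \<otimes>\<^bsub>Isom_H3\<^esub> h)"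
      have gh: "h \<otimes>\<^bsub>Isom_H3\<^esub> g \<in> \<Gamma>" "g \<otimes>\<^bsub>Isom_H3\<^esub> h \<in> \<Gamma>" using g h by (auto intro: C.mult_in)
      \<comment> \<open>A commutator has image 0 in the integers and so lies in
        \<open>N\<close>.\<close>
      have "\<phi> ?x = 0" using gh g h hom W.hom_inv[OF gh(1)] C.inv_in[OF gh(1)] by simp
      then have "?x \<in> N" using N C.mult_in[OF C.inv_in[OF gh(1)] gh(2)] by blast
      then have "?x = \<one>\<^bsub>Isom_H3\<^esub>" using N1 by simp
      then show "g \<otimes>\<^bsub>Isom_H3\<^esub> h = h \<otimes>\<^bsub>Isom_H3\<^esub> g"
        using C.in_carrier[OF gh(1)] C.in_carrier[OF gh(2)]
        by (metis C.I.inv_closed C.I.inv_equality C.I.inv_inv)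
    qed
  qed
  let ?m = W.ret_pmf
  have supp: "set_pmf ?m \<subseteq> N" using W.set_ret_pmf WN by auto
  have gen: "generate Isom_H3 (set_pmf ?m) = N" using W.generate_ret by (simp only: W.set_ret_pmf WN)
  interpret B: boundary_walk N ?m
  proof (rule boundary_walk.intro)
    show "finite {g \<in> N. hdist 0 (g 0) < r}" for r
      using C.finite_orbit[of r] by (rule rev_finite_subset) (use NG in auto)
    show "(\<integral>\<^sup>+g. ennreal (poisson (g 0) \<xi>) \<partial>measure_pmf ?m) \<le> 1" if xi: "\<xi> \<in> bdH3" for \<xi>
    proof -
      have "(\<integral>\<^sup>+h. W.ret h * ennreal (poisson (h 0) \<xi>) \<partial>count_space W.N) \<le> ennreal (poisson (\<one>\<^bsub>Isom_H3\<^esub> 0) \<xi>)"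
      proof (rule W.nn_integral_ret_le)
        fix x assume "x \<in> \<Gamma>"
        then have x: "x \<in> carrier Isom_H3" by (rule C.in_carrier)
        have "set_pmf C.step_pmf \<subseteq> carrier Isom_H3" using C.set_step_pmf C.in_carrier by blast
        then show "(\<integral>\<^sup>+s. ennreal (poisson ((x \<otimes>\<^bsub>Isom_H3\<^esub> s) 0) \<xi>) \<partial>measure_pmf C.step_pmf) \<le> ennreal (poisson (x 0) \<xi>)"
          using superG x xi by (rule poisson_translate_le)
      qed
      then show ?thesis unfolding W.nn_integral_ret_pmf C.one_0 by (simp add: poisson_0 xi)
    qed
    show "pmf ?m (inv\<^bsub>Isom_H3\<^esub> g) = pmf ?m g" if "g \<in> N" for g
      using W.pmf_ret_pmf_inv that WN by simp
  qed (use sgN infN supp gen in auto)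
  show ?thesis
    using supp gen B.associated_stationary_unif_sphere absolutely_continuous_unif_sphere[OF assms(10)]
    by blast
qed

end
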